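(* Let $d\ge 1$, $d<\beta<2d$, and let $f$ be a probability density on $\mathbb{R}_+$ such that $f(r)\sim C_\beta r^{-\beta-1}$ as $r\to+\infty$ for some constant $C_\beta>0$, and $r^{\beta+1}f(r)\le C_0$ for all $r$ for some constant $C_0$. For every $\rho>0$ let $\phi_\rho$ be a stationary determinantal point process on $\mathbb{R}^d$ with kernel $K_\rho(x,y)=K_\rho(x-y)$ with respect to Lebesgue measure, and assume: (a) the operator $\mathbf{K}_\rho g(x)=\int_{\mathbb{R}^d}K_\rho(x,y)g(y)\,dy$ is a bounded symmetric integral operator on $L^2(\mathbb{R}^d,dx)$ with spectrum included in $[0,1[$, and it is locally trace-class (for every compact $\Lambda\subset\mathbb{R}^d$ its restriction to $L^2(\Lambda,dx)$ is trace-class); (b) $K_\rho(0)=\lambda(\rho)K(0)$ with $\lim_{\rho\to0}\lambda(\rho)=+\infty$; (c) $\int_{\mathbb{R}^d}|K_\rho(x)|^2\,dx=\mathcal{O}(\lambda(\rho))$ as $\rho\to0$. Suppose $\lambda(\rho)\rho^\beta\to0$ as $\rho\to0$, and set $n(\rho)=(\lambda(\rho)\rho^\beta)^{1/\gamma}$ with $\gamma=\beta/d$. Then, as $\rho\to0$, the field $n(\rho)^{-1}\widetilde M_\rho(\cdot)$ converges in the sense of finite-dimensional distributions on $L_c^2(\mathbb{R}^d)$ to $Z(\cdot)$, where $$Z(\mu)=\int_{\mathbb{R}^d}\varphi(x)\,M_\gamma(dx)\quad\text{for }\mu(dx)=\varphi(x)\,dx,$$ and $M_\gamma$ is a $\gamma$-stable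 random measure on $\mathbb{R}^d$ with control measure $\sigma_\gamma\,dx$, where $$\sigma_\gamma=\frac{K(0)C_\beta v_d^\gamma}{d}\int_0^{+\infty}\frac{1-\cos(r)}{r^{1+\gamma}}\,dr,$$ and with constant unit skewness.
   Context: $B(x,r)=\{y\in\mathbb{R}^d:\|y-x\|\le r\}$ is the Euclidean ball and $v_d$ is the Lebesgue measure of $B(0,1)$. Determinantal point process (Dpp): a simple point process $\xi$ on a Polish space $E$ is a Dpp with kernel $K$ with respect to a Radon measure $\lambda$ if for all $k\ge1$ and all mutually disjoint Borel sets $D_1,\dots,D_k\subset E$, $\mathbb{E}[\prod_{i=1}^k\xi(D_i)]=\int_{\prod_i D_i}\rho_k(x_1,\dots,x_k)\,\lambda(dx_1)\cdots\lambda(dx_k)$ with $\rho_k(x_1,\dots,x_k)=\det(K(x_i,x_j))_{1\le i,j\le k}$. $K(0)$ is the value at $0$ of the kernel $K(x,y)=K(x-y)$ of a fixed (unscaled) stationary Dpp $\phi$ on $\mathbb{R}^d$; the same letter denotes the two-variable kernel and the one-variable function. $\Phi_\rho$ is the marked point process on $\mathbb{R}^d\times\mathbb{R}_+$ obtained by attaching to the points of $\phi_\rho$ i.i.d. marks (radii), independent of $\phi_\rho$, with density $r\mapsto f(r/\rho)/\rho$. It is identified with the random measure $\sum_{(X,R)\in\Phi_\rho}\delta_{(X,R)}$. It is a Dpp with kernel $\widehat K_\rho((x,r),(y,s))=\sqrt{f(r/\rho)/\rho}\,K_\rho(x,y)\sqrt{f(s/\rho)/\rho}$ with respect to Lebesgue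 measure. Put $$M_\rho(\mu)=\int_{\mathbb{R}^d\times\mathbb{R}_+}\mu(B(x,r))\,\Phi_\rho(dx,dr),\qquad \widetilde M_\rho(\mu)=M_\rho(\mu)-\mathbb{E}[M_\rho(\mu)].$$ $L_c^2(\mathbb{R}^d)$ denotes (by abuse of notation) the set of positive measures $\mu(dx)=\varphi(x)\,dx$ whose density $\varphi\ge0$ belongs to $L^2(\mathbb{R}^d)$ and has compact support. Stable integrals (Samorodnitsky–Taqqu conventions): for $\gamma\in(1,2)$, the law $S_\gamma(\sigma,b,0)$ has characteristic function $t\mapsto\exp\{-\sigma^\gamma|t|^\gamma(1-i\,b\,\mathrm{sign}(t)\tan(\pi\gamma/2))\}$. For a $\gamma$-stable random measure $M_\gamma$ with control measure $m$ and unit skewness, $\int\varphi\,dM_\gamma$ is linear in $\varphi\in L^\gamma(m)$ and has law $S_\gamma(\sigma_\varphi,b_\varphi,0)$ with $\sigma_\varphi^\gamma=\int|\varphi|^\gamma dm$ and $b_\varphi=\sigma_\varphi^{-\gamma}\int|\varphi|^\gamma\mathrm{sign}(\varphi)\,dm$. *)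

theory Defs
  imports
    "HOL-Probability.Probability"
    "HOL-Library.Landau_Symbols"
    "Jordan_Normal_Form.Determinant"
begin

section \<open>Operators on square-integrable functions\<close>

text \<open>
  Elements of \<open>L\<^sup>2(m)\<close> are represented by measurable complex functions; operators act on
  functions and all identities between them are understood almost everywhere.
\<close>

definition L2_space :: "'a measure \<Rightarrow> ('a \<Rightarrow> complex) set" where
  "L2_space m = {g \<in> borel_measurable m. integrable m (\<lambda>x. (cmod (g x))\<^sup>2)}"

definition L2_inner :: "'a measure \<Rightarrow> ('a \<Rightarrow> complex) \<Rightarrow> ('a \<Rightarrow> complex) \<Rightarrow> complex" where
  "L2_inner m g h = (\<integral>x. g x * cnj (h x) \<partial>m)"

definition L2_nrm :: "'a measure \<Rightarrow> ('a \<Rightarrow> complex) \<Rightarrow> real" where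
  "L2_nrm m g = sqrt (\<integral>x. (cmod (g x))\<^sup>2 \<partial>m)"

definition L2_bounded_op :: "'a measure \<Rightarrow> (('a \<Rightarrow> complex) \<Rightarrow> 'a \<Rightarrow> complex) \<Rightarrow> bool" where
  "L2_bounded_op m T \<longleftrightarrow>
     (\<forall>g\<in>L2_space m. T g \<in> L2_space m) \<and>
     (\<forall>g\<in>L2_space m. \<forall>h\<in>L2_space m. \<forall>a b.
        AE x in m. T (\<lambda>y. a * g y + b * h y) x = a * T g x + b * T h x) \<and>
     (\<exists>C. \<forall>g\<in>L2_space m. L2_nrm m (T g) \<le> C * L2_nrm m g)"

definition L2_symmetric_op :: "'a measure \<Rightarrow> (('a \<Rightarrow> complex) \<Rightarrow> 'a \<Rightarrow> complex) \<Rightarrow> bool" where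
  "L2_symmetric_op m T \<longleftrightarrow>
     (\<forall>g\<in>L2_space m. \<forall>h\<in>L2_space m. L2_inner m (T g) h = L2_inner m g (T h))"

definition L2_spectrum :: "'a measure \<Rightarrow> (('a \<Rightarrow> complex) \<Rightarrow> 'a \<Rightarrow> complex) \<Rightarrow> complex set" where
  "L2_spectrum m T = {z. \<not> (\<exists>S. L2_bounded_op m S \<and>
     (\<forall>g\<in>L2_space m.
        (AE x in m. S (\<lambda>y. T g y - z * g y) x = g x) \<and>
        (AE x in m. T (S g) x - z * S g x = g x)))}"

definition L2_orthonormal_basis :: "'a measure \<Rightarrow> ('a \<Rightarrow> complex) set \<Rightarrow> bool" where
  "L2_orthonormal_basis m E \<longleftrightarrow>
     E \<subseteq> L2_space m \<and>
     (\<forall>e\<in>E. \<forall>e'\<in>E. L2_inner m e e' = (if e = e' then 1 else 0)) \<and>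
     (\<forall>g\<in>L2_space m. (\<forall>e\<in>E. L2_inner m g e = 0) \<longrightarrow> (AE x in m. g x = 0))"

text \<open>
  \<open>A\<close> is the modulus \<open>\<bar>T\<bar>\<close>, the positive square root of \<open>T\<^sup>* T\<close>; being positive, it is
  self-adjoint, so that \<open>A\<^sup>2 = T\<^sup>* T\<close> is the condition on inner products below.
  The value of the trace does not depend on the orthonormal basis.
\<close>

definition L2_trace_class :: "'a measure \<Rightarrow> (('a \<Rightarrow> complex) \<Rightarrow> 'a \<Rightarrow> complex) \<Rightarrow> bool" where
  "L2_trace_class m T \<longleftrightarrow>
     L2_bounded_op m T \<and>
     (\<exists>A. L2_bounded_op m A \<and>
        (\<forall>g\<in>L2_space m. L2_inner m (A g) g \<in> \<real>\<^sub>\<ge>\<^sub>0) \<and>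
        (\<forall>g\<in>L2_space m. \<forall>h\<in>L2_space m. L2_inner m (A g) (A h) = L2_inner m (T g) (T h)) \<and>
        (\<exists>E. L2_orthonormal_basis m E \<and> (\<lambda>e. Re (L2_inner m (A e) e)) summable_on E))"

definition kernel_op :: "'a measure \<Rightarrow> ('a \<Rightarrow> 'a \<Rightarrow> complex) \<Rightarrow> ('a \<Rightarrow> complex) \<Rightarrow> 'a \<Rightarrow> complex" where
  "kernel_op m k g x = (\<integral>y. k x y * g y \<partial>m)"

definition bounded_integral_op :: "'a measure \<Rightarrow> ('a \<Rightarrow> 'a \<Rightarrow> complex) \<Rightarrow> bool" where
  "bounded_integral_op m k \<longleftrightarrow>
     case_prod k \<in> borel_measurable (m \<Otimes>\<^sub>M m) \<and>
     (\<forall>g\<in>L2_space m. AE x in m. integrable m (\<lambda>y. k x y * g y)) \<and>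
     L2_bounded_op m (kernel_op m k)"

definition locally_trace_class :: "('a::euclidean_space \<Rightarrow> 'a \<Rightarrow> complex) \<Rightarrow> bool" where
  "locally_trace_class k \<longleftrightarrow>
     (\<forall>\<Lambda>. compact \<Lambda> \<longrightarrow>
        L2_trace_class (restrict_space lborel \<Lambda>) (kernel_op (restrict_space lborel \<Lambda>) k))"


section \<open>Point processes\<close>

text \<open>
  A simple point process is a random locally finite set of points, i.e. the support of the
  corresponding random sum of Dirac masses; integration against that random measure is
  integration with respect to \<open>count_space\<close> of the random set.
\<close>

definition locally_finite_set :: "'a::euclidean_space set \<Rightarrow> bool" where
  "locally_finite_set S \<longleftrightarrow> (\<forall>C. compact C \<longrightarrow> finite (S \<inter> C))"

definition config_space :: "'a::euclidean_space set measure" where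
  "config_space = sigma {S. locally_finite_set S}
     {{S. locally_finite_set S \<and> card (S \<inter> D) = n} | D n. D \<in> sets borel \<and> bounded D}"

definition simple_point_process :: "'w measure \<Rightarrow> ('w \<Rightarrow> 'a::euclidean_space set) \<Rightarrow> bool" where
  "simple_point_process M \<xi> \<longleftrightarrow> prob_space M \<and> \<xi> \<in> measurable M config_space"

definition num_points :: "'a set \<Rightarrow> 'a set \<Rightarrow> ennreal" where
  "num_points S D = emeasure (count_space UNIV) (S \<inter> D)"

definition stationary_pp :: "'w measure \<Rightarrow> ('w \<Rightarrow> 'a::euclidean_space set) \<Rightarrow> bool" where
  "stationary_pp M \<xi> \<longleftrightarrow>
     (\<forall>v. distr M config_space (\<lambda>\<omega>. (+) v ` \<xi> \<omega>) = distr M config_space \<xi>)"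

definition corr_det :: "('a \<Rightarrow> 'a \<Rightarrow> complex) \<Rightarrow> nat \<Rightarrow> (nat \<Rightarrow> 'a) \<Rightarrow> complex" where
  "corr_det k n x = Determinant.det (Matrix.mat n n (\<lambda>(i, j). k (x i) (x j)))"

text \<open>
  The right-hand side of the defining identity is a possibly infinite integral of a correlation
  function. Requiring \<open>\<rho>\<^sub>n\<close> to be real and nonnegative almost everywhere, which is what the
  identity for bounded sets forces, makes \<open>ennreal (Re _)\<close> lossless.
\<close>

definition determinantal_pp ::
    "'w measure \<Rightarrow> ('w \<Rightarrow> 'a::euclidean_space set) \<Rightarrow> ('a \<Rightarrow> 'a \<Rightarrow> complex) \<Rightarrow> bool" where
  "determinantal_pp M \<xi> k \<longleftrightarrow>
     simple_point_process M \<xi> \<and>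
     case_prod k \<in> borel_measurable (lborel \<Otimes>\<^sub>M lborel) \<and>
     (\<forall>n\<ge>1.
        (AE x in (\<Pi>\<^sub>M i\<in>{..<n}. lborel). corr_det k n x \<in> \<real>\<^sub>\<ge>\<^sub>0) \<and>
        (\<forall>D. (\<forall>i<n. D i \<in> sets borel) \<and> disjoint_family_on D {..<n} \<longrightarrow>
           (\<integral>\<^sup>+\<omega>. (\<Prod>i<n. num_points (\<xi> \<omega>) (D i)) \<partial>M) =
           (\<integral>\<^sup>+x. ennreal (Re (corr_det k n x)) * indicator (\<Pi>\<^sub>E i\<in>{..<n}. D i) x
              \<partial>(\<Pi>\<^sub>M i\<in>{..<n}. lborel))))"

text \<open>
  Independent marking: the points of \<open>\<phi>\<close> are enumerated measurably, without repetition, as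
  \<open>X\<^sub>0, X\<^sub>1, \<dots>\<close> (finitely many or infinitely many, according to \<open>N\<close>), and \<open>X\<^sub>n\<close> receives
  the mark \<open>R\<^sub>n\<close>, where \<open>(R\<^sub>n)\<close> is i.i.d. with density \<open>g\<close> and independent of \<open>(N, (X\<^sub>n))\<close>.
\<close>

definition iid_marking ::
    "'w measure \<Rightarrow> ('w \<Rightarrow> 'a::euclidean_space set) \<Rightarrow> ('w \<Rightarrow> ('a \<times> real) set) \<Rightarrow> (real \<Rightarrow> real) \<Rightarrow> bool"
where
  "iid_marking M \<phi> \<Phi> g \<longleftrightarrow>
     (\<exists>(N :: 'w \<Rightarrow> enat) (X :: nat \<Rightarrow> 'w \<Rightarrow> 'a) (R :: nat \<Rightarrow> 'w \<Rightarrow> real).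
        N \<in> measurable M (count_space UNIV) \<and>
        (\<forall>n. X n \<in> borel_measurable M) \<and>
        (\<forall>n. distributed M lborel (R n) (\<lambda>r. ennreal (g r))) \<and>
        prob_space.indep_vars M (\<lambda>_. borel) R UNIV \<and>
        prob_space.indep_set M
          (sets (vimage_algebra (space M) (\<lambda>\<omega>. (N \<omega>, \<lambda>n. X n \<omega>))
             (count_space UNIV \<Otimes>\<^sub>M (\<Pi>\<^sub>M n\<in>UNIV. borel))))
          (sets (vimage_algebra (space M) (\<lambda>\<omega> n. R n \<omega>) (\<Pi>\<^sub>M n\<in>UNIV. borel))) \<and>
        (\<forall>\<omega>\<in>space M.
           inj_on (\<lambda>n. X n \<omega>) {n. enat n < N \<omega>} \<and>
           \<phi> \<omega> = (\<lambda>n. X n \<omega>) ` {n. enat n < N \<omega>} \<and>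
           \<Phi> \<omega> = (\<lambda>n. (X n \<omega>, R n \<omega>)) ` {n. enat n < N \<omega>}))"

definition ball_field ::
    "('w \<Rightarrow> ('a::euclidean_space \<times> real) set) \<Rightarrow> 'a measure \<Rightarrow> 'w \<Rightarrow> real" where
  "ball_field \<Phi> \<mu> \<omega> = (\<integral>(x, r). measure \<mu> (cball x r) \<partial>count_space (\<Phi> \<omega>))"

definition centered_ball_field ::
    "'w measure \<Rightarrow> ('w \<Rightarrow> ('a::euclidean_space \<times> real) set) \<Rightarrow> 'a measure \<Rightarrow> 'w \<Rightarrow> real" where
  "centered_ball_field M \<Phi> \<mu> \<omega> = ball_field \<Phi> \<mu> \<omega> - (\<integral>\<omega>'. ball_field \<Phi> \<mu> \<omega>' \<partial>M)"


section \<open>The index set of the fields\<close>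

definition L2c_densities :: "('a::euclidean_space \<Rightarrow> real) set" where
  "L2c_densities = {\<phi> \<in> borel_measurable borel.
     (\<forall>x. 0 \<le> \<phi> x) \<and> integrable lborel (\<lambda>x. (\<phi> x)\<^sup>2) \<and>
     (\<exists>C. compact C \<and> (\<forall>x. x \<notin> C \<longrightarrow> \<phi> x = 0))}"

definition L2c_measures :: "'a::euclidean_space measure set" where
  "L2c_measures = {density lborel (\<lambda>x. ennreal (\<phi> x)) | \<phi>. \<phi> \<in> L2c_densities}"


section \<open>Stable random measures and stable integrals\<close>

definition has_stable_law :: "'w measure \<Rightarrow> ('w \<Rightarrow> real) \<Rightarrow> real \<Rightarrow> real \<Rightarrow> real \<Rightarrow> bool" where
  "has_stable_law Q X \<gamma> \<sigma> b \<longleftrightarrow>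
     X \<in> borel_measurable Q \<and>
     (\<forall>t. char (distr Q borel X) t =
        exp (- complex_of_real (\<sigma> powr \<gamma> * \<bar>t\<bar> powr \<gamma>) *
             (1 - \<i> * complex_of_real (b * sgn t * tan (pi * \<gamma> / 2)))))"

text \<open>
  A \<open>\<gamma>\<close>-stable random measure with control measure \<open>m\<close> and constant skewness \<open>b\<close>, defined on
  the sets of finite control measure: independently scattered, almost surely countably
  additive, and \<open>W A\<close> has law \<open>S\<^sub>\<gamma>(m(A)\<^sup>1\<^sup>/\<^sup>\<gamma>, b, 0)\<close>.
\<close>

definition finite_sets :: "'a measure \<Rightarrow> 'a set set" where
  "finite_sets m = {A \<in> sets m. emeasure m A < \<infinity>}"

definition stable_random_measure ::
    "'w measure \<Rightarrow> real \<Rightarrow> 'a measure \<Rightarrow> real \<Rightarrow> ('a set \<Rightarrow> 'w \<Rightarrow> real) \<Rightarrow> bool" where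
  "stable_random_measure Q \<gamma> m b W \<longleftrightarrow>
     prob_space Q \<and>
     (\<forall>A\<in>finite_sets m. has_stable_law Q (W A) \<gamma> (measure m A powr (1 / \<gamma>)) b) \<and>
     (\<forall>A :: nat \<Rightarrow> 'a set. range A \<subseteq> finite_sets m \<and> disjoint_family A \<longrightarrow>
        prob_space.indep_vars Q (\<lambda>_. borel) (\<lambda>i. W (A i)) UNIV) \<and>
     (\<forall>A :: nat \<Rightarrow> 'a set. range A \<subseteq> finite_sets m \<and> disjoint_family A \<and> (\<Union>i. A i) \<in> finite_sets m \<longrightarrow>
        (AE \<omega> in Q. (\<lambda>i. W (A i) \<omega>) sums W (\<Union>i. A i) \<omega>))"

definition integrable_simple :: "'a measure \<Rightarrow> ('a \<Rightarrow> real) \<Rightarrow> bool" where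
  "integrable_simple m s \<longleftrightarrow>
     simple_function m s \<and> (\<forall>c. c \<noteq> 0 \<longrightarrow> s -` {c} \<inter> space m \<in> finite_sets m)"

definition simple_stable_integral ::
    "'a measure \<Rightarrow> ('a set \<Rightarrow> 'w \<Rightarrow> real) \<Rightarrow> ('a \<Rightarrow> real) \<Rightarrow> 'w \<Rightarrow> real" where
  "simple_stable_integral m W s \<omega> = (\<Sum>c\<in>s ` space m - {0}. c * W (s -` {c} \<inter> space m) \<omega>)"

definition conv_in_prob :: "'w measure \<Rightarrow> (nat \<Rightarrow> 'w \<Rightarrow> real) \<Rightarrow> ('w \<Rightarrow> real) \<Rightarrow> bool" where
  "conv_in_prob Q X Y \<longleftrightarrow>
     (\<forall>\<epsilon>>0. (\<lambda>n. measure Q {\<omega>\<in>space Q. \<bar>X n \<omega> - Y \<omega>\<bar> > \<epsilon>}) \<longlonglongrightarrow> 0)"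

text \<open>
  \<open>Y\<close> is (a version of) the stable integral of \<open>\<phi> \<in> L\<^sup>\<gamma>(m)\<close> with respect to \<open>W\<close>: the limit in
  probability of the integrals of simple functions converging to \<open>\<phi>\<close> in \<open>L\<^sup>\<gamma>(m)\<close>.
\<close>

definition has_stable_integral ::
    "'w measure \<Rightarrow> real \<Rightarrow> 'a measure \<Rightarrow> ('a set \<Rightarrow> 'w \<Rightarrow> real) \<Rightarrow> ('a \<Rightarrow> real) \<Rightarrow> ('w \<Rightarrow> real) \<Rightarrow> bool"
where
  "has_stable_integral Q \<gamma> m W \<phi> Y \<longleftrightarrow>
     \<phi> \<in> borel_measurable m \<and> integrable m (\<lambda>x. \<bar>\<phi> x\<bar> powr \<gamma>) \<and>
     Y \<in> borel_measurable Q \<and>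
     (\<exists>s :: nat \<Rightarrow> 'a \<Rightarrow> real.
        (\<forall>n. integrable_simple m (s n)) \<and>
        (\<lambda>n. \<integral>\<^sup>+x. ennreal (\<bar>s n x - \<phi> x\<bar> powr \<gamma>) \<partial>m) \<longlonglongrightarrow> 0 \<and>
        conv_in_prob Q (\<lambda>n. simple_stable_integral m W (s n)) Y)"


section \<open>Convergence in distribution\<close>

definition conv_in_distr ::
    "'b filter \<Rightarrow> ('b \<Rightarrow> 'w measure) \<Rightarrow> ('b \<Rightarrow> 'w \<Rightarrow> 'e::euclidean_space) \<Rightarrow>
     'v measure \<Rightarrow> ('v \<Rightarrow> 'e) \<Rightarrow> bool" where
  "conv_in_distr F P X Q Y \<longleftrightarrow>
     (\<forall>\<^sub>F i in F. X i \<in> borel_measurable (P i)) \<and> Y \<in> borel_measurable Q \<and>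
     (\<forall>h :: 'e \<Rightarrow> real. continuous_on UNIV h \<and> bounded (range h) \<longrightarrow>
        ((\<lambda>i. \<integral>\<omega>. h (X i \<omega>) \<partial>P i) \<longlongrightarrow> (\<integral>\<omega>. h (Y \<omega>) \<partial>Q)) F)"

end

theory Submission
  imports Defs "HOL-Real_Asymp.Real_Asymp"
begin

text \<open>
  For a linear combination of the fields, let \<open>u(x, r)\<close> be the contribution of a ball and
  \<open>G(x) = \<integral> (exp (i u(x, r)) - 1) \<nu>(dr)\<close>. Integrating out the marks turns the characteristic
  function into the expectation of the product of \<open>1 + G\<close> over the points. The product differs from
  \<open>exp (\<Sum> G)\<close> by \<open>O(\<Sum> \<bar>G\<bar>\<^sup>2)\<close>, and the variance of \<open>\<Sum> G\<close> is at most
  \<open>(K\<^sub>\<rho>(0) + \<integral> \<bar>K\<^sub>\<rho>\<bar>\<^sup>2) \<integral> \<bar>G\<bar>\<^sup>2\<close>, because only the term \<open>\<bar>K\<^sub>\<rho>(x - y)\<bar>\<^sup>2\<close> distinguishes the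
  second correlation function from a product. As \<open>\<integral> \<bar>G\<bar>\<^sup>2 = O(\<lambda>(\<rho>)\<^sup>-\<^sup>2\<^sup>/\<^sup>\<gamma>)\<close> with \<open>\<gamma> < 2\<close>, the
  characteristic function agrees in the limit with the Poissonian \<open>exp (K\<^sub>\<rho>(0) \<integral> G)\<close>; of
  the determinantal structure only two moments are used. Rescaling the radii by
  \<open>\<lambda>(\<rho>)\<^sup>1\<^sup>/\<^sup>\<beta> \<rho>\<close>, which tends to 0, replaces ball integrals by multiples of the density itself and
  the radius law by its power tail, and the exponent converges to the stable one. The continuity
  theorem of Levy, reduced to the Stone-Weierstrass theorem on a torus, concludes.
\<close>

section \<open>Power integrals\<close>

text \<open>A \<gamma>-stable law with \<gamma> < 2 has infinite variance unless it is degenerate,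
  so no uniform variance bound for the normalised fields can hold. The detour through
  \<open>G\<close> is what makes second moments usable: the mark at a point is averaged before
  anything is squared. This average needs only the mean volume of a ball, which is finite because
  \<beta> > d, whereas the mean squared volume is infinite because \<beta> < 2d. Membership of the
  densities in L^2 enters here, since integration over balls of volume V acts on L^2 with norm at
  most V. The radius unit \<lambda>(\<rho>)^(1/\<beta>) \<rho> is the size that, up to constants,
  one ball per unit volume exceeds, and n(\<rho>) is its d-th power. In this unit the compensated
  exponent is quadratic in the volume for small balls and linear for large ones; the two bounds on
  \<beta> are the convergence of its two ends. Every ball adds mass, so all jumps are positive and
  the skewness is 1.\<close>

lemma nn_integral_powr_substitution:
  fixes F :: "real \<Rightarrow> ennreal" and c p :: real
  assumes [measurable]: "F \<in> borel_measurable borel" and c: "0 < c" and p: "0 < p"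
  shows "(\<integral>\<^sup>+s. F (c * s powr p) * ennreal (c * p * s powr (p - 1)) * indicator {0<..} s \<partial>lborel) =
         (\<integral>\<^sup>+v. F v * indicator {0<..} v \<partial>lborel)"
proof -
  \<comment> \<open>The substitution rule is available for compact intervals on which the map is
    differentiable, and \<open>s powr p\<close> need not be differentiable at 0. Both half lines are
    therefore exhausted by compact intervals, \<open>B k\<close> being the image of
    \<open>A k\<close>, and the two sides become measures of increasing unions.\<close>
  define A where "A k = {1 / real (Suc k) .. real (Suc k)}" for k
  define g where "g s = c * s powr p" for s :: real
  define B where "B k = {g (1 / real (Suc k)) .. g (real (Suc k))}" for k
  have A_mono: "incseq A"
    by (auto simp: incseq_def A_def frac_le intro: order_trans)
  have mono_g: "0 \<le> s \<Longrightarrow> s \<le> t \<Longrightarrow> g s \<le> g t" for s t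
    unfolding g_def using c p by (intro mult_left_mono powr_mono2) auto
  have B_mono: "incseq B"
  proof (unfold incseq_def, intro allI impI)
    fix m n :: nat assume "m \<le> n"
    then have "g (1 / real (Suc n)) \<le> g (1 / real (Suc m))" "g (real (Suc m)) \<le> g (real (Suc n))"
      by (auto intro!: mono_g simp: frac_le)
    then show "B m \<subseteq> B n" by (auto simp: B_def)
  qed
  have A_un: "(\<Union>k. A k) = {0<..}"
  proof (intro Set.set_eqI iffI)
    fix x :: real assume "x \<in> (\<Union>k. A k)"
    then obtain k where "1 / real (Suc k) \<le> x" by (auto simp: A_def)
    moreover have "0 < 1 / real (Suc k)" by simp
    ultimately have "0 < x" by linarith
    then show "x \<in> {0<..}" by simp
  next
    fix x :: real assume x: "x \<in> {0<..}"
    obtain k where k: "max x (1 / x) \<le> real k" using real_arch_simple by blast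
    then have "x \<le> real (Suc k)" "1 / x \<le> real (Suc k)" by auto
    with x have "x \<in> A k" by (auto simp: A_def field_simps)
    then show "x \<in> (\<Union>k. A k)" by blast
  qed
  have B_un: "(\<Union>k. B k) = {0<..}"
  proof (intro Set.set_eqI iffI)
    fix x :: real assume "x \<in> (\<Union>k. B k)"
    then obtain k where "g (1 / real (Suc k)) \<le> x" by (auto simp: B_def)
    moreover have "0 < g (1 / real (Suc k))" using c by (simp add: g_def)
    ultimately have "0 < x" by linarith
    then show "x \<in> {0<..}" by simp
  next
    fix x :: real assume x: "x \<in> {0<..}"
    define s where "s = (x / c) powr (1 / p)"
    have gs: "g s = x" and s0: "s > 0" using x c p by (auto simp: s_def g_def powr_powr)
    have "s \<in> (\<Union>k. A k)" using s0 A_un by simp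
    then obtain k where "s \<in> A k" by blast
    then have "x \<in> B k" using s0 by (auto simp: A_def B_def gs[symmetric] intro!: mono_g)
    then show "x \<in> (\<Union>k. B k)" by blast
  qed
  have eq: "(\<integral>\<^sup>+v. F v * indicator (B k) v \<partial>lborel) =
      (\<integral>\<^sup>+s. F (g s) * ennreal (c * p * s powr (p - 1)) * indicator (A k) s \<partial>lborel)" for k
    unfolding A_def B_def
  \<comment> \<open>For \<open>k = 0\<close> the interval is the single point 1, which the
    substitution rule for proper intervals excludes; both sides are then integrals over null
    sets.\<close>
  proof (cases "k = 0")
    case True
    have "(\<integral>\<^sup>+v. F v * indicator {g 1..g 1} v \<partial>lborel) = 0"
      by (subst nn_integral_0_iff_AE, measurable)
         (auto intro!: AE_I'[of "{g 1}"] simp: indicator_def split: if_splits)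
    moreover have "(\<integral>\<^sup>+s. F (g s) * ennreal (c * p * s powr (p - 1)) * indicator {1..1} s \<partial>lborel) = 0"
      unfolding g_def by (subst nn_integral_0_iff_AE, measurable)
         (auto intro!: AE_I'[of "{1}"] simp: indicator_def split: if_splits)
    ultimately show "(\<integral>\<^sup>+v. F v * indicator {g (1 / real (Suc k))..g (real (Suc k))} v \<partial>lborel) =
      (\<integral>\<^sup>+s. F (g s) * ennreal (c * p * s powr (p - 1)) * indicator {1 / real (Suc k)..real (Suc k)} s \<partial>lborel)"
      using True by simp
  next
    case False
    then show "(\<integral>\<^sup>+v. F v * indicator {g (1 / real (Suc k))..g (real (Suc k))} v \<partial>lborel) =
      (\<integral>\<^sup>+s. F (g s) * ennreal (c * p * s powr (p - 1)) * indicator {1 / real (Suc k)..real (Suc k)} s \<partial>lborel)"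
    proof (intro nn_integral_substitution_aux)
      have pos: "x > 0" if "x \<in> {1 / real (Suc k)..real (Suc k)}" for x
      proof -
        have "0 < 1 / real (Suc k)" by simp
        moreover have "1 / real (Suc k) \<le> x" using that by simp
        ultimately show ?thesis by linarith
      qed
      show "(g has_real_derivative c * p * x powr (p - 1)) (at x)" if "x \<in> {1 / real (Suc k)..real (Suc k)}" for x
        unfolding g_def using pos[OF that] p
        by (auto intro!: derivative_eq_intros simp: field_simps powr_diff)
      show "continuous_on {1 / real (Suc k)..real (Suc k)} (\<lambda>x. c * p * x powr (p - 1))"
        using pos by (intro continuous_intros) force
      show "0 \<le> c * p * x powr (p - 1)" for x using c p by simp
      show "1 / real (Suc k) < real (Suc k)" using False by (simp add: field_simps add_pos_nonneg)
    qed auto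
  qed
  have "(\<integral>\<^sup>+v. F v * indicator {0<..} v \<partial>lborel) = emeasure (density lborel F) (\<Union>k. B k)"
    unfolding B_un by (subst emeasure_density) auto
  also have "\<dots> = (SUP k. emeasure (density lborel F) (B k))"
    by (intro SUP_emeasure_incseq[symmetric] B_mono) (auto simp: B_def)
  also have "\<dots> = (SUP k. \<integral>\<^sup>+v. F v * indicator (B k) v \<partial>lborel)"
    by (subst emeasure_density) (auto simp: B_def)
  also have "\<dots> = (SUP k. emeasure (density lborel (\<lambda>s. F (g s) * ennreal (c * p * s powr (p - 1)))) (A k))"
    unfolding eq g_def by (subst emeasure_density) (auto simp: A_def)
  also have "\<dots> = emeasure (density lborel (\<lambda>s. F (g s) * ennreal (c * p * s powr (p - 1)))) (\<Union>k. A k)"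
    by (intro SUP_emeasure_incseq A_mono) (auto simp: A_def)
  also have "\<dots> = (\<integral>\<^sup>+s. F (g s) * ennreal (c * p * s powr (p - 1)) * indicator {0<..} s \<partial>lborel)"
    unfolding A_un g_def by (subst emeasure_density) auto
  finally show ?thesis by (simp add: g_def)
qed

lemma nn_integral_exp_powr:
  assumes a: "0 < (a::real)" and s: "0 < (s::real)"
  shows "(\<integral>\<^sup>+v. ennreal (v powr (a - 1) * exp (- (s * v))) * indicator {0<..} v \<partial>lborel) =
    ennreal (Gamma a * s powr (- a))"
proof -
  have "ennreal (Gamma a) = (\<integral>\<^sup>+t. ennreal (t powr (a - 1) / exp t) * indicator {0<..} t \<partial>lborel)"
    unfolding Gamma_conv_nn_integral_real[OF a]
    by (rule nn_integral_cong_AE, rule AE_I'[of "{0}"])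
       (auto simp: indicator_def split: if_splits)
  also have "\<dots> = (\<integral>\<^sup>+v. ennreal ((s * v powr 1) powr (a - 1) / exp (s * v powr 1)) * ennreal (s * 1 * v powr (1 - 1)) * indicator {0<..} v \<partial>lborel)"
    using s by (intro nn_integral_powr_substitution[symmetric]) auto
  also have "\<dots> = (\<integral>\<^sup>+v. ennreal (s powr a) * (ennreal (v powr (a - 1) * exp (- (s * v))) * indicator {0<..} v) \<partial>lborel)"
    using s by (intro nn_integral_cong)
       (auto simp: indicator_def ennreal_mult[symmetric] powr_mult exp_minus powr_diff field_simps)
  also have "\<dots> = ennreal (s powr a) * (\<integral>\<^sup>+v. ennreal (v powr (a - 1) * exp (- (s * v))) * indicator {0<..} v \<partial>lborel)"
    by (intro nn_integral_cmult) auto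
  finally have "ennreal (s powr - a) * ennreal (Gamma a) = ennreal (s powr - a * s powr a) * (\<integral>\<^sup>+v. ennreal (v powr (a - 1) * exp (- (s * v))) * indicator {0<..} v \<partial>lborel)"
    by (simp add: ennreal_mult mult.assoc)
  then show ?thesis using s a
    by (simp add: powr_add[symmetric] ennreal_mult[symmetric] Gamma_real_pos mult.commute less_imp_le)
qed

text \<open>Writing \<open>1 / (1 + s\<^sup>2)\<close> as the integral of
  \<open>exp (- (u * (1 + s\<^sup>2)))\<close> over \<open>u > 0\<close> and exchanging the
  integrals leaves two Gamma integrals, with parameters \<open>a / 2\<close> and
  \<open>1 - a / 2\<close>; the reflection formula turns their product into the sine.\<close>

lemma nn_integral_powr_div_one_plus_square:
  assumes a: "0 < (a::real)" "a < 2"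
  shows "(\<integral>\<^sup>+s. ennreal (s powr (a - 1) / (1 + s\<^sup>2)) * indicator {0<..} s \<partial>lborel) =
    ennreal (pi / (2 * sin (pi * a / 2)))"
proof -
  have inner: "(\<integral>\<^sup>+s. ennreal (s powr (a - 1) * exp (- (u * s\<^sup>2))) * indicator {0<..} s \<partial>lborel) =
      ennreal (Gamma (a / 2) / 2 * u powr (- a / 2))" if u: "u > 0" for u
  proof -
    have "ennreal (Gamma (a / 2)) = (\<integral>\<^sup>+v. ennreal (v powr (a/2 - 1) * exp (- (1 * v))) * indicator {0<..} v \<partial>lborel)"
      using nn_integral_exp_powr[of "a/2" 1] a by simp
    also have "\<dots> = (\<integral>\<^sup>+s. ennreal ((u * s powr 2) powr (a/2 - 1) * exp (- (1 * (u * s powr 2)))) * ennreal (u * 2 * s powr (2 - 1)) * indicator {0<..} s \<partial>lborel)"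
      using u by (intro nn_integral_powr_substitution[symmetric]) auto
    also have "\<dots> = (\<integral>\<^sup>+s. ennreal (2 * u powr (a/2)) * (ennreal (s powr (a - 1) * exp (- (u * s\<^sup>2))) * indicator {0<..} s) \<partial>lborel)"
    proof (intro nn_integral_cong)
      fix s :: real
      have "(u * s powr 2) powr (a / 2 - 1) * (u * 2 * s powr (2 - 1)) = 2 * u powr (a / 2) * s powr (a - 1)"
        if "s > 0"
      proof -
        have "(u * s powr 2) powr (a / 2 - 1) * (u * 2 * s powr (2 - 1)) =
          2 * (u powr (a / 2 - 1) * u powr 1) * (s powr (a - 2) * s powr 1)"
          using u that powr_powr[of s 2 "a/2 - 1"]
          by (simp add: powr_mult right_diff_distrib del: powr_numeral)
        also have "\<dots> = 2 * u powr (a / 2) * s powr (a - 1)"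
          unfolding powr_add[symmetric] by simp
        finally show ?thesis .
      qed
      then show "ennreal ((u * s powr 2) powr (a/2 - 1) * exp (- (1 * (u * s powr 2)))) * ennreal (u * 2 * s powr (2 - 1)) * indicator {0<..} s
        = ennreal (2 * u powr (a/2)) * (ennreal (s powr (a - 1) * exp (- (u * s\<^sup>2))) * indicator {0<..} s)"
        using u by (auto simp: indicator_def ennreal_mult[symmetric] mult_ac)
    qed
    also have "\<dots> = ennreal (2 * u powr (a/2)) * (\<integral>\<^sup>+s. (ennreal (s powr (a - 1) * exp (- (u * s\<^sup>2))) * indicator {0<..} s) \<partial>lborel)"
      by (intro nn_integral_cmult) auto
    finally have "ennreal (u powr (- a / 2) / 2) * ennreal (Gamma (a/2)) =
      ennreal (u powr (- a / 2) / 2 * (2 * u powr (a/2))) * (\<integral>\<^sup>+s. (ennreal (s powr (a - 1) * exp (- (u * s\<^sup>2))) * indicator {0<..} s) \<partial>lborel)"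
      by (subst ennreal_mult) (auto simp: mult.assoc)
    moreover have "u powr (- a / 2) / 2 * (2 * u powr (a/2)) = 1"
      using u by (simp add: powr_add[symmetric])
    ultimately show ?thesis using a
      by (simp add: ennreal_mult[symmetric] Gamma_real_pos mult.commute less_imp_le)
  qed
  have e: "(\<integral>\<^sup>+u. ennreal (exp (- (u * (1 + s\<^sup>2)))) * indicator {0<..} u \<partial>lborel) = ennreal (1 / (1 + s\<^sup>2))" for s :: real
  proof -
    have p: "0 < 1 + s\<^sup>2" by (simp add: add_pos_nonneg)
    have "(\<integral>\<^sup>+u. ennreal (exp (- (u * (1 + s\<^sup>2)))) * indicator {0<..} u \<partial>lborel) =
      (\<integral>\<^sup>+u. ennreal (u powr (1 - 1) * exp (- ((1 + s\<^sup>2) * u))) * indicator {0<..} u \<partial>lborel)"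
      by (intro nn_integral_cong) (auto simp: mult.commute split: split_indicator)
    also have "\<dots> = ennreal (1 / (1 + s\<^sup>2))"
      using p by (subst nn_integral_exp_powr) (auto simp: powr_minus divide_inverse)
    finally show ?thesis .
  qed
  have "(\<integral>\<^sup>+s. ennreal (s powr (a - 1) / (1 + s\<^sup>2)) * indicator {0<..} s \<partial>lborel) =
    (\<integral>\<^sup>+s. (\<integral>\<^sup>+u. ennreal (s powr (a - 1)) * indicator {0<..} s * (ennreal (exp (- (u * (1 + s\<^sup>2)))) * indicator {0<..} u) \<partial>lborel) \<partial>lborel)"
  proof (intro nn_integral_cong)
    fix s :: real
    show "ennreal (s powr (a - 1) / (1 + s\<^sup>2)) * indicator {0<..} s =
      (\<integral>\<^sup>+u. ennreal (s powr (a - 1)) * indicator {0<..} s * (ennreal (exp (- (u * (1 + s\<^sup>2)))) * indicator {0<..} u) \<partial>lborel)"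
      by (subst nn_integral_cmult, measurable, cases "s > 0")
        (simp_all add: e ennreal_mult[symmetric] divide_inverse)
  qed
  also have "\<dots> = (\<integral>\<^sup>+u. (\<integral>\<^sup>+s. ennreal (s powr (a - 1)) * indicator {0<..} s * (ennreal (exp (- (u * (1 + s\<^sup>2)))) * indicator {0<..} u) \<partial>lborel) \<partial>lborel)"
    by (rule lborel_pair.Fubini') measurable
  also have "\<dots> = (\<integral>\<^sup>+u. (\<integral>\<^sup>+s. (ennreal (exp (- u)) * indicator {0<..} u) * (ennreal (s powr (a - 1) * exp (- (u * s\<^sup>2))) * indicator {0<..} s) \<partial>lborel) \<partial>lborel)"
    by (intro nn_integral_cong)
       (auto simp: indicator_def ennreal_mult[symmetric] exp_add[symmetric] algebra_simps)
  also have "\<dots> = (\<integral>\<^sup>+u. (ennreal (exp (- u)) * indicator {0<..} u) * ennreal (Gamma (a / 2) / 2 * u powr (- a / 2)) \<partial>lborel)"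
  proof (intro nn_integral_cong)
    fix u :: real
    show "(\<integral>\<^sup>+s. (ennreal (exp (- u)) * indicator {0<..} u) * (ennreal (s powr (a - 1) * exp (- (u * s\<^sup>2))) * indicator {0<..} s) \<partial>lborel)
      = (ennreal (exp (- u)) * indicator {0<..} u) * ennreal (Gamma (a / 2) / 2 * u powr (- a / 2))"
      by (subst nn_integral_cmult, measurable, cases "u > 0") (simp_all add: inner)
  qed
  also have "\<dots> = (\<integral>\<^sup>+u. ennreal (Gamma (a / 2) / 2) * (ennreal (u powr ((1 - a / 2) - 1) * exp (- (1 * u))) * indicator {0<..} u) \<partial>lborel)"
    using a by (intro nn_integral_cong) (auto simp: indicator_def ennreal_mult[symmetric] Gamma_real_pos less_imp_le)
  also have "\<dots> = ennreal (Gamma (a / 2) / 2) * ennreal (Gamma (1 - a / 2) * 1 powr (- (1 - a / 2)))"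
    using a by (subst nn_integral_cmult, measurable, subst nn_integral_exp_powr) simp_all
  also have "\<dots> = ennreal (Gamma (a / 2) * Gamma (1 - a / 2) / 2)"
    using a by (simp add: ennreal_mult[symmetric] Gamma_real_pos less_imp_le)
  also have "Gamma (a / 2) * Gamma (1 - a / 2) = pi / sin (pi * (a / 2))"
  proof -
    have "complex_of_real (Gamma (a / 2) * Gamma (1 - a / 2)) = complex_of_real (pi / sin (pi * (a / 2)))"
      using Gamma_reflection_complex[of "complex_of_real (a/2)"]
      by (simp add: Gamma_complex_of_real[symmetric] sin_of_real[symmetric])
    then show ?thesis by (simp only: of_real_eq_iff)
  qed
  finally show ?thesis by (simp add: mult.commute)
qed

text \<open>
  Writing \<open>v\<^sup>-\<^sup>g\<^sup>-\<^sup>1\<close> as a mixture of exponentials makes the oscillating integrals elementary and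
  leaves a beta integral.
\<close>

lemma nn_integral_powr_eq_laplace:
  fixes h :: "real \<Rightarrow> real"
  assumes [measurable]: "h \<in> borel_measurable borel" and h: "\<And>v. 0 < v \<Longrightarrow> 0 \<le> h v" and g: "-1 < g"
  shows "(\<integral>\<^sup>+v. ennreal (h v * v powr (- g - 1)) * indicator {0<..} v \<partial>lborel) =
    ennreal (1 / Gamma (g + 1)) * (\<integral>\<^sup>+s. ennreal (s powr g) *
       (\<integral>\<^sup>+v. ennreal (h v * exp (- (s * v))) * indicator {0<..} v \<partial>lborel) * indicator {0<..} s \<partial>lborel)"
proof -
  have G: "0 < Gamma (g + 1)" using g by (simp add: Gamma_real_pos)
  have e: "ennreal (v powr (- g - 1)) =
     ennreal (1 / Gamma (g + 1)) * (\<integral>\<^sup>+s. ennreal (s powr g * exp (- (s * v))) * indicator {0<..} s \<partial>lborel)" if "v > 0" for v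
    using nn_integral_exp_powr[of "g + 1" v] g that G less_imp_neq[OF G]
    by (simp add: mult.commute ennreal_mult[symmetric])
  have "(\<integral>\<^sup>+v. ennreal (h v * v powr (- g - 1)) * indicator {0<..} v \<partial>lborel) =
    (\<integral>\<^sup>+v. ennreal (h v) * indicator {0<..} v * (ennreal (1 / Gamma (g + 1)) *
       (\<integral>\<^sup>+s. ennreal (s powr g * exp (- (s * v))) * indicator {0<..} s \<partial>lborel)) \<partial>lborel)"
  proof (intro nn_integral_cong)
    fix v :: real
    show "ennreal (h v * v powr (- g - 1)) * indicator {0<..} v = ennreal (h v) * indicator {0<..} v * (ennreal (1 / Gamma (g + 1)) *
       (\<integral>\<^sup>+s. ennreal (s powr g * exp (- (s * v))) * indicator {0<..} s \<partial>lborel))"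
      using h[of v] by (cases "v > 0") (simp_all add: e[simplified] ennreal_mult)
  qed
  also have "\<dots> = ennreal (1 / Gamma (g + 1)) * (\<integral>\<^sup>+v. ennreal (h v) * indicator {0<..} v *
       (\<integral>\<^sup>+s. ennreal (s powr g * exp (- (s * v))) * indicator {0<..} s \<partial>lborel) \<partial>lborel)"
    by (subst nn_integral_cmult[symmetric], measurable) (simp add: mult_ac)
  also have "(\<integral>\<^sup>+v. ennreal (h v) * indicator {0<..} v *
       (\<integral>\<^sup>+s. ennreal (s powr g * exp (- (s * v))) * indicator {0<..} s \<partial>lborel) \<partial>lborel) =
     (\<integral>\<^sup>+v. (\<integral>\<^sup>+s. ennreal (h v) * indicator {0<..} v *
       (ennreal (s powr g * exp (- (s * v))) * indicator {0<..} s) \<partial>lborel) \<partial>lborel)"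
    by (subst nn_integral_cmult, measurable)
  also have "\<dots> = (\<integral>\<^sup>+s. (\<integral>\<^sup>+v. ennreal (h v) * indicator {0<..} v *
       (ennreal (s powr g * exp (- (s * v))) * indicator {0<..} s) \<partial>lborel) \<partial>lborel)"
    by (rule lborel_pair.Fubini') measurable
  also have "\<dots> = (\<integral>\<^sup>+s. (\<integral>\<^sup>+v. ennreal (s powr g) * indicator {0<..} s *
       (ennreal (h v * exp (- (s * v))) * indicator {0<..} v) \<partial>lborel) \<partial>lborel)"
    using h by (intro nn_integral_cong) (auto simp: indicator_def ennreal_mult[symmetric] mult_ac)
  also have "\<dots> = (\<integral>\<^sup>+s. ennreal (s powr g) * (\<integral>\<^sup>+v.
       (ennreal (h v * exp (- (s * v))) * indicator {0<..} v) \<partial>lborel) * indicator {0<..} s \<partial>lborel)"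
    by (intro nn_integral_cong, subst nn_integral_cmult) (auto simp: mult_ac)
  finally show ?thesis .
qed

section \<open>Laplace transforms of \<open>1 - cos v\<close> and \<open>v - sin v\<close>\<close>

lemma tendsto_exp_bounded_at_top:
  fixes q :: "real \<Rightarrow> real"
  assumes s: "0 < s" and q: "\<And>v. \<bar>q v\<bar> \<le> C"
  shows "((\<lambda>v. exp (- (s * v)) * q v) \<longlongrightarrow> 0) at_top"
proof (rule Lim_null_comparison)
  show "((\<lambda>v. exp (- (s * v)) * C) \<longlongrightarrow> 0) at_top" using s by real_asymp
  show "\<forall>\<^sub>F v in at_top. norm (exp (- (s * v)) * q v) \<le> exp (- (s * v)) * C"
    using q by (intro always_eventually) (auto simp: abs_mult)
qed

lemma nn_integral_one_minus_cos_exp: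
  assumes s: "0 < (s::real)"
  shows "(\<integral>\<^sup>+v. ennreal ((1 - cos v) * exp (- (s * v))) * indicator {0<..} v \<partial>lborel) =
    ennreal (1 / (s * (1 + s\<^sup>2)))"
proof -
  \<comment> \<open>Primitive of \<open>(1 - cos v) * exp (- (s * v))\<close> that vanishes at
    infinity; its second term comes from integrating \<open>exp (- (s * v)) * cos v\<close> by parts
    twice. The integral is then \<open>- F 0\<close>.\<close>
  define F where "F v = - exp (- (s * v)) / s - exp (- (s * v)) * ((sin v - s * cos v) / (1 + s\<^sup>2))" for v
  have p: "1 + s\<^sup>2 > 0" by (simp add: add_pos_nonneg)
  have "(\<integral>\<^sup>+v. ennreal ((1 - cos v) * exp (- (s * v))) * indicator {0<..} v \<partial>lborel) =
    (\<integral>\<^sup>+v. ennreal ((1 - cos v) * exp (- (s * v))) * indicator {0..} v \<partial>lborel)"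
    by (rule nn_integral_cong_AE, rule AE_I'[of "{0}"])
       (auto simp: indicator_def split: if_splits)
  also have "\<dots> = ennreal (0 - F 0)"
  proof (rule nn_integral_FTC_atLeast)
    show "DERIV F v :> (1 - cos v) * exp (- (s * v))" for v
    proof -
      have s2: "s \<noteq> 0" "1 + s\<^sup>2 \<noteq> 0" using s p by auto
      have dE: "DERIV (\<lambda>v. exp (- (s * v))) v :> - s * exp (- (s * v))"
        by (auto intro!: derivative_eq_intros)
      have dR: "DERIV (\<lambda>v. - 1 / s - (sin v - s * cos v) / (1 + s\<^sup>2)) v :> - (cos v + s * sin v) / (1 + s\<^sup>2)"
      proof -
        have "DERIV (\<lambda>v. - 1 / s - (sin v - s * cos v) * X) v :> - (cos v + s * sin v) * X" for X
          by (auto intro!: derivative_eq_intros simp: algebra_simps)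
        from this[of "inverse (1 + s\<^sup>2)"] show ?thesis by (simp only: divide_inverse)
      qed
      have F: "F = (\<lambda>v. exp (- (s * v)) * (- 1 / s - (sin v - s * cos v) / (1 + s\<^sup>2)))"
        by (auto simp: F_def algebra_simps)
      have "DERIV F v :> exp (- (s * v)) * (- (cos v + s * sin v) / (1 + s\<^sup>2))
          + - s * exp (- (s * v)) * (- 1 / s - (sin v - s * cos v) / (1 + s\<^sup>2))"
        unfolding F by (rule DERIV_mult'[OF dE dR])
      also have "exp (- (s * v)) * (- (cos v + s * sin v) / (1 + s\<^sup>2))
          + - s * exp (- (s * v)) * (- 1 / s - (sin v - s * cos v) / (1 + s\<^sup>2))
        = exp (- (s * v)) * (- (cos v + s * sin v) / (1 + s\<^sup>2) + 1 + s * ((sin v - s * cos v) / (1 + s\<^sup>2)))"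
      proof -
        have "E * A + - s * E * (- 1 / s - B) = E * (A + 1 + s * B)" for E A B :: real
          using s2(1) by (simp add: algebra_simps)
        then show ?thesis .
      qed
      also have "- (cos v + s * sin v) / (1 + s\<^sup>2) + 1 + s * ((sin v - s * cos v) / (1 + s\<^sup>2)) = 1 - cos v"
      proof -
        have "- (cos v + s * sin v) + (1 + s\<^sup>2) + s * (sin v - s * cos v) = (1 - cos v) * (1 + s\<^sup>2)"
          by (simp add: algebra_simps power2_eq_square)
        then have "(- (cos v + s * sin v) + (1 + s\<^sup>2) + s * (sin v - s * cos v)) / (1 + s\<^sup>2) = 1 - cos v"
          by (simp only: nonzero_mult_div_cancel_right[OF s2(2)])
        moreover have gen: "A / D + 1 + B / D = (A + D + B) / D" if "D \<noteq> 0" for A B D :: real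
          using that by (simp add: add_divide_distrib)
        ultimately show ?thesis by (simp only: times_divide_eq_right gen[OF s2(2)])
      qed
      finally show ?thesis by (simp add: mult.commute)
    qed
    have "((\<lambda>v. exp (- (s * v)) * (- 1 / s - (sin v - s * cos v) / (1 + s\<^sup>2))) \<longlongrightarrow> 0) at_top"
    proof (rule tendsto_exp_bounded_at_top[OF s])
      fix v
      have "\<bar>- 1 / s - (sin v - s * cos v) / (1 + s\<^sup>2)\<bar> \<le> 1 / s + (\<bar>sin v\<bar> + \<bar>s * cos v\<bar>) / (1 + s\<^sup>2)"
        using s p by (intro order_trans[OF abs_triangle_ineq4] add_mono)
          (auto simp: abs_divide intro!: divide_right_mono order_trans[OF abs_triangle_ineq4])
      also have "\<dots> \<le> 1 / s + (1 + s) / (1 + s\<^sup>2)"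
        using s p by (intro add_mono divide_right_mono) (auto simp: abs_mult)
      finally show "\<bar>- 1 / s - (sin v - s * cos v) / (1 + s\<^sup>2)\<bar> \<le> 1 / s + (1 + s) / (1 + s\<^sup>2)" .
    qed
    then show "(F \<longlongrightarrow> 0) at_top" unfolding F_def by (simp add: algebra_simps)
  qed auto
  also have "0 - F 0 = 1 / (s * (1 + s\<^sup>2))"
  proof -
    have "0 - F 0 = 1 / s - s / (1 + s\<^sup>2)" by (simp add: F_def)
    also have "\<dots> = ((1 + s\<^sup>2) - s * s) / (s * (1 + s\<^sup>2))"
      using s p by (subst diff_frac_eq) auto
    finally show ?thesis by (simp add: power2_eq_square)
  qed
  finally show ?thesis .
qed

lemma nn_integral_minus_sin_exp:
  assumes s: "0 < (s::real)"
  shows "(\<integral>\<^sup>+v. ennreal ((v - sin v) * exp (- (s * v))) * indicator {0<..} v \<partial>lborel) =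
    ennreal (1 / (s\<^sup>2 * (1 + s\<^sup>2)))"
proof -
  \<comment> \<open>Again the primitive vanishing at infinity: \<open>v * exp (- (s * v))\<close>
    contributes the first term, the sine the second one.\<close>
  define F where "F v = - (v / s + 1 / s\<^sup>2) * exp (- (s * v)) + exp (- (s * v)) * ((s * sin v + cos v) / (1 + s\<^sup>2))" for v
  have p: "1 + s\<^sup>2 > 0" by (simp add: add_pos_nonneg)
  have "(\<integral>\<^sup>+v. ennreal ((v - sin v) * exp (- (s * v))) * indicator {0<..} v \<partial>lborel) =
    (\<integral>\<^sup>+v. ennreal ((v - sin v) * exp (- (s * v))) * indicator {0..} v \<partial>lborel)"
    by (rule nn_integral_cong_AE, rule AE_I'[of "{0}"])
       (auto simp: indicator_def split: if_splits)
  also have "\<dots> = ennreal (0 - F 0)"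
  proof (rule nn_integral_FTC_atLeast)
    show "DERIV F v :> (v - sin v) * exp (- (s * v))" for v
    proof -
      have s2: "s \<noteq> 0" "1 + s\<^sup>2 \<noteq> 0" using s p by auto
      have dE: "DERIV (\<lambda>v. exp (- (s * v))) v :> - s * exp (- (s * v))"
        by (auto intro!: derivative_eq_intros)
      have dR: "DERIV (\<lambda>v. - (v / s + 1 / s\<^sup>2) + (s * sin v + cos v) / (1 + s\<^sup>2)) v :> - 1 / s + (s * cos v - sin v) / (1 + s\<^sup>2)"
      proof -
        have "DERIV (\<lambda>v. - (v * Y + Z) + (s * sin v + cos v) * X) v :> - 1 * Y + (s * cos v - sin v) * X" for X Y Z
          by (auto intro!: derivative_eq_intros simp: algebra_simps)
        from this[of "inverse s" "1 / s\<^sup>2" "inverse (1 + s\<^sup>2)"] show ?thesis by (simp only: divide_inverse)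
      qed
      have F: "F = (\<lambda>v. exp (- (s * v)) * (- (v / s + 1 / s\<^sup>2) + (s * sin v + cos v) / (1 + s\<^sup>2)))"
        by (auto simp: F_def algebra_simps)
      have "DERIV F v :> exp (- (s * v)) * (- 1 / s + (s * cos v - sin v) / (1 + s\<^sup>2))
          + - s * exp (- (s * v)) * (- (v / s + 1 / s\<^sup>2) + (s * sin v + cos v) / (1 + s\<^sup>2))"
        unfolding F by (rule DERIV_mult'[OF dE dR])
      also have "exp (- (s * v)) * (- 1 / s + (s * cos v - sin v) / (1 + s\<^sup>2))
          + - s * exp (- (s * v)) * (- (v / s + 1 / s\<^sup>2) + (s * sin v + cos v) / (1 + s\<^sup>2))
        = exp (- (s * v)) * (v + ((s * cos v - sin v) / (1 + s\<^sup>2) - s * ((s * sin v + cos v) / (1 + s\<^sup>2))))"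
      proof -
        have "E * (- 1 / s + A) + - s * E * (- (v / s + 1 / s\<^sup>2) + B) = E * (v + (A - s * B))" for E A B :: real
          using s2(1) by (simp add: algebra_simps power2_eq_square)
        then show ?thesis .
      qed
      also have "(s * cos v - sin v) / (1 + s\<^sup>2) - s * ((s * sin v + cos v) / (1 + s\<^sup>2)) = - sin v"
      proof -
        have "(s * cos v - sin v) - s * (s * sin v + cos v) = - sin v * (1 + s\<^sup>2)"
          by (simp add: algebra_simps power2_eq_square)
        then have "((s * cos v - sin v) - s * (s * sin v + cos v)) / (1 + s\<^sup>2) = - sin v"
          by (simp only: nonzero_mult_div_cancel_right[OF s2(2)])
        then show ?thesis by (simp only: diff_divide_distrib[of _ _ "1 + s\<^sup>2"] times_divide_eq_right)
      qed
      finally show ?thesis by (simp add: mult.commute)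
    qed
    have "((\<lambda>v. exp (- (s * v)) * ((s * sin v + cos v) / (1 + s\<^sup>2))) \<longlongrightarrow> 0) at_top"
    proof (rule tendsto_exp_bounded_at_top[OF s])
      fix v
      have "\<bar>(s * sin v + cos v) / (1 + s\<^sup>2)\<bar> \<le> (\<bar>s * sin v\<bar> + \<bar>cos v\<bar>) / (1 + s\<^sup>2)"
        using s p by (auto simp: abs_divide intro!: divide_right_mono order_trans[OF abs_triangle_ineq])
      also have "\<dots> \<le> (s + 1) / (1 + s\<^sup>2)"
        using s p by (intro add_mono divide_right_mono) (auto simp: abs_mult)
      finally show "\<bar>(s * sin v + cos v) / (1 + s\<^sup>2)\<bar> \<le> (s + 1) / (1 + s\<^sup>2)" .
    qed
    moreover have "((\<lambda>v. - (v / s + 1 / s\<^sup>2) * exp (- (s * v))) \<longlongrightarrow> 0) at_top"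
      using s by real_asymp
    ultimately show "(F \<longlongrightarrow> 0) at_top" unfolding F_def by (rule tendsto_add_zero[rotated])
  qed (use sin_x_le_x in auto)
  also have "0 - F 0 = 1 / (s\<^sup>2 * (1 + s\<^sup>2))"
  proof -
    have "0 - F 0 = 1 / s\<^sup>2 - 1 / (1 + s\<^sup>2)" by (simp add: F_def)
    also have "\<dots> = ((1 + s\<^sup>2) - s\<^sup>2) / (s\<^sup>2 * (1 + s\<^sup>2))"
      using s p by (subst diff_frac_eq) auto
    finally show ?thesis by simp
  qed
  finally show ?thesis .
qed

lemma nn_integral_one_minus_cos_powr:
  assumes g: "0 < g" "g < 2"
  shows "(\<integral>\<^sup>+v. ennreal ((1 - cos v) * v powr (- g - 1)) * indicator {0<..} v \<partial>lborel) =
    ennreal (pi / (2 * sin (pi * g / 2) * Gamma (g + 1)))"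
proof -
  have G: "0 < Gamma (g + 1)" using g by (simp add: Gamma_real_pos)
  have "(\<integral>\<^sup>+v. ennreal ((1 - cos v) * v powr (- g - 1)) * indicator {0<..} v \<partial>lborel) =
    ennreal (1 / Gamma (g + 1)) * (\<integral>\<^sup>+s. ennreal (s powr g) *
       (\<integral>\<^sup>+v. ennreal ((1 - cos v) * exp (- (s * v))) * indicator {0<..} v \<partial>lborel) * indicator {0<..} s \<partial>lborel)"
    using g by (intro nn_integral_powr_eq_laplace) auto
  also have "(\<integral>\<^sup>+s. ennreal (s powr g) *
       (\<integral>\<^sup>+v. ennreal ((1 - cos v) * exp (- (s * v))) * indicator {0<..} v \<partial>lborel) * indicator {0<..} s \<partial>lborel) =
     (\<integral>\<^sup>+s. ennreal (s powr (g - 1) / (1 + s\<^sup>2)) * indicator {0<..} s \<partial>lborel)"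
    by (intro nn_integral_cong)
       (auto simp: nn_integral_one_minus_cos_exp ennreal_mult[symmetric] powr_diff split: split_indicator)
  also have "\<dots> = ennreal (pi / (2 * sin (pi * g / 2)))"
    using g by (rule nn_integral_powr_div_one_plus_square)
  finally show ?thesis using G
    by (simp add: ennreal_mult'[symmetric] mult_ac)
qed

text \<open>The Laplace transform carries one more power of \<open>1 / s\<close> than that of
  \<open>1 - cos v\<close>, so the remaining integral has exponent \<open>g - 1\<close> in place of
  \<open>g\<close>; its convergence at 0 is the condition \<open>1 < g\<close>. Since
  \<open>sin (pi * (g - 1) / 2) = - cos (pi * g / 2)\<close>, the value is
  \<open>- tan (pi * g / 2)\<close> times the cosine integral, which is the form in which the
  skewness term of a stable law is written.\<close>

lemma nn_integral_minus_sin_powr: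
  assumes g: "1 < g" "g < 2"
  shows "(\<integral>\<^sup>+v. ennreal ((v - sin v) * v powr (- g - 1)) * indicator {0<..} v \<partial>lborel) =
    ennreal (- tan (pi * g / 2) * (pi / (2 * sin (pi * g / 2) * Gamma (g + 1))))"
proof -
  have G: "0 < Gamma (g + 1)" using g by (simp add: Gamma_real_pos)
  have "(\<integral>\<^sup>+v. ennreal ((v - sin v) * v powr (- g - 1)) * indicator {0<..} v \<partial>lborel) =
    ennreal (1 / Gamma (g + 1)) * (\<integral>\<^sup>+s. ennreal (s powr g) *
       (\<integral>\<^sup>+v. ennreal ((v - sin v) * exp (- (s * v))) * indicator {0<..} v \<partial>lborel) * indicator {0<..} s \<partial>lborel)"
    using g sin_x_le_x by (intro nn_integral_powr_eq_laplace) auto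
  also have "(\<integral>\<^sup>+s. ennreal (s powr g) *
       (\<integral>\<^sup>+v. ennreal ((v - sin v) * exp (- (s * v))) * indicator {0<..} v \<partial>lborel) * indicator {0<..} s \<partial>lborel) =
     (\<integral>\<^sup>+s. ennreal (s powr ((g - 1) - 1) / (1 + s\<^sup>2)) * indicator {0<..} s \<partial>lborel)"
  proof (intro nn_integral_cong)
    fix s :: real
    have "s powr g * (1 / (s\<^sup>2 * (1 + s\<^sup>2))) = s powr ((g - 1) - 1) / (1 + s\<^sup>2)" if "s > 0"
      using that by (simp add: powr_diff power2_eq_square)
    then show "ennreal (s powr g) * (\<integral>\<^sup>+v. ennreal ((v - sin v) * exp (- (s * v))) * indicator {0<..} v \<partial>lborel) * indicator {0<..} s
      = ennreal (s powr ((g - 1) - 1) / (1 + s\<^sup>2)) * indicator {0<..} s"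
      by (cases "s > 0") (simp_all add: nn_integral_minus_sin_exp ennreal_mult[symmetric] del: ennreal_1)
  qed
  also have "\<dots> = ennreal (pi / (2 * sin (pi * (g - 1) / 2)))"
    using g by (intro nn_integral_powr_div_one_plus_square) auto
  finally have e1: "(\<integral>\<^sup>+v. ennreal ((v - sin v) * v powr (- g - 1)) * indicator {0<..} v \<partial>lborel) =
      ennreal (1 / Gamma (g + 1)) * ennreal (pi / (2 * sin (pi * (g - 1) / 2)))" .
  have e2: "sin (pi * (g - 1) / 2) = - cos (pi * g / 2)"
  proof -
    have "pi * (g - 1) / 2 = pi * g / 2 - pi / 2" by (simp add: algebra_simps diff_divide_distrib)
    then show ?thesis by (simp only: sin_diff) simp
  qed
  have e3: "ennreal (1 / Gamma (g + 1)) * ennreal (pi / (2 * - cos (pi * g / 2))) =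
     ennreal (1 / Gamma (g + 1) * (pi / (2 * - cos (pi * g / 2))))"
    using G by (intro ennreal_mult'[symmetric]) auto
  have e4: "1 / Gamma (g + 1) * (pi / (2 * - cos (pi * g / 2))) = - tan (pi * g / 2) * (pi / (2 * sin (pi * g / 2) * Gamma (g + 1)))"
  proof -
    have "pi * g < pi * 2" "0 < pi * g"
      using g by (auto intro: mult_strict_left_mono)
    then have "0 < pi * g / 2" "pi * g / 2 < pi" by linarith+
    then have "0 < sin (pi * g / 2)" by (rule sin_gt_zero)
    then have S: "sin (pi * g / 2) \<noteq> 0" by (rule less_imp_neq[symmetric])
    have id: "1 / G * (pi / (2 * - C)) = - (S / C) * (pi / (2 * S * G))" if "S \<noteq> 0" for G S C :: real
      using that by (simp add: field_split_simps)
    show ?thesis unfolding tan_def by (rule id[OF S])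
  qed
  show ?thesis
    unfolding e1 e2 e3 e4 by (rule refl)
qed

section \<open>Integrals over balls\<close>

lemma sets_borel_cball[measurable]: "cball (x::'a::metric_space) r \<in> sets borel"
  by (intro borel_closed closed_cball)

text \<open>For a nonnegative density this is the mass of the closed ball
  (\<open>measure_density_cball\<close>). It is an integral rather than a measure because linear
  combinations of the fields lead to densities of both signs. For a negative radius the ball is
  empty and the value is 0.\<close>

definition ball_integral :: "('a::euclidean_space \<Rightarrow> real) \<Rightarrow> 'a \<Rightarrow> real \<Rightarrow> real" where
  "ball_integral \<phi> x r = (LINT y|lborel. indicator (cball x r) y * \<phi> y)"

abbreviation ball_vol :: "'a::euclidean_space itself \<Rightarrow> real \<Rightarrow> real" where
  "ball_vol _ r \<equiv> measure lborel (cball (0::'a) r)"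

lemma emeasure_cball_eq_ball_vol:
  "emeasure lborel (cball (x::'a::euclidean_space) r) = ennreal (ball_vol TYPE('a) r)"
proof (cases "0 \<le> r")
  case True
  then show ?thesis by (simp add: emeasure_cball measure_def)
qed simp

lemma measure_cball_eq_ball_vol: "measure lborel (cball (x::'a::euclidean_space) r) = ball_vol TYPE('a) r"
  by (cases "0 \<le> r") (simp_all add: emeasure_cball measure_def)

lemma ball_vol_eq: "0 \<le> r \<Longrightarrow> ball_vol TYPE('a::euclidean_space) r = ball_vol TYPE('a) 1 * r ^ DIM('a)"
  by (simp add: emeasure_cball measure_def)

lemma ball_vol_pos: "0 < r \<Longrightarrow> 0 < ball_vol TYPE('a::euclidean_space) r"
  by (simp add: emeasure_cball measure_def)

lemma integrable_indicator_cball: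
  fixes \<phi> :: "'a::euclidean_space \<Rightarrow> real"
  assumes "integrable lborel \<phi>"
  shows "integrable lborel (\<lambda>y. indicator (cball x r) y * \<phi> y)"
  using integrable_mult_indicator[OF _ assms, of "cball x r"] by simp

lemma measurable_cball_indicator[measurable]:
  "(\<lambda>(x, y). indicator (cball (fst x) (snd x)) y :: real) \<in> borel_measurable ((borel \<Otimes>\<^sub>M borel) \<Otimes>\<^sub>M (borel :: 'a::euclidean_space measure))"
proof -
  have "(\<lambda>(x, y). indicator (cball (fst x) (snd x)) y :: real) =
    (\<lambda>(x :: 'a \<times> real, y). if dist (fst x) y \<le> snd x then 1 else 0)"
    by (auto simp: fun_eq_iff indicator_def)
  then show ?thesis by simp
qed

lemma borel_measurable_ball_integral[measurable (raw)]:
  fixes \<phi> :: "'a::euclidean_space \<Rightarrow> real"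
  assumes [measurable]: "\<phi> \<in> borel_measurable borel" "f \<in> borel_measurable M" "g \<in> borel_measurable M"
  shows "(\<lambda>w. ball_integral \<phi> (f w) (g w)) \<in> borel_measurable M"
proof -
  have "(\<lambda>z. LINT y|lborel. indicator (cball (fst z) (snd z)) y * \<phi> y) \<in> borel_measurable (borel \<Otimes>\<^sub>M borel :: ('a \<times> real) measure)"
  proof (rule sigma_finite_measure.borel_measurable_lebesgue_integral)
    have "(\<lambda>p. ((case p of (x, y) \<Rightarrow> indicator (cball (fst x) (snd x)) y) :: real) * \<phi> (snd p))
      \<in> borel_measurable (((borel :: 'a measure) \<Otimes>\<^sub>M (borel :: real measure)) \<Otimes>\<^sub>M lborel)"
      by measurable
    then show "(\<lambda>(z, y). indicator (cball (fst z) (snd z)) y * \<phi> y) \<in> borel_measurable ((borel \<Otimes>\<^sub>M borel :: ('a \<times> real) measure) \<Otimes>\<^sub>M lborel)"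
      by (simp add: case_prod_beta)
  qed (rule sigma_finite_lborel)
  from measurable_compose[OF measurable_Pair[OF assms(2,3)] this]
  show ?thesis by (simp add: ball_integral_def)
qed

lemma ball_integral_add:
  assumes "integrable lborel f" "integrable lborel g"
  shows "ball_integral (\<lambda>y. f y + g y) x r = ball_integral f x r + ball_integral g x r"
  unfolding ball_integral_def distrib_left
  by (intro Bochner_Integration.integral_add integrable_indicator_cball assms)

lemma ball_integral_cmult: "ball_integral (\<lambda>y. c * f y) x r = c * ball_integral f x r"
  unfolding ball_integral_def by (simp add: mult.left_commute)

lemma ball_integral_sum:
  assumes "\<And>i. i \<in> I \<Longrightarrow> integrable lborel (f i)"
  shows "ball_integral (\<lambda>y. \<Sum>i\<in>I. f i y) x r = (\<Sum>i\<in>I. ball_integral (f i) x r)"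
  unfolding ball_integral_def sum_distrib_left
  by (intro Bochner_Integration.integral_sum integrable_indicator_cball assms)

lemma abs_ball_integral_le:
  assumes "integrable lborel \<phi>"
  shows "ennreal \<bar>ball_integral \<phi> x r\<bar> \<le> (\<integral>\<^sup>+y. ennreal \<bar>\<phi> y\<bar> * indicator (cball x r) y \<partial>lborel)"
proof -
  have "ennreal \<bar>ball_integral \<phi> x r\<bar> \<le> (\<integral>\<^sup>+y. norm (indicator (cball x r) y * \<phi> y) \<partial>lborel)"
    unfolding ball_integral_def using integral_norm_bound_ennreal[OF integrable_indicator_cball[OF assms]] by simp
  also have "\<dots> = (\<integral>\<^sup>+y. ennreal \<bar>\<phi> y\<bar> * indicator (cball x r) y \<partial>lborel)"
    by (intro nn_integral_cong) (auto split: split_indicator)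
  finally show ?thesis .
qed

text \<open>Tonelli and the symmetry of \<open>dist x y \<le> r\<close>: the centres whose ball
  contains a given point form a ball of the same radius.\<close>

lemma nn_integral_ball_average:
  fixes \<phi> :: "'a::euclidean_space \<Rightarrow> ennreal"
  assumes [measurable]: "\<phi> \<in> borel_measurable borel"
  shows "(\<integral>\<^sup>+x. (\<integral>\<^sup>+y. \<phi> y * indicator (cball x r) y \<partial>lborel) \<partial>lborel) = ennreal (ball_vol TYPE('a) r) * (\<integral>\<^sup>+y. \<phi> y \<partial>lborel)"
proof -
  have ind: "(indicator (cball x r) y :: ennreal) = (if dist x y \<le> r then 1 else 0)" for x y :: 'a
    by (auto simp: indicator_def)
  have "(\<integral>\<^sup>+x. (\<integral>\<^sup>+y. \<phi> y * indicator (cball x r) y \<partial>lborel) \<partial>lborel) =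
    (\<integral>\<^sup>+y. (\<integral>\<^sup>+x. \<phi> y * indicator (cball x r) y \<partial>lborel) \<partial>lborel)"
    unfolding ind by (rule lborel_pair.Fubini') measurable
  also have "\<dots> = (\<integral>\<^sup>+y. (\<integral>\<^sup>+x. \<phi> y * indicator (cball y r) x \<partial>lborel) \<partial>lborel)"
    unfolding ind by (simp add: dist_commute)
  also have "\<dots> = (\<integral>\<^sup>+y. ennreal (ball_vol TYPE('a) r) * \<phi> y \<partial>lborel)"
    by (subst nn_integral_cmult_indicator) (auto simp: emeasure_cball_eq_ball_vol mult.commute)
  also have "\<dots> = ennreal (ball_vol TYPE('a) r) * (\<integral>\<^sup>+y. \<phi> y \<partial>lborel)"
    by (rule nn_integral_cmult) auto
  finally show ?thesis .
qed

lemma nn_integral_abs_ball_integral_le: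
  fixes \<phi> :: "'a::euclidean_space \<Rightarrow> real"
  assumes "integrable lborel \<phi>"
  shows "(\<integral>\<^sup>+x. ennreal \<bar>ball_integral \<phi> x r\<bar> \<partial>lborel) \<le> ennreal (ball_vol TYPE('a) r) * (\<integral>\<^sup>+y. ennreal \<bar>\<phi> y\<bar> \<partial>lborel)"
proof -
  have [measurable]: "\<phi> \<in> borel_measurable borel" using assms by auto
  have "(\<integral>\<^sup>+x. ennreal \<bar>ball_integral \<phi> x r\<bar> \<partial>lborel) \<le> (\<integral>\<^sup>+x. (\<integral>\<^sup>+y. ennreal \<bar>\<phi> y\<bar> * indicator (cball x r) y \<partial>lborel) \<partial>lborel)"
    by (intro nn_integral_mono abs_ball_integral_le assms)
  also have "\<dots> = ennreal (ball_vol TYPE('a) r) * (\<integral>\<^sup>+y. ennreal \<bar>\<phi> y\<bar> \<partial>lborel)"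
    by (rule nn_integral_ball_average) measurable
  finally show ?thesis .
qed

text \<open>Cauchy-Schwarz on each ball costs one factor of the volume and leaves the ball integral
  of \<open>(\<phi> y)\<^sup>2\<close>; integrating over the centres costs a second one.\<close>

lemma nn_integral_ball_integral_square_le:
  fixes \<phi> :: "'a::euclidean_space \<Rightarrow> real"
  assumes int: "integrable lborel \<phi>"
  shows "(\<integral>\<^sup>+x. ennreal ((ball_integral \<phi> x r)\<^sup>2) \<partial>lborel) \<le> ennreal ((ball_vol TYPE('a) r)\<^sup>2) * (\<integral>\<^sup>+y. ennreal ((\<phi> y)\<^sup>2) \<partial>lborel)"
proof -
  have [measurable]: "\<phi> \<in> borel_measurable borel" using int by auto
  let ?V = "ennreal (ball_vol TYPE('a) r)"
  have "ennreal ((ball_integral \<phi> x r)\<^sup>2) \<le> ?V * (\<integral>\<^sup>+y. ennreal ((\<phi> y)\<^sup>2) * indicator (cball x r) y \<partial>lborel)" for x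
  proof -
    have "ennreal ((ball_integral \<phi> x r)\<^sup>2) = (ennreal \<bar>ball_integral \<phi> x r\<bar>)\<^sup>2"
      by (simp add: ennreal_power)
    also have "\<dots> \<le> (\<integral>\<^sup>+y. ennreal \<bar>\<phi> y\<bar> * indicator (cball x r) y \<partial>lborel)\<^sup>2"
      by (intro power_mono abs_ball_integral_le int) auto
    also have "(\<integral>\<^sup>+y. ennreal \<bar>\<phi> y\<bar> * indicator (cball x r) y \<partial>lborel) = (\<integral>\<^sup>+y. (ennreal \<bar>\<phi> y\<bar> * indicator (cball x r) y) * indicator (cball x r) y \<partial>lborel)"
      by (intro nn_integral_cong) (auto split: split_indicator)
    also have "(\<integral>\<^sup>+y. (ennreal \<bar>\<phi> y\<bar> * indicator (cball x r) y) * indicator (cball x r) y \<partial>lborel)\<^sup>2 \<le>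
       (\<integral>\<^sup>+y. (ennreal \<bar>\<phi> y\<bar> * indicator (cball x r) y)\<^sup>2 \<partial>lborel) * (\<integral>\<^sup>+y. (indicator (cball x r) y)\<^sup>2 \<partial>lborel)"
      by (rule Cauchy_Schwarz_nn_integral) auto
    also have "(\<integral>\<^sup>+y. (indicator (cball x r) y)\<^sup>2 \<partial>lborel) = ?V"
    proof -
      have "(\<integral>\<^sup>+y. (indicator (cball x r) y)\<^sup>2 \<partial>lborel) = (\<integral>\<^sup>+y. indicator (cball x r) y \<partial>lborel)"
        by (intro nn_integral_cong) (auto split: split_indicator)
      then show ?thesis by (simp add: emeasure_cball_eq_ball_vol)
    qed
    also have "(\<integral>\<^sup>+y. (ennreal \<bar>\<phi> y\<bar> * indicator (cball x r) y)\<^sup>2 \<partial>lborel) = (\<integral>\<^sup>+y. ennreal ((\<phi> y)\<^sup>2) * indicator (cball x r) y \<partial>lborel)"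
      by (intro nn_integral_cong) (auto simp: ennreal_power split: split_indicator)
    finally show ?thesis by (simp add: mult.commute)
  qed
  then have "(\<integral>\<^sup>+x. ennreal ((ball_integral \<phi> x r)\<^sup>2) \<partial>lborel) \<le> (\<integral>\<^sup>+x. ?V * (\<integral>\<^sup>+y. ennreal ((\<phi> y)\<^sup>2) * indicator (cball x r) y \<partial>lborel) \<partial>lborel)"
    by (intro nn_integral_mono)
  also have "\<dots> = ?V * (\<integral>\<^sup>+x. (\<integral>\<^sup>+y. ennreal ((\<phi> y)\<^sup>2) * indicator (cball x r) y \<partial>lborel) \<partial>lborel)"
  proof (rule nn_integral_cmult)
    have ind: "(indicator (cball x r) y :: ennreal) = (if dist x y \<le> r then 1 else 0)" for x y :: 'a
      by (auto simp: indicator_def)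
    show "(\<lambda>x. \<integral>\<^sup>+y. ennreal ((\<phi> y)\<^sup>2) * indicator (cball x r) y \<partial>lborel) \<in> borel_measurable lborel"
      unfolding ind by measurable
  qed
  also have "\<dots> = ?V * (?V * (\<integral>\<^sup>+y. ennreal ((\<phi> y)\<^sup>2) \<partial>lborel))"
    by (subst nn_integral_ball_average) auto
  also have "\<dots> = ennreal ((ball_vol TYPE('a) r)\<^sup>2) * (\<integral>\<^sup>+y. ennreal ((\<phi> y)\<^sup>2) \<partial>lborel)"
    by (simp add: power2_eq_square ennreal_mult mult.assoc)
  finally show ?thesis .
qed

section \<open>Convergence of ball averages in L^1\<close>

definition ball_average_error :: "('a::euclidean_space \<Rightarrow> real) \<Rightarrow> real \<Rightarrow> ennreal" where
  "ball_average_error f r = (\<integral>\<^sup>+x. ennreal \<bar>ball_integral f x r / ball_vol TYPE('a) r - f x\<bar> \<partial>lborel)"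

lemma ball_average_error_add:
  fixes f g :: "'a::euclidean_space \<Rightarrow> real"
  assumes "integrable lborel f" "integrable lborel g"
  shows "ball_average_error (\<lambda>x. f x + g x) r \<le> ball_average_error f r + ball_average_error g r"
proof -
  have [measurable]: "f \<in> borel_measurable borel" "g \<in> borel_measurable borel" using assms by auto
  have "ball_average_error (\<lambda>x. f x + g x) r \<le> (\<integral>\<^sup>+x. ennreal \<bar>ball_integral f x r / ball_vol TYPE('a) r - f x\<bar> +
     ennreal \<bar>ball_integral g x r / ball_vol TYPE('a) r - g x\<bar> \<partial>lborel)"
    unfolding ball_average_error_def ball_integral_add[OF assms]
    by (intro nn_integral_mono) (auto simp: add_divide_distrib ennreal_plus[symmetric] simp del: ennreal_plus intro!: ennreal_leI)
  then show ?thesis unfolding ball_average_error_def by (subst (asm) nn_integral_add) auto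
qed

lemma ball_average_error_le:
  fixes f :: "'a::euclidean_space \<Rightarrow> real"
  assumes int: "integrable lborel f" and r: "0 < r"
  shows "ball_average_error f r \<le> 2 * (\<integral>\<^sup>+x. ennreal \<bar>f x\<bar> \<partial>lborel)"
proof -
  have [measurable]: "f \<in> borel_measurable borel" using int by auto
  let ?V = "ball_vol TYPE('a) r"
  have V: "0 < ?V" by (rule ball_vol_pos[OF r])
  have "ball_average_error f r \<le> (\<integral>\<^sup>+x. ennreal (1 / ?V) * ennreal \<bar>ball_integral f x r\<bar> + ennreal \<bar>f x\<bar> \<partial>lborel)"
    unfolding ball_average_error_def
  proof (intro nn_integral_mono)
    fix x
    have "\<bar>ball_integral f x r / ?V - f x\<bar> \<le> 1 / ?V * \<bar>ball_integral f x r\<bar> + \<bar>f x\<bar>"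
      using abs_triangle_ineq4[of "ball_integral f x r / ?V" "f x"] V by (simp add: abs_divide)
    then show "ennreal \<bar>ball_integral f x r / ?V - f x\<bar> \<le> ennreal (1 / ?V) * ennreal \<bar>ball_integral f x r\<bar> + ennreal \<bar>f x\<bar>"
      using V by (simp add: ennreal_mult[symmetric] ennreal_plus[symmetric] ennreal_leI del: ennreal_plus)
  qed
  also have "\<dots> = ennreal (1 / ?V) * (\<integral>\<^sup>+x. ennreal \<bar>ball_integral f x r\<bar> \<partial>lborel) + (\<integral>\<^sup>+x. ennreal \<bar>f x\<bar> \<partial>lborel)"
    by (subst nn_integral_add) (auto simp: nn_integral_cmult)
  also have "\<dots> \<le> ennreal (1 / ?V) * (ennreal ?V * (\<integral>\<^sup>+x. ennreal \<bar>f x\<bar> \<partial>lborel)) + (\<integral>\<^sup>+x. ennreal \<bar>f x\<bar> \<partial>lborel)"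
    by (intro add_mono mult_left_mono nn_integral_abs_ball_integral_le int) auto
  also have "ennreal (1 / ?V) * (ennreal ?V * (\<integral>\<^sup>+x. ennreal \<bar>f x\<bar> \<partial>lborel)) = (\<integral>\<^sup>+x. ennreal \<bar>f x\<bar> \<partial>lborel)"
    using V by (simp add: mult.assoc[symmetric] ennreal_mult[symmetric])
  finally show ?thesis by (simp add: mult_2)
qed

text \<open>The error is subadditive and at most twice the L^1 norm, uniformly in the radius, so the
  functions whose error vanishes in the limit form a closed subset of L^1.\<close>

lemma ball_average_error_approx:
  fixes f :: "'a::euclidean_space \<Rightarrow> real"
  assumes f: "integrable lborel f"
    and approx: "\<And>e::real. 0 < e \<Longrightarrow> \<exists>g. integrable lborel g \<and> (ball_average_error g \<longlongrightarrow> 0) (at_right 0) \<and>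
      (\<integral>\<^sup>+x. ennreal \<bar>f x - g x\<bar> \<partial>lborel) \<le> ennreal e"
  shows "(ball_average_error f \<longlongrightarrow> 0) (at_right 0)"
proof (rule order_tendstoI)
  fix a :: ennreal assume a: "0 < a"
  obtain e :: real where e: "0 < e" "ennreal e < a"
  proof (cases a)
    case (real x)
    then show ?thesis using a by (intro that[of "x / 2"]) (auto intro!: ennreal_lessI)
  next
    case top
    then show ?thesis by (intro that[of 1]) auto
  qed
  obtain g where g: "integrable lborel g" "(ball_average_error g \<longlongrightarrow> 0) (at_right 0)"
    "(\<integral>\<^sup>+x. ennreal \<bar>f x - g x\<bar> \<partial>lborel) \<le> ennreal (e / 4)"
    using approx[of "e / 4"] e by auto
  have "\<forall>\<^sub>F r in at_right 0. ball_average_error g r < ennreal (e / 4)"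
    using g(2) e by (intro order_tendstoD(2)) auto
  moreover have "\<forall>\<^sub>F r in at_right (0::real). 0 < r" by (rule eventually_at_right_less)
  ultimately show "\<forall>\<^sub>F r in at_right 0. ball_average_error f r < a"
  proof eventually_elim
    fix r :: real assume gr: "ball_average_error g r < ennreal (e / 4)" and r: "0 < r"
    have "ball_average_error f r = ball_average_error (\<lambda>x. g x + (f x - g x)) r" by simp
    also have "\<dots> \<le> ball_average_error g r + ball_average_error (\<lambda>x. f x - g x) r"
      using f g by (intro ball_average_error_add) auto
    also have "\<dots> \<le> ennreal (e / 4) + 2 * ennreal (e / 4)"
      using f g by (intro add_mono[OF less_imp_le[OF gr] order_trans[OF ball_average_error_le[OF _ r] mult_left_mono[OF g(3)]]]) auto
    also have "\<dots> = ennreal (e / 4 + 2 * (e / 4))"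
      using e by (simp add: ennreal_plus[symmetric] ennreal_mult[symmetric] numeral_mult_ennreal del: ennreal_plus)
    also have "\<dots> < a" using e by (intro le_less_trans[OF _ e(2)] ennreal_leI) auto
    finally show "ball_average_error f r < a" .
  qed
qed simp

text \<open>Averaging preserves the total integral, so the L^1 distance is twice the integral of the
  positive part of \<open>indicator U x - A n x\<close>, as in Scheffe's lemma. This part is
  dominated by the indicator of \<open>U\<close> and eventually 0 at each point: inside
  \<open>U\<close> small balls stay in \<open>U\<close>, and outside it is never positive. The mass
  that the averages put outside \<open>U\<close> thus needs no separate estimate.\<close>

lemma ball_average_error_open:
  fixes U :: "'a::euclidean_space set"
  assumes U: "open U" and fin: "emeasure lborel U < \<infinity>"
  shows "(ball_average_error (indicator U) \<longlongrightarrow> 0) (at_right 0)"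
proof (rule tendsto_at_right_sequentially[of _ 1])
  fix s :: "nat \<Rightarrow> real" assume s: "\<And>n. 0 < s n" "\<And>n. s n < 1" "decseq s" "s \<longlonglongrightarrow> 0"
  have [measurable]: "U \<in> sets borel" using U by auto
  let ?u = "indicator U :: 'a \<Rightarrow> real"
  have int: "integrable lborel ?u" using fin by (simp add: integrable_indicator_iff)
  define A where "A n x = ball_integral ?u x (s n) / ball_vol TYPE('a) (s n)" for n x
  have [measurable]: "A n \<in> borel_measurable borel" for n unfolding A_def by measurable
  have V: "0 < ball_vol TYPE('a) (s n)" for n by (rule ball_vol_pos[OF s(1)])
  have A0: "0 \<le> A n x" for n x
    unfolding A_def ball_integral_def by (intro divide_nonneg_nonneg integral_nonneg_AE) auto
  have A_eq: "ennreal (A n x) = ennreal (1 / ball_vol TYPE('a) (s n)) * (\<integral>\<^sup>+y. ennreal (?u y) * indicator (cball x (s n)) y \<partial>lborel)" for n x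
  proof -
    have "ennreal (ball_integral ?u x (s n)) = (\<integral>\<^sup>+y. ennreal (indicator (cball x (s n)) y * ?u y) \<partial>lborel)"
      unfolding ball_integral_def by (intro nn_integral_eq_integral[symmetric] integrable_indicator_cball int) auto
    also have "\<dots> = (\<integral>\<^sup>+y. ennreal (?u y) * indicator (cball x (s n)) y \<partial>lborel)"
      by (intro nn_integral_cong) (auto split: split_indicator)
    finally show ?thesis unfolding A_def using V[of n]
      by (simp add: ennreal_mult'[symmetric] divide_inverse mult.commute ennreal_mult'')
  qed
  have A_int: "(\<integral>\<^sup>+x. ennreal (A n x) \<partial>lborel) = emeasure lborel U" for n
  proof -
    have ind: "(indicator (cball x (s n)) y :: ennreal) = (if dist x y \<le> s n then 1 else 0)" for x y :: 'a
      by (auto simp: indicator_def)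
    have "(\<integral>\<^sup>+x. ennreal (A n x) \<partial>lborel) = ennreal (1 / ball_vol TYPE('a) (s n)) * (\<integral>\<^sup>+x. (\<integral>\<^sup>+y. ennreal (?u y) * indicator (cball x (s n)) y \<partial>lborel) \<partial>lborel)"
      unfolding A_eq by (rule nn_integral_cmult) (simp only: ind, measurable)
    also have "\<dots> = ennreal (1 / ball_vol TYPE('a) (s n)) * (ennreal (ball_vol TYPE('a) (s n)) * (\<integral>\<^sup>+y. ennreal (?u y) \<partial>lborel))"
      by (subst nn_integral_ball_average) auto
    also have "\<dots> = emeasure lborel U"
      using V[of n] by (simp add: mult.assoc[symmetric] ennreal_mult[symmetric] ennreal_indicator)
    finally show ?thesis .
  qed
  have A_integrable: "integrable lborel (A n)" for n
    using A_int[of n] fin A0 by (intro integrableI_nonneg) auto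
  have A_integral: "integral\<^sup>L lborel (A n) = measure lborel U" for n
    using A_int[of n] A0 by (simp add: integral_eq_nn_integral measure_def)
  have "(\<lambda>n. LINT x|lborel. max 0 (?u x - A n x)) \<longlonglongrightarrow> (LINT x|(lborel :: 'a measure). 0)"
  proof (rule integral_dominated_convergence[where w="?u"])
    show "AE x in lborel. (\<lambda>n. max 0 (?u x - A n x)) \<longlonglongrightarrow> 0"
    proof (intro AE_I2)
      fix x
      show "(\<lambda>n. max 0 (?u x - A n x)) \<longlonglongrightarrow> 0"
      proof (cases "x \<in> U")
        case True
        then obtain e where e: "0 < e" "cball x e \<subseteq> U" using U open_contains_cball by blast
        have "\<forall>\<^sub>F n in sequentially. s n < e" using s(4) e(1) by (rule order_tendstoD)
        then have "\<forall>\<^sub>F n in sequentially. max 0 (?u x - A n x) = 0"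
        proof eventually_elim
          fix n assume "s n < e"
          then have sub: "cball x (s n) \<subseteq> U" using e(2) by (auto simp: subset_iff)
          have "ball_integral ?u x (s n) = (LINT y|lborel. indicator (cball x (s n)) y)"
            unfolding ball_integral_def using sub by (intro Bochner_Integration.integral_cong) (auto split: split_indicator)
          also have "\<dots> = ball_vol TYPE('a) (s n)"
            using measure_cball_eq_ball_vol[of x "s n"] by simp
          finally have "A n x = 1" using V[of n] by (simp add: A_def)
          then show "max 0 (?u x - A n x) = 0" using True by simp
        qed
        then show ?thesis by (rule tendsto_eventually)
      next
        case False
        then show ?thesis using A0 by (simp add: max_absorb1)
      qed
    qed
    show "AE x in lborel. norm (max 0 (?u x - A n x)) \<le> ?u x" for n
      using A0 by (auto simp: max_def split: split_indicator)
  qed (use int in auto)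
  then have lim: "(\<lambda>n. ennreal (2 * (LINT x|lborel. max 0 (?u x - A n x)))) \<longlonglongrightarrow> ennreal (2 * 0)"
    by (intro tendsto_ennrealI tendsto_mult_left) simp
  have "ball_average_error ?u (s n) = ennreal (2 * (LINT x|lborel. max 0 (?u x - A n x)))" for n
  proof -
    have i1: "integrable lborel (\<lambda>x. max 0 (?u x - A n x))"
      using int A_integrable by (intro integrable_max) auto
    have "ball_average_error ?u (s n) = (\<integral>\<^sup>+x. ennreal (A n x - ?u x + 2 * max 0 (?u x - A n x)) \<partial>lborel)"
      unfolding ball_average_error_def A_def[symmetric]
      by (intro nn_integral_cong arg_cong[where f=ennreal]) (auto simp: max_def)
    also have "\<dots> = ennreal (LINT x|lborel. A n x - ?u x + 2 * max 0 (?u x - A n x))"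
      using i1 int A_integrable by (intro nn_integral_eq_integral) (auto simp: max_def)
    also have "(LINT x|lborel. A n x - ?u x + 2 * max 0 (?u x - A n x)) = 2 * (LINT x|lborel. max 0 (?u x - A n x))"
      using i1 int A_integrable A_integral by simp
    finally show ?thesis .
  qed
  with lim show "(\<lambda>n. ball_average_error ?u (s n)) \<longlonglongrightarrow> 0" by simp
qed simp

text \<open>Induction over integrable functions. A set of finite measure is approximated from
  outside by open sets, and a limit function by its approximations in L^1; both passages are
  instances of \<open>ball_average_error_approx\<close>.\<close>

lemma ball_average_error_tendsto_0:
  fixes f :: "'a::euclidean_space \<Rightarrow> real"
  assumes "integrable lborel f"
  shows "(ball_average_error f \<longlongrightarrow> 0) (at_right 0)"
  using assms
proof induction
  case (base A c)
  have [measurable]: "A \<in> sets borel" using base by simp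
  have ind: "(ball_average_error (indicator A) \<longlongrightarrow> 0) (at_right 0)"
  proof (rule ball_average_error_approx)
    show "integrable lborel (indicator A :: 'a \<Rightarrow> real)" using base by (simp add: integrable_indicator_iff)
    fix e :: real assume "0 < e"
    obtain U where U: "open U" "A \<subseteq> U" "emeasure lborel (U - A) < ennreal e"
      using outer_regular_lborel[OF \<open>A \<in> sets borel\<close> \<open>0 < e\<close>] by blast
    have [measurable]: "U \<in> sets borel" using U(1) by auto
    have "emeasure lborel U = emeasure lborel A + emeasure lborel (U - A)"
      using U(2) by (subst plus_emeasure) (auto intro!: arg_cong[where f="emeasure lborel"])
    then have finU: "emeasure lborel U < \<infinity>" using base U(3) by (auto simp: less_top[symmetric])
    have "(\<integral>\<^sup>+x. ennreal \<bar>indicator A x - indicator U x\<bar> \<partial>lborel) = (\<integral>\<^sup>+x. indicator (U - A) x \<partial>lborel)"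
      using U(2) by (intro nn_integral_cong) (auto split: split_indicator)
    also have "\<dots> = emeasure lborel (U - A)" by simp
    finally have "(\<integral>\<^sup>+x. ennreal \<bar>indicator A x - indicator U x\<bar> \<partial>lborel) \<le> ennreal e" using U(3) by simp
    moreover have "integrable lborel (indicator U :: 'a \<Rightarrow> real)" using finU by (simp add: integrable_indicator_iff)
    ultimately show "\<exists>g. integrable lborel g \<and> (ball_average_error g \<longlongrightarrow> 0) (at_right 0) \<and>
      (\<integral>\<^sup>+x. ennreal \<bar>indicator A x - g x\<bar> \<partial>lborel) \<le> ennreal e"
      using ball_average_error_open[OF U(1) finU] by blast
  qed
  have "ball_average_error (\<lambda>x. indicator A x *\<^sub>R c) r = ennreal \<bar>c\<bar> * ball_average_error (indicator A) r" for r
  proof -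
    have "ball_average_error (\<lambda>x. indicator A x *\<^sub>R c) r = ball_average_error (\<lambda>x. c * indicator A x) r"
      by (simp add: mult.commute)
    also have "\<dots> = (\<integral>\<^sup>+x. ennreal \<bar>c\<bar> * ennreal \<bar>ball_integral (indicator A) x r / ball_vol TYPE('a) r - indicator A x\<bar> \<partial>lborel)"
      unfolding ball_average_error_def ball_integral_cmult
      by (intro nn_integral_cong) (simp add: ennreal_mult[symmetric] abs_mult[symmetric] right_diff_distrib)
    also have "\<dots> = ennreal \<bar>c\<bar> * ball_average_error (indicator A) r"
      unfolding ball_average_error_def by (rule nn_integral_cmult) measurable
    finally show ?thesis .
  qed
  then show ?case using ennreal_tendsto_cmult[OF _ ind, of "ennreal \<bar>c\<bar>"] by simp
next
  case (add f g)
  have "((\<lambda>r. ball_average_error f r + ball_average_error g r) \<longlongrightarrow> 0 + 0) (at_right 0)"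
    by (intro tendsto_add add.IH)
  then have lim: "((\<lambda>r. ball_average_error f r + ball_average_error g r) \<longlongrightarrow> 0) (at_right 0)" by simp
  show ?case
  proof (rule tendsto_sandwich[OF _ _ tendsto_const lim])
    show "\<forall>\<^sub>F r in at_right 0. ball_average_error (\<lambda>x. f x + g x) r \<le> ball_average_error f r + ball_average_error g r"
      by (intro always_eventually allI ball_average_error_add add.hyps)
  qed simp
next
  case (lim f s)
  show ?case
  proof (rule ball_average_error_approx[OF lim.hyps(4)])
    fix e :: real assume e: "0 < e"
    have [measurable]: "f \<in> borel_measurable borel" "s i \<in> borel_measurable borel" for i using lim.hyps(1,4) by auto
    have "(\<lambda>i. \<integral>\<^sup>+x. norm (f x - s i x) \<partial>lborel) \<longlonglongrightarrow> 0"
    proof (rule nn_integral_dominated_convergence_norm[where w="\<lambda>x. 2 * norm (f x)"])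
      show "(\<integral>\<^sup>+x. ennreal (2 * norm (f x)) \<partial>lborel) < \<infinity>"
        using lim.hyps(4) by (simp add: integrable_iff_bounded ennreal_mult nn_integral_cmult ennreal_mult_less_top)
    qed (use lim.hyps in auto)
    then have "\<forall>\<^sub>F i in sequentially. (\<integral>\<^sup>+x. norm (f x - s i x) \<partial>lborel) < ennreal e"
      using e by (intro order_tendstoD(2)) auto
    then obtain i where "(\<integral>\<^sup>+x. norm (f x - s i x) \<partial>lborel) < ennreal e"
      by (auto simp: eventually_sequentially)
    then show "\<exists>g. integrable lborel g \<and> (ball_average_error g \<longlongrightarrow> 0) (at_right 0) \<and>
      (\<integral>\<^sup>+x. ennreal \<bar>f x - g x\<bar> \<partial>lborel) \<le> ennreal e"
      using lim.hyps(1) lim.IH by (intro exI[of _ "s i"]) auto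
  qed
qed

section \<open>Continuity theorem in Euclidean space\<close>

text \<open>Expectations of such functions are linear combinations of values of characteristic
  functions, and products of exponentials are again exponentials, so these functions form an algebra
  to which Stone-Weierstrass can be related.\<close>

inductive trig_poly :: "('e::euclidean_space \<Rightarrow> complex) \<Rightarrow> bool" where
  mono: "trig_poly (\<lambda>x. c * iexp (t \<bullet> x))"
| add: "trig_poly f \<Longrightarrow> trig_poly g \<Longrightarrow> trig_poly (\<lambda>x. f x + g x)"

lemma trig_poly_const: "trig_poly (\<lambda>x. c)"
  using trig_poly.mono[of c 0] by simp

lemma trig_poly_mult:
  assumes "trig_poly f" "trig_poly g"
  shows "trig_poly (\<lambda>x. f x * g x)"
  using assms(1)
proof induction
  case (mono c t)
  from assms(2) show ?case
  proof induction
    case (mono c' t')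
    have "(\<lambda>x. c * iexp (t \<bullet> x) * (c' * iexp (t' \<bullet> x))) = (\<lambda>x. (c * c') * iexp ((t + t') \<bullet> x))"
      by (auto simp: inner_add_left exp_add[symmetric] algebra_simps)
    then show ?case using trig_poly.mono by metis
  next
    case (add f g)
    then show ?case using trig_poly.add[OF add.IH] by (simp add: distrib_left)
  qed
next
  case (add f g)
  then show ?case using trig_poly.add[OF add.IH] by (simp add: distrib_right)
qed

lemma trig_poly_sum:
  assumes "\<And>i. i \<in> I \<Longrightarrow> trig_poly (f i)"
  shows "trig_poly (\<lambda>x. \<Sum>i\<in>I. f i x)"
  using assms by (induction I rule: infinite_finite_induct) (auto intro: trig_poly.add trig_poly_const)

lemma trig_poly_cos: "trig_poly (\<lambda>x. complex_of_real (cos (t \<bullet> x)))"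
proof -
  have "(\<lambda>x. complex_of_real (cos (t \<bullet> x))) = (\<lambda>x. 1/2 * iexp (t \<bullet> x) + 1/2 * iexp ((-t) \<bullet> x))"
    by (intro ext, subst cos_of_real[symmetric], subst cos_exp_eq) (simp add: add_divide_distrib)
  then show ?thesis by (simp only:) (intro trig_poly.add trig_poly.mono)
qed

lemma trig_poly_sin: "trig_poly (\<lambda>x. complex_of_real (sin (t \<bullet> x)))"
proof -
  have "(\<lambda>x. complex_of_real (sin (t \<bullet> x))) = (\<lambda>x. 1/(2*\<i>) * iexp (t \<bullet> x) + (-1/(2*\<i>)) * iexp ((-t) \<bullet> x))"
    by (intro ext, subst sin_of_real[symmetric], subst sin_exp_eq) (simp add: diff_divide_distrib right_diff_distrib)
  then show ?thesis by (simp only:) (intro trig_poly.add trig_poly.mono)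
qed

text \<open>
  The map identifies opposite faces of the cube of side \<open>2L\<close>, so a function vanishing on the
  boundary of the cube descends to the image, where polynomials are trigonometric polynomials.
\<close>

definition torus_map :: "real \<Rightarrow> 'e::euclidean_space \<Rightarrow> 'e \<times> 'e" where
  "torus_map L x = (\<Sum>b\<in>Basis. cos ((pi / L) *\<^sub>R b \<bullet> x) *\<^sub>R b, \<Sum>b\<in>Basis. sin ((pi / L) *\<^sub>R b \<bullet> x) *\<^sub>R b)"

lemma trig_poly_polynomial_torus_map:
  fixes p :: "'e::euclidean_space \<times> 'e \<Rightarrow> real"
  assumes "real_polynomial_function p"
  shows "trig_poly (\<lambda>x. complex_of_real (p (torus_map L x)))"
  using assms
proof induction
  case (linear f)
  interpret f: bounded_linear f by fact
  have "f (torus_map L x) = (\<Sum>b\<in>Basis. cos ((pi / L) *\<^sub>R b \<bullet> x) * f (b, 0) + sin ((pi / L) *\<^sub>R b \<bullet> x) * f (0, b))" for x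
  proof -
    have "torus_map L x = (\<Sum>b\<in>Basis. cos ((pi / L) *\<^sub>R b \<bullet> x) *\<^sub>R (b, 0) + sin ((pi / L) *\<^sub>R b \<bullet> x) *\<^sub>R (0, b))"
      by (simp add: torus_map_def sum.distrib prod_eq_iff fst_sum snd_sum)
    then show ?thesis by (simp only: f.sum f.add f.scaleR real_scaleR_def)
  qed
  then show ?case
    by (simp only: of_real_sum of_real_add of_real_mult)
      (intro trig_poly_sum trig_poly.add trig_poly_mult trig_poly_const trig_poly_cos trig_poly_sin)
next
  case (const c)
  then show ?case by (rule trig_poly_const)
next
  case (add f g)
  then show ?case by (auto intro: trig_poly.add)
next
  case (mult f g)
  then show ?case by (auto intro: trig_poly_mult)
qed

text \<open>Rounding \<open>(x \<bullet> b) / (2 * L)\<close> to the nearest integer in each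
  coordinate and subtracting that multiple of \<open>2 * L\<close> gives a point of the cube with
  the same image. Bounds for functions of \<open>torus_map L\<close> on the cube therefore hold
  everywhere.\<close>

lemma torus_map_periodic:
  fixes x :: "'e::euclidean_space"
  assumes "0 < L"
  shows "\<exists>y. (\<forall>b\<in>Basis. \<bar>y \<bullet> b\<bar> \<le> L) \<and> torus_map L x = torus_map L y"
proof -
  define k where "k b = round ((x \<bullet> b) / (2 * L))" for b
  define y where "y = (\<Sum>b\<in>Basis. (x \<bullet> b - 2 * L * real_of_int (k b)) *\<^sub>R b)"
  have y: "y \<bullet> b = x \<bullet> b - 2 * L * real_of_int (k b)" if "b \<in> Basis" for b
    using that by (simp add: y_def)
  have "\<bar>y \<bullet> b\<bar> \<le> L" if b: "b \<in> Basis" for b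
  proof -
    have "\<bar>of_int (k b) - (x \<bullet> b) / (2 * L)\<bar> \<le> 1 / 2"
      unfolding k_def by (rule of_int_round_abs_le)
    then have "2 * L * \<bar>of_int (k b) - (x \<bullet> b) / (2 * L)\<bar> \<le> 2 * L * (1 / 2)"
      using assms by (intro mult_left_mono) auto
    also have "2 * L * \<bar>of_int (k b) - (x \<bullet> b) / (2 * L)\<bar> = \<bar>2 * L * (of_int (k b) - (x \<bullet> b) / (2 * L))\<bar>"
      using assms by (simp add: abs_mult)
    also have "2 * L * (of_int (k b) - (x \<bullet> b) / (2 * L)) = - (y \<bullet> b)"
      using assms by (simp add: y[OF b] right_diff_distrib)
    finally show ?thesis by simp
  qed
  moreover have "cos ((pi / L) *\<^sub>R b \<bullet> x) = cos ((pi / L) *\<^sub>R b \<bullet> y)"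
    "sin ((pi / L) *\<^sub>R b \<bullet> x) = sin ((pi / L) *\<^sub>R b \<bullet> y)" if b: "b \<in> Basis" for b
  proof -
    have "(pi / L) *\<^sub>R b \<bullet> x = (pi / L) *\<^sub>R b \<bullet> y + 2 * pi * real_of_int (k b)"
    proof -
      have h: "x \<bullet> b = y \<bullet> b + 2 * L * real_of_int (k b)" using y[OF b] by simp
      show ?thesis
        unfolding inner_scaleR_left inner_commute[of b] h using assms by (simp add: distrib_left)
    qed
    then have "sin ((pi / L) *\<^sub>R b \<bullet> x) = sin ((pi / L) *\<^sub>R b \<bullet> y) \<and> cos ((pi / L) *\<^sub>R b \<bullet> x) = cos ((pi / L) *\<^sub>R b \<bullet> y)"
      unfolding sin_cos_eq_iff by auto
    then show "cos ((pi / L) *\<^sub>R b \<bullet> x) = cos ((pi / L) *\<^sub>R b \<bullet> y)"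
      "sin ((pi / L) *\<^sub>R b \<bullet> x) = sin ((pi / L) *\<^sub>R b \<bullet> y)" by auto
  qed
  ultimately show ?thesis
    by (intro exI[of _ y]) (auto simp: torus_map_def)
qed

text \<open>Sine and cosine fix each coordinate up to multiples of \<open>2 * L\<close>, and inside
  the cube a nonzero multiple forces the two coordinates to be \<open>L\<close> and
  \<open>- L\<close>. Distinct points are thus identified only on the faces, where the function to
  be approximated vanishes.\<close>

lemma torus_map_eqD:
  fixes x y :: "'e::euclidean_space"
  assumes L: "0 < L" and x: "\<forall>b\<in>Basis. \<bar>x \<bullet> b\<bar> \<le> L" and y: "\<forall>b\<in>Basis. \<bar>y \<bullet> b\<bar> \<le> L"
    and eq: "torus_map L x = torus_map L y"
  shows "x = y \<or> (\<exists>b\<in>Basis. \<bar>x \<bullet> b\<bar> = L \<and> \<bar>y \<bullet> b\<bar> = L)"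
proof -
  have "x \<bullet> b = y \<bullet> b \<or> (\<bar>x \<bullet> b\<bar> = L \<and> \<bar>y \<bullet> b\<bar> = L)" if b: "b \<in> Basis" for b
  proof -
    have "fst (torus_map L x) \<bullet> b = fst (torus_map L y) \<bullet> b" "snd (torus_map L x) \<bullet> b = snd (torus_map L y) \<bullet> b"
      using eq by auto
    then have "sin ((pi / L) *\<^sub>R b \<bullet> x) = sin ((pi / L) *\<^sub>R b \<bullet> y) \<and> cos ((pi / L) *\<^sub>R b \<bullet> x) = cos ((pi / L) *\<^sub>R b \<bullet> y)"
      using b by (simp add: torus_map_def)
    then obtain n :: int where "(pi / L) *\<^sub>R b \<bullet> x = (pi / L) *\<^sub>R b \<bullet> y + 2 * pi * n"
      unfolding sin_cos_eq_iff by auto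
    then have "pi * (x \<bullet> b) = pi * (y \<bullet> b + 2 * L * n)" using L by (simp add: inner_commute field_simps)
    then have n: "x \<bullet> b = y \<bullet> b + 2 * L * n" by simp
    have xb: "\<bar>x \<bullet> b\<bar> \<le> L" and yb: "\<bar>y \<bullet> b\<bar> \<le> L" using x y b by auto
    consider "n = 0" | "n \<ge> 1" | "n \<le> -1" by linarith
    then show ?thesis
    proof cases
      case 1 then show ?thesis using n by simp
    next
      case 2
      then have "2 * L * n \<ge> 2 * L * 1" using L by (intro mult_left_mono) auto
      then show ?thesis using n xb yb by auto
    next
      case 3
      then have "2 * L * n \<le> 2 * L * (-1)" using L by (intro mult_left_mono) auto
      then show ?thesis using n xb yb by auto
    qed
  qed
  then show ?thesis by (meson euclidean_eqI)
qed

text \<open>The bound by \<open>C + e\<close> on the whole space is the point: outside the cube the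
  approximation is bad, but by periodicity it is no larger there than inside. Truncation errors can
  then be paid for by a tail probability.\<close>

lemma trig_poly_approx:
  fixes g :: "'e::euclidean_space \<Rightarrow> real"
  assumes L: "0 < L" and e: "0 < e" and g: "continuous_on UNIV g"
    and zero: "\<And>x b. b \<in> Basis \<Longrightarrow> L \<le> \<bar>x \<bullet> b\<bar> \<Longrightarrow> g x = 0"
    and bound: "\<And>x. \<bar>g x\<bar> \<le> C"
  obtains T where "trig_poly (\<lambda>x. complex_of_real (T x))" "\<And>x. \<bar>T x\<bar> \<le> C + e"
    "\<And>x. (\<forall>b\<in>Basis. \<bar>x \<bullet> b\<bar> \<le> L) \<Longrightarrow> \<bar>T x - g x\<bar> \<le> e"
proof -
  define S :: "'e set" where "S = cbox (- (L *\<^sub>R One)) (L *\<^sub>R One)"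
  have S: "x \<in> S \<longleftrightarrow> (\<forall>b\<in>Basis. \<bar>x \<bullet> b\<bar> \<le> L)" for x
    unfolding S_def mem_box by (auto simp: abs_le_iff inner_sum_left_Basis; force)
  have cS: "compact S" unfolding S_def by (rule compact_cbox)
  have cont: "continuous_on A (torus_map L)" for A :: "'e set"
    unfolding torus_map_def by (intro continuous_intros)
  \<comment> \<open>A continuous map of a compact space onto a Hausdorff space is a quotient map, so
    \<open>g\<close>, being constant on its fibres, factors through a continuous function
    \<open>H\<close> on the image.\<close>
  have q: "quotient_map (top_of_set S) (top_of_set (torus_map L ` S)) (torus_map L)"
    using cS cont by (intro T1_Spaces.continuous_imp_quotient_map)
      (auto simp: compact_space_subtopology Hausdorff_space_subtopology)
  have "continuous_map (top_of_set S) euclideanreal g"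
    using g by (auto intro: continuous_on_subset)
  from quotient_map_lift_exists[OF q this] obtain H where
    H: "continuous_map (top_of_set (torus_map L ` S)) euclideanreal H" "\<And>x. x \<in> S \<Longrightarrow> H (torus_map L x) = g x"
  proof -
    have "g x = g y" if "x \<in> S" "y \<in> S" "torus_map L x = torus_map L y" for x y
      using torus_map_eqD[OF L _ _ that(3)] that(1,2) zero[of _ x] zero[of _ y] unfolding S by auto
    then show ?thesis using quotient_map_lift_exists[OF q \<open>continuous_map (top_of_set S) euclideanreal g\<close>] that
      by (metis topspace_euclidean_subtopology)
  qed
  have "compact (torus_map L ` S)" using cS cont by (intro compact_continuous_image)
  moreover have "continuous_on (torus_map L ` S) H" using H(1) by simp
  ultimately obtain p where p: "real_polynomial_function p" "\<And>z. z \<in> torus_map L ` S \<Longrightarrow> \<bar>H z - p z\<bar> < e"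
    using Stone_Weierstrass_real_polynomial_function[OF _ _ e] by metis
  have near: "\<bar>p (torus_map L x) - g x\<bar> \<le> e" if "x \<in> S" for x
    using p(2)[of "torus_map L x"] H(2)[OF that] that by auto
  show ?thesis
  proof
    show "trig_poly (\<lambda>x. complex_of_real (p (torus_map L x)))"
      by (rule trig_poly_polynomial_torus_map[OF p(1)])
    show "\<bar>p (torus_map L x) - g x\<bar> \<le> e" if "\<forall>b\<in>Basis. \<bar>x \<bullet> b\<bar> \<le> L" for x
      using near that by (simp add: S)
    show "\<bar>p (torus_map L x)\<bar> \<le> C + e" for x
    proof -
      obtain y where "y \<in> S" "torus_map L x = torus_map L y"
        using torus_map_periodic[OF L, of x] by (auto simp: S)
      then show ?thesis using near[of y] bound[of y] by auto
    qed
  qed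
qed

section \<open>Passage to the limit for random vectors\<close>

lemma trig_poly_integral_tendsto:
  fixes X :: "nat \<Rightarrow> 'w \<Rightarrow> 'e::euclidean_space" and Y :: "'u \<Rightarrow> 'e"
  assumes "trig_poly T"
    and M: "\<And>j. prob_space (M j)" and Q: "prob_space Q"
    and [measurable]: "\<And>j. X j \<in> borel_measurable (M j)" "Y \<in> borel_measurable Q"
    and char: "\<And>t. (\<lambda>j. CLINT w|M j. iexp (t \<bullet> X j w)) \<longlonglongrightarrow> (CLINT w|Q. iexp (t \<bullet> Y w))"
  shows "(\<lambda>j. CLINT w|M j. T (X j w)) \<longlonglongrightarrow> (CLINT w|Q. T (Y w)) \<and>
    (\<forall>j. integrable (M j) (\<lambda>w. T (X j w))) \<and> integrable Q (\<lambda>w. T (Y w))"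
  using assms(1)
proof induction
  case (mono c t)
  have *: "integrable N (\<lambda>w. iexp (t \<bullet> Z w))" if "prob_space N" "Z \<in> borel_measurable N" for N :: "'z measure" and Z
  proof -
    interpret prob_space N by fact
    note [measurable] = that(2)
    show ?thesis by (rule integrable_const_bound[of _ 1]) auto
  qed
  show ?case
    using *[OF M] *[OF Q] char[of t] by (auto intro!: tendsto_mult_left)
next
  case (add f g)
  then show ?case by (auto intro!: tendsto_add)
qed

text \<open>One-dimensional continuity theorem for random variables on varying spaces. It is applied
  to truncation functions of single coordinates and thereby supplies the tightness of the
  vectors.\<close>

lemma char_tight:
  fixes X :: "nat \<Rightarrow> 'w \<Rightarrow> real" and Y :: "'u \<Rightarrow> real"
  assumes M: "\<And>j. prob_space (M j)" and Q: "prob_space Q"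
    and [measurable]: "\<And>j. X j \<in> borel_measurable (M j)" "Y \<in> borel_measurable Q"
    and char: "\<And>t. (\<lambda>j. CLINT w|M j. iexp (t * X j w)) \<longlonglongrightarrow> (CLINT w|Q. iexp (t * Y w))"
    and f: "continuous_on UNIV f" "\<And>x. \<bar>f x\<bar> \<le> (B::real)"
  shows "(\<lambda>j. LINT w|M j. f (X j w)) \<longlonglongrightarrow> (LINT w|Q. f (Y w))"
proof -
  have [measurable]: "f \<in> borel_measurable borel" using f(1) by (rule borel_measurable_continuous_onI)
  have rdM: "real_distribution (distr (M j) borel (X j))" for j
  proof -
    interpret prob_space "M j" by (rule M)
    show ?thesis by (rule real_distribution_distr) simp
  qed
  have rdQ: "real_distribution (distr Q borel Y)"
  proof -
    interpret prob_space Q by (rule Q)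
    show ?thesis by (rule real_distribution_distr) simp
  qed
  have "weak_conv_m (\<lambda>j. distr (M j) borel (X j)) (distr Q borel Y)"
  proof (rule levy_continuity[OF rdM rdQ])
    show "(\<lambda>n. char (distr (M n) borel (X n)) t) \<longlonglongrightarrow> char (distr Q borel Y) t" for t
      using char[of t] by (simp add: char_def integral_distr)
  qed
  from weak_conv_imp_integral_bdd_continuous_conv[OF rdM rdQ this, of f B]
  have "(\<lambda>n. integral\<^sup>L (distr (M n) borel (X n)) f) \<longlonglongrightarrow> integral\<^sup>L (distr Q borel Y) f"
    using f by (simp add: continuous_on_eq_continuous_at)
  then show ?thesis by (simp add: integral_distr)
qed

text \<open>\<open>h\<close> is multiplied by a cut-off supported in a cube and then replaced by a
  trigonometric polynomial \<open>T\<close>, whose expectations converge by hypothesis. The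
  replacement costs \<open>e\<close> plus a multiple of the expectation of \<open>\<Psi> L\<close>,
  a continuous function that dominates the indicator of the complement of the cube.\<close>

lemma levy_continuity_euclidean:
  fixes X :: "nat \<Rightarrow> 'w \<Rightarrow> 'e::euclidean_space" and Y :: "'u \<Rightarrow> 'e" and h :: "'e \<Rightarrow> real"
  assumes M: "\<And>j. prob_space (M j)" and Q: "prob_space Q"
    and X[measurable]: "\<And>j. X j \<in> borel_measurable (M j)" and Y[measurable]: "Y \<in> borel_measurable Q"
    and char: "\<And>t. (\<lambda>j. CLINT w|M j. iexp (t \<bullet> X j w)) \<longlonglongrightarrow> (CLINT w|Q. iexp (t \<bullet> Y w))"
    and h: "continuous_on UNIV h" "bounded (range h)"
  shows "(\<lambda>j. LINT w|M j. h (X j w)) \<longlonglongrightarrow> (LINT w|Q. h (Y w))"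
proof -
  interpret Q: prob_space Q by fact
  obtain B where B: "\<And>x. \<bar>h x\<bar> \<le> B" "0 < B"
    using h(2) unfolding bounded_pos by auto
  \<comment> \<open>For \<open>L > 0\<close> this is 0 when
    \<open>\<bar>u\<bar> \<le> L / 2\<close>, 1 when \<open>\<bar>u\<bar> \<ge> L\<close>, and
    linear in between. Continuity lets its expectations pass to the limit coordinate by
    coordinate.\<close>
  define \<psi> :: "real \<Rightarrow> real \<Rightarrow> real" where "\<psi> L u = min 1 (max 0 (2 * \<bar>u\<bar> / L - 1))" for L u
  define \<Psi> :: "real \<Rightarrow> 'e \<Rightarrow> real" where "\<Psi> L x = (\<Sum>b\<in>Basis. \<psi> L (b \<bullet> x))" for L x
  have \<psi>_cont: "continuous_on A (\<psi> L)" for A L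
    unfolding \<psi>_def by (cases "L = 0") (auto intro!: continuous_intros)
  have \<psi>01: "0 \<le> \<psi> L u" "\<psi> L u \<le> 1" for L u by (auto simp: \<psi>_def)
  have \<Psi>_cont: "continuous_on A (\<Psi> L)" for A L
    unfolding \<Psi>_def by (intro continuous_on_sum continuous_on_compose2[OF \<psi>_cont[of UNIV]] continuous_intros) auto
  have [measurable]: "\<Psi> L \<in> borel_measurable borel" "h \<in> borel_measurable borel" "\<psi> L \<in> borel_measurable borel" for L
    using \<Psi>_cont \<psi>_cont h(1) by (auto intro: borel_measurable_continuous_onI)
  have \<Psi>0: "0 \<le> \<Psi> L x" for L x unfolding \<Psi>_def by (intro sum_nonneg \<psi>01)
  have \<Psi>le: "\<Psi> L x \<le> real DIM('e)" for L x
    unfolding \<Psi>_def using sum_mono[of Basis "\<lambda>b. \<psi> L (b \<bullet> x)" "\<lambda>_. 1"] \<psi>01 by simp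
  have \<Psi>1: "1 \<le> \<Psi> L x" if "b \<in> Basis" "L \<le> \<bar>x \<bullet> b\<bar>" "0 < L" for L :: real and x b :: 'e
  proof -
    have "\<psi> L (b \<bullet> x) = 1" using that by (auto simp: \<psi>_def inner_commute field_simps)
    then show ?thesis unfolding \<Psi>_def using that(1) \<psi>01 by (metis finite_Basis member_le_sum)
  qed
  have \<Psi>_lim: "(\<lambda>j. LINT w|M j. \<Psi> L (X j w)) \<longlonglongrightarrow> (LINT w|Q. \<Psi> L (Y w))" for L
  proof -
    have int: "integrable N (\<lambda>w. \<psi> L (b \<bullet> Z w))" if "prob_space N" "Z \<in> borel_measurable N" for N :: "'z measure" and Z and b :: 'e
    proof -
      interpret prob_space N by fact
      note [measurable] = that(2)
      show ?thesis using \<psi>01 by (intro integrable_const_bound[of _ 1]) auto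
    qed
    have "(\<lambda>j. LINT w|M j. \<psi> L (b \<bullet> X j w)) \<longlonglongrightarrow> (LINT w|Q. \<psi> L (b \<bullet> Y w))" for b
    proof (rule char_tight[OF M Q, where f="\<psi> L" and B=1 and X="\<lambda>j w. b \<bullet> X j w" and Y="\<lambda>w. b \<bullet> Y w"])
      show "(\<lambda>j. CLINT w|M j. iexp (t * (b \<bullet> X j w))) \<longlonglongrightarrow> (CLINT w|Q. iexp (t * (b \<bullet> Y w)))" for t
        using char[of "t *\<^sub>R b"] by simp
    qed (use \<psi>_cont \<psi>01 in \<open>auto intro: \<psi>_cont[of UNIV]\<close>)
    then show ?thesis unfolding \<Psi>_def
      by (subst (1 2) Bochner_Integration.integral_sum) (auto intro!: tendsto_sum int M Q)
  qed
  \<comment> \<open>Tightness is proved for the limit \<open>Y\<close> alone: for a fixed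
    \<open>L\<close> the expectations of \<open>\<Psi> L\<close> along the sequence converge to the
    one under \<open>Y\<close> and so become small as well.\<close>
  have tight: "(\<lambda>k. LINT w|Q. \<Psi> (real (Suc k)) (Y w)) \<longlonglongrightarrow> 0"
  proof -
    have "(\<lambda>k. LINT w|Q. \<Psi> (real (Suc k)) (Y w)) \<longlonglongrightarrow> (LINT w|Q. 0)"
    proof (rule integral_dominated_convergence[where w="\<lambda>_. real DIM('e)"])
      have "(\<lambda>k. \<psi> (real (Suc k)) u) \<longlonglongrightarrow> 0" for u
      proof (rule tendsto_eventually)
        obtain n where "2 * \<bar>u\<bar> \<le> real n" using real_arch_simple by blast
        then have "\<psi> (real (Suc k)) u = 0" if "n \<le> k" for k
        proof -
          have "2 * \<bar>u\<bar> \<le> real (Suc k)" using \<open>2 * \<bar>u\<bar> \<le> real n\<close> that by simp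
          then have "2 * \<bar>u\<bar> / real (Suc k) \<le> 1" by (simp add: divide_le_eq)
          then show ?thesis by (simp add: \<psi>_def)
        qed
        then show "\<forall>\<^sub>F k in sequentially. \<psi> (real (Suc k)) u = 0" by (auto simp: eventually_sequentially)
      qed
      then show "AE w in Q. (\<lambda>k. \<Psi> (real (Suc k)) (Y w)) \<longlonglongrightarrow> 0"
        unfolding \<Psi>_def by (intro AE_I2 tendsto_null_sum)
      show "\<And>i. AE w in Q. norm (\<Psi> (real (Suc i)) (Y w)) \<le> real DIM('e)"
        using \<Psi>0 \<Psi>le by simp
    qed auto
    then show ?thesis by simp
  qed
  show ?thesis
  proof (rule LIMSEQ_I)
    fix r :: real assume r: "0 < r"
    \<comment> \<open>The final error is below \<open>3 * e + 3 * ((2 * B + 1) * e)\<close>, that is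
      \<open>6 * (B + 1) * e\<close>; the denominator leaves a wide margin.\<close>
    define e where "e = min 1 (r / (8 * (2 * B + 2)))"
    have D: "0 < 8 * (2 * B + 2)" using B(2) by simp
    have "e \<le> r / (8 * (2 * B + 2))" by (simp add: e_def)
    then have e3: "e * (8 * (2 * B + 2)) \<le> r" by (simp only: pos_le_divide_eq[OF D])
    have e: "0 < e" "e \<le> 1" using r D by (simp_all add: e_def)
    obtain k where "\<bar>LINT w|Q. \<Psi> (real (Suc k)) (Y w)\<bar> < e"
      using LIMSEQ_D[OF tight e(1)] by auto
    then obtain L where L: "0 < L" and LQ: "(LINT w|Q. \<Psi> L (Y w)) < e"
      by (intro that[of "real (Suc k)"]) auto
    define g where "g x = h x * max 0 (1 - \<Psi> L x)" for x
    have g_cont: "continuous_on UNIV g" unfolding g_def by (intro continuous_intros h \<Psi>_cont)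
    have g_zero: "g x = 0" if "b \<in> Basis" "L \<le> \<bar>x \<bullet> b\<bar>" for x b :: 'e
      using \<Psi>1[OF that L] by (simp add: g_def)
    have g_bd: "\<bar>g x\<bar> \<le> B" for x
    proof -
      have "\<bar>h x\<bar> * \<bar>max 0 (1 - \<Psi> L x)\<bar> \<le> B * 1" using B \<Psi>0[of L x] by (intro mult_mono) auto
      then show ?thesis by (simp add: g_def abs_mult)
    qed
    have gh: "\<bar>h x - g x\<bar> \<le> B * \<Psi> L x" for x
    proof -
      have "\<bar>h x - g x\<bar> = \<bar>h x\<bar> * \<bar>1 - max 0 (1 - \<Psi> L x)\<bar>"
        by (simp add: g_def abs_mult[symmetric] right_diff_distrib)
      also have "\<dots> \<le> B * \<Psi> L x" using B \<Psi>0[of L x] by (intro mult_mono) auto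
      finally show ?thesis .
    qed
    have "\<exists>T. trig_poly (\<lambda>x. complex_of_real (T x)) \<and> (\<forall>x. \<bar>T x\<bar> \<le> B + e) \<and>
        (\<forall>x. (\<forall>b\<in>Basis. \<bar>x \<bullet> b\<bar> \<le> L) \<longrightarrow> \<bar>T x - g x\<bar> \<le> e)"
      by (rule trig_poly_approx[OF L e(1) g_cont g_zero g_bd]) auto
    then obtain T where T: "trig_poly (\<lambda>x. complex_of_real (T x))" "\<And>x. \<bar>T x\<bar> \<le> B + e"
      "\<And>x. (\<forall>b\<in>Basis. \<bar>x \<bullet> b\<bar> \<le> L) \<Longrightarrow> \<bar>T x - g x\<bar> \<le> e"
      by blast
    \<comment> \<open>Inside the cube \<open>T\<close> is close to \<open>g\<close>, and
      \<open>g\<close> differs from \<open>h\<close> by at most \<open>B * \<Psi> L x\<close>.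
      Outside, \<open>\<Psi> L x\<close> is at least 1, so it absorbs the trivial bound
      \<open>2 * B + e\<close>.\<close>
    have Th: "\<bar>h x - T x\<bar> \<le> e + (2 * B + 1) * \<Psi> L x" for x
    proof (cases "\<forall>b\<in>Basis. \<bar>x \<bullet> b\<bar> \<le> L")
      case True
      have "\<bar>h x - T x\<bar> \<le> e + B * \<Psi> L x" using T(3)[OF True] gh[of x] by linarith
      also have "\<dots> \<le> e + (2 * B + 1) * \<Psi> L x" using \<Psi>0[of L x] B by (intro add_left_mono mult_right_mono) auto
      finally show ?thesis .
    next
      case False
      then obtain b where "b \<in> Basis" "L \<le> \<bar>x \<bullet> b\<bar>" by force
      define Z where "Z = (2 * B + 1) * \<Psi> L x"
      from \<Psi>1[OF \<open>b \<in> Basis\<close> \<open>L \<le> \<bar>x \<bullet> b\<bar>\<close> L] have "(2 * B + 1) * 1 \<le> Z"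
        unfolding Z_def using B by (intro mult_left_mono) auto
      moreover have "\<bar>h x - T x\<bar> \<le> B + (B + e)" using T(2)[of x] B(1)[of x] by linarith
      ultimately have "\<bar>h x - T x\<bar> \<le> e + Z" by simp
      then show ?thesis by (simp only: Z_def)
    qed
    note lim = trig_poly_integral_tendsto[OF T(1) M Q X Y char]
    have close: "\<bar>(LINT w|N. h (Z w)) - (LINT w|N. T (Z w))\<bar> \<le> e + (2 * B + 1) * (LINT w|N. \<Psi> L (Z w))"
      if N: "prob_space N" and [measurable]: "Z \<in> borel_measurable N" and int: "integrable N (\<lambda>w. complex_of_real (T (Z w)))"
      for N :: "'z measure" and Z
    proof -
      interpret N: prob_space N by fact
      have iT: "integrable N (\<lambda>w. T (Z w))" using integrable_Re[OF int] by simp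
      have ih: "integrable N (\<lambda>w. h (Z w))" using B by (intro N.integrable_const_bound[of _ B]) auto
      have i\<Psi>: "integrable N (\<lambda>w. \<Psi> L (Z w))"
        using \<Psi>0 \<Psi>le by (intro N.integrable_const_bound[of _ "real DIM('e)"]) auto
      have "\<bar>LINT w|N. h (Z w) - T (Z w)\<bar> \<le> (LINT w|N. e + (2 * B + 1) * \<Psi> L (Z w))"
        using iT ih i\<Psi> Th by (intro order_trans[OF integral_abs_bound] integral_mono) auto
      then show ?thesis using iT ih i\<Psi> by (simp add: N.prob_space)
    qed
    have "(\<lambda>j. LINT w|M j. T (X j w)) \<longlonglongrightarrow> (LINT w|Q. T (Y w))"
      using lim by (simp add: tendsto_of_real_iff)
    from LIMSEQ_D[OF this e(1)] obtain n1 where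
      n1: "\<And>j. j \<ge> n1 \<Longrightarrow> \<bar>(LINT w|M j. T (X j w)) - (LINT w|Q. T (Y w))\<bar> < e" by auto
    from LIMSEQ_D[OF \<Psi>_lim e(1), of L] obtain n2 where
      n2: "\<And>j. j \<ge> n2 \<Longrightarrow> \<bar>(LINT w|M j. \<Psi> L (X j w)) - (LINT w|Q. \<Psi> L (Y w))\<bar> < e" by auto
    have "norm ((LINT w|M j. h (X j w)) - (LINT w|Q. h (Y w))) < r" if j: "j \<ge> max n1 n2" for j
    proof -
      have c1: "\<bar>(LINT w|M j. h (X j w)) - (LINT w|M j. T (X j w))\<bar> \<le> e + (2 * B + 1) * (LINT w|M j. \<Psi> L (X j w))"
        using lim by (intro close M) auto
      have c2: "\<bar>(LINT w|Q. h (Y w)) - (LINT w|Q. T (Y w))\<bar> \<le> e + (2 * B + 1) * (LINT w|Q. \<Psi> L (Y w))"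
        using lim by (intro close Q) auto
      define P where "P = (2 * B + 1) * e"
      define P1 where "P1 = (2 * B + 1) * (LINT w|M j. \<Psi> L (X j w))"
      define P2 where "P2 = (2 * B + 1) * (LINT w|Q. \<Psi> L (Y w))"
      have "(LINT w|M j. \<Psi> L (X j w)) \<le> 2 * e" using n2[of j] LQ j by auto
      then have "P1 \<le> (2 * B + 1) * (2 * e)" unfolding P1_def using B by (intro mult_left_mono) auto
      then have P1: "P1 \<le> 2 * P" by (simp add: P_def)
      have P2: "P2 \<le> P" unfolding P2_def P_def using B LQ by (intro mult_left_mono) auto
      have "j \<ge> n1" using j by simp
      then have "\<bar>(LINT w|M j. h (X j w)) - (LINT w|Q. h (Y w))\<bar> < 3 * e + 3 * P"
        using c1 c2 n1[of j] P1 P2 unfolding P1_def[symmetric] P2_def[symmetric] by linarith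
      also have "3 * e + 3 * P = 3 * e + 3 * ((2 * B + 1) * e)" by (simp add: P_def)
      also have "\<dots> \<le> e * (8 * (2 * B + 2))"       proof -
        have "0 \<le> e * B" using e B by simp
        then show ?thesis using e(1) by (simp add: algebra_simps)
      qed
      also have "\<dots> \<le> r" by (rule e3)
      finally show ?thesis by simp
    qed
    then show "\<exists>no. \<forall>j\<ge>no. norm ((LINT w|M j. h (X j w)) - (LINT w|Q. h (Y w))) < r" by blast
  qed
qed

section \<open>Determinantal point processes\<close>

section \<open>Independence and countable sums\<close>

text \<open>Independence is assumed for the sigma-algebras generated by \<open>Y\<close> and
  \<open>Z\<close>, the form it has in \<open>iid_marking\<close>. It enters through the joint law
  of the pair, which is the product of the two laws.\<close>

locale independent_pair = prob_space M for M :: "'w measure" +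
  fixes S :: "'y measure" and Y :: "'w \<Rightarrow> 'y" and T :: "'z measure" and Z :: "'w \<Rightarrow> 'z"
  assumes Y[measurable]: "Y \<in> measurable M S" and Z[measurable]: "Z \<in> measurable M T"
    and indep: "indep_set (sets (vimage_algebra (space M) Y S)) (sets (vimage_algebra (space M) Z T))"
begin

lemma distr_pair: "distr M (S \<Otimes>\<^sub>M T) (\<lambda>w. (Y w, Z w)) = distr M S Y \<Otimes>\<^sub>M distr M T Z"
proof -
  interpret Yd: prob_space "distr M S Y" by (rule prob_space_distr) measurable
  interpret Zd: prob_space "distr M T Z" by (rule prob_space_distr) measurable
  show ?thesis
  proof (rule pair_measure_eqI[symmetric])
    fix A B assume A: "A \<in> sets (distr M S Y)" and B: "B \<in> sets (distr M T Z)"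
    have "Y -` A \<inter> space M \<in> sets (vimage_algebra (space M) Y S)"
      "Z -` B \<inter> space M \<in> sets (vimage_algebra (space M) Z T)"
      using A B by (auto intro: in_vimage_algebra)
    from indep_setD[OF indep this]
    have "prob ((Y -` A \<inter> space M) \<inter> (Z -` B \<inter> space M)) = prob (Y -` A \<inter> space M) * prob (Z -` B \<inter> space M)" .
    moreover have "(\<lambda>w. (Y w, Z w)) -` (A \<times> B) \<inter> space M = (Y -` A \<inter> space M) \<inter> (Z -` B \<inter> space M)" by auto
    ultimately show "emeasure (distr M S Y) A * emeasure (distr M T Z) B = emeasure (distr M (S \<Otimes>\<^sub>M T) (\<lambda>w. (Y w, Z w))) (A \<times> B)"
      using A B by (simp add: emeasure_distr emeasure_eq_measure ennreal_mult)
  qed (auto intro: Yd.sigma_finite_measure Zd.sigma_finite_measure Yd.sigma_finite_measure_axioms Zd.sigma_finite_measure_axioms cong: sets_pair_measure_cong)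
qed

text \<open>In the inner integral \<open>Z\<close> is evaluated at an independent outcome
  \<open>w'\<close> of the same space, so that conditioning on \<open>Y\<close> is expressed without
  conditional expectations.\<close>

lemma nn_integral_iterated:
  assumes F[measurable]: "case_prod F \<in> borel_measurable (S \<Otimes>\<^sub>M T)"
  shows "(\<integral>\<^sup>+w. F (Y w) (Z w) \<partial>M) = (\<integral>\<^sup>+w. (\<integral>\<^sup>+w'. F (Y w) (Z w') \<partial>M) \<partial>M)"
proof -
  interpret Zd: prob_space "distr M T Z" by (rule prob_space_distr) measurable
  have "(\<integral>\<^sup>+w. F (Y w) (Z w) \<partial>M) = (\<integral>\<^sup>+p. case_prod F p \<partial>distr M (S \<Otimes>\<^sub>M T) (\<lambda>w. (Y w, Z w)))"
    by (subst nn_integral_distr) auto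
  also have "\<dots> = (\<integral>\<^sup>+p. case_prod F p \<partial>(distr M S Y \<Otimes>\<^sub>M distr M T Z))"
    unfolding distr_pair ..
  also have "\<dots> = (\<integral>\<^sup>+y. (\<integral>\<^sup>+z. F y z \<partial>distr M T Z) \<partial>distr M S Y)"
    by (subst Zd.nn_integral_fst[symmetric]) auto
  also have "\<dots> = (\<integral>\<^sup>+w. (\<integral>\<^sup>+z. F (Y w) z \<partial>distr M T Z) \<partial>M)"
    by (rule nn_integral_distr) measurable
  also have "\<dots> = (\<integral>\<^sup>+w. (\<integral>\<^sup>+w'. F (Y w) (Z w') \<partial>M) \<partial>M)"
  proof (rule nn_integral_cong)
    fix w assume w[measurable]: "w \<in> space M"
    have [measurable]: "Y w \<in> space S" using measurable_space[OF Y w] .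
    show "(\<integral>\<^sup>+z. F (Y w) z \<partial>distr M T Z) = (\<integral>\<^sup>+w'. F (Y w) (Z w') \<partial>M)"
      by (rule nn_integral_distr) measurable
  qed
  finally show ?thesis .
qed

lemma integral_iterated:
  fixes F :: "'y \<Rightarrow> 'z \<Rightarrow> complex"
  assumes F[measurable]: "case_prod F \<in> borel_measurable (S \<Otimes>\<^sub>M T)" and bd: "\<And>y z. norm (F y z) \<le> B"
  shows "(\<integral>w. F (Y w) (Z w) \<partial>M) = (\<integral>w. (\<integral>w'. F (Y w) (Z w') \<partial>M) \<partial>M)"
proof -
  interpret Yd: prob_space "distr M S Y" by (rule prob_space_distr) measurable
  interpret Zd: prob_space "distr M T Z" by (rule prob_space_distr) measurable
  interpret YZ: pair_prob_space "distr M S Y" "distr M T Z" ..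
  have "(\<integral>w. F (Y w) (Z w) \<partial>M) = (\<integral>p. case_prod F p \<partial>distr M (S \<Otimes>\<^sub>M T) (\<lambda>w. (Y w, Z w)))"
    by (subst integral_distr) auto
  also have "\<dots> = (\<integral>p. case_prod F p \<partial>(distr M S Y \<Otimes>\<^sub>M distr M T Z))"
    unfolding distr_pair ..
  also have "\<dots> = (\<integral>y. (\<integral>z. F y z \<partial>distr M T Z) \<partial>distr M S Y)"
  proof (subst YZ.integral_fst'[symmetric])
    show "integrable (distr M S Y \<Otimes>\<^sub>M distr M T Z) (case_prod F)"
      using bd by (intro YZ.P.integrable_const_bound[of _ B]) auto
  qed simp
  also have "\<dots> = (\<integral>w. (\<integral>z. F (Y w) z \<partial>distr M T Z) \<partial>M)"
    by (rule integral_distr) measurable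
  also have "\<dots> = (\<integral>w. (\<integral>w'. F (Y w) (Z w') \<partial>M) \<partial>M)"
  proof (rule Bochner_Integration.integral_cong[OF refl])
    fix w assume w[measurable]: "w \<in> space M"
    have [measurable]: "Y w \<in> space S" using measurable_space[OF Y w] .
    show "(\<integral>z. F (Y w) z \<partial>distr M T Z) = (\<integral>w'. F (Y w) (Z w') \<partial>M)"
      by (rule integral_distr) measurable
  qed
  finally show ?thesis .
qed

end

lemma nn_integral_count_space_image:
  assumes "inj_on f A"
  shows "(\<integral>\<^sup>+x. h x \<partial>count_space (f ` A)) = (\<integral>\<^sup>+n. indicator A n * h (f n) \<partial>count_space UNIV)"
proof -
  have "(\<integral>\<^sup>+x. h x \<partial>count_space (f ` A)) = (\<integral>\<^sup>+n. h (f n) \<partial>count_space A)"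
    using assms by (intro nn_integral_bij_count_space[symmetric]) (rule inj_on_imp_bij_betw)
  also have "\<dots> = (\<integral>\<^sup>+n. indicator A n * h (f n) \<partial>count_space UNIV)"
    by (subst nn_integral_count_space_indicator) (auto simp: mult.commute)
  finally show ?thesis .
qed

lemma integral_count_space_image:
  fixes h :: "'b \<Rightarrow> real"
  assumes "inj_on f A"
  shows "(\<integral>x. h x \<partial>count_space (f ` A)) = (\<integral>n. indicator A n * h (f n) \<partial>count_space UNIV)"
proof -
  have "(\<integral>x. h x \<partial>count_space (f ` A)) = (\<integral>n. h (f n) \<partial>count_space A)"
    using assms by (intro integral_bij_count_space[symmetric]) (rule inj_on_imp_bij_betw)
  also have "count_space A = restrict_space (count_space UNIV) A" by (simp add: restrict_count_space)
  also have "(\<integral>n. h (f n) \<partial>restrict_space (count_space UNIV) A) = (\<integral>n. indicator A n * h (f n) \<partial>count_space UNIV)"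
    by (subst integral_restrict_space) auto
  finally show ?thesis .
qed

text \<open>The measure that assigns to a set the mean total weight of the points
  \<open>Z j w\<close> in it, with weights \<open>c j w\<close>. As the image of a density on the
  product of the index set and the probability space it is a measure by construction, so moment
  identities can be checked on a generator. The indices are natural numbers for first moments and
  pairs of them for second moments.\<close>

definition count_intensity :: "'w measure \<Rightarrow> ('j \<Rightarrow> 'w \<Rightarrow> ennreal) \<Rightarrow> ('j \<Rightarrow> 'w \<Rightarrow> 'b) \<Rightarrow> 'b measure \<Rightarrow> 'b measure" where
  "count_intensity M c Z S = distr (density (count_space UNIV \<Otimes>\<^sub>M M) (\<lambda>(j, w). c j w)) S (\<lambda>(j, w). Z j w)"

lemma measurable_count_space_pair:
  assumes "\<And>j::'j::countable. f j \<in> measurable M S"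
  shows "(\<lambda>(j, w). f j w) \<in> measurable (count_space UNIV \<Otimes>\<^sub>M M) S"
  using assms by (intro measurable_pair_measure_countable1) auto

lemma nn_integral_count_swap:
  fixes f :: "'j::countable \<Rightarrow> 'w \<Rightarrow> ennreal"
  assumes M: "sigma_finite_measure M" and f: "\<And>j. f j \<in> borel_measurable M"
  shows "(\<integral>\<^sup>+w. (\<integral>\<^sup>+j. f j w \<partial>count_space UNIV) \<partial>M) = (\<integral>\<^sup>+j. (\<integral>\<^sup>+w. f j w \<partial>M) \<partial>count_space UNIV)"
proof -
  interpret pair_sigma_finite "count_space (UNIV :: 'j set)" M
    using M by (intro pair_sigma_finite.intro sigma_finite_measure_count_space)
  show ?thesis
    using measurable_count_space_pair[of f, OF f] by (intro Fubini') (simp add: case_prod_beta')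
qed

lemma borel_measurable_count_nn_integral:
  fixes f :: "'j::countable \<Rightarrow> 'w \<Rightarrow> ennreal"
  assumes f: "\<And>j. f j \<in> borel_measurable M"
  shows "(\<lambda>w. \<integral>\<^sup>+j. f j w \<partial>count_space UNIV) \<in> borel_measurable M"
proof (rule sigma_finite_measure.borel_measurable_nn_integral)
  show "sigma_finite_measure (count_space (UNIV :: 'j set))" by (rule sigma_finite_measure_count_space)
  have "(\<lambda>p. (case (snd p, fst p) of (j, w) \<Rightarrow> f j w)) \<in> borel_measurable (M \<Otimes>\<^sub>M count_space UNIV)"
    using measurable_count_space_pair[of f, OF f] by (rule measurable_compose[rotated]) measurable
  then show "(\<lambda>(w, j). f j w) \<in> borel_measurable (M \<Otimes>\<^sub>M count_space UNIV)" by (simp add: case_prod_beta')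
qed

lemma borel_measurable_count_integral:
  fixes f :: "'j::countable \<Rightarrow> 'w \<Rightarrow> 'b::{banach, second_countable_topology}"
  assumes f: "\<And>j. f j \<in> borel_measurable M"
  shows "(\<lambda>w. \<integral>j. f j w \<partial>count_space UNIV) \<in> borel_measurable M"
proof (rule sigma_finite_measure.borel_measurable_lebesgue_integral)
  show "sigma_finite_measure (count_space (UNIV :: 'j set))" by (rule sigma_finite_measure_count_space)
  have "(\<lambda>p. (case (snd p, fst p) of (j, w) \<Rightarrow> f j w)) \<in> borel_measurable (M \<Otimes>\<^sub>M count_space UNIV)"
    using measurable_count_space_pair[of f, OF f] by (rule measurable_compose[rotated]) measurable
  then show "(\<lambda>(w, j). f j w) \<in> borel_measurable (M \<Otimes>\<^sub>M count_space UNIV)" by (simp add: case_prod_beta')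
qed

lemma nn_integral_count_intensity:
  fixes c :: "'j::countable \<Rightarrow> 'w \<Rightarrow> ennreal"
  assumes M: "sigma_finite_measure M" and c: "\<And>j. c j \<in> borel_measurable M"
    and Z: "\<And>j. Z j \<in> measurable M S" and h: "h \<in> borel_measurable S"
  shows "(\<integral>\<^sup>+z. h z \<partial>count_intensity M c Z S) = (\<integral>\<^sup>+w. (\<integral>\<^sup>+j. c j w * h (Z j w) \<partial>count_space UNIV) \<partial>M)"
proof -
  interpret M: sigma_finite_measure M by fact
  note [measurable] = measurable_count_space_pair[of c, OF c] measurable_count_space_pair[of Z, OF Z] h
  have [measurable]: "(\<lambda>p. h (case p of (j, w) \<Rightarrow> Z j w)) \<in> borel_measurable (count_space UNIV \<Otimes>\<^sub>M M)"
    by measurable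
  have "(\<integral>\<^sup>+z. h z \<partial>count_intensity M c Z S) =
    (\<integral>\<^sup>+p. (case p of (j, w) \<Rightarrow> c j w) * h (case p of (j, w) \<Rightarrow> Z j w) \<partial>(count_space UNIV \<Otimes>\<^sub>M M))"
    unfolding count_intensity_def by (subst nn_integral_distr) (auto simp: nn_integral_density)
  also have "\<dots> = (\<integral>\<^sup>+j. (\<integral>\<^sup>+w. c j w * h (Z j w) \<partial>M) \<partial>count_space UNIV)"
    by (subst M.nn_integral_fst[symmetric]) auto
  also have "\<dots> = (\<integral>\<^sup>+w. (\<integral>\<^sup>+j. c j w * h (Z j w) \<partial>count_space UNIV) \<partial>M)"
    using c measurable_compose[OF Z h] by (intro nn_integral_count_swap[OF M, symmetric]) auto
  finally show ?thesis .
qed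

section \<open>Moments of first and second order of a determinantal process\<close>

lemma corr_det_1: "corr_det k 1 x = k (x 0) (x 0)"
  unfolding corr_det_def by (subst det_single) auto

lemma corr_det_2: "corr_det k 2 x = k (x 0) (x 0) * k (x 1) (x 1) - k (x 0) (x 1) * k (x 1) (x 0)"
proof -
  let ?A = "Matrix.mat 2 2 (\<lambda>(i, j). k (x i) (x j))"
  have "Determinant.det ?A = (\<Sum>i<2. ?A $$ (i, 0) * cofactor ?A i 0)"
    by (rule laplace_expansion_column) auto
  also have "\<dots> = ?A $$ (0, 0) * cofactor ?A 0 0 + ?A $$ (1, 0) * cofactor ?A 1 0"
    by (simp add: numeral_2_eq_2)
  also have "cofactor ?A 0 0 = k (x 1) (x 1)"
    unfolding cofactor_def by (subst det_single) (auto simp: mat_delete_def)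
  also have "cofactor ?A 1 0 = - k (x 0) (x 1)"
    unfolding cofactor_def by (subst det_single) (auto simp: mat_delete_def)
  finally show ?thesis by (simp add: corr_det_def algebra_simps)
qed

lemma measurable_kernel_compose:
  assumes k: "case_prod k \<in> borel_measurable (lborel \<Otimes>\<^sub>M lborel)"
    and "u \<in> measurable N borel" "v \<in> measurable N borel"
  shows "(\<lambda>p. k (u p) (v p)) \<in> borel_measurable N"
proof -
  have "(\<lambda>p. (u p, v p)) \<in> measurable N (lborel \<Otimes>\<^sub>M lborel)"
    using assms(2,3) by (intro measurable_Pair) simp_all
  from measurable_compose[OF this k] show ?thesis by simp
qed

lemma determinantal_pp_correlation:
  assumes "determinantal_pp M \<xi> k" "1 \<le> n" "\<forall>i<n. D i \<in> sets borel" "disjoint_family_on D {..<n}"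
  shows "(\<integral>\<^sup>+w. (\<Prod>i<n. num_points (\<xi> w) (D i)) \<partial>M) =
    (\<integral>\<^sup>+x. ennreal (Re (corr_det k n x)) * indicator (\<Pi>\<^sub>E i\<in>{..<n}. D i) x \<partial>(\<Pi>\<^sub>M i\<in>{..<n}. lborel))"
  by (rule assms(1)[unfolded determinantal_pp_def, THEN conjunct2, THEN conjunct2, THEN spec, THEN mp,
    OF assms(2), THEN conjunct2, THEN spec, THEN mp, OF conjI[OF assms(3,4)]])

lemma determinantal_pp_1:
  fixes \<xi> :: "'w \<Rightarrow> 'a::euclidean_space set"
  assumes dpp: "determinantal_pp M \<xi> k" and D[measurable]: "D \<in> sets borel"
  shows "(\<integral>\<^sup>+w. num_points (\<xi> w) D \<partial>M) = (\<integral>\<^sup>+x. ennreal (Re (k x x)) * indicator D x \<partial>lborel)"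
proof -
  have k: "case_prod k \<in> borel_measurable (lborel \<Otimes>\<^sub>M lborel)"
    using dpp by (simp add: determinantal_pp_def)
  have [measurable]: "(\<lambda>x. k x x) \<in> borel_measurable borel"
    by (rule measurable_kernel_compose[OF k]) simp_all
  interpret product_sigma_finite "\<lambda>_::nat. lborel :: 'a measure" ..
  have lt1: "{..<1} = {0::nat}" by auto
  have dis: "disjoint_family_on (\<lambda>_::nat. D) {..<1}" unfolding disjoint_family_on_def lt1 by simp
  have sets: "\<forall>i<(1::nat). (\<lambda>_. D) i \<in> sets borel" using D by simp
  have "(\<integral>\<^sup>+w. num_points (\<xi> w) D \<partial>M) =
    (\<integral>\<^sup>+x. ennreal (Re (k (x 0) (x 0))) * indicator (\<Pi>\<^sub>E i\<in>{0::nat}. D) x \<partial>(\<Pi>\<^sub>M i\<in>{0::nat}. lborel))"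
    using determinantal_pp_correlation[OF dpp order.refl sets dis] unfolding corr_det_1 lt1 by simp
  also have "\<dots> = (\<integral>\<^sup>+x. ennreal (Re (k (x 0) (x 0))) * indicator D (x 0) \<partial>(\<Pi>\<^sub>M i\<in>{0::nat}. lborel))"
  proof (rule nn_integral_cong)
    fix x :: "nat \<Rightarrow> 'a" assume "x \<in> space (\<Pi>\<^sub>M i\<in>{0::nat}. lborel)"
    then have "x \<in> (\<Pi>\<^sub>E i\<in>{0::nat}. D) \<longleftrightarrow> x 0 \<in> D" by (auto simp: space_PiM PiE_iff)
    then show "ennreal (Re (k (x 0) (x 0))) * indicator (\<Pi>\<^sub>E i\<in>{0::nat}. D) x = ennreal (Re (k (x 0) (x 0))) * indicator D (x 0)"
      by (simp add: indicator_def)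
  qed
  also have "\<dots> = (\<integral>\<^sup>+x. ennreal (Re (k x x)) * indicator D x \<partial>lborel)"
    by (rule product_nn_integral_singleton) measurable
  finally show ?thesis .
qed

lemma determinantal_pp_2:
  fixes \<xi> :: "'w \<Rightarrow> 'a::euclidean_space set"
  assumes dpp: "determinantal_pp M \<xi> k" and D[measurable]: "D \<in> sets borel" "D' \<in> sets borel" and disj: "D \<inter> D' = {}"
  shows "(\<integral>\<^sup>+w. num_points (\<xi> w) D * num_points (\<xi> w) D' \<partial>M) =
    (\<integral>\<^sup>+p. ennreal (Re (k (fst p) (fst p) * k (snd p) (snd p) - k (fst p) (snd p) * k (snd p) (fst p))) * indicator (D \<times> D') p \<partial>(lborel \<Otimes>\<^sub>M lborel))"
proof -
  have k: "case_prod k \<in> borel_measurable (lborel \<Otimes>\<^sub>M lborel)"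
    using dpp by (simp add: determinantal_pp_def)
  interpret product_sigma_finite "\<lambda>_::nat. lborel :: 'a measure" ..
  define E where "E i = (if i = 0 then D else D')" for i :: nat
  define q where "q x y = ennreal (Re (k x x * k y y - k x y * k y x)) * indicator D x * indicator D' y" for x y
  have lt2: "{..<2} = {0, 1::nat}" by auto
  have dis: "disjoint_family_on E {..<2}"
    unfolding lt2 disjoint_family_on_def using disj by (auto simp: E_def)
  have sets: "\<forall>i<2. E i \<in> sets borel" using D by (simp add: E_def)
  have "(\<Prod>i<2. a (E i)) = a D * a D'" for a :: "'a set \<Rightarrow> ennreal"
    by (simp add: lt2 E_def)
  then have "(\<integral>\<^sup>+w. num_points (\<xi> w) D * num_points (\<xi> w) D' \<partial>M) =
    (\<integral>\<^sup>+x. ennreal (Re (k (x 0) (x 0) * k (x 1) (x 1) - k (x 0) (x 1) * k (x 1) (x 0))) * indicator (\<Pi>\<^sub>E i\<in>{0, 1}. E i) x \<partial>(\<Pi>\<^sub>M i\<in>{0, 1::nat}. lborel))"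
    using determinantal_pp_correlation[OF dpp one_le_numeral sets dis] unfolding corr_det_2 lt2[symmetric] by simp
  also have "\<dots> = (\<integral>\<^sup>+x. q (x 0) (x 1) \<partial>(\<Pi>\<^sub>M i\<in>{0, 1::nat}. lborel))"
  proof (rule nn_integral_cong)
    fix x :: "nat \<Rightarrow> 'a" assume "x \<in> space (\<Pi>\<^sub>M i\<in>{0, 1::nat}. lborel)"
    then have "x \<in> (\<Pi>\<^sub>E i\<in>{0, 1::nat}. E i) \<longleftrightarrow> x 0 \<in> D \<and> x 1 \<in> D'" by (auto simp: space_PiM PiE_iff E_def)
    then show "ennreal (Re (k (x 0) (x 0) * k (x 1) (x 1) - k (x 0) (x 1) * k (x 1) (x 0))) * indicator (\<Pi>\<^sub>E i\<in>{0, 1::nat}. E i) x = q (x 0) (x 1)"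
      by (simp add: indicator_def q_def)
  qed
  also have "\<dots> = (\<integral>\<^sup>+p. q (fst p) (snd p) \<partial>(lborel \<Otimes>\<^sub>M lborel))"
  proof (rule product_nn_integral_pair)
    have "(\<lambda>p. q (fst p) (snd p)) \<in> borel_measurable (lborel \<Otimes>\<^sub>M lborel)"
      unfolding q_def
      by (intro borel_measurable_times_ennreal borel_measurable_indicator' measurable_compose[OF _ measurable_ennreal]
        measurable_compose[OF _ borel_measurable_Re] borel_measurable_diff borel_measurable_times measurable_kernel_compose[OF k]) measurable
    then show "case_prod q \<in> borel_measurable (lborel \<Otimes>\<^sub>M lborel)" by (simp add: case_prod_beta')
  qed simp
  also have "\<dots> = (\<integral>\<^sup>+p. ennreal (Re (k (fst p) (fst p) * k (snd p) (snd p) - k (fst p) (snd p) * k (snd p) (fst p))) * indicator (D \<times> D') p \<partial>(lborel \<Otimes>\<^sub>M lborel))"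
    by (intro nn_integral_cong) (auto simp: q_def indicator_def)
  finally show ?thesis .
qed

text \<open>
  The defining identity of a determinantal process only sees products of disjoint sets; these
  generate the Borel sets off the diagonal.
\<close>

lemma sigma_sets_off_diagonal:
  fixes E :: "('a::euclidean_space \<times> 'a) set set" and Om :: "('a \<times> 'a) set"
  defines "E \<equiv> {D \<times> D' | D D'. D \<in> sets borel \<and> D' \<in> sets borel \<and> D \<inter> D' = {}}"
    and "Om \<equiv> {p. fst p \<noteq> snd p}"
  shows "\<exists>A. A \<subseteq> E \<and> \<Union>A = Om \<and> countable A \<and> (\<forall>a\<in>A. \<exists>B B'. a = B \<times> B' \<and> bounded B \<and> bounded B' \<and> a \<in> E \<and> B \<in> sets borel \<and> B' \<in> sets borel \<and> B \<inter> B' = {})"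
    and "sets (restrict_space (borel :: ('a \<times> 'a) measure) Om) = sigma_sets Om E"
proof -
  obtain D :: "'a set" where D: "countable D" "\<And>X. open X \<Longrightarrow> X \<noteq> {} \<Longrightarrow> \<exists>d\<in>D. d \<in> X"
    using countable_dense_exists[where 'a='a] by blast
  \<comment> \<open>Balls around the points of a countable dense set: products of disjoint ones are
    countably many bounded rectangles covering the complement of the diagonal, the exhaustion that
    the uniqueness theorem for measures asks for.\<close>
  define Bs where "Bs = (\<lambda>(d, n). ball d (1 / real (Suc n))) ` (D \<times> (UNIV :: nat set))"
  have Bs: "countable Bs" unfolding Bs_def using D(1) by auto
  have BsB: "B \<in> sets borel" "bounded B" if "B \<in> Bs" for B using that by (auto simp: Bs_def)
  define A where "A = {B \<times> B' | B B'. B \<in> Bs \<and> B' \<in> Bs \<and> B \<inter> B' = {}}"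
  have "A \<subseteq> (\<lambda>(B, B'). B \<times> B') ` (Bs \<times> Bs)" by (auto simp: A_def)
  then have Ac: "countable A" using Bs by (meson countable_SIGMA countable_image countable_subset)
  have AE: "A \<subseteq> E" unfolding A_def E_def using BsB by blast
  have AU: "\<Union>A = Om"
  proof (intro equalityI subsetI)
    fix p assume "p \<in> Om"
    then obtain x y where p: "p = (x, y)" "x \<noteq> y" by (cases p) (auto simp: Om_def)
    \<comment> \<open>A quarter of the distance: if the two balls met in \<open>z\<close>, the path
      from \<open>x\<close> through \<open>d\<close>, \<open>z\<close> and \<open>d'\<close> to
      \<open>y\<close> would have four legs shorter than the radius and would be shorter than
      \<open>dist x y\<close>.\<close>
    then have "0 < dist x y / 4" by simp
    then obtain n where n: "1 / real (Suc n) < dist x y / 4" using nat_approx_posE by blast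
    have "\<exists>d\<in>D. z \<in> ball d (1 / real (Suc n))" for z
    proof -
      have "ball z (1 / real (Suc n)) \<noteq> {}" by simp
      then obtain d where "d \<in> D" "d \<in> ball z (1 / real (Suc n))" using D(2)[OF open_ball] by blast
      then show ?thesis by (auto simp: dist_commute)
    qed
    then obtain d d' where d: "d \<in> D" "x \<in> ball d (1 / real (Suc n))" "d' \<in> D" "y \<in> ball d' (1 / real (Suc n))" by blast
    have "ball d (1 / real (Suc n)) \<inter> ball d' (1 / real (Suc n)) = {}"
    proof (rule ccontr)
      assume "ball d (1 / real (Suc n)) \<inter> ball d' (1 / real (Suc n)) \<noteq> {}"
      then obtain z where z: "dist d z < 1 / real (Suc n)" "dist d' z < 1 / real (Suc n)" by auto
      have "dist x y \<le> dist x d + dist d z + dist z d' + dist d' y"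
        by (meson add_le_cancel_right dist_triangle order_trans)
      with z d n show False by (simp add: dist_commute)
    qed
    then have "ball d (1 / real (Suc n)) \<times> ball d' (1 / real (Suc n)) \<in> A"
      using d unfolding A_def Bs_def by blast
    then show "p \<in> \<Union>A" using d p by blast
  next
    fix p assume "p \<in> \<Union>A" then show "p \<in> Om" by (auto simp: A_def Om_def)
  qed
  have rect: "\<exists>B B'. a = B \<times> B' \<and> bounded B \<and> bounded B' \<and> a \<in> E \<and> B \<in> sets borel \<and> B' \<in> sets borel \<and> B \<inter> B' = {}" if "a \<in> A" for a
  proof -
    from that obtain B B' where B: "a = B \<times> B'" "B \<in> Bs" "B' \<in> Bs" "B \<inter> B' = {}" unfolding A_def by blast
    have "a \<in> E" using AE that by blast
    then show ?thesis using B BsB by (intro exI[of _ B] exI[of _ B'] conjI) simp_all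
  qed
  let ?R = "{a \<times> b | a b. a \<in> sets (borel :: 'a measure) \<and> b \<in> sets (borel :: 'a measure)}"
  have EOm: "E \<subseteq> Pow Om" by (auto simp: E_def Om_def)
  have gen: "sets (borel :: ('a \<times> 'a) measure) = sigma_sets UNIV ?R"
    by (simp only: borel_prod[symmetric] sets_pair_measure space_borel UNIV_Times_UNIV)
  then have "sets (restrict_space (borel :: ('a \<times> 'a) measure) Om) = (\<inter>) Om ` sigma_sets UNIV ?R"
    by (simp add: sets_restrict_space)
  also have "\<dots> = sigma_sets Om ((\<inter>) Om ` ?R)"
  proof (rule sigma_sets_Int)
    have "open Om" unfolding Om_def by (intro open_Collect_neq continuous_intros)
    then show "Om \<in> sigma_sets UNIV ?R" unfolding gen[symmetric] by simp
  qed simp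
  also have "\<dots> = sigma_sets Om E"
  proof (rule sigma_sets_eqI)
    fix a assume "a \<in> (\<inter>) Om ` ?R"
    then obtain u v where uv: "a = Om \<inter> (u \<times> v)" "u \<in> sets borel" "v \<in> sets borel" by auto
    have "a = (\<Union>c\<in>A. c \<inter> (u \<times> v))" using uv AU by auto
    moreover have "(\<Union>c\<in>A. c \<inter> (u \<times> v)) \<in> sigma_sets Om E"
    proof (rule sigma_sets_UNION)
      show "countable ((\<lambda>c. c \<inter> (u \<times> v)) ` A)" using Ac by simp
      fix b assume "b \<in> (\<lambda>c. c \<inter> (u \<times> v)) ` A"
      then obtain B B' where "B \<in> Bs" "B' \<in> Bs" "B \<inter> B' = {}" "b = (B \<inter> u) \<times> (B' \<inter> v)"
        by (auto simp: A_def)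
      then have "b \<in> E" using BsB uv unfolding E_def by blast
      then show "b \<in> sigma_sets Om E" by (rule sigma_sets.Basic)
    qed
    ultimately show "a \<in> sigma_sets Om E" by simp
  next
    fix a assume "a \<in> E"
    then have "a = Om \<inter> a" "a \<in> ?R" using EOm unfolding E_def by blast+
    then have "a \<in> (\<inter>) Om ` ?R" by (rule image_eqI)
    then show "a \<in> sigma_sets Om ((\<inter>) Om ` ?R)" by (rule sigma_sets.Basic)
  qed
  finally show "sets (restrict_space (borel :: ('a \<times> 'a) measure) Om) = sigma_sets Om E" .
  show "\<exists>A. A \<subseteq> E \<and> \<Union>A = Om \<and> countable A \<and> (\<forall>a\<in>A. \<exists>B B'. a = B \<times> B' \<and> bounded B \<and> bounded B' \<and> a \<in> E \<and> B \<in> sets borel \<and> B' \<in> sets borel \<and> B \<inter> B' = {})"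
    by (intro exI[of _ A] conjI ballI AE AU Ac rect)
qed

section \<open>Second moments of sums over the points\<close>

lemma nn_integral_lborel_reflect:
  fixes f :: "'a::euclidean_space \<Rightarrow> ennreal"
  assumes [measurable]: "f \<in> borel_measurable borel"
  shows "(\<integral>\<^sup>+y. f (x - y) \<partial>lborel) = (\<integral>\<^sup>+y. f y \<partial>lborel)" "(\<integral>\<^sup>+y. f (y - x) \<partial>lborel) = (\<integral>\<^sup>+y. f y \<partial>lborel)"
proof -
  have t: "(\<integral>\<^sup>+y. h (c + y) \<partial>lborel) = (\<integral>\<^sup>+y. h y \<partial>lborel)" if [measurable]: "h \<in> borel_measurable borel" for h :: "'a \<Rightarrow> ennreal" and c
  proof -
    have "(\<integral>\<^sup>+y. h y \<partial>lborel) = (\<integral>\<^sup>+y. h y \<partial>distr lborel borel ((+) c))" by (simp add: lborel_distr_plus)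
    also have "\<dots> = (\<integral>\<^sup>+y. h (c + y) \<partial>lborel)" by (subst nn_integral_distr) auto
    finally show ?thesis by simp
  qed
  have u: "(\<integral>\<^sup>+y. h (- y) \<partial>lborel) = (\<integral>\<^sup>+y. h y \<partial>lborel)" if [measurable]: "h \<in> borel_measurable borel" for h :: "'a \<Rightarrow> ennreal"
  proof -
    have "(\<integral>\<^sup>+y. h y \<partial>lborel) = (\<integral>\<^sup>+y. h y \<partial>density (distr lborel borel (\<lambda>x. 0 + (-1) *\<^sub>R x)) (\<lambda>_. ennreal (\<bar>-1\<bar> ^ DIM('a))))"
      by (subst lborel_affine[of "-1" 0]) simp_all
    also have "\<dots> = (\<integral>\<^sup>+y. h (- y) \<partial>lborel)" by (simp add: nn_integral_density nn_integral_distr)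
    finally show ?thesis by simp
  qed
  show "(\<integral>\<^sup>+y. f (x - y) \<partial>lborel) = (\<integral>\<^sup>+y. f y \<partial>lborel)"
    using u[of "\<lambda>z. f (x + z)"] t[of f x] by simp
  show "(\<integral>\<^sup>+y. f (y - x) \<partial>lborel) = (\<integral>\<^sup>+y. f y \<partial>lborel)"
    using t[of f "- x"] by simp
qed

text \<open>Correlation functions speak of pairs of distinct points, so the diagonal terms are
  separated; they form a sum over single points.\<close>

lemma nn_integral_count_space_square:
  fixes a :: "nat \<Rightarrow> ennreal"
  shows "(\<integral>\<^sup>+n. a n \<partial>count_space UNIV)\<^sup>2 = (\<integral>\<^sup>+n. (a n)\<^sup>2 \<partial>count_space UNIV) +
    (\<integral>\<^sup>+p. (if fst p \<noteq> snd p then a (fst p) * a (snd p) else 0) \<partial>count_space (UNIV :: (nat \<times> nat) set))"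
proof -
  have single: "(\<integral>\<^sup>+m. (if n = m then a n * a m else 0) \<partial>count_space UNIV) = (a n)\<^sup>2" for n
    by (subst nn_integral_count_space'[of "{n}"]) (auto simp: power2_eq_square)
  have "(\<integral>\<^sup>+n. a n \<partial>count_space UNIV)\<^sup>2 = (\<integral>\<^sup>+n. (\<integral>\<^sup>+m. a n * a m \<partial>count_space UNIV) \<partial>count_space UNIV)"
    by (simp add: power2_eq_square nn_integral_cmult nn_integral_multc)
  also have "\<dots> = (\<integral>\<^sup>+n. (\<integral>\<^sup>+m. (if n = m then a n * a m else 0) + (if n \<noteq> m then a n * a m else 0) \<partial>count_space UNIV) \<partial>count_space UNIV)"
    by (intro nn_integral_cong) auto
  also have "\<dots> = (\<integral>\<^sup>+n. (a n)\<^sup>2 \<partial>count_space UNIV) + (\<integral>\<^sup>+n. (\<integral>\<^sup>+m. (if n \<noteq> m then a n * a m else 0) \<partial>count_space UNIV) \<partial>count_space UNIV)"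
    by (simp add: nn_integral_add single)
  also have "(\<integral>\<^sup>+n. (\<integral>\<^sup>+m. (if n \<noteq> m then a n * a m else 0) \<partial>count_space UNIV) \<partial>count_space UNIV) =
    (\<integral>\<^sup>+p. (if fst p \<noteq> snd p then a (fst p) * a (snd p) else 0) \<partial>count_space (UNIV :: (nat \<times> nat) set))"
    by (subst nn_integral_fst_count_space[symmetric]) (simp cong: if_cong)
  finally show ?thesis .
qed

lemma num_points_eq: "num_points S D = (\<integral>\<^sup>+x. indicator D x \<partial>count_space S)"
proof -
  have "(\<integral>\<^sup>+x. indicator D x \<partial>count_space S) = (\<integral>\<^sup>+x. indicator (S \<inter> D) x \<partial>count_space UNIV)"
    by (subst nn_integral_count_space_indicator, simp, rule nn_integral_cong) (auto split: split_indicator)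
  also have "\<dots> = emeasure (count_space UNIV) (S \<inter> D)" by (rule nn_integral_indicator) simp
  finally show ?thesis unfolding num_points_def ..
qed

text \<open>Sums over the random set are written as sums over indices restricted to
  \<open>enat n < N w\<close>, because the marks are attached to indices. Injectivity of the
  enumeration makes the two sums equal and lets distinct indices stand for distinct points.\<close>

locale enumerated_dpp = prob_space M for M :: "'w measure" +
  fixes \<xi> :: "'w \<Rightarrow> 'a::euclidean_space set" and k :: "'a \<Rightarrow> complex"
    and N :: "'w \<Rightarrow> enat" and X :: "nat \<Rightarrow> 'w \<Rightarrow> 'a"
  assumes dpp: "determinantal_pp M \<xi> (\<lambda>x y. k (x - y))"
    and k_square: "integrable lborel (\<lambda>x. (cmod (k x))\<^sup>2)"
    and N[measurable]: "N \<in> measurable M (count_space UNIV)"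
    and X[measurable]: "\<And>n. X n \<in> borel_measurable M"
    and inj: "\<And>w. w \<in> space M \<Longrightarrow> inj_on (\<lambda>n. X n w) {n. enat n < N w}"
    and range: "\<And>w. w \<in> space M \<Longrightarrow> \<xi> w = (\<lambda>n. X n w) ` {n. enat n < N w}"
begin

definition alive :: "nat \<Rightarrow> 'w \<Rightarrow> bool" where "alive n w \<longleftrightarrow> enat n < N w"

definition intensity :: real where "intensity = Re (k 0)"

definition kernel_energy :: real where "kernel_energy = (LINT x|lborel. (cmod (k x))\<^sup>2)"

lemma pred_alive[measurable]: "Measurable.pred M (alive n)"
  unfolding alive_def[abs_def] by measurable

lemma k_measurable[measurable]: "k \<in> borel_measurable borel"
proof -
  have "case_prod (\<lambda>x y. k (x - y)) \<in> borel_measurable (lborel \<Otimes>\<^sub>M lborel)"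
    using dpp by (simp add: determinantal_pp_def)
  from measurable_kernel_compose[OF this, of "\<lambda>x. x" borel "\<lambda>x. 0"] show ?thesis by simp
qed

lemma nn_integral_k_square: "(\<integral>\<^sup>+x. ennreal ((cmod (k x))\<^sup>2) \<partial>lborel) = ennreal kernel_energy"
  unfolding kernel_energy_def using k_square by (intro nn_integral_eq_integral) auto

lemma kernel_energy_nonneg: "0 \<le> kernel_energy"
  unfolding kernel_energy_def by (intro integral_nonneg_AE) auto

text \<open>The definition gives nonnegativity of the first correlation function almost everywhere.
  That function is constant, and the whole space is not a null set.\<close>

lemma intensity_nonneg: "0 \<le> intensity"
proof (rule ccontr)
  assume neg: "\<not> 0 \<le> intensity"
  interpret finite_product_sigma_finite "\<lambda>_::nat. lborel :: 'a measure" "{..<1}" by standard simp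
  have "AE x in (\<Pi>\<^sub>M i\<in>{..<1}. lborel). corr_det (\<lambda>x y. k (x - y)) 1 x \<in> \<real>\<^sub>\<ge>\<^sub>0"
    by (rule dpp[unfolded determinantal_pp_def, THEN conjunct2, THEN conjunct2, THEN spec, THEN mp, OF order.refl, THEN conjunct1])
  then have "AE x in (\<Pi>\<^sub>M i\<in>{..<1::nat}. lborel :: 'a measure). False"
    using neg unfolding corr_det_1 by (simp add: intensity_def complex_nonneg_Reals_iff)
  then have "emeasure (\<Pi>\<^sub>M i\<in>{..<1::nat}. lborel :: 'a measure) (\<Pi>\<^sub>E i\<in>{..<1}. UNIV) = 0"
    by (simp add: AE_iff_null null_sets_def space_PiM)
  moreover have "emeasure (\<Pi>\<^sub>M i\<in>{..<1::nat}. lborel :: 'a measure) (\<Pi>\<^sub>E i\<in>{..<1}. UNIV) = (\<Prod>i<1::nat. emeasure (lborel :: 'a measure) UNIV)"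
    by (intro measure_times) simp
  ultimately show False by simp
qed

lemma nn_integral_points:
  assumes "w \<in> space M"
  shows "(\<integral>\<^sup>+x. h x \<partial>count_space (\<xi> w)) = (\<integral>\<^sup>+n. of_bool (alive n w) * h (X n w) \<partial>count_space UNIV)"
  unfolding range[OF assms] nn_integral_count_space_image[OF inj[OF assms]]
  by (intro nn_integral_cong) (auto simp: alive_def indicator_def)

text \<open>The defining identity for a single set says that the intensity measure of the points and
  \<open>intensity\<close> times Lebesgue measure agree on every Borel set.\<close>

lemma campbell:
  assumes [measurable]: "h \<in> borel_measurable borel"
  shows "(\<integral>\<^sup>+w. (\<integral>\<^sup>+n. of_bool (alive n w) * h (X n w) \<partial>count_space UNIV) \<partial>M) = ennreal intensity * (\<integral>\<^sup>+x. h x \<partial>lborel)"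
proof -
  let ?L = "count_intensity M (\<lambda>n w. of_bool (alive n w)) X borel"
  have ci: "(\<integral>\<^sup>+z. f z \<partial>?L) = (\<integral>\<^sup>+w. (\<integral>\<^sup>+n. of_bool (alive n w) * f (X n w) \<partial>count_space UNIV) \<partial>M)"
    if [measurable]: "f \<in> borel_measurable borel" for f :: "'a \<Rightarrow> ennreal"
    by (rule nn_integral_count_intensity) (auto intro: sigma_finite_measure_axioms)
  have "?L = density lborel (\<lambda>_. ennreal intensity)"
  proof (rule measure_eqI)
    show s: "sets ?L = sets (density lborel (\<lambda>_. ennreal intensity))" by (simp add: count_intensity_def)
    fix D assume "D \<in> sets ?L"
    then have [measurable]: "D \<in> sets borel" by (simp add: count_intensity_def)
    have "emeasure ?L D = (\<integral>\<^sup>+z. indicator D z \<partial>?L)" by (simp add: count_intensity_def)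
    also have "\<dots> = (\<integral>\<^sup>+w. num_points (\<xi> w) D \<partial>M)"
      by (subst ci) (auto intro!: nn_integral_cong simp: num_points_eq nn_integral_points)
    also have "\<dots> = (\<integral>\<^sup>+x. ennreal intensity * indicator D x \<partial>lborel)"
      using determinantal_pp_1[OF dpp \<open>D \<in> sets borel\<close>] by (simp add: intensity_def)
    also have "\<dots> = emeasure (density lborel (\<lambda>_. ennreal intensity)) D"
      by (subst emeasure_density) auto
    finally show "emeasure ?L D = emeasure (density lborel (\<lambda>_. ennreal intensity)) D" .
  qed
  then have "(\<integral>\<^sup>+w. (\<integral>\<^sup>+n. of_bool (alive n w) * h (X n w) \<partial>count_space UNIV) \<partial>M) = (\<integral>\<^sup>+z. h z \<partial>density lborel (\<lambda>_. ennreal intensity))"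
    using ci[of h] by simp
  also have "\<dots> = ennreal intensity * (\<integral>\<^sup>+x. h x \<partial>lborel)"
    by (subst nn_integral_density) (auto simp: nn_integral_cmult)
  finally show ?thesis .
qed

definition pair_density :: "'a \<times> 'a \<Rightarrow> ennreal" where
  "pair_density p = ennreal (Re (k 0 * k 0 - k (fst p - snd p) * k (snd p - fst p)))"

lemma pair_density_measurable[measurable]: "pair_density \<in> borel_measurable borel"
proof -
  have "pair_density \<in> borel_measurable (borel \<Otimes>\<^sub>M borel)" unfolding pair_density_def by measurable
  then show ?thesis by (simp add: borel_prod)
qed

lemma pair_density_bound:
  fixes h h' :: "'a \<Rightarrow> real"
  assumes [measurable]: "h \<in> borel_measurable borel" "h' \<in> borel_measurable borel"
    and h: "\<And>x. 0 \<le> h x" "\<And>x. 0 \<le> h' x"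
  shows "(\<integral>\<^sup>+p. ennreal (h (fst p)) * ennreal (h' (snd p)) * pair_density p \<partial>lborel) \<le>
    ennreal (intensity\<^sup>2) * (\<integral>\<^sup>+x. ennreal (h x) \<partial>lborel) * (\<integral>\<^sup>+x. ennreal (h' x) \<partial>lborel) +
    ennreal (kernel_energy / 2) * ((\<integral>\<^sup>+x. ennreal ((h x)\<^sup>2) \<partial>lborel) + (\<integral>\<^sup>+x. ennreal ((h' x)\<^sup>2) \<partial>lborel))"
proof -
  define E where "E = (\<integral>\<^sup>+x. ennreal ((cmod (k x))\<^sup>2) \<partial>lborel)"
  have [measurable]: "(\<lambda>x. ennreal ((cmod (k x))\<^sup>2)) \<in> borel_measurable borel" by measurable
  let ?k = "\<lambda>x. ennreal ((cmod (k x))\<^sup>2)"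
  let ?H = "\<integral>\<^sup>+x. ennreal ((h x)\<^sup>2) \<partial>lborel" and ?H' = "\<integral>\<^sup>+x. ennreal ((h' x)\<^sup>2) \<partial>lborel"
  have pt: "ennreal (h x) * ennreal (h' y) * pair_density (x, y) \<le>
    ennreal (intensity\<^sup>2) * (ennreal (h x) * ennreal (h' y)) +
    ennreal (1/4) * (ennreal ((h x)\<^sup>2) * ?k (x - y) + ennreal ((h x)\<^sup>2) * ?k (y - x) +
      (ennreal ((h' y)\<^sup>2) * ?k (x - y) + ennreal ((h' y)\<^sup>2) * ?k (y - x)))" for x y
  proof -
    let ?u = "cmod (k (x - y))" and ?v = "cmod (k (y - x))"
    have "Re (k 0 * k 0) \<le> intensity\<^sup>2" by (simp add: intensity_def power2_eq_square)
    moreover have "- Re (k (x - y) * k (y - x)) \<le> ?u * ?v"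
      using abs_Re_le_cmod[of "k (x - y) * k (y - x)"] by (simp add: norm_mult)
    moreover have "?u * ?v \<le> (?u\<^sup>2 + ?v\<^sup>2) / 2" using sum_squares_bound[of ?u ?v] by simp
    ultimately have r: "Re (k 0 * k 0 - k (x - y) * k (y - x)) \<le> intensity\<^sup>2 + (?u\<^sup>2 + ?v\<^sup>2) / 2"
      unfolding minus_complex.sel by linarith
    have hh: "h x * h' y \<le> ((h x)\<^sup>2 + (h' y)\<^sup>2) / 2" using sum_squares_bound[of "h x" "h' y"] by simp
    have "h x * h' y * Re (k 0 * k 0 - k (x - y) * k (y - x)) \<le> h x * h' y * (intensity\<^sup>2 + (?u\<^sup>2 + ?v\<^sup>2) / 2)"
      using h by (intro mult_left_mono r) auto
    also have "\<dots> = intensity\<^sup>2 * (h x * h' y) + h x * h' y * ((?u\<^sup>2 + ?v\<^sup>2) / 2)" by (simp add: algebra_simps)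
    also have "\<dots> \<le> intensity\<^sup>2 * (h x * h' y) + ((h x)\<^sup>2 + (h' y)\<^sup>2) / 2 * ((?u\<^sup>2 + ?v\<^sup>2) / 2)"
      by (intro add_left_mono mult_right_mono hh) auto
    also have "\<dots> = intensity\<^sup>2 * (h x * h' y) + 1/4 * ((h x)\<^sup>2 * ?u\<^sup>2 + (h x)\<^sup>2 * ?v\<^sup>2 + ((h' y)\<^sup>2 * ?u\<^sup>2 + (h' y)\<^sup>2 * ?v\<^sup>2))"
      by (simp add: algebra_simps add_divide_distrib)
    finally have "ennreal (h x * h' y * Re (k 0 * k 0 - k (x - y) * k (y - x))) \<le>
      ennreal (intensity\<^sup>2 * (h x * h' y) + 1/4 * ((h x)\<^sup>2 * ?u\<^sup>2 + (h x)\<^sup>2 * ?v\<^sup>2 + ((h' y)\<^sup>2 * ?u\<^sup>2 + (h' y)\<^sup>2 * ?v\<^sup>2)))"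
      by (rule ennreal_leI)
    moreover have "ennreal (h x * h' y * Re (k 0 * k 0 - k (x - y) * k (y - x))) = ennreal (h x) * ennreal (h' y) * pair_density (x, y)"
      unfolding pair_density_def fst_conv snd_conv using h by (simp only: ennreal_mult' mult_nonneg_nonneg)
    moreover have "ennreal (i * (p * q) + 1/4 * (a * u + a * v + (b * u + b * v))) = ennreal i * (ennreal p * ennreal q) +
        ennreal (1/4) * (ennreal a * ennreal u + ennreal a * ennreal v + (ennreal b * ennreal u + ennreal b * ennreal v))"
      if "0 \<le> i" "0 \<le> p" "0 \<le> q" "0 \<le> a" "0 \<le> b" "0 \<le> u" "0 \<le> v" for i p q a b u v :: real
      using that by (simp add: ennreal_mult[symmetric] ennreal_plus[symmetric] del: ennreal_plus)
    ultimately show ?thesis using h by simp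
  qed
  have "(\<integral>\<^sup>+p. ennreal (h (fst p)) * ennreal (h' (snd p)) * pair_density p \<partial>lborel) =
    (\<integral>\<^sup>+p. ennreal (h (fst p)) * ennreal (h' (snd p)) * pair_density p \<partial>(lborel \<Otimes>\<^sub>M lborel))"
    by (simp add: lborel_prod)
  also have "\<dots> = (\<integral>\<^sup>+x. (\<integral>\<^sup>+y. ennreal (h x) * ennreal (h' y) * pair_density (x, y) \<partial>lborel) \<partial>lborel)"
  proof (subst lborel.nn_integral_fst[symmetric])
    have "pair_density \<in> borel_measurable (borel \<Otimes>\<^sub>M borel)" by (simp add: borel_prod)
    then show "(\<lambda>p. ennreal (h (fst p)) * ennreal (h' (snd p)) * pair_density p) \<in> borel_measurable (lborel \<Otimes>\<^sub>M lborel)" by simp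
  qed simp
  also have "\<dots> \<le> (\<integral>\<^sup>+x. (\<integral>\<^sup>+y. ennreal (intensity\<^sup>2) * (ennreal (h x) * ennreal (h' y)) +
    ennreal (1/4) * (ennreal ((h x)\<^sup>2) * ?k (x - y) + ennreal ((h x)\<^sup>2) * ?k (y - x) +
      (ennreal ((h' y)\<^sup>2) * ?k (x - y) + ennreal ((h' y)\<^sup>2) * ?k (y - x))) \<partial>lborel) \<partial>lborel)"
    by (intro nn_integral_mono pt)
  also have "\<dots> = ennreal (intensity\<^sup>2) * ((\<integral>\<^sup>+x. ennreal (h x) \<partial>lborel) * (\<integral>\<^sup>+x. ennreal (h' x) \<partial>lborel)) +
    ennreal (1/4) * (?H * E + ?H * E + (?H' * E + ?H' * E))"
  proof -
    have 1: "(\<integral>\<^sup>+x. (\<integral>\<^sup>+y. ennreal (h x) * ennreal (h' y) \<partial>lborel) \<partial>lborel) = (\<integral>\<^sup>+x. ennreal (h x) \<partial>lborel) * (\<integral>\<^sup>+x. ennreal (h' x) \<partial>lborel)"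
      by (simp add: nn_integral_cmult nn_integral_multc)
    have 2: "(\<integral>\<^sup>+x. (\<integral>\<^sup>+y. ennreal ((h x)\<^sup>2) * ?k (x - y) \<partial>lborel) \<partial>lborel) = ?H * E"
      by (simp add: nn_integral_cmult nn_integral_multc nn_integral_lborel_reflect[of ?k] E_def)
    have 3: "(\<integral>\<^sup>+x. (\<integral>\<^sup>+y. ennreal ((h x)\<^sup>2) * ?k (y - x) \<partial>lborel) \<partial>lborel) = ?H * E"
      by (simp add: nn_integral_cmult nn_integral_multc nn_integral_lborel_reflect[of ?k] E_def)
    have 4: "(\<integral>\<^sup>+x. (\<integral>\<^sup>+y. ennreal ((h' y)\<^sup>2) * ?k (x - y) \<partial>lborel) \<partial>lborel) = ?H' * E"
      by (subst lborel_pair.Fubini', measurable)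
        (simp add: nn_integral_cmult nn_integral_multc nn_integral_lborel_reflect[of ?k] E_def)
    have 5: "(\<integral>\<^sup>+x. (\<integral>\<^sup>+y. ennreal ((h' y)\<^sup>2) * ?k (y - x) \<partial>lborel) \<partial>lborel) = ?H' * E"
      by (subst lborel_pair.Fubini', measurable)
        (simp add: nn_integral_cmult nn_integral_multc nn_integral_lborel_reflect[of ?k] E_def)
    have [measurable]: "(\<lambda>x. \<integral>\<^sup>+y. f x y \<partial>lborel) \<in> borel_measurable borel" if "case_prod f \<in> borel_measurable (borel \<Otimes>\<^sub>M borel)" for f :: "'a \<Rightarrow> 'a \<Rightarrow> ennreal"
      using lborel.borel_measurable_nn_integral[of f lborel] that by simp
    have 6: "(\<integral>\<^sup>+x. ennreal (h x) * (\<integral>\<^sup>+y. ennreal (h' y) \<partial>lborel) \<partial>lborel) = (\<integral>\<^sup>+x. ennreal (h x) \<partial>lborel) * (\<integral>\<^sup>+x. ennreal (h' x) \<partial>lborel)"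
      by (simp add: nn_integral_multc)
    have 7: "(\<integral>\<^sup>+x. ennreal ((h x)\<^sup>2) * (\<integral>\<^sup>+y. ?k (x - y) \<partial>lborel) \<partial>lborel) = ?H * E"
      by (simp add: nn_integral_multc nn_integral_lborel_reflect[of ?k] E_def)
    have 8: "(\<integral>\<^sup>+x. ennreal ((h x)\<^sup>2) * (\<integral>\<^sup>+y. ?k (y - x) \<partial>lborel) \<partial>lborel) = ?H * E"
      by (simp add: nn_integral_multc nn_integral_lborel_reflect[of ?k] E_def)
    show ?thesis
      by (simp add: nn_integral_add nn_integral_cmult 1 2 3 4 5 6 7 8)
  qed
  also have "ennreal (1/4) * (?H * E + ?H * E + (?H' * E + ?H' * E)) = ennreal (1/4) * (ennreal 2 * (E * (?H + ?H')))"
    by (simp add: mult_2 algebra_simps)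
  also have "\<dots> = ennreal (kernel_energy / 2) * (?H + ?H')"
  proof -
    have "ennreal (1/4 * 2 * kernel_energy) = ennreal (1/4) * ennreal 2 * ennreal kernel_energy"
      using kernel_energy_nonneg by (simp only: ennreal_mult mult_nonneg_nonneg zero_le_divide_1_iff zero_le_numeral)
    then have "ennreal (1/4) * ennreal 2 * ennreal kernel_energy = ennreal (kernel_energy / 2)" by simp
    then show ?thesis unfolding E_def nn_integral_k_square by (simp only: mult.assoc[symmetric])
  qed
  finally show ?thesis by (simp add: mult.assoc)
qed

text \<open>Two measures on pairs of points, one counting pairs of distinct indices and one with
  density \<open>pair_density\<close>, agree on products of disjoint sets, hence off the diagonal.
  Distinct indices never produce a pair on the diagonal, by injectivity; adding the diagonal on the
  right-hand side gives the inequality.\<close>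

lemma second_moment_off_diagonal:
  assumes [measurable]: "H \<in> borel_measurable borel"
  shows "(\<integral>\<^sup>+w. (\<integral>\<^sup>+p. (if fst p \<noteq> snd p then of_bool (alive (fst p) w) * of_bool (alive (snd p) w) else 0) * H (X (fst p) w, X (snd p) w)
      \<partial>count_space UNIV) \<partial>M) \<le> (\<integral>\<^sup>+z. H z * pair_density z \<partial>lborel)"
proof -
  define c :: "nat \<times> nat \<Rightarrow> 'w \<Rightarrow> ennreal" where
    "c p w = (if fst p \<noteq> snd p then of_bool (alive (fst p) w) * of_bool (alive (snd p) w) else 0)" for p w
  define Z where "Z p w = (X (fst p) w, X (snd p) w)" for p w
  have cm[measurable]: "c p \<in> borel_measurable M" for p unfolding c_def by measurable
  have Zm[measurable]: "Z p \<in> borel_measurable M" for p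
    unfolding Z_def borel_prod[symmetric] by measurable
  let ?L = "count_intensity M c Z borel" and ?N = "density (lborel :: ('a \<times> 'a) measure) pair_density"
  have ci: "(\<integral>\<^sup>+z. f z \<partial>?L) = (\<integral>\<^sup>+w. (\<integral>\<^sup>+p. c p w * f (Z p w) \<partial>count_space UNIV) \<partial>M)"
    if "f \<in> borel_measurable borel" for f :: "'a \<times> 'a \<Rightarrow> ennreal"
    by (rule nn_integral_count_intensity[OF sigma_finite_measure_axioms cm Zm that])
  have sL: "sets ?L = sets borel" by (simp add: count_intensity_def)
  define E where "E = {D \<times> D' | D D'. D \<in> sets (borel :: 'a measure) \<and> D' \<in> sets (borel :: 'a measure) \<and> D \<inter> D' = {}}"
  define Om where "Om = {p :: 'a \<times> 'a. fst p \<noteq> snd p}"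
  have Om[measurable]: "Om \<in> sets borel" unfolding Om_def by (intro borel_open open_Collect_neq continuous_intros)
  have rect: "emeasure ?L (D \<times> D') = emeasure ?N (D \<times> D')"
    if D: "D \<in> sets borel" "D' \<in> sets borel" "D \<inter> D' = {}" for D D'
  proof -
    have [measurable]: "D \<times> D' \<in> sets borel" using D(1,2) by (auto simp: borel_prod[symmetric])
    have "emeasure ?L (D \<times> D') = (\<integral>\<^sup>+z. indicator (D \<times> D') z \<partial>?L)" using sL by simp
    also have "\<dots> = (\<integral>\<^sup>+w. (\<integral>\<^sup>+p. c p w * indicator (D \<times> D') (Z p w) \<partial>count_space UNIV) \<partial>M)"
      by (rule ci) simp
    also have "\<dots> = (\<integral>\<^sup>+w. num_points (\<xi> w) D * num_points (\<xi> w) D' \<partial>M)"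
    proof (rule nn_integral_cong)
      fix w assume w: "w \<in> space M"
      let ?a = "\<lambda>n. of_bool (alive n w) * indicator D (X n w) :: ennreal"
      let ?b = "\<lambda>n. of_bool (alive n w) * indicator D' (X n w) :: ennreal"
      have "num_points (\<xi> w) D * num_points (\<xi> w) D' = (\<integral>\<^sup>+n. ?a n \<partial>count_space UNIV) * (\<integral>\<^sup>+n. ?b n \<partial>count_space UNIV)"
        by (simp add: num_points_eq nn_integral_points[OF w])
      also have "\<dots> = (\<integral>\<^sup>+n. (\<integral>\<^sup>+m. ?a n * ?b m \<partial>count_space UNIV) \<partial>count_space UNIV)"
        by (simp add: nn_integral_cmult nn_integral_multc)
      also have "\<dots> = (\<integral>\<^sup>+p. ?a (fst p) * ?b (snd p) \<partial>count_space UNIV)"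
        by (subst nn_integral_fst_count_space[symmetric]) simp
      also have "\<dots> = (\<integral>\<^sup>+p. c p w * indicator (D \<times> D') (Z p w) \<partial>count_space UNIV)"
        using D(3) by (intro nn_integral_cong) (auto simp: c_def Z_def indicator_def)
      finally show "(\<integral>\<^sup>+p. c p w * indicator (D \<times> D') (Z p w) \<partial>count_space UNIV) = num_points (\<xi> w) D * num_points (\<xi> w) D'" ..
    qed
    also have "\<dots> = emeasure ?N (D \<times> D')"
      unfolding determinantal_pp_2[OF dpp D] by (subst emeasure_density) (simp_all add: lborel_prod pair_density_def)
    finally show ?thesis .
  qed
  \<comment> \<open>Finiteness on bounded rectangles, required for the uniqueness of measures, is
    the bound on \<open>pair_density\<close> applied to indicator functions.\<close>
  have fin: "emeasure ?N (B \<times> B') \<noteq> \<infinity>" if B[measurable]: "B \<in> sets borel" "B' \<in> sets borel" and bd: "bounded B" "bounded B'" for B B' :: "'a set"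
  proof -
    have [measurable]: "B \<times> B' \<in> sets borel" using B by (auto simp: borel_prod[symmetric])
    have fB: "emeasure lborel B < \<infinity>" "emeasure lborel B' < \<infinity>" using emeasure_bounded_finite[OF bd(1)] emeasure_bounded_finite[OF bd(2)] by auto
    have "emeasure ?N (B \<times> B') = (\<integral>\<^sup>+p. ennreal (indicator B (fst p)) * ennreal (indicator B' (snd p)) * pair_density p \<partial>lborel)"
      by (subst emeasure_density) (auto intro!: nn_integral_cong simp: indicator_def)
    also have "\<dots> \<le> ennreal (intensity\<^sup>2) * (\<integral>\<^sup>+x. ennreal (indicator B x) \<partial>lborel) * (\<integral>\<^sup>+x. ennreal (indicator B' x) \<partial>lborel) +
      ennreal (kernel_energy / 2) * ((\<integral>\<^sup>+x. ennreal ((indicator B x)\<^sup>2) \<partial>lborel) + (\<integral>\<^sup>+x. ennreal ((indicator B' x)\<^sup>2) \<partial>lborel))"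
      by (rule pair_density_bound) auto
    also have "\<dots> < \<infinity>"
    proof -
      have sq: "ennreal ((indicator B x)\<^sup>2) = indicator B x" for B :: "'a set" and x by (simp add: indicator_def)
      show ?thesis using fB unfolding sq by (simp add: ennreal_indicator ennreal_mult_less_top)
    qed
    finally show ?thesis by simp
  qed
  have "\<exists>A. A \<subseteq> E \<and> \<Union>A = Om \<and> countable A \<and> (\<forall>a\<in>A. \<exists>B B'. a = B \<times> B' \<and> bounded B \<and> bounded B' \<and> a \<in> E \<and> B \<in> sets borel \<and> B' \<in> sets borel \<and> B \<inter> B' = {})"
    unfolding E_def Om_def by (rule sigma_sets_off_diagonal)
  then obtain A where A: "A \<subseteq> E" "\<Union>A = Om" "countable A" "\<And>a. a \<in> A \<Longrightarrow> \<exists>B B'. a = B \<times> B' \<and> bounded B \<and> bounded B' \<and> a \<in> E \<and> B \<in> sets borel \<and> B' \<in> sets borel \<and> B \<inter> B' = {}"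
    by blast
  have gen: "sets (restrict_space (borel :: ('a \<times> 'a) measure) Om) = sigma_sets Om E"
    unfolding E_def Om_def by (rule sigma_sets_off_diagonal)
  have EOm: "E \<subseteq> Pow Om" by (auto simp: E_def Om_def)
  have emL: "emeasure (restrict_space ?L Om) a = emeasure ?L a" "emeasure (restrict_space ?N Om) a = emeasure ?N a" if "a \<in> E" for a
    using that EOm Om sL by (auto intro!: emeasure_restrict_space)
  have "restrict_space ?L Om = restrict_space ?N Om"
  proof (rule measure_eqI_generator_eq_countable[where E=E and \<Omega>=Om and A=A])
    show "Int_stable E"
    proof (rule Int_stableI)
      fix a b assume "a \<in> E" "b \<in> E"
      then obtain D D' F F' where "a = D \<times> D'" "b = F \<times> F'" "D \<in> sets borel" "D' \<in> sets borel" "F \<in> sets borel" "F' \<in> sets borel" "D \<inter> D' = {}"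
        unfolding E_def by blast
      then have "a \<inter> b = (D \<inter> F) \<times> (D' \<inter> F')" "(D \<inter> F) \<inter> (D' \<inter> F') = {}" "D \<inter> F \<in> sets borel" "D' \<inter> F' \<in> sets borel" by auto
      then show "a \<inter> b \<in> E" unfolding E_def by blast
    qed
    show "emeasure (restrict_space ?L Om) a = emeasure (restrict_space ?N Om) a" if "a \<in> E" for a
    proof -
      from that obtain D D' where "a = D \<times> D'" "D \<in> sets borel" "D' \<in> sets borel" "D \<inter> D' = {}" unfolding E_def by blast
      then show ?thesis using emL[OF that] rect[of D D'] by simp
    qed
    show "sets (restrict_space ?L Om) = sigma_sets Om E"
      using gen by (simp add: sets_restrict_space sL)
    show "sets (restrict_space ?N Om) = sigma_sets Om E"
      using gen by (simp add: sets_restrict_space)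
    show "emeasure (restrict_space ?L Om) a \<noteq> \<infinity>" if "a \<in> A" for a
    proof -
      from A(4)[OF that] obtain B B' where B: "a = B \<times> B'" "bounded B" "bounded B'" "B \<in> sets borel" "B' \<in> sets borel" "B \<inter> B' = {}" by blast
      have "a \<in> E" using A(1) that by blast
      then show ?thesis using emL(1) rect[OF B(4,5,6)] fin[OF B(4,5,2,3)] B(1) by simp
    qed
  qed (use EOm A in auto)
  then have eq: "(\<integral>\<^sup>+z. H z \<partial>restrict_space ?L Om) = (\<integral>\<^sup>+z. H z \<partial>restrict_space ?N Om)" by simp
  have "(\<integral>\<^sup>+w. (\<integral>\<^sup>+p. c p w * H (Z p w) \<partial>count_space UNIV) \<partial>M) = (\<integral>\<^sup>+w. (\<integral>\<^sup>+p. c p w * (H (Z p w) * indicator Om (Z p w)) \<partial>count_space UNIV) \<partial>M)"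
  proof (intro nn_integral_cong)
    fix w p assume w: "w \<in> space M"
    show "c p w * H (Z p w) = c p w * (H (Z p w) * indicator Om (Z p w))"
      using inj[OF w] by (auto simp: c_def Z_def Om_def alive_def inj_on_def indicator_def)
  qed
  also have "\<dots> = (\<integral>\<^sup>+z. H z * indicator Om z \<partial>?L)" by (rule ci[symmetric]) simp
  also have "\<dots> = (\<integral>\<^sup>+z. H z \<partial>restrict_space ?L Om)"
    by (subst nn_integral_restrict_space) (auto simp: sL)
  also have "\<dots> = (\<integral>\<^sup>+z. H z * indicator Om z \<partial>?N)"
    unfolding eq by (subst nn_integral_restrict_space) auto
  also have "\<dots> \<le> (\<integral>\<^sup>+z. H z \<partial>?N)"
    by (intro nn_integral_mono) (auto simp: indicator_def)
  also have "\<dots> = (\<integral>\<^sup>+z. H z * pair_density z \<partial>lborel)"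
    by (subst nn_integral_density) (auto simp: mult.commute)
  finally show ?thesis unfolding c_def Z_def .
qed

text \<open>Equal indices contribute \<open>intensity\<close> times the integral of
  \<open>(h x)\<^sup>2\<close>, distinct ones at most the squared mean plus
  \<open>kernel_energy\<close> times that integral. The squared mean is kept apart so that it
  cancels in the variance.\<close>

lemma second_moment:
  fixes h :: "'a \<Rightarrow> real"
  assumes [measurable]: "h \<in> borel_measurable borel" and h: "\<And>x. 0 \<le> h x"
  shows "(\<integral>\<^sup>+w. (\<integral>\<^sup>+n. of_bool (alive n w) * ennreal (h (X n w)) \<partial>count_space UNIV)\<^sup>2 \<partial>M) \<le>
    (ennreal intensity * (\<integral>\<^sup>+x. ennreal (h x) \<partial>lborel))\<^sup>2 + ennreal (intensity + kernel_energy) * (\<integral>\<^sup>+x. ennreal ((h x)\<^sup>2) \<partial>lborel)"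
proof -
  let ?a = "\<lambda>n w. of_bool (alive n w) * ennreal (h (X n w))"
  let ?H = "\<integral>\<^sup>+x. ennreal ((h x)\<^sup>2) \<partial>lborel"
  have [measurable]: "(\<lambda>z. ennreal (h (fst z)) * ennreal (h (snd z))) \<in> borel_measurable (borel :: ('a \<times> 'a) measure)"
    unfolding borel_prod[symmetric] by measurable
  have "(\<integral>\<^sup>+w. (\<integral>\<^sup>+n. ?a n w \<partial>count_space UNIV)\<^sup>2 \<partial>M) =
    (\<integral>\<^sup>+w. (\<integral>\<^sup>+n. of_bool (alive n w) * ennreal ((h (X n w))\<^sup>2) \<partial>count_space UNIV) +
      (\<integral>\<^sup>+p. (if fst p \<noteq> snd p then of_bool (alive (fst p) w) * of_bool (alive (snd p) w) else 0) *
        (ennreal (h (X (fst p) w)) * ennreal (h (X (snd p) w))) \<partial>count_space UNIV) \<partial>M)"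
    unfolding nn_integral_count_space_square
    by (intro nn_integral_cong arg_cong2[where f="(+)"]) (auto simp: power_mult_distrib ennreal_power h mult_ac)
  also have "\<dots> = (\<integral>\<^sup>+w. (\<integral>\<^sup>+n. of_bool (alive n w) * ennreal ((h (X n w))\<^sup>2) \<partial>count_space UNIV) \<partial>M) +
      (\<integral>\<^sup>+w. (\<integral>\<^sup>+p. (if fst p \<noteq> snd p then of_bool (alive (fst p) w) * of_bool (alive (snd p) w) else 0) *
        (ennreal (h (X (fst p) w)) * ennreal (h (X (snd p) w))) \<partial>count_space UNIV) \<partial>M)"
    by (intro nn_integral_add borel_measurable_count_nn_integral) measurable
  also have "\<dots> \<le> ennreal intensity * ?H + (\<integral>\<^sup>+z. ennreal (h (fst z)) * ennreal (h (snd z)) * pair_density z \<partial>lborel)"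
    using second_moment_off_diagonal[of "\<lambda>z. ennreal (h (fst z)) * ennreal (h (snd z))"] campbell[of "\<lambda>x. ennreal ((h x)\<^sup>2)"]
    by (intro add_mono) simp_all
  also have "\<dots> \<le> ennreal intensity * ?H + (ennreal (intensity\<^sup>2) * (\<integral>\<^sup>+x. ennreal (h x) \<partial>lborel) * (\<integral>\<^sup>+x. ennreal (h x) \<partial>lborel) +
    ennreal (kernel_energy / 2) * (?H + ?H))"
    by (intro add_left_mono pair_density_bound h) measurable
  also have "\<dots> = (ennreal intensity * (\<integral>\<^sup>+x. ennreal (h x) \<partial>lborel))\<^sup>2 + (ennreal intensity * ?H + ennreal kernel_energy * ?H)"
  proof -
    have "ennreal (kernel_energy / 2) * (?H + ?H) = ennreal (kernel_energy / 2) * 2 * ?H" by (simp add: mult_2 algebra_simps)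
    also have "ennreal (kernel_energy / 2) * 2 = ennreal kernel_energy"
      using kernel_energy_nonneg by (simp add: ennreal_mult[symmetric] flip: ennreal_numeral)
    finally show ?thesis using intensity_nonneg by (simp add: power2_eq_square ennreal_mult mult_ac add_ac)
  qed
  also have "ennreal intensity * ?H + ennreal kernel_energy * ?H = ennreal (intensity + kernel_energy) * ?H"
    using intensity_nonneg kernel_energy_nonneg by (simp add: distrib_right)
  finally show ?thesis .
qed

text \<open>Subtracting the squared mean in \<open>second_moment\<close> bounds the variance, and
  Jensen's inequality turns this into a mean absolute deviation, the quantity needed to compare a
  Lipschitz function of the sum with its value at the mean. The sum is first handled in
  \<open>ennreal\<close>, where convergence is not an issue, and then identified with
  \<open>S\<close> almost surely.\<close>

lemma linear_statistic_deviation: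
  fixes h :: "'a \<Rightarrow> real"
  assumes h: "\<And>x. 0 \<le> h x" and int: "integrable lborel h" and int2: "integrable lborel (\<lambda>x. (h x)\<^sup>2)"
  defines "S \<equiv> \<lambda>w. LINT n|count_space UNIV. of_bool (alive n w) * h (X n w)"
  shows "AE w in M. integrable (count_space UNIV) (\<lambda>n. of_bool (alive n w) * h (X n w))"
    and "integrable M S"
    and "expectation S = intensity * integral\<^sup>L lborel h"
    and "expectation (\<lambda>w. \<bar>S w - intensity * integral\<^sup>L lborel h\<bar>) \<le> sqrt ((intensity + kernel_energy) * (LINT x|lborel. (h x)\<^sup>2))"
proof -
  have [measurable]: "h \<in> borel_measurable borel" using int by auto
  let ?N = "\<lambda>w. \<integral>\<^sup>+n. of_bool (alive n w) * ennreal (h (X n w)) \<partial>count_space UNIV"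
  let ?m = "intensity * integral\<^sup>L lborel h" and ?v = "(intensity + kernel_energy) * (LINT x|lborel. (h x)\<^sup>2)"
  have m0: "0 \<le> ?m" using intensity_nonneg h by (simp add: integral_nonneg_AE)
  have v0: "0 \<le> ?v" using intensity_nonneg kernel_energy_nonneg by (intro mult_nonneg_nonneg integral_nonneg_AE) auto
  have Nm[measurable]: "?N \<in> borel_measurable M" by (intro borel_measurable_count_nn_integral) measurable
  have Sm[measurable]: "S \<in> borel_measurable M" unfolding S_def by (intro borel_measurable_count_integral) measurable
  have hi: "(\<integral>\<^sup>+x. ennreal (h x) \<partial>lborel) = ennreal (integral\<^sup>L lborel h)"
    using int h by (intro nn_integral_eq_integral) auto
  have hi2: "(\<integral>\<^sup>+x. ennreal ((h x)\<^sup>2) \<partial>lborel) = ennreal (LINT x|lborel. (h x)\<^sup>2)"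
    using int2 by (intro nn_integral_eq_integral) auto
  have EN: "(\<integral>\<^sup>+w. ?N w \<partial>M) = ennreal ?m"
    using campbell[of "\<lambda>x. ennreal (h x)"] hi intensity_nonneg by (simp add: ennreal_mult' integral_nonneg_AE h)
  have N_eq: "?N w = (\<integral>\<^sup>+n. ennreal (of_bool (alive n w) * h (X n w)) \<partial>count_space UNIV)" for w
    by (intro nn_integral_cong) auto
  have fin: "AE w in M. ?N w \<noteq> \<infinity>" using EN by (intro nn_integral_PInf_AE) auto
  then show ae: "AE w in M. integrable (count_space UNIV) (\<lambda>n. of_bool (alive n w) * h (X n w))"
  proof eventually_elim
    fix w assume "?N w \<noteq> \<infinity>"
    then show "integrable (count_space UNIV) (\<lambda>n. of_bool (alive n w) * h (X n w))"
      unfolding N_eq using h by (intro integrableI_nonneg) (auto simp: less_top)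
  qed
  have S0: "0 \<le> S w" for w unfolding S_def using h by (intro integral_nonneg_AE) auto
  have SN: "AE w in M. ?N w = ennreal (S w)"
    using ae unfolding N_eq S_def
    by eventually_elim (use h in \<open>auto intro!: nn_integral_eq_integral\<close>)
  have ES: "(\<integral>\<^sup>+w. ennreal (S w) \<partial>M) = ennreal ?m"
    using nn_integral_cong_AE[OF SN] EN by simp
  show iS: "integrable M S" using ES S0 by (intro integrableI_nonneg) auto
  show eS: "expectation S = ?m"
    using ES S0 m0 by (subst integral_eq_nn_integral) auto
  have "(\<integral>\<^sup>+w. ennreal ((S w)\<^sup>2) \<partial>M) = (\<integral>\<^sup>+w. (?N w)\<^sup>2 \<partial>M)"
    using SN by (intro nn_integral_cong_AE) (auto simp: ennreal_power S0 elim!: eventually_mono)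
  also have "\<dots> \<le> ennreal (?m\<^sup>2 + ?v)"
  proof -
    have "ennreal (?m\<^sup>2 + ?v) = (ennreal intensity * ennreal (integral\<^sup>L lborel h))\<^sup>2 + ennreal (intensity + kernel_energy) * ennreal (LINT x|lborel. (h x)\<^sup>2)"
    proof -
      have "ennreal ?m = ennreal intensity * ennreal (integral\<^sup>L lborel h)" by (rule ennreal_mult') (rule intensity_nonneg)
      moreover have "ennreal ?v = ennreal (intensity + kernel_energy) * ennreal (LINT x|lborel. (h x)\<^sup>2)"
        using intensity_nonneg kernel_energy_nonneg by (intro ennreal_mult') simp
      moreover have "ennreal (?m\<^sup>2 + ?v) = (ennreal ?m)\<^sup>2 + ennreal ?v"
        using m0 v0 by (simp only: ennreal_plus zero_le_power2 ennreal_power)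
      ultimately show ?thesis by (simp only:)
    qed
    then show ?thesis using second_moment[of h, OF _ h] unfolding hi hi2 by simp
  qed
  finally have S2: "(\<integral>\<^sup>+w. ennreal ((S w)\<^sup>2) \<partial>M) \<le> ennreal (?m\<^sup>2 + ?v)" .
  have iS2: "integrable M (\<lambda>w. (S w)\<^sup>2)"
    using le_less_trans[OF S2 ennreal_less_top] by (intro integrableI_nonneg) auto
  have "expectation (\<lambda>w. (S w)\<^sup>2) \<le> ?m\<^sup>2 + ?v"
  proof -
    have "ennreal (expectation (\<lambda>w. (S w)\<^sup>2)) \<le> ennreal (?m\<^sup>2 + ?v)"
      using S2 nn_integral_eq_integral[OF iS2] by simp
    moreover have "0 \<le> ?m\<^sup>2 + ?v" using v0 by simp
    ultimately show ?thesis by (simp only: ennreal_le_iff)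
  qed
  then have var: "expectation (\<lambda>w. (S w - ?m)\<^sup>2) \<le> ?v"
  proof -
    have "expectation (\<lambda>w. (S w - m)\<^sup>2) = expectation (\<lambda>w. (S w)\<^sup>2) + m\<^sup>2 - 2 * expectation S * m" for m
      using iS iS2 by (simp add: power2_diff prob_space)
    from this[of ?m] have "expectation (\<lambda>w. (S w - ?m)\<^sup>2) = expectation (\<lambda>w. (S w)\<^sup>2) - ?m\<^sup>2"
      unfolding eS by (simp only: power2_eq_square mult.assoc)
    then show ?thesis using \<open>expectation (\<lambda>w. (S w)\<^sup>2) \<le> ?m\<^sup>2 + ?v\<close> by simp
  qed
  have iD: "integrable M (\<lambda>w. (S w - ?m)\<^sup>2)" using iS iS2 by (simp add: power2_diff)
  have "(expectation (\<lambda>w. \<bar>S w - ?m\<bar>))\<^sup>2 \<le> expectation (\<lambda>w. (\<bar>S w - ?m\<bar>)\<^sup>2)"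
  proof (rule jensens_inequality[of "\<lambda>w. \<bar>S w - ?m\<bar>" UNIV])
    show "convex_on UNIV (\<lambda>x::real. x\<^sup>2)" by (rule convex_power2)
  qed (use iS iD in auto)
  also have "\<dots> \<le> ?v" using var by simp
  finally show "expectation (\<lambda>w. \<bar>S w - ?m\<bar>) \<le> sqrt ?v" by (rule real_le_rsqrt)
qed

end

section \<open>Marked processes\<close>

text \<open>The closed left half-plane is convex, and the derivative of \<open>exp\<close> has
  modulus at most 1 on it.\<close>

lemma norm_exp_diff_le:
  fixes z w :: complex
  assumes "Re z \<le> 0" "Re w \<le> 0"
  shows "norm (exp z - exp w) \<le> norm (z - w)"
proof -
  have "norm (exp z - exp w) \<le> 1 * norm (z - w)"
  proof (rule field_differentiable_bound[where S="{v. Re v \<le> 0}" and f'=exp])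
    show "convex {v. Re v \<le> 0}" by (rule convex_halfspace_Re_le)
    show "(exp has_field_derivative exp v) (at v within {v. Re v \<le> 0})" for v by (rule DERIV_exp[THEN DERIV_subset]) simp
    show "norm (exp v) \<le> 1" if "v \<in> {v. Re v \<le> 0}" for v :: complex using that by simp
  qed (use assms in auto)
  then show ?thesis by simp
qed

text \<open>On the part of the left half-plane within distance \<open>norm z\<close> of 0,
  \<open>exp v - v\<close> has derivative \<open>exp v - 1\<close>, of modulus at most
  \<open>norm z\<close> by the preceding lemma; the mean value inequality supplies the second
  factor.\<close>

lemma norm_exp_minus_one_minus_le:
  fixes z :: complex
  assumes "Re z \<le> 0"
  shows "norm (exp z - 1 - z) \<le> (norm z)\<^sup>2"
proof -
  let ?S = "{v. Re v \<le> 0} \<inter> cball 0 (norm z)"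
  have "norm ((exp z - z) - (exp 0 - 0)) \<le> norm z * norm (z - 0)"
  proof (rule field_differentiable_bound[where S="?S" and f'="\<lambda>v. exp v - 1" and f="\<lambda>v. exp v - v"])
    show "convex ?S" by (intro convex_Int convex_halfspace_Re_le convex_cball)
    show "((\<lambda>v. exp v - v) has_field_derivative exp v - 1) (at v within ?S)" for v by (auto intro!: derivative_eq_intros)
    show "norm (exp v - 1) \<le> norm z" if "v \<in> ?S" for v
      using norm_exp_diff_le[of v 0] that by auto
  qed (use assms in auto)
  then show ?thesis by (simp add: power2_eq_square algebra_simps)
qed

lemma norm_iexp_minus_one_le: "norm (iexp x - 1) \<le> \<bar>x\<bar>"
  using norm_exp_diff_le[of "\<i> * of_real x" 0] by (simp add: norm_mult)

locale marked_dpp = enumerated_dpp M \<xi> k N X + independent_pair M "count_space UNIV \<Otimes>\<^sub>M (\<Pi>\<^sub>M n\<in>UNIV. borel)" "\<lambda>w. (N w, \<lambda>n. X n w)"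
    "\<Pi>\<^sub>M n\<in>UNIV. borel" "\<lambda>w n. R n w"
  for M :: "'w measure" and \<xi> :: "'w \<Rightarrow> 'a::euclidean_space set" and k :: "'a \<Rightarrow> complex"
    and N :: "'w \<Rightarrow> enat" and X :: "nat \<Rightarrow> 'w \<Rightarrow> 'a" and R :: "nat \<Rightarrow> 'w \<Rightarrow> real" +
  fixes \<nu> :: "real measure"
  assumes R[measurable]: "\<And>n. R n \<in> borel_measurable M"
    and R_distr: "\<And>n. distr M borel (R n) = \<nu>"
    and R_indep: "indep_vars (\<lambda>_. borel) R UNIV"
begin

lemma prob_space_mark: "prob_space \<nu>"
  unfolding R_distr[of 0, symmetric] by (rule prob_space_distr) measurable

sublocale mark: prob_space \<nu> by (rule prob_space_mark)

lemma sets_mark[simp, measurable_cong]: "sets \<nu> = sets borel"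
  unfolding R_distr[of 0, symmetric] by simp

lemma mark_nn_integral: "h \<in> borel_measurable borel \<Longrightarrow> (\<integral>\<^sup>+w. h (R n w) \<partial>M) = (\<integral>\<^sup>+r. h r \<partial>\<nu>)"
  unfolding R_distr[of n, symmetric] by (subst nn_integral_distr) auto

lemma mark_integral:
  fixes h :: "real \<Rightarrow> complex"
  shows "h \<in> borel_measurable borel \<Longrightarrow> (\<integral>w. h (R n w) \<partial>M) = (\<integral>r. h r \<partial>\<nu>)"
  unfolding R_distr[of n, symmetric] by (subst integral_distr) auto

text \<open>For each index the mark may be resampled independently of the points and thus integrated
  out; what remains is a sum over the unmarked points.\<close>

lemma marked_campbell:
  assumes h[measurable]: "(\<lambda>(x, r). h x r) \<in> borel_measurable (borel \<Otimes>\<^sub>M borel)"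
  shows "(\<integral>\<^sup>+w. (\<integral>\<^sup>+n. of_bool (alive n w) * h (X n w) (R n w) \<partial>count_space UNIV) \<partial>M) =
    ennreal intensity * (\<integral>\<^sup>+x. (\<integral>\<^sup>+r. h x r \<partial>\<nu>) \<partial>lborel)"
proof -
  have hc: "(\<lambda>w. h (f w) (g w)) \<in> borel_measurable L" if "f \<in> borel_measurable L" "g \<in> borel_measurable L" for f g and L :: "'z measure"
    using measurable_compose[OF measurable_Pair[OF that] h] by simp
  have hx[measurable]: "h x \<in> borel_measurable borel" for x by (rule hc) auto
  have hi[measurable]: "(\<lambda>x. \<integral>\<^sup>+r. h x r \<partial>\<nu>) \<in> borel_measurable borel"
    using mark.borel_measurable_nn_integral[of h borel] h by (simp cong: measurable_cong_sets)
  have one: "(\<integral>\<^sup>+w. of_bool (alive n w) * h (X n w) (R n w) \<partial>M) = (\<integral>\<^sup>+w. of_bool (alive n w) * (\<integral>\<^sup>+r. h (X n w) r \<partial>\<nu>) \<partial>M)" for n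
  proof -
    have "(\<integral>\<^sup>+w. (\<lambda>(m, x) rs. of_bool (enat n < m) * h (x n) (rs n)) (N w, \<lambda>n. X n w) (\<lambda>n. R n w) \<partial>M) =
      (\<integral>\<^sup>+w. (\<integral>\<^sup>+w'. (\<lambda>(m, x) rs. of_bool (enat n < m) * h (x n) (rs n)) (N w, \<lambda>n. X n w) (\<lambda>n. R n w') \<partial>M) \<partial>M)"
    proof (rule nn_integral_iterated)
      have m1: "(\<lambda>p. of_bool (enat n < fst (fst p)) :: ennreal) \<in> borel_measurable ((count_space UNIV \<Otimes>\<^sub>M (\<Pi>\<^sub>M n\<in>UNIV. (borel :: 'a measure))) \<Otimes>\<^sub>M (\<Pi>\<^sub>M n\<in>(UNIV :: nat set). (borel :: real measure)))"
        by measurable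
      have m2: "(\<lambda>p. h (snd (fst p) n) (snd p n)) \<in> borel_measurable ((count_space UNIV \<Otimes>\<^sub>M (\<Pi>\<^sub>M n\<in>UNIV. (borel :: 'a measure))) \<Otimes>\<^sub>M (\<Pi>\<^sub>M n\<in>(UNIV :: nat set). (borel :: real measure)))"
        by (rule hc) measurable
      show "(\<lambda>(y, z). (case y of (m, x) \<Rightarrow> \<lambda>rs. of_bool (enat n < m) * h (x n) (rs n)) z)
        \<in> borel_measurable ((count_space UNIV \<Otimes>\<^sub>M (\<Pi>\<^sub>M n\<in>UNIV. borel)) \<Otimes>\<^sub>M (\<Pi>\<^sub>M n\<in>UNIV. borel))"
        using borel_measurable_times_ennreal[OF m1 m2] by (simp add: case_prod_beta')
    qed
    also have "\<dots> = (\<integral>\<^sup>+w. of_bool (alive n w) * (\<integral>\<^sup>+r. h (X n w) r \<partial>\<nu>) \<partial>M)"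
      unfolding prod.case by (intro nn_integral_cong, subst nn_integral_cmult) (auto simp: alive_def mark_nn_integral)
    finally show ?thesis by (simp add: alive_def)
  qed
  have m: "(\<lambda>w. of_bool (alive n w) * h (X n w) (R n w)) \<in> borel_measurable M" for n
    using hc[OF X R, of n n] by measurable
  have "(\<integral>\<^sup>+w. (\<integral>\<^sup>+n. of_bool (alive n w) * h (X n w) (R n w) \<partial>count_space UNIV) \<partial>M) =
    (\<integral>\<^sup>+n. (\<integral>\<^sup>+w. of_bool (alive n w) * h (X n w) (R n w) \<partial>M) \<partial>count_space UNIV)"
    using m by (rule nn_integral_count_swap[OF sigma_finite_measure_axioms])
  also have "\<dots> = (\<integral>\<^sup>+w. (\<integral>\<^sup>+n. of_bool (alive n w) * (\<integral>\<^sup>+r. h (X n w) r \<partial>\<nu>) \<partial>count_space UNIV) \<partial>M)"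
    unfolding one by (rule nn_integral_count_swap[OF sigma_finite_measure_axioms, symmetric]) measurable
  also have "\<dots> = ennreal intensity * (\<integral>\<^sup>+x. (\<integral>\<^sup>+r. h x r \<partial>\<nu>) \<partial>lborel)"
    by (rule campbell[OF hi])
  finally show ?thesis .
qed

definition mark_sum :: "('a \<Rightarrow> real \<Rightarrow> real) \<Rightarrow> 'w \<Rightarrow> real" where
  "mark_sum u w = (LINT n|count_space UNIV. of_bool (alive n w) * u (X n w) (R n w))"

text \<open>By \<open>marked_campbell\<close> this condition makes the random series converge
  absolutely almost surely, so that \<open>mark_sum\<close> is then a genuine sum and not the
  default value of a divergent integral.\<close>

definition summable_marks :: "('a \<Rightarrow> real \<Rightarrow> real) \<Rightarrow> bool" where
  "summable_marks u \<longleftrightarrow> (\<lambda>(x, r). u x r) \<in> borel_measurable (borel \<Otimes>\<^sub>M borel) \<and>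
    (\<integral>\<^sup>+x. (\<integral>\<^sup>+r. ennreal \<bar>u x r\<bar> \<partial>\<nu>) \<partial>lborel) < \<infinity>"

lemma compose_measurable:
  assumes u: "(\<lambda>(x, r). u x r) \<in> borel_measurable (borel \<Otimes>\<^sub>M borel)"
    and "f \<in> borel_measurable L" "g \<in> borel_measurable L"
  shows "(\<lambda>w. u (f w) (g w)) \<in> borel_measurable L"
  using measurable_compose[OF measurable_Pair[OF assms(2,3)] u] by simp

lemma mark_sum_measurable:
  assumes u: "(\<lambda>(x, r). u x r) \<in> borel_measurable (borel \<Otimes>\<^sub>M borel)"
  shows "mark_sum u \<in> borel_measurable M"
proof -
  have [measurable]: "(\<lambda>w. u (X n w) (R n w)) \<in> borel_measurable M" for n
    using compose_measurable[OF u X R] .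
  show ?thesis unfolding mark_sum_def[abs_def] by (intro borel_measurable_count_integral) measurable
qed

lemma mark_sum_AE_integrable:
  assumes "summable_marks u"
  shows "AE w in M. integrable (count_space UNIV) (\<lambda>n. of_bool (alive n w) * u (X n w) (R n w))"
proof -
  from assms have u: "(\<lambda>(x, r). u x r) \<in> borel_measurable (borel \<Otimes>\<^sub>M borel)"
    and fin: "(\<integral>\<^sup>+x. (\<integral>\<^sup>+r. ennreal \<bar>u x r\<bar> \<partial>\<nu>) \<partial>lborel) < \<infinity>" by (auto simp: summable_marks_def)
  have [measurable]: "(\<lambda>w. u (X n w) (R n w)) \<in> borel_measurable M" for n
    using compose_measurable[OF u X R] .
  have u': "(\<lambda>(x, r). ennreal \<bar>u x r\<bar>) \<in> borel_measurable (borel \<Otimes>\<^sub>M borel)"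
    using u by (simp add: case_prod_beta')
  have "(\<integral>\<^sup>+w. (\<integral>\<^sup>+n. of_bool (alive n w) * ennreal \<bar>u (X n w) (R n w)\<bar> \<partial>count_space UNIV) \<partial>M) \<noteq> \<infinity>"
    unfolding marked_campbell[OF u'] using fin by (simp add: ennreal_mult_eq_top_iff)
  then have "AE w in M. (\<integral>\<^sup>+n. of_bool (alive n w) * ennreal \<bar>u (X n w) (R n w)\<bar> \<partial>count_space UNIV) \<noteq> \<infinity>"
    by (intro nn_integral_PInf_AE borel_measurable_count_nn_integral) measurable
  then show ?thesis
  proof eventually_elim
    fix w assume "(\<integral>\<^sup>+n. of_bool (alive n w) * ennreal \<bar>u (X n w) (R n w)\<bar> \<partial>count_space UNIV) \<noteq> \<infinity>"
    moreover have "(\<integral>\<^sup>+n. of_bool (alive n w) * ennreal \<bar>u (X n w) (R n w)\<bar> \<partial>count_space UNIV) =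
      (\<integral>\<^sup>+n. norm (of_bool (alive n w) * u (X n w) (R n w)) \<partial>count_space UNIV)"
      by (intro nn_integral_cong) auto
    ultimately show "integrable (count_space UNIV) (\<lambda>n. of_bool (alive n w) * u (X n w) (R n w))"
      by (simp add: integrable_iff_bounded less_top)
  qed
qed

lemma mark_sum_expectation:
  assumes sm: "summable_marks u" and pos: "\<And>x r. 0 \<le> u x r"
  shows "expectation (mark_sum u) = intensity * (LINT x|lborel. LINT r|\<nu>. u x r)"
    and "integrable M (mark_sum u)"
proof -
  from sm have u: "(\<lambda>(x, r). u x r) \<in> borel_measurable (borel \<Otimes>\<^sub>M borel)"
    and fin: "(\<integral>\<^sup>+x. (\<integral>\<^sup>+r. ennreal (u x r) \<partial>\<nu>) \<partial>lborel) < \<infinity>" using pos by (auto simp: summable_marks_def)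
  have u': "(\<lambda>(x, r). ennreal (u x r)) \<in> borel_measurable (borel \<Otimes>\<^sub>M borel)"
    using u by (simp add: case_prod_beta')
  have ux[measurable]: "u x \<in> borel_measurable borel" for x by (rule compose_measurable[OF u]) auto
  have ui[measurable]: "(\<lambda>x. \<integral>\<^sup>+r. ennreal (u x r) \<partial>\<nu>) \<in> borel_measurable borel"
    using mark.borel_measurable_nn_integral[of "\<lambda>x r. ennreal (u x r)" borel] u' by (simp cong: measurable_cong_sets)
  have fx: "AE x in lborel. (\<integral>\<^sup>+r. ennreal (u x r) \<partial>\<nu>) \<noteq> \<infinity>"
    using fin by (intro nn_integral_PInf_AE) auto
  have inner: "AE x in lborel. (\<integral>\<^sup>+r. ennreal (u x r) \<partial>\<nu>) = ennreal (LINT r|\<nu>. u x r)"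
    using fx
  proof eventually_elim
    fix x assume "(\<integral>\<^sup>+r. ennreal (u x r) \<partial>\<nu>) \<noteq> \<infinity>"
    then have "integrable \<nu> (u x)" using pos by (intro integrableI_nonneg) (auto simp: less_top)
    then show "(\<integral>\<^sup>+r. ennreal (u x r) \<partial>\<nu>) = ennreal (LINT r|\<nu>. u x r)"
      using pos by (intro nn_integral_eq_integral) auto
  qed
  have i0: "0 \<le> (LINT r|\<nu>. u x r)" for x using pos by (intro integral_nonneg_AE) auto
  have im[measurable]: "(\<lambda>x. LINT r|\<nu>. u x r) \<in> borel_measurable borel"
    using mark.borel_measurable_lebesgue_integral[of u borel] u by (simp cong: measurable_cong_sets)
  have eqi: "(\<integral>\<^sup>+x. (\<integral>\<^sup>+r. ennreal (u x r) \<partial>\<nu>) \<partial>lborel) = (\<integral>\<^sup>+x. ennreal (LINT r|\<nu>. u x r) \<partial>lborel)"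
    using inner by (rule nn_integral_cong_AE)
  have "integrable lborel (\<lambda>x. LINT r|\<nu>. u x r)"
    using fin i0 unfolding eqi by (intro integrableI_nonneg) auto
  then have eqi2: "(\<integral>\<^sup>+x. (\<integral>\<^sup>+r. ennreal (u x r) \<partial>\<nu>) \<partial>lborel) = ennreal (LINT x|lborel. LINT r|\<nu>. u x r)"
    unfolding eqi using i0 by (intro nn_integral_eq_integral) auto
  have [measurable]: "mark_sum u \<in> borel_measurable M" by (rule mark_sum_measurable[OF u])
  have ms0: "0 \<le> mark_sum u w" for w unfolding mark_sum_def using pos by (intro integral_nonneg_AE) auto
  have "AE w in M. ennreal (mark_sum u w) = (\<integral>\<^sup>+n. of_bool (alive n w) * ennreal (u (X n w) (R n w)) \<partial>count_space UNIV)"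
    using mark_sum_AE_integrable[OF sm]
  proof eventually_elim
    fix w assume "integrable (count_space UNIV) (\<lambda>n. of_bool (alive n w) * u (X n w) (R n w))"
    then have "(\<integral>\<^sup>+n. ennreal (of_bool (alive n w) * u (X n w) (R n w)) \<partial>count_space UNIV) = ennreal (mark_sum u w)"
      unfolding mark_sum_def using pos by (intro nn_integral_eq_integral) auto
    moreover have "(\<integral>\<^sup>+n. ennreal (of_bool (alive n w) * u (X n w) (R n w)) \<partial>count_space UNIV) =
      (\<integral>\<^sup>+n. of_bool (alive n w) * ennreal (u (X n w) (R n w)) \<partial>count_space UNIV)"
      by (intro nn_integral_cong) auto
    ultimately show "ennreal (mark_sum u w) = (\<integral>\<^sup>+n. of_bool (alive n w) * ennreal (u (X n w) (R n w)) \<partial>count_space UNIV)" by simp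
  qed
  then have "(\<integral>\<^sup>+w. ennreal (mark_sum u w) \<partial>M) = ennreal intensity * ennreal (LINT x|lborel. LINT r|\<nu>. u x r)"
    using marked_campbell[OF u'] eqi2 by (simp add: nn_integral_cong_AE)
  then have E: "(\<integral>\<^sup>+w. ennreal (mark_sum u w) \<partial>M) = ennreal (intensity * (LINT x|lborel. LINT r|\<nu>. u x r))"
    using intensity_nonneg by (simp add: ennreal_mult')
  then show "integrable M (mark_sum u)" using ms0 by (intro integrableI_nonneg) auto
  show "expectation (mark_sum u) = intensity * (LINT x|lborel. LINT r|\<nu>. u x r)"
    using E ms0 i0 intensity_nonneg by (subst integral_eq_nn_integral) (auto intro!: mult_nonneg_nonneg integral_nonneg_AE)
qed

text \<open>Given the points, the marks are independent, so the product may be integrated factor by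
  factor. Indices that carry no point get the factor 1, which keeps the number of factors
  deterministic; infinitely many points are reached later by a limit in \<open>m\<close>.\<close>

lemma mark_product:
  fixes v :: "'a \<Rightarrow> real \<Rightarrow> complex"
  assumes v: "(\<lambda>(x, r). v x r) \<in> borel_measurable (borel \<Otimes>\<^sub>M borel)" and bd: "\<And>x r. norm (v x r) \<le> 1"
  shows "expectation (\<lambda>w. \<Prod>n<m. if alive n w then v (X n w) (R n w) else 1) =
    expectation (\<lambda>w. \<Prod>n<m. if alive n w then (LINT r|\<nu>. v (X n w) r) else 1)"
proof -
  have vc: "(\<lambda>w. v (f w) (g w)) \<in> borel_measurable L" if "f \<in> borel_measurable L" "g \<in> borel_measurable L" for f g and L :: "'z measure"
    using measurable_compose[OF measurable_Pair[OF that] v] by simp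
  have vx[measurable]: "v x \<in> borel_measurable borel" for x by (rule vc) auto
  let ?F = "\<lambda>(N, x) rs. \<Prod>n<m. if enat n < N then v (x n) (rs n) else 1"
  let ?P = "(count_space UNIV \<Otimes>\<^sub>M (\<Pi>\<^sub>M n\<in>UNIV. (borel :: 'a measure))) \<Otimes>\<^sub>M (\<Pi>\<^sub>M n\<in>(UNIV :: nat set). (borel :: real measure))"
  have "expectation (\<lambda>w. ?F (N w, \<lambda>n. X n w) (\<lambda>n. R n w)) = (\<integral>w. (\<integral>w'. ?F (N w, \<lambda>n. X n w) (\<lambda>n. R n w') \<partial>M) \<partial>M)"
  proof (rule integral_iterated[where B=1])
    have [measurable]: "(\<lambda>p. v (snd (fst p) n) (snd p n)) \<in> borel_measurable ?P" for n
      by (rule vc) measurable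
    have "(\<lambda>p. \<Prod>n<m. if enat n < fst (fst p) then v (snd (fst p) n) (snd p n) else 1) \<in> borel_measurable ?P"
      by measurable
    then show "case_prod ?F \<in> borel_measurable ?P" by (simp add: case_prod_beta')
    show "norm (?F y z) \<le> 1" for y z
      using bd by (cases y) (auto simp: prod_norm[symmetric] intro!: prod_le_1)
  qed
  also have "\<dots> = expectation (\<lambda>w. \<Prod>n<m. if alive n w then (LINT r|\<nu>. v (X n w) r) else 1)"
  proof (rule Bochner_Integration.integral_cong[OF refl])
    fix w assume "w \<in> space M"
    define q where "q n r = (if alive n w then v (X n w) r else 1)" for n r
    have qm[measurable]: "q n \<in> borel_measurable borel" for n unfolding q_def by measurable
    have "(\<integral>w'. ?F (N w, \<lambda>n. X n w) (\<lambda>n. R n w') \<partial>M) = (\<integral>w'. (\<Prod>n<m. q n (R n w')) \<partial>M)"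
      by (simp add: q_def alive_def)
    also have "\<dots> = (\<Prod>n<m. \<integral>w'. q n (R n w') \<partial>M)"
    proof (rule indep_vars_lebesgue_integral)
      show "indep_vars (\<lambda>_. borel) (\<lambda>n w'. q n (R n w')) {..<m}"
        by (rule indep_vars_compose2[OF indep_vars_subset[OF R_indep]]) auto
      show "integrable M (\<lambda>w'. q n (R n w'))" for n
        using bd by (intro integrable_const_bound[of _ 1]) (auto simp: q_def)
    qed simp
    also have "\<dots> = (\<Prod>n<m. if alive n w then (LINT r|\<nu>. v (X n w) r) else 1)"
      by (intro prod.cong refl) (auto simp: mark_integral q_def mark.prob_space prob_space)
    finally show "(\<integral>w'. ?F (N w, \<lambda>n. X n w) (\<lambda>n. R n w') \<partial>M) = (\<Prod>n<m. if alive n w then (LINT r|\<nu>. v (X n w) r) else 1)" .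
  qed
  finally show ?thesis by (simp add: alive_def)
qed

text \<open>The first error term is the cost of replacing \<open>1 + G\<close> by
  \<open>exp G\<close> at every point, summed by \<open>campbell\<close>; the second is the cost of
  replacing the sum of \<open>G\<close> over the points by its mean inside \<open>exp\<close>. Both
  replacements take place in the closed left half-plane, where \<open>exp\<close> has modulus at
  most 1 and is Lipschitz with constant 1.\<close>

lemma characteristic_function_bound:
  fixes u :: "'a \<Rightarrow> real \<Rightarrow> real"
  defines "G \<equiv> \<lambda>x. (CLINT r|\<nu>. iexp (u x r) - 1)"
  assumes sm: "summable_marks u" and G2: "integrable lborel (\<lambda>x. (cmod (G x))\<^sup>2)"
  shows "cmod (expectation (\<lambda>w. iexp (mark_sum u w)) - exp (complex_of_real intensity * (CLINT x|lborel. G x))) \<le>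
    intensity * (LINT x|lborel. (cmod (G x))\<^sup>2) + 3 * sqrt ((intensity + kernel_energy) * (LINT x|lborel. (cmod (G x))\<^sup>2))"
    and "integrable lborel G"
proof -
  from sm have u: "(\<lambda>(x, r). u x r) \<in> borel_measurable (borel \<Otimes>\<^sub>M borel)"
    and fin: "(\<integral>\<^sup>+x. (\<integral>\<^sup>+r. ennreal \<bar>u x r\<bar> \<partial>\<nu>) \<partial>lborel) < \<infinity>" by (auto simp: summable_marks_def)
  have ux[measurable]: "u x \<in> borel_measurable borel" for x by (rule compose_measurable[OF u]) auto
  have [measurable]: "(\<lambda>w. u (X n w) (R n w)) \<in> borel_measurable M" for n
    using compose_measurable[OF u X R] .
  have um: "(\<lambda>(x, r). iexp (u x r) - 1) \<in> borel_measurable (borel \<Otimes>\<^sub>M \<nu>)"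
    using u by (simp add: case_prod_beta' cong: measurable_cong_sets)
  have Gm[measurable]: "G \<in> borel_measurable borel"
    unfolding G_def using mark.borel_measurable_lebesgue_integral[OF um] by simp
  have ii: "integrable \<nu> (\<lambda>r. iexp (u x r))" for x
    by (intro mark.integrable_const_bound[of _ 1]) auto
  have G_eq: "G x = (CLINT r|\<nu>. iexp (u x r)) - 1" for x
    unfolding G_def using ii by (simp add: mark.prob_space)
  have psi: "cmod (1 + G x) \<le> 1" for x
  proof -
    have "cmod (CLINT r|\<nu>. iexp (u x r)) \<le> (LINT r|\<nu>. norm (iexp (u x r)))" by (rule integral_norm_bound)
    then show ?thesis by (simp add: G_eq mark.prob_space)
  qed
  \<comment> \<open>\<open>1 + G x\<close> is an average of numbers of modulus 1, so it lies in the
    unit disc; this puts \<open>G\<close> and its sums into the left half-plane.\<close>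
  have ReG: "Re (G x) \<le> 0" for x
    using psi[of x] complex_Re_le_cmod[of "1 + G x"] by simp
  have Gle: "ennreal (cmod (G x)) \<le> (\<integral>\<^sup>+r. ennreal \<bar>u x r\<bar> \<partial>\<nu>)" for x
  proof -
    have "ennreal (cmod (G x)) \<le> (\<integral>\<^sup>+r. norm (iexp (u x r) - 1) \<partial>\<nu>)"
      unfolding G_def using ii by (intro integral_norm_bound_ennreal) auto
    also have "\<dots> \<le> (\<integral>\<^sup>+r. ennreal \<bar>u x r\<bar> \<partial>\<nu>)" by (intro nn_integral_mono ennreal_leI norm_iexp_minus_one_le)
    finally show ?thesis .
  qed
  have "(\<integral>\<^sup>+x. ennreal (cmod (G x)) \<partial>lborel) < \<infinity>"
    using fin by (intro le_less_trans[OF nn_integral_mono[OF Gle]]) auto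
  then show iG: "integrable lborel G" by (simp add: integrable_iff_bounded)
  let ?Q = "LINT x|lborel. (cmod (G x))\<^sup>2"
  let ?C = "sqrt ((intensity + kernel_energy) * ?Q)"
  have Q0: "0 \<le> ?Q" by (intro integral_nonneg_AE) auto
  have C0: "0 \<le> intensity + kernel_energy" using intensity_nonneg kernel_energy_nonneg by simp
  define S where "S w = (CLINT n|count_space UNIV. of_bool (alive n w) * G (X n w))" for w
  \<comment> \<open>The deviation estimate is for nonnegative functions. Since
    \<open>Re (G x) \<le> 0\<close>, three of them suffice to represent \<open>G\<close>, which is
    where the factor 3 in the bound comes from.\<close>
  define h1 where "h1 x = - Re (G x)" for x
  define h2 where "h2 x = max 0 (Im (G x))" for x
  define h3 where "h3 x = max 0 (- Im (G x))" for x
  have h0: "0 \<le> h1 x" "0 \<le> h2 x" "0 \<le> h3 x" for x using ReG[of x] by (auto simp: h1_def h2_def h3_def)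
  have hle: "h1 x \<le> cmod (G x)" "h2 x \<le> cmod (G x)" "h3 x \<le> cmod (G x)" for x
    using abs_Re_le_cmod[of "G x"] abs_Im_le_cmod[of "G x"] by (auto simp: h1_def h2_def h3_def)
  have hm[measurable]: "h1 \<in> borel_measurable borel" "h2 \<in> borel_measurable borel" "h3 \<in> borel_measurable borel"
    unfolding h1_def h2_def h3_def by measurable
  have dev: "(AE w in M. integrable (count_space UNIV) (\<lambda>n. of_bool (alive n w) * h (X n w))) \<and>
    integrable M (\<lambda>w. LINT n|count_space UNIV. of_bool (alive n w) * h (X n w)) \<and> integrable lborel h \<and>
    expectation (\<lambda>w. \<bar>(LINT n|count_space UNIV. of_bool (alive n w) * h (X n w)) - intensity * integral\<^sup>L lborel h\<bar>) \<le> ?C"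
    if [measurable]: "h \<in> borel_measurable borel" and h: "\<And>x. 0 \<le> h x" "\<And>x. h x \<le> cmod (G x)" for h
  proof -
    have i1: "integrable lborel h" using h by (intro Bochner_Integration.integrable_bound[OF iG]) auto
    have i2: "integrable lborel (\<lambda>x. (h x)\<^sup>2)"
      using h by (intro Bochner_Integration.integrable_bound[OF G2]) (auto intro!: power_mono)
    have "(LINT x|lborel. (h x)\<^sup>2) \<le> ?Q" using i2 G2 h by (intro integral_mono) (auto intro!: power_mono)
    then have "sqrt ((intensity + kernel_energy) * (LINT x|lborel. (h x)\<^sup>2)) \<le> ?C"
      using C0 by (intro real_sqrt_le_mono mult_left_mono)
    then show ?thesis
      using linear_statistic_deviation(1,2)[OF h(1) i1 i2] order_trans[OF linear_statistic_deviation(4)[OF h(1) i1 i2]] i1 by blast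
  qed
  note d1 = dev[OF hm(1) h0(1) hle(1)] and d2 = dev[OF hm(2) h0(2) hle(2)] and d3 = dev[OF hm(3) h0(3) hle(3)]
  have Gh: "G x = - complex_of_real (h1 x) + \<i> * (complex_of_real (h2 x) - complex_of_real (h3 x))" for x
    by (rule complex_eqI) (auto simp: h1_def h2_def h3_def)
  define L where "L h w = (LINT n|count_space UNIV. of_bool (alive n w) * h (X n w))" for h :: "'a \<Rightarrow> real" and w
  have S_AE: "AE w in M. integrable (count_space UNIV) (\<lambda>n. of_bool (alive n w) * G (X n w)) \<and>
    S w = - complex_of_real (L h1 w) + \<i> * (complex_of_real (L h2 w) - complex_of_real (L h3 w))"
    using conjunct1[OF d1] conjunct1[OF d2] conjunct1[OF d3]
  proof eventually_elim
    fix w assume i: "integrable (count_space UNIV) (\<lambda>n. of_bool (alive n w) * h1 (X n w))"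
      "integrable (count_space UNIV) (\<lambda>n. of_bool (alive n w) * h2 (X n w))"
      "integrable (count_space UNIV) (\<lambda>n. of_bool (alive n w) * h3 (X n w))"
    have j: "integrable (count_space UNIV) (\<lambda>n. complex_of_real (of_bool (alive n w) * h (X n w)))"
      "(CLINT n|count_space UNIV. complex_of_real (of_bool (alive n w) * h (X n w))) = complex_of_real (L h w)"
      if "integrable (count_space UNIV) (\<lambda>n. of_bool (alive n w) * h (X n w))" for h
      using that by (simp_all only: L_def integral_complex_of_real integrable_of_real)
    have eq: "(\<lambda>n. of_bool (alive n w) * G (X n w)) = (\<lambda>n. - complex_of_real (of_bool (alive n w) * h1 (X n w)) +
       \<i> * (complex_of_real (of_bool (alive n w) * h2 (X n w)) - complex_of_real (of_bool (alive n w) * h3 (X n w))))"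
      by (auto simp: Gh fun_eq_iff)
    show "integrable (count_space UNIV) (\<lambda>n. of_bool (alive n w) * G (X n w)) \<and>
      S w = - complex_of_real (L h1 w) + \<i> * (complex_of_real (L h2 w) - complex_of_real (L h3 w))"
      unfolding S_def eq using j[OF i(1)] j[OF i(2)] j[OF i(3)] by (simp del: of_real_mult)
  qed
  have Sm[measurable]: "S \<in> borel_measurable M" unfolding S_def[abs_def] by (intro borel_measurable_count_integral) measurable
  have intG: "(CLINT x|lborel. G x) = - complex_of_real (integral\<^sup>L lborel h1) + \<i> * (complex_of_real (integral\<^sup>L lborel h2) - complex_of_real (integral\<^sup>L lborel h3))"
    unfolding Gh using d1 d2 d3 by simp
  let ?K = "complex_of_real intensity * (CLINT x|lborel. G x)"
  have diff: "AE w in M. cmod (S w - ?K) \<le> \<bar>L h1 w - intensity * integral\<^sup>L lborel h1\<bar> + \<bar>L h2 w - intensity * integral\<^sup>L lborel h2\<bar> + \<bar>L h3 w - intensity * integral\<^sup>L lborel h3\<bar>"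
    using S_AE
  proof eventually_elim
    fix w assume w: "integrable (count_space UNIV) (\<lambda>n. of_bool (alive n w) * G (X n w)) \<and>
      S w = - complex_of_real (L h1 w) + \<i> * (complex_of_real (L h2 w) - complex_of_real (L h3 w))"
    define a b c where "a = L h1 w - intensity * integral\<^sup>L lborel h1" and "b = L h2 w - intensity * integral\<^sup>L lborel h2"
      and "c = L h3 w - intensity * integral\<^sup>L lborel h3"
    have "S w - ?K = - complex_of_real a + \<i> * (complex_of_real b - complex_of_real c)"
      using w unfolding intG a_def b_def c_def by (simp add: algebra_simps)
    also have "cmod \<dots> \<le> \<bar>a\<bar> + (\<bar>b\<bar> + \<bar>c\<bar>)"
      by (rule order_trans[OF norm_triangle_ineq]) (auto simp: norm_mult intro!: order_trans[OF norm_triangle_ineq4])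
    finally show "cmod (S w - ?K) \<le> \<bar>L h1 w - intensity * integral\<^sup>L lborel h1\<bar> + \<bar>L h2 w - intensity * integral\<^sup>L lborel h2\<bar> + \<bar>L h3 w - intensity * integral\<^sup>L lborel h3\<bar>"
      by (simp add: a_def b_def c_def)
  qed
  have ReS: "AE w in M. Re (S w) \<le> 0"
    using S_AE by eventually_elim (use h0 in \<open>auto simp: L_def intro!: integral_nonneg_AE\<close>)
  have ReK: "Re ?K \<le> 0"
    using intensity_nonneg h0(1) unfolding intG by (auto simp: mult_nonneg_nonpos2 intro!: mult_nonneg_nonneg integral_nonneg_AE)
  have iL: "integrable M (L h1)" "integrable M (L h2)" "integrable M (L h3)"
    using d1 d2 d3 unfolding L_def[abs_def] by auto
  have iexpS: "integrable M (\<lambda>w. exp (S w))"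
    using ReS by (intro integrable_const_bound[of _ 1]) auto
  have step2: "cmod (expectation (\<lambda>w. exp (S w)) - exp ?K) \<le> 3 * ?C"
  proof -
    have "expectation (\<lambda>w. exp (S w)) - exp ?K = expectation (\<lambda>w. exp (S w) - exp ?K)"
      using iexpS by (simp add: prob_space)
    also have "cmod \<dots> \<le> expectation (\<lambda>w. cmod (exp (S w) - exp ?K))" by (rule integral_norm_bound)
    also have "\<dots> \<le> expectation (\<lambda>w. \<bar>L h1 w - intensity * integral\<^sup>L lborel h1\<bar> + \<bar>L h2 w - intensity * integral\<^sup>L lborel h2\<bar> + \<bar>L h3 w - intensity * integral\<^sup>L lborel h3\<bar>)"
    proof (rule integral_mono_AE)
      show "AE w in M. cmod (exp (S w) - exp ?K) \<le> \<bar>L h1 w - intensity * integral\<^sup>L lborel h1\<bar> + \<bar>L h2 w - intensity * integral\<^sup>L lborel h2\<bar> + \<bar>L h3 w - intensity * integral\<^sup>L lborel h3\<bar>"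
        using diff ReS by eventually_elim (use ReK norm_exp_diff_le order_trans in blast)
    qed (use iL iexpS in auto)
    also have "\<dots> = expectation (\<lambda>w. \<bar>L h1 w - intensity * integral\<^sup>L lborel h1\<bar>) + expectation (\<lambda>w. \<bar>L h2 w - intensity * integral\<^sup>L lborel h2\<bar>) + expectation (\<lambda>w. \<bar>L h3 w - intensity * integral\<^sup>L lborel h3\<bar>)"
      using iL by simp
    also have "\<dots> \<le> ?C + ?C + ?C" using d1 d2 d3 unfolding L_def by (intro add_mono) auto
    finally show ?thesis by simp
  qed
  \<comment> \<open>Independence factorises finite products, so both expectations are truncated to
    the first \<open>m\<close> indices. The comparison below is uniform in \<open>m\<close>, and
    dominated convergence removes the truncation.\<close>
  let ?A = "\<lambda>m. expectation (\<lambda>w. iexp (\<Sum>n<m. of_bool (alive n w) * u (X n w) (R n w)))"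
  let ?B = "\<lambda>m. expectation (\<lambda>w. exp (\<Sum>n<m. of_bool (alive n w) * G (X n w)))"
  have limA: "?A \<longlonglongrightarrow> expectation (\<lambda>w. iexp (mark_sum u w))"
  proof (rule integral_dominated_convergence[where w="\<lambda>_. 1"])
    have [measurable]: "mark_sum u \<in> borel_measurable M" by (rule mark_sum_measurable[OF u])
    show "(\<lambda>w. iexp (mark_sum u w)) \<in> borel_measurable M" by measurable
    show "AE w in M. (\<lambda>m. iexp (\<Sum>n<m. of_bool (alive n w) * u (X n w) (R n w))) \<longlonglongrightarrow> iexp (mark_sum u w)"
      using mark_sum_AE_integrable[OF sm]
    proof eventually_elim
      fix w assume "integrable (count_space UNIV) (\<lambda>n. of_bool (alive n w) * u (X n w) (R n w))"
      from sums_integral_count_space_nat[OF this]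
      have "(\<lambda>m. \<Sum>n<m. of_bool (alive n w) * u (X n w) (R n w)) \<longlonglongrightarrow> mark_sum u w"
        by (simp add: sums_def mark_sum_def)
      then show "(\<lambda>m. iexp (\<Sum>n<m. of_bool (alive n w) * u (X n w) (R n w))) \<longlonglongrightarrow> iexp (mark_sum u w)"
        by (intro tendsto_intros)
    qed
    show "AE w in M. norm (iexp (\<Sum>n<m. of_bool (alive n w) * u (X n w) (R n w))) \<le> 1" for m
      by (simp only: norm_exp_i_times) simp
  qed measurable
  have limB: "?B \<longlonglongrightarrow> expectation (\<lambda>w. exp (S w))"
  proof (rule integral_dominated_convergence[where w="\<lambda>_. 1"])
    show "AE w in M. (\<lambda>m. exp (\<Sum>n<m. of_bool (alive n w) * G (X n w))) \<longlonglongrightarrow> exp (S w)"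
      using S_AE
    proof eventually_elim
      fix w assume "integrable (count_space UNIV) (\<lambda>n. of_bool (alive n w) * G (X n w)) \<and>
        S w = - complex_of_real (L h1 w) + \<i> * (complex_of_real (L h2 w) - complex_of_real (L h3 w))"
      then have "integrable (count_space UNIV) (\<lambda>n. of_bool (alive n w) * G (X n w))" by blast
      from sums_integral_count_space_nat[OF this]
      have "(\<lambda>m. \<Sum>n<m. of_bool (alive n w) * G (X n w)) \<longlonglongrightarrow> S w" by (simp add: sums_def S_def)
      then show "(\<lambda>m. exp (\<Sum>n<m. of_bool (alive n w) * G (X n w))) \<longlonglongrightarrow> exp (S w)" by (intro tendsto_intros)
    qed
    show "AE w in M. norm (exp (\<Sum>n<m. of_bool (alive n w) * G (X n w))) \<le> 1" for m
      using ReG by (auto simp: sum_nonpos)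
  qed measurable
  have AB: "cmod (?A m - ?B m) \<le> intensity * ?Q" for m
  proof -
    have ebd: "norm (iexp (u x r)) \<le> 1" for x r by simp
    have v: "(\<lambda>(x, r). iexp (u x r)) \<in> borel_measurable (borel \<Otimes>\<^sub>M borel)" using u by (simp add: case_prod_beta')
    have A_eq: "?A m = expectation (\<lambda>w. \<Prod>n<m. if alive n w then 1 + G (X n w) else 1)"
    proof -
      have "?A m = expectation (\<lambda>w. \<Prod>n<m. if alive n w then iexp (u (X n w) (R n w)) else 1)"
      proof (intro Bochner_Integration.integral_cong refl)
        show "iexp (\<Sum>n<m. of_bool (alive n w) * u (X n w) (R n w)) = (\<Prod>n<m. if alive n w then iexp (u (X n w) (R n w)) else 1)" for w
          by (induction m) (auto simp: exp_add distrib_left)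
      qed
      also have "\<dots> = expectation (\<lambda>w. \<Prod>n<m. if alive n w then 1 + G (X n w) else 1)"
        unfolding mark_product[OF v ebd] by (simp add: G_eq cong: if_cong)
      finally show ?thesis .
    qed
    have B_eq: "?B m = expectation (\<lambda>w. \<Prod>n<m. if alive n w then exp (G (X n w)) else 1)"
    proof (intro Bochner_Integration.integral_cong refl)
      show "exp (\<Sum>n<m. of_bool (alive n w) * G (X n w)) = (\<Prod>n<m. if alive n w then exp (G (X n w)) else 1)" for w
        by (induction m) (auto simp: exp_add)
    qed
    have n1: "norm (if alive n w then 1 + G (X n w) else 1) \<le> 1" "norm (if alive n w then exp (G (X n w)) else 1) \<le> 1" for n w
      using psi ReG by auto
    \<comment> \<open>For factors in the unit disc the difference of two products is at most the sum
      of the differences of the factors, and each of these is at most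
      \<open>(cmod (G (X n w)))\<^sup>2\<close> by the second-order bound for
      \<open>exp\<close>.\<close>
    have pt: "cmod ((\<Prod>n<m. if alive n w then 1 + G (X n w) else 1) - (\<Prod>n<m. if alive n w then exp (G (X n w)) else 1)) \<le>
      (\<Sum>n<m. of_bool (alive n w) * (cmod (G (X n w)))\<^sup>2)" for w
    proof (rule order_trans[OF norm_prod_diff])
      show "(\<Sum>n<m. norm ((if alive n w then 1 + G (X n w) else 1) - (if alive n w then exp (G (X n w)) else 1))) \<le> (\<Sum>n<m. of_bool (alive n w) * (cmod (G (X n w)))\<^sup>2)"
        using norm_exp_minus_one_minus_le[OF ReG] by (intro sum_mono) (auto simp: norm_minus_commute algebra_simps)
    qed (rule n1)+
    have i1: "integrable M (\<lambda>w. \<Prod>n<m. if alive n w then 1 + G (X n w) else 1)" "integrable M (\<lambda>w. \<Prod>n<m. if alive n w then exp (G (X n w)) else 1)"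
    proof -
      have "norm (\<Prod>n<m. z n) \<le> 1" if "\<And>n. norm (z n) \<le> 1" for z :: "nat \<Rightarrow> complex"
        using that by (simp add: prod_norm[symmetric] prod_le_1)
      then show "integrable M (\<lambda>w. \<Prod>n<m. if alive n w then 1 + G (X n w) else 1)" "integrable M (\<lambda>w. \<Prod>n<m. if alive n w then exp (G (X n w)) else 1)"
        using n1 by (intro integrable_const_bound[of _ 1] AE_I2; simp)+
    qed
    let ?D = "\<lambda>w. cmod ((\<Prod>n<m. if alive n w then 1 + G (X n w) else 1) - (\<Prod>n<m. if alive n w then exp (G (X n w)) else 1))"
    have "cmod (?A m - ?B m) \<le> expectation ?D"
      unfolding A_eq B_eq using i1 by (simp only: Bochner_Integration.integral_diff[symmetric]) (rule integral_norm_bound)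
    also have "ennreal (expectation ?D) = (\<integral>\<^sup>+w. ennreal (?D w) \<partial>M)"
      using i1 by (intro nn_integral_eq_integral[symmetric]) auto
    finally have "ennreal (cmod (?A m - ?B m)) \<le> (\<integral>\<^sup>+w. ennreal (?D w) \<partial>M)" using ennreal_leI by metis
    also have "\<dots> \<le> (\<integral>\<^sup>+w. (\<integral>\<^sup>+n. of_bool (alive n w) * ennreal ((cmod (G (X n w)))\<^sup>2) \<partial>count_space UNIV) \<partial>M)"
    proof (intro nn_integral_mono)
      fix w
      have "ennreal (?D w) \<le> ennreal (\<Sum>n<m. of_bool (alive n w) * (cmod (G (X n w)))\<^sup>2)" by (intro ennreal_leI pt)
      also have "\<dots> = (\<Sum>n<m. of_bool (alive n w) * ennreal ((cmod (G (X n w)))\<^sup>2))"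
        by (subst sum_ennreal[symmetric]) (auto intro!: sum.cong)
      also have "\<dots> \<le> (\<integral>\<^sup>+n. of_bool (alive n w) * ennreal ((cmod (G (X n w)))\<^sup>2) \<partial>count_space UNIV)"
        unfolding nn_integral_count_space_nat by (intro sum_le_suminf) auto
      finally show "ennreal (?D w) \<le> (\<integral>\<^sup>+n. of_bool (alive n w) * ennreal ((cmod (G (X n w)))\<^sup>2) \<partial>count_space UNIV)" .
    qed
    also have "\<dots> = ennreal intensity * (\<integral>\<^sup>+x. ennreal ((cmod (G x))\<^sup>2) \<partial>lborel)"
      using campbell[of "\<lambda>x. ennreal ((cmod (G x))\<^sup>2)"] by simp
    also have "\<dots> = ennreal (intensity * ?Q)"
      using G2 intensity_nonneg by (subst nn_integral_eq_integral) (auto simp: ennreal_mult')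
    finally show ?thesis using intensity_nonneg Q0 by (simp add: ennreal_le_iff)
  qed
  have "cmod (expectation (\<lambda>w. iexp (mark_sum u w)) - expectation (\<lambda>w. exp (S w))) \<le> intensity * ?Q"
    by (rule tendsto_upperbound[OF tendsto_norm[OF tendsto_diff[OF limA limB]]]) (rule always_eventually allI AB trivial_limit_sequentially)+
  then show "cmod (expectation (\<lambda>w. iexp (mark_sum u w)) - exp ?K) \<le> intensity * ?Q + 3 * ?C"
    using step2 norm_triangle_ineq[of "expectation (\<lambda>w. iexp (mark_sum u w)) - expectation (\<lambda>w. exp (S w))" "expectation (\<lambda>w. exp (S w)) - exp ?K"]
    by simp
qed

end

section \<open>Stable integrals\<close>

text \<open>Minus the logarithm of the characteristic function of the \<gamma>-stable law with scale
  1, skewness \<open>b\<close> and shift 0; a scale \<sigma> multiplies it by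
  \<open>\<sigma> powr \<gamma>\<close>. In this form the exponent of a stable integral is the
  integral of \<open>stable_exponent\<close> composed with the integrand.\<close>

definition stable_exponent :: "real \<Rightarrow> real \<Rightarrow> real \<Rightarrow> complex" where
  "stable_exponent \<gamma> b u = complex_of_real (\<bar>u\<bar> powr \<gamma>) * (1 - \<i> * complex_of_real (b * sgn u * tan (pi * \<gamma> / 2)))"

lemma stable_exponent_0[simp]: "stable_exponent \<gamma> b 0 = 0"
  by (simp add: stable_exponent_def)

lemma borel_measurable_stable_exponent[measurable]: "stable_exponent \<gamma> b \<in> borel_measurable borel"
  unfolding stable_exponent_def by measurable

lemma norm_stable_exponent_le:
  "cmod (stable_exponent \<gamma> b u) \<le> (1 + \<bar>b * tan (pi * \<gamma> / 2)\<bar>) * \<bar>u\<bar> powr \<gamma>"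
proof -
  have "cmod (1 - \<i> * complex_of_real (b * sgn u * tan (pi * \<gamma> / 2))) \<le> 1 + \<bar>b * sgn u * tan (pi * \<gamma> / 2)\<bar>"
    by (rule order_trans[OF norm_triangle_ineq4]) (simp add: norm_mult abs_mult)
  also have "\<dots> \<le> 1 + \<bar>b * tan (pi * \<gamma> / 2)\<bar>"
    by (cases "u = 0") (auto simp: abs_mult)
  finally have "\<bar>u\<bar> powr \<gamma> * cmod (1 - \<i> * complex_of_real (b * sgn u * tan (pi * \<gamma> / 2))) \<le> \<bar>u\<bar> powr \<gamma> * (1 + \<bar>b * tan (pi * \<gamma> / 2)\<bar>)"
    by (intro mult_left_mono) auto
  then show ?thesis by (simp add: stable_exponent_def norm_mult mult.commute)
qed

lemma stable_exponent_mult: "0 < c \<Longrightarrow> stable_exponent \<gamma> b (c * u) = complex_of_real (c powr \<gamma>) * stable_exponent \<gamma> b u"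
  by (simp add: stable_exponent_def abs_mult powr_mult sgn_mult mult.assoc)

text \<open>
  If \<open>a\<close> is relatively close to \<open>v\<close>, homogeneity reduces the claim to continuity of
  \<open>c \<mapsto> c\<^sup>\<gamma>\<close> at \<open>1\<close>; otherwise \<open>\<bar>v\<bar>\<close> is dominated by \<open>\<bar>a - v\<bar>\<close>.
\<close>
lemma stable_exponent_diff_le:
  assumes g: "0 < \<gamma>" and e: "0 < e"
  shows "\<exists>C\<ge>0. \<forall>a v. cmod (stable_exponent \<gamma> b a - stable_exponent \<gamma> b v) \<le> e * \<bar>v\<bar> powr \<gamma> + C * \<bar>a - v\<bar> powr \<gamma>"
proof -
  define B where "B = 1 + \<bar>b * tan (pi * \<gamma> / 2)\<bar>"
  have B: "0 < B" by (simp add: B_def add_pos_nonneg)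
  have nB: "cmod (stable_exponent \<gamma> b u) \<le> B * \<bar>u\<bar> powr \<gamma>" for u
    unfolding B_def by (rule norm_stable_exponent_le)
  have "isCont (\<lambda>c::real. c powr \<gamma>) 1" by (intro continuous_intros) auto
  then obtain d where d: "0 < d" "\<And>c. dist c 1 < d \<Longrightarrow> dist (c powr \<gamma>) (1 powr \<gamma>) < e / B"
    unfolding continuous_at_eps_delta using B e divide_pos_pos by (metis dist_commute)
  \<comment> \<open>\<open>D < d\<close> turns \<open>\<bar>c - 1\<bar> \<le> D\<close> into the
    strict inequality of the continuity statement, and \<open>D < 1\<close> keeps the quotient
    \<open>c = a / v\<close> positive, as homogeneity requires.\<close>
  define D where "D = min (d / 2) (1 / 2)"
  have D: "0 < D" "D < 1" "D < d" using d(1) by (auto simp: D_def)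
  define C where "C = B * (1 + 1 / D) powr \<gamma> + B * (1 / D) powr \<gamma>"
  have C0: "0 \<le> C" using B by (simp add: C_def)
  have "cmod (stable_exponent \<gamma> b a - stable_exponent \<gamma> b v) \<le> e * \<bar>v\<bar> powr \<gamma> + C * \<bar>a - v\<bar> powr \<gamma>" for a v
  proof (cases "\<bar>a - v\<bar> \<le> D * \<bar>v\<bar> \<and> v \<noteq> 0")
    case True
    define c where "c = a / v"
    have a: "a = c * v" using True by (simp add: c_def)
    have "\<bar>c - 1\<bar> * \<bar>v\<bar> \<le> D * \<bar>v\<bar>" using True by (simp add: a abs_mult[symmetric] left_diff_distrib)
    then have c: "\<bar>c - 1\<bar> \<le> D" using True by simp
    then have c0: "0 < c" using D by linarith
    have "\<bar>c powr \<gamma> - 1\<bar> \<le> e / B" using d(2)[of c] c D by (simp add: dist_real_def)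
    then have "\<bar>c powr \<gamma> - 1\<bar> * (B * \<bar>v\<bar> powr \<gamma>) \<le> e / B * (B * \<bar>v\<bar> powr \<gamma>)"
      using B by (intro mult_right_mono) auto
    moreover have "cmod (stable_exponent \<gamma> b a - stable_exponent \<gamma> b v) = \<bar>c powr \<gamma> - 1\<bar> * cmod (stable_exponent \<gamma> b v)"
    proof -
      have "stable_exponent \<gamma> b a - stable_exponent \<gamma> b v = complex_of_real (c powr \<gamma> - 1) * stable_exponent \<gamma> b v"
        unfolding a stable_exponent_mult[OF c0] by (simp add: left_diff_distrib)
      then show ?thesis by (simp only: norm_mult norm_of_real)
    qed
    moreover have "\<bar>c powr \<gamma> - 1\<bar> * cmod (stable_exponent \<gamma> b v) \<le> \<bar>c powr \<gamma> - 1\<bar> * (B * \<bar>v\<bar> powr \<gamma>)"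
      by (intro mult_left_mono nB) auto
    moreover have "e / B * (B * \<bar>v\<bar> powr \<gamma>) = e * \<bar>v\<bar> powr \<gamma>" using B by simp
    moreover have "0 \<le> C * \<bar>a - v\<bar> powr \<gamma>" using C0 by simp
    ultimately show ?thesis by linarith
  next
    case False
    have v: "\<bar>v\<bar> \<le> 1 / D * \<bar>a - v\<bar>"
    proof (cases "v = 0")
      case False
      with \<open>\<not> (\<bar>a - v\<bar> \<le> D * \<bar>v\<bar> \<and> v \<noteq> 0)\<close> have "D * \<bar>v\<bar> \<le> \<bar>a - v\<bar>" by auto
      then show ?thesis using D by (simp add: field_simps)
    qed (use D in simp)
    have "\<bar>a\<bar> \<le> \<bar>a - v\<bar> + \<bar>v\<bar>" by simp
    also have "\<dots> \<le> (1 + 1 / D) * \<bar>a - v\<bar>" using v by (simp add: distrib_right)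
    finally have a: "\<bar>a\<bar> \<le> (1 + 1 / D) * \<bar>a - v\<bar>" .
    have D1: "0 \<le> 1 / D" "0 \<le> 1 + 1 / D" using D by auto
    have "\<bar>a\<bar> powr \<gamma> \<le> ((1 + 1 / D) * \<bar>a - v\<bar>) powr \<gamma>" using a g by (intro powr_mono2) auto
    then have pa: "\<bar>a\<bar> powr \<gamma> \<le> (1 + 1 / D) powr \<gamma> * \<bar>a - v\<bar> powr \<gamma>" using D1 by (simp only: powr_mult abs_ge_zero)
    have "\<bar>v\<bar> powr \<gamma> \<le> (1 / D * \<bar>a - v\<bar>) powr \<gamma>" using v g by (intro powr_mono2) auto
    then have pv: "\<bar>v\<bar> powr \<gamma> \<le> (1 / D) powr \<gamma> * \<bar>a - v\<bar> powr \<gamma>" using D1 by (simp only: powr_mult abs_ge_zero)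
    have "cmod (stable_exponent \<gamma> b a - stable_exponent \<gamma> b v) \<le> B * \<bar>a\<bar> powr \<gamma> + B * \<bar>v\<bar> powr \<gamma>"
      using norm_triangle_ineq4[of "stable_exponent \<gamma> b a" "stable_exponent \<gamma> b v"] nB[of a] nB[of v] by linarith
    also have "\<dots> \<le> B * ((1 + 1 / D) powr \<gamma> * \<bar>a - v\<bar> powr \<gamma>) + B * ((1 / D) powr \<gamma> * \<bar>a - v\<bar> powr \<gamma>)"
      using B pa pv by (intro add_mono mult_left_mono) auto
    also have "\<dots> = C * \<bar>a - v\<bar> powr \<gamma>" by (simp add: C_def distrib_right)
    also have "\<dots> \<le> e * \<bar>v\<bar> powr \<gamma> + C * \<bar>a - v\<bar> powr \<gamma>" using e by simp
    finally show ?thesis .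
  qed
  with C0 show ?thesis by blast
qed

text \<open>Every summand is at most the largest one in modulus, whose power is itself one of the
  terms on the right. The argument covers exponents above and below 1 alike.\<close>

lemma powr_sum_le:
  fixes x :: "'i \<Rightarrow> real"
  assumes g: "0 < \<gamma>" and I: "finite I"
  shows "\<bar>\<Sum>i\<in>I. x i\<bar> powr \<gamma> \<le> real (card I) powr \<gamma> * (\<Sum>i\<in>I. \<bar>x i\<bar> powr \<gamma>)"
proof (cases "I = {}")
  case False
  define m where "m = Max ((\<lambda>i. \<bar>x i\<bar>) ` I)"
  have "m \<in> (\<lambda>i. \<bar>x i\<bar>) ` I" unfolding m_def using I False by (intro Max_in) auto
  then obtain j where j: "j \<in> I" "m = \<bar>x j\<bar>" by auto
  have le: "\<bar>x i\<bar> \<le> m" if "i \<in> I" for i unfolding m_def using I that by (intro Max_ge) auto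
  have "\<bar>\<Sum>i\<in>I. x i\<bar> \<le> (\<Sum>i\<in>I. \<bar>x i\<bar>)" by (rule sum_abs)
  also have "\<dots> \<le> real (card I) * m" using sum_bounded_above[of I "\<lambda>i. \<bar>x i\<bar>" m] le by simp
  finally have "\<bar>\<Sum>i\<in>I. x i\<bar> powr \<gamma> \<le> (real (card I) * m) powr \<gamma>" using g by (intro powr_mono2) auto
  also have "\<dots> = real (card I) powr \<gamma> * m powr \<gamma>" using j by (simp add: powr_mult)
  also have "m powr \<gamma> \<le> (\<Sum>i\<in>I. \<bar>x i\<bar> powr \<gamma>)"
    unfolding j(2) using I j(1) by (intro member_le_sum[of j I "\<lambda>i. \<bar>x i\<bar> powr \<gamma>"]) auto
  finally show ?thesis by (simp add: mult_left_mono)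
qed simp

text \<open>The cap at 2 makes the bound usable under convergence in probability, where the
  differences themselves need not be integrable.\<close>

lemma iexp_diff_le: "norm (iexp x - iexp y) \<le> min 2 \<bar>x - y\<bar>"
proof -
  have "norm (iexp x - iexp y) \<le> norm (iexp x) + norm (iexp y)" by (rule norm_triangle_ineq4)
  then have 1: "norm (iexp x - iexp y) \<le> 2" by simp
  have "iexp x - iexp y = iexp y * (iexp (x - y) - 1)"
    by (simp add: right_diff_distrib exp_add[symmetric])
  then have "norm (iexp x - iexp y) = norm (iexp (x - y) - 1)" by (simp add: norm_mult)
  also have "\<dots> \<le> \<bar>x - y\<bar>" using iexp_approx1[of "x - y" 0] by simp
  finally show ?thesis using 1 by simp
qed

section \<open>Characteristic functions of stable integrals\<close>

locale stable_measure = prob_space Q for Q :: "'u measure" +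
  fixes \<gamma> :: real and m :: "'a measure" and b :: real and W :: "'a set \<Rightarrow> 'u \<Rightarrow> real"
  assumes W: "stable_random_measure Q \<gamma> m b W" and gamma_pos: "0 < \<gamma>"
begin

lemma W_law: "A \<in> finite_sets m \<Longrightarrow> has_stable_law Q (W A) \<gamma> (measure m A powr (1 / \<gamma>)) b"
  using W unfolding stable_random_measure_def by blast

lemma W_measurable: "A \<in> finite_sets m \<Longrightarrow> W A \<in> borel_measurable Q"
  using W_law unfolding has_stable_law_def by blast

lemma W_char:
  assumes A: "A \<in> finite_sets m"
  shows "expectation (\<lambda>w. iexp (c * W A w)) = exp (- complex_of_real (measure m A) * stable_exponent \<gamma> b c)"
proof -
  have [measurable]: "W A \<in> borel_measurable Q" by (rule W_measurable[OF A])
  have "expectation (\<lambda>w. iexp (c * W A w)) = char (distr Q borel (W A)) c"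
    by (simp add: char_def integral_distr)
  also have "\<dots> = exp (- complex_of_real ((measure m A powr (1 / \<gamma>)) powr \<gamma> * \<bar>c\<bar> powr \<gamma>) *
             (1 - \<i> * complex_of_real (b * sgn c * tan (pi * \<gamma> / 2))))"
    using W_law[OF A] unfolding has_stable_law_def by blast
  also have "(measure m A powr (1 / \<gamma>)) powr \<gamma> = measure m A"
    using gamma_pos by (simp add: powr_powr)
  finally show ?thesis by (simp add: stable_exponent_def mult.assoc)
qed

lemma empty_finite_set: "{} \<in> finite_sets m"
  by (simp add: finite_sets_def)

lemma W_sums:
  assumes "\<And>i. A i \<in> finite_sets m" "disjoint_family A" "(\<Union>i::nat. A i) \<in> finite_sets m"
  shows "AE w in Q. (\<lambda>i. W (A i) w) sums W (\<Union>i. A i) w"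
  using W assms unfolding stable_random_measure_def by blast

text \<open>The empty set is a countable disjoint union of copies of itself, and a convergent series
  with constant terms has terms 0.\<close>

lemma W_empty: "AE w in Q. W {} w = 0"
proof -
  have "AE w in Q. (\<lambda>i::nat. W {} w) sums W {} w"
    using W_sums[of "\<lambda>_. {}"] empty_finite_set by (simp add: disjoint_family_on_def)
  then show ?thesis
  proof eventually_elim
    fix w assume "(\<lambda>i::nat. W {} w) sums W {} w"
    then have "(\<lambda>i::nat. W {} w) \<longlonglongrightarrow> 0" using sums_summable summable_LIMSEQ_zero by blast
    then show "W {} w = 0" by (simp add: LIMSEQ_const_iff)
  qed
qed

text \<open>Independence and additivity of a stable random measure are stated for sequences of sets;
  a finite family is brought to that form by numbering it and padding with empty sets.\<close>

lemma finite_family_sequence: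
  assumes J: "finite J" and A: "\<And>j. j \<in> J \<Longrightarrow> A j \<in> finite_sets m" and disj: "disjoint_family_on A J"
  obtains A' :: "nat \<Rightarrow> 'a set" and h :: "nat \<Rightarrow> 'j" where
    "bij_betw h {..<card J} J" "\<And>i. i < card J \<Longrightarrow> A' i = A (h i)" "\<And>i. \<not> i < card J \<Longrightarrow> A' i = {}"
    "\<And>i. A' i \<in> finite_sets m" "disjoint_family A'" "(\<Union>i. A' i) = (\<Union>j\<in>J. A j)"
proof -
  obtain h where h: "bij_betw h {..<card J} J"
    using ex_bij_betw_nat_finite[OF J] by (auto simp: atLeast0LessThan)
  define A' where "A' i = (if i < card J then A (h i) else {})" for i
  have hJ: "h i \<in> J" if "i < card J" for i using h that by (auto simp: bij_betw_def)
  show ?thesis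
  proof (rule that[of h A'])
    show "disjoint_family A'"
      unfolding disjoint_family_on_def
    proof (intro ballI impI)
      fix i j :: nat assume ij: "i \<noteq> j"
      show "A' i \<inter> A' j = {}"
      proof (cases "i < card J \<and> j < card J")
        case True
        then have "h i \<noteq> h j" using h ij by (auto simp: bij_betw_def inj_on_def)
        then show ?thesis using disj hJ True by (auto simp: A'_def disjoint_family_on_def)
      qed (auto simp: A'_def)
    qed
    have "(\<Union>i. A' i) = (\<Union>i\<in>{..<card J}. A (h i))" by (auto simp: A'_def split: if_splits)
    also have "\<dots> = (\<Union>j\<in>h ` {..<card J}. A j)" by auto
    also have "h ` {..<card J} = J" using h by (simp add: bij_betw_def)
    finally show "(\<Union>i. A' i) = (\<Union>j\<in>J. A j)" .
  qed (use h hJ A empty_finite_set in \<open>auto simp: A'_def\<close>)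
qed

lemma finite_sets_UN:
  assumes "finite J" "\<And>j. j \<in> J \<Longrightarrow> A j \<in> finite_sets m"
  shows "(\<Union>j\<in>J. A j) \<in> finite_sets m"
proof -
  have "emeasure m (\<Union>j\<in>J. A j) \<le> (\<Sum>j\<in>J. emeasure m (A j))"
    using assms by (intro emeasure_subadditive_finite) (auto simp: finite_sets_def)
  also have "\<dots> < \<infinity>" using assms by (auto simp: finite_sets_def)
  finally show ?thesis using assms by (auto simp: finite_sets_def)
qed

lemma W_finite_additive:
  assumes J: "finite J" and A: "\<And>j. j \<in> J \<Longrightarrow> A j \<in> finite_sets m" and disj: "disjoint_family_on A J"
  shows "AE w in Q. W (\<Union>j\<in>J. A j) w = (\<Sum>j\<in>J. W (A j) w)"
proof -
  from finite_family_sequence[OF assms] obtain A' h where h: "bij_betw h {..<card J} J"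
    and A': "\<And>i. i < card J \<Longrightarrow> A' i = A (h i)" "\<And>i. \<not> i < card J \<Longrightarrow> A' i = {}"
    "\<And>i. A' i \<in> finite_sets m" "disjoint_family A'" and U: "(\<Union>i. A' i) = (\<Union>j\<in>J. A j)" by metis
  have "AE w in Q. (\<lambda>i. W (A' i) w) sums W (\<Union>i. A' i) w"
    using A' U finite_sets_UN[OF J A] by (intro W_sums) auto
  then show ?thesis
    using W_empty
  proof eventually_elim
    fix w assume s: "(\<lambda>i. W (A' i) w) sums W (\<Union>i. A' i) w" and e: "W {} w = 0"
    have "(\<lambda>i. W (A' i) w) sums (\<Sum>i<card J. W (A' i) w)"
      using A'(2) e by (intro sums_finite) auto
    then have "W (\<Union>i. A' i) w = (\<Sum>i<card J. W (A' i) w)" using s sums_unique2 by blast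
    also have "\<dots> = (\<Sum>i<card J. W (A (h i)) w)" using A'(1) by simp
    also have "\<dots> = (\<Sum>j\<in>J. W (A j) w)" using h by (rule sum.reindex_bij_betw)
    finally show "W (\<Union>j\<in>J. A j) w = (\<Sum>j\<in>J. W (A j) w)" by (simp add: U)
  qed
qed

lemma W_combination_char:
  assumes J: "finite J" and A: "\<And>j. j \<in> J \<Longrightarrow> A j \<in> finite_sets m" and disj: "disjoint_family_on A J"
  shows "expectation (\<lambda>w. iexp (\<Sum>j\<in>J. c j * W (A j) w)) = exp (- (\<Sum>j\<in>J. complex_of_real (measure m (A j)) * stable_exponent \<gamma> b (c j)))"
proof -
  from finite_family_sequence[OF assms] obtain A' h where h: "bij_betw h {..<card J} J"
    and A': "\<And>i. i < card J \<Longrightarrow> A' i = A (h i)" "\<And>i. A' i \<in> finite_sets m" "disjoint_family A'" by metis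
  have ind: "indep_vars (\<lambda>_. borel) (\<lambda>i. W (A' i)) UNIV"
    using W A' unfolding stable_random_measure_def by blast
  have [measurable]: "W (A' i) \<in> borel_measurable Q" for i by (rule W_measurable[OF A'(2)])
  have "expectation (\<lambda>w. iexp (\<Sum>j\<in>J. c j * W (A j) w)) = expectation (\<lambda>w. iexp (\<Sum>i<card J. c (h i) * W (A' i) w))"
  proof -
    have "(\<Sum>j\<in>J. c j * W (A j) w) = (\<Sum>i<card J. c (h i) * W (A' i) w)" for w
      using sum.reindex_bij_betw[OF h, of "\<lambda>j. c j * W (A j) w"] A'(1) by (auto intro!: sum.cong trans[OF sym])
    then show ?thesis by (simp only:)
  qed
  also have "\<dots> = expectation (\<lambda>w. \<Prod>i<card J. iexp (c (h i) * W (A' i) w))"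
    by (simp add: exp_sum sum_distrib_left)
  also have "\<dots> = (\<Prod>i<card J. expectation (\<lambda>w. iexp (c (h i) * W (A' i) w)))"
  proof (rule indep_vars_lebesgue_integral)
    show "indep_vars (\<lambda>_. borel) (\<lambda>i w. iexp (c (h i) * W (A' i) w)) {..<card J}"
      by (rule indep_vars_compose2[OF indep_vars_subset[OF ind], where Y="\<lambda>i x. iexp (c (h i) * x)"]) auto
    show "integrable Q (\<lambda>w. iexp (c (h i) * W (A' i) w))" for i
    proof (rule integrable_const_bound[of _ 1])
      show "AE w in Q. norm (iexp (c (h i) * W (A' i) w)) \<le> 1" by (simp only: norm_exp_i_times) simp
    qed measurable
  qed simp
  also have "\<dots> = (\<Prod>i<card J. exp (- complex_of_real (measure m (A (h i))) * stable_exponent \<gamma> b (c (h i))))"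
  proof (intro prod.cong refl)
    fix i assume "i \<in> {..<card J}"
    then have "A' i = A (h i)" using A'(1) by simp
    then show "expectation (\<lambda>w. iexp (c (h i) * W (A' i) w)) = exp (- complex_of_real (measure m (A (h i))) * stable_exponent \<gamma> b (c (h i)))"
      using W_char[OF A'(2)[of i], of "c (h i)"] by (simp only:)
  qed
  also have "\<dots> = (\<Prod>j\<in>J. exp (- complex_of_real (measure m (A j)) * stable_exponent \<gamma> b (c j)))"
    using h by (rule prod.reindex_bij_betw)
  also have "\<dots> = exp (- (\<Sum>j\<in>J. complex_of_real (measure m (A j)) * stable_exponent \<gamma> b (c j)))"
    using J by (simp add: exp_sum sum_negf[symmetric])
  finally show ?thesis .
qed

lemma simple_integral_measurable:
  assumes "integrable_simple m s"
  shows "simple_stable_integral m W s \<in> borel_measurable Q"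
proof -
  have [measurable]: "W (s -` {c} \<inter> space m) \<in> borel_measurable Q" if "c \<in> s ` space m - {0}" for c
    using assms that by (intro W_measurable) (auto simp: integrable_simple_def)
  show ?thesis unfolding simple_stable_integral_def[abs_def] by (intro borel_measurable_sum borel_measurable_times) measurable
qed

text \<open>The simple functions are refined together: on the set \<open>A v\<close> where the
  vector of their values is \<open>v\<close>, every linear combination is constant, and these sets
  are disjoint, so their random masses are independent. The vector 0 is left out of \<open>F\<close>
  because its set may have infinite measure; it contributes nothing.\<close>

lemma simple_integral_char:
  fixes s :: "'i::finite \<Rightarrow> 'a \<Rightarrow> real"
  assumes s: "\<And>k. integrable_simple m (s k)"
  shows "integrable m (\<lambda>x. stable_exponent \<gamma> b (\<Sum>k\<in>UNIV. t k * s k x))"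
    and "expectation (\<lambda>w. iexp (\<Sum>k\<in>UNIV. t k * simple_stable_integral m W (s k) w)) =
    exp (- (CLINT x|m. stable_exponent \<gamma> b (\<Sum>k\<in>UNIV. t k * s k x)))"
proof -
  have sf: "simple_function m (s k)" for k using s by (auto simp: integrable_simple_def)
  define F where "F = (\<lambda>x k. s k x) ` space m - {\<lambda>_. 0}"
  have "(\<lambda>x k. s k x) ` space m \<subseteq> PiE UNIV (\<lambda>k. s k ` space m)" by auto
  moreover have "finite (PiE UNIV (\<lambda>k. s k ` space m))"
    using simple_functionD(1)[OF sf] by (intro finite_PiE) auto
  ultimately have F: "finite F" unfolding F_def using finite_subset by blast
  define A where "A v = {x \<in> space m. \<forall>k. s k x = v k}" for v :: "'i \<Rightarrow> real"
  have A_sets: "A v \<in> sets m" for v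
  proof -
    have "A v = (\<Inter>k\<in>UNIV. s k -` {v k} \<inter> space m)" by (auto simp: A_def)
    also have "\<dots> \<in> sets m" using simple_functionD(2)[OF sf] by (intro sets.finite_INT) auto
    finally show ?thesis .
  qed
  have A_fin: "A v \<in> finite_sets m" if "v \<in> F" for v
  proof -
    from that obtain k where k: "v k \<noteq> 0" by (auto simp: F_def fun_eq_iff)
    have "emeasure m (A v) \<le> emeasure m (s k -` {v k} \<inter> space m)"
      using simple_functionD(2)[OF sf] by (intro emeasure_mono) (auto simp: A_def)
    also have "\<dots> < \<infinity>" using s[of k] k by (auto simp: integrable_simple_def finite_sets_def)
    finally show ?thesis using A_sets by (simp add: finite_sets_def)
  qed
  have A_disj: "disjoint_family_on A F'" for F'
    by (auto simp: disjoint_family_on_def A_def fun_eq_iff)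
  have level: "s k -` {c} \<inter> space m = (\<Union>v\<in>{v\<in>F. v k = c}. A v)" if "c \<noteq> 0" for k c
    using that by (auto simp: A_def F_def fun_eq_iff)
  \<comment> \<open>Additivity over the refinement holds almost surely for each level set
    separately. There are only finitely many level sets, so one exceptional set serves them
    all.\<close>
  have W_level: "AE w in Q. \<forall>k. \<forall>c\<in>s k ` space m - {0}. W (s k -` {c} \<inter> space m) w = (\<Sum>v\<in>{v\<in>F. v k = c}. W (A v) w)"
  proof (subst AE_all_countable, intro allI)
    fix k
    have fin: "countable (s k ` space m - {0})" using simple_functionD(1)[OF sf] by (simp add: countable_finite)
    show "AE w in Q. \<forall>c\<in>s k ` space m - {0}. W (s k -` {c} \<inter> space m) w = (\<Sum>v\<in>{v\<in>F. v k = c}. W (A v) w)"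
    proof (subst AE_ball_countable[OF fin], intro ballI)
      fix c assume "c \<in> s k ` space m - {0}"
      then have "c \<noteq> 0" by auto
      then show "AE w in Q. W (s k -` {c} \<inter> space m) w = (\<Sum>v\<in>{v\<in>F. v k = c}. W (A v) w)"
        unfolding level[OF \<open>c \<noteq> 0\<close>] using F A_fin A_disj by (intro W_finite_additive) auto
    qed
  qed
  let ?c = "\<lambda>v. \<Sum>k\<in>UNIV. t k * v k"
  have "AE w in Q. (\<Sum>k\<in>UNIV. t k * simple_stable_integral m W (s k) w) = (\<Sum>v\<in>F. ?c v * W (A v) w)"
    using W_level
  proof eventually_elim
    fix w assume w: "\<forall>k. \<forall>c\<in>s k ` space m - {0}. W (s k -` {c} \<inter> space m) w = (\<Sum>v\<in>{v\<in>F. v k = c}. W (A v) w)"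
    have one: "simple_stable_integral m W (s k) w = (\<Sum>v\<in>F. v k * W (A v) w)" for k
    proof -
      let ?R = "s k ` space m - {0}"
      have R: "finite ?R" using simple_functionD(1)[OF sf] by simp
      have "simple_stable_integral m W (s k) w = (\<Sum>c\<in>?R. \<Sum>v\<in>{v\<in>F. v k = c}. v k * W (A v) w)"
        unfolding simple_stable_integral_def
      proof (rule sum.cong[OF refl])
        fix c assume "c \<in> ?R"
        then have "c * W (s k -` {c} \<inter> space m) w = c * (\<Sum>v\<in>{v\<in>F. v k = c}. W (A v) w)" using w by auto
        then show "c * W (s k -` {c} \<inter> space m) w = (\<Sum>v\<in>{v\<in>F. v k = c}. v k * W (A v) w)"
          by (simp add: sum_distrib_left)
      qed
      also have "\<dots> = (\<Sum>c\<in>?R. \<Sum>v\<in>{v\<in>{v\<in>F. v k \<in> ?R}. v k = c}. v k * W (A v) w)"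
        by (intro sum.cong refl) auto
      also have "\<dots> = (\<Sum>v\<in>{v\<in>F. v k \<in> ?R}. v k * W (A v) w)"
        using F R by (intro sum.group) auto
      also have "\<dots> = (\<Sum>v\<in>F. v k * W (A v) w)"
        using F by (intro sum.mono_neutral_left) (auto simp: F_def)
      finally show ?thesis .
    qed
    have "(\<Sum>k\<in>UNIV. t k * simple_stable_integral m W (s k) w) = (\<Sum>k\<in>UNIV. \<Sum>v\<in>F. t k * v k * W (A v) w)"
      by (simp add: one sum_distrib_left mult.assoc)
    also have "\<dots> = (\<Sum>v\<in>F. \<Sum>k\<in>UNIV. t k * v k * W (A v) w)" by (rule sum.swap)
    also have "\<dots> = (\<Sum>v\<in>F. ?c v * W (A v) w)" by (simp add: sum_distrib_right)
    finally show "(\<Sum>k\<in>UNIV. t k * simple_stable_integral m W (s k) w) = (\<Sum>v\<in>F. ?c v * W (A v) w)" .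
  qed
  then have ae: "AE w in Q. iexp (\<Sum>k\<in>UNIV. t k * simple_stable_integral m W (s k) w) = iexp (\<Sum>v\<in>F. ?c v * W (A v) w)"
    by eventually_elim (simp only:)
  have m1: "(\<lambda>w. iexp (\<Sum>k\<in>UNIV. t k * simple_stable_integral m W (s k) w)) \<in> borel_measurable Q"
  proof -
    have [measurable]: "simple_stable_integral m W (s k) \<in> borel_measurable Q" for k by (rule simple_integral_measurable[OF s])
    show ?thesis by measurable
  qed
  have m2: "(\<lambda>w. iexp (\<Sum>v\<in>F. ?c v * W (A v) w)) \<in> borel_measurable Q"
  proof -
    have [measurable]: "(\<lambda>w. \<Sum>v\<in>F. ?c v * W (A v) w) \<in> borel_measurable Q"
      using W_measurable[OF A_fin] by (intro borel_measurable_sum borel_measurable_times) auto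
    show ?thesis by measurable
  qed
  have "expectation (\<lambda>w. iexp (\<Sum>k\<in>UNIV. t k * simple_stable_integral m W (s k) w)) = expectation (\<lambda>w. iexp (\<Sum>v\<in>F. ?c v * W (A v) w))"
    by (rule integral_cong_AE[OF m1 m2 ae])
  also have "\<dots> = exp (- (\<Sum>v\<in>F. complex_of_real (measure m (A v)) * stable_exponent \<gamma> b (?c v)))"
    using F A_fin A_disj by (intro W_combination_char) auto
  finally have E: "expectation (\<lambda>w. iexp (\<Sum>k\<in>UNIV. t k * simple_stable_integral m W (s k) w)) =
    exp (- (\<Sum>v\<in>F. complex_of_real (measure m (A v)) * stable_exponent \<gamma> b (?c v)))" .
  have pt: "stable_exponent \<gamma> b (\<Sum>k\<in>UNIV. t k * s k x) = (\<Sum>v\<in>F. indicator (A v) x *\<^sub>R stable_exponent \<gamma> b (?c v))" if x: "x \<in> space m" for x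
  proof -
    let ?v = "\<lambda>k. s k x"
    have "(\<Sum>v\<in>F. indicator (A v) x *\<^sub>R stable_exponent \<gamma> b (?c v)) = (\<Sum>v\<in>F. if v = ?v then stable_exponent \<gamma> b (?c v) else 0)"
    proof (rule sum.cong[OF refl])
      fix v
      have "x \<in> A v \<longleftrightarrow> v = ?v" using x by (auto simp: A_def fun_eq_iff)
      then show "indicator (A v) x *\<^sub>R stable_exponent \<gamma> b (?c v) = (if v = ?v then stable_exponent \<gamma> b (?c v) else 0)"
        by (simp add: indicator_def)
    qed
    also have "\<dots> = (if ?v \<in> F then stable_exponent \<gamma> b (?c ?v) else 0)" using F by simp
    also have "\<dots> = stable_exponent \<gamma> b (?c ?v)"
    proof (cases "?v \<in> F")
      case False
      then have "?v = (\<lambda>_. 0)" using x unfolding F_def by blast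
      then have "s k x = 0" for k by (rule fun_cong)
      then show ?thesis by simp
    qed simp
    finally show ?thesis ..
  qed
  have iA: "integrable m (\<lambda>x. indicator (A v) x *\<^sub>R stable_exponent \<gamma> b (?c v))" if "v \<in> F" for v
    using A_fin[OF that] by (intro integrable_scaleR_left integrable_real_indicator) (auto simp: finite_sets_def)
  show "integrable m (\<lambda>x. stable_exponent \<gamma> b (\<Sum>k\<in>UNIV. t k * s k x))"
    using iA by (subst Bochner_Integration.integrable_cong[OF refl pt]) auto
  have "(CLINT x|m. stable_exponent \<gamma> b (\<Sum>k\<in>UNIV. t k * s k x)) = (\<Sum>v\<in>F. CLINT x|m. indicator (A v) x *\<^sub>R stable_exponent \<gamma> b (?c v))"
    using iA by (subst Bochner_Integration.integral_cong[OF refl pt]) (auto intro!: Bochner_Integration.integral_sum)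
  also have "\<dots> = (\<Sum>v\<in>F. complex_of_real (measure m (A v)) * stable_exponent \<gamma> b (?c v))"
  proof (rule sum.cong[OF refl])
    fix v assume "v \<in> F"
    then have "integrable m (indicator (A v) :: _ \<Rightarrow> real)" "A v \<subseteq> space m"
      using A_fin[of v] sets.sets_into_space by (auto simp: finite_sets_def intro!: integrable_real_indicator)
    then show "(CLINT x|m. indicator (A v) x *\<^sub>R stable_exponent \<gamma> b (?c v)) = complex_of_real (measure m (A v)) * stable_exponent \<gamma> b (?c v)"
      by (simp add: integral_scaleR_left scaleR_conv_of_real Int_absorb2)
  qed
  finally show "expectation (\<lambda>w. iexp (\<Sum>k\<in>UNIV. t k * simple_stable_integral m W (s k) w)) =
    exp (- (CLINT x|m. stable_exponent \<gamma> b (\<Sum>k\<in>UNIV. t k * s k x)))" using E by simp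
qed

text \<open>Both sides are continuous along the approximating simple functions: the left one because
  \<open>iexp\<close> is bounded and Lipschitz and the integrals converge in probability, the right
  one because convergence in L^\<gamma> carries over to the integral of
  \<open>stable_exponent\<close> by \<open>stable_exponent_diff_le\<close>.\<close>

lemma stable_integral_char:
  fixes \<psi> :: "'i::finite \<Rightarrow> 'a \<Rightarrow> real"
  assumes Y: "\<And>k. has_stable_integral Q \<gamma> m W (\<psi> k) (Y k)"
  shows "expectation (\<lambda>w. iexp (\<Sum>k\<in>UNIV. t k * Y k w)) = exp (- (CLINT x|m. stable_exponent \<gamma> b (\<Sum>k\<in>UNIV. t k * \<psi> k x)))"
proof -
  have \<psi>m[measurable]: "\<psi> k \<in> borel_measurable m" and \<psi>i: "integrable m (\<lambda>x. \<bar>\<psi> k x\<bar> powr \<gamma>)" and Ym[measurable]: "Y k \<in> borel_measurable Q" for k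
    using Y[of k] by (auto simp: has_stable_integral_def)
  have "\<forall>k. \<exists>s. (\<forall>n. integrable_simple m (s n)) \<and>
        (\<lambda>n. \<integral>\<^sup>+x. ennreal (\<bar>s n x - \<psi> k x\<bar> powr \<gamma>) \<partial>m) \<longlonglongrightarrow> 0 \<and>
        conv_in_prob Q (\<lambda>n. simple_stable_integral m W (s n)) (Y k)"
    using Y by (simp add: has_stable_integral_def)
  from choice[OF this] obtain s where s0: "\<forall>k. (\<forall>n. integrable_simple m (s k n)) \<and>
        (\<lambda>n. \<integral>\<^sup>+x. ennreal (\<bar>s k n x - \<psi> k x\<bar> powr \<gamma>) \<partial>m) \<longlonglongrightarrow> 0 \<and>
        conv_in_prob Q (\<lambda>n. simple_stable_integral m W (s k n)) (Y k)" by (rule exE)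
  then have s: "\<And>k n. integrable_simple m (s k n)"
    and s_lim: "\<And>k. (\<lambda>n. \<integral>\<^sup>+x. ennreal (\<bar>s k n x - \<psi> k x\<bar> powr \<gamma>) \<partial>m) \<longlonglongrightarrow> 0"
    and s_prob: "\<And>k. conv_in_prob Q (\<lambda>n. simple_stable_integral m W (s k n)) (Y k)"
    by simp_all
  have sm[measurable]: "s k n \<in> borel_measurable m" for k n
    using s[of k n] by (auto simp: integrable_simple_def intro: borel_measurable_simple_function)
  define I where "I k n = simple_stable_integral m W (s k n)" for k n
  have Im[measurable]: "I k n \<in> borel_measurable Q" for k n unfolding I_def by (rule simple_integral_measurable[OF s])
  have lim1: "(\<lambda>n. expectation (\<lambda>w. iexp (\<Sum>k\<in>UNIV. t k * I k n w))) \<longlonglongrightarrow> expectation (\<lambda>w. iexp (\<Sum>k\<in>UNIV. t k * Y k w))"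
  proof (rule LIM_zero_cancel, rule Lim_null_comparison)
    have ie: "integrable Q (\<lambda>w. iexp (f w))" if "f \<in> borel_measurable Q" for f
      using that by (intro integrable_const_bound[of _ 1]) (simp_all only: norm_exp_i_times, simp_all)
    have im: "integrable Q (\<lambda>w. min 2 \<bar>t k * I k n w - t k * Y k w\<bar>)" for k n
      by (intro integrable_const_bound[of _ 2]) auto
    show "\<forall>\<^sub>F n in sequentially. norm (expectation (\<lambda>w. iexp (\<Sum>k\<in>UNIV. t k * I k n w)) - expectation (\<lambda>w. iexp (\<Sum>k\<in>UNIV. t k * Y k w)))
      \<le> (\<Sum>k\<in>UNIV. expectation (\<lambda>w. min 2 \<bar>t k * I k n w - t k * Y k w\<bar>))"
    proof (intro always_eventually allI)
      fix n
      have iU: "integrable Q (\<lambda>w. iexp (\<Sum>k\<in>UNIV. t k * I k n w))" by (rule ie) measurable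
      have iV: "integrable Q (\<lambda>w. iexp (\<Sum>k\<in>UNIV. t k * Y k w))" by (rule ie) measurable
      have "norm (expectation (\<lambda>w. iexp (\<Sum>k\<in>UNIV. t k * I k n w)) - expectation (\<lambda>w. iexp (\<Sum>k\<in>UNIV. t k * Y k w))) =
        norm (expectation (\<lambda>w. iexp (\<Sum>k\<in>UNIV. t k * I k n w) - iexp (\<Sum>k\<in>UNIV. t k * Y k w)))"
        by (simp only: Bochner_Integration.integral_diff[OF iU iV])
      also have "\<dots> \<le> expectation (\<lambda>w. norm (iexp (\<Sum>k\<in>UNIV. t k * I k n w) - iexp (\<Sum>k\<in>UNIV. t k * Y k w)))"
        by (rule integral_norm_bound)
      also have "\<dots> \<le> expectation (\<lambda>w. \<Sum>k\<in>UNIV. min 2 \<bar>t k * I k n w - t k * Y k w\<bar>)"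
      proof (rule integral_mono)
        fix w
        have "norm (iexp (\<Sum>k\<in>UNIV. t k * I k n w) - iexp (\<Sum>k\<in>UNIV. t k * Y k w)) \<le> min 2 \<bar>\<Sum>k\<in>UNIV. t k * I k n w - t k * Y k w\<bar>"
          unfolding sum_subtractf by (rule iexp_diff_le)
        also have "\<dots> \<le> min 2 (\<Sum>k\<in>UNIV. \<bar>t k * I k n w - t k * Y k w\<bar>)"
          by (intro min.mono order.refl sum_abs)
        also have "\<dots> \<le> (\<Sum>k\<in>UNIV. min 2 \<bar>t k * I k n w - t k * Y k w\<bar>)"
        \<comment> \<open>Subadditivity of \<open>min 2\<close>: a summand that reaches the cap
          suffices alone, and otherwise no cap is active. This reduces the linear combination to the
          single integrals.\<close>
        proof (cases "\<exists>k. 2 \<le> \<bar>t k * I k n w - t k * Y k w\<bar>")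
          case True
          then obtain k where "2 \<le> \<bar>t k * I k n w - t k * Y k w\<bar>" by blast
          then have "2 = min 2 \<bar>t k * I k n w - t k * Y k w\<bar>" by simp
          also have "\<dots> \<le> (\<Sum>k\<in>UNIV. min 2 \<bar>t k * I k n w - t k * Y k w\<bar>)"
            by (rule member_le_sum[of k UNIV "\<lambda>k. min 2 \<bar>t k * I k n w - t k * Y k w\<bar>"]) auto
          finally show ?thesis by simp
        next
          case False
          then have "min 2 \<bar>t k * I k n w - t k * Y k w\<bar> = \<bar>t k * I k n w - t k * Y k w\<bar>" for k
            by (simp add: not_le min_absorb2 less_imp_le)
          then show ?thesis by simp
        qed
        finally show "norm (iexp (\<Sum>k\<in>UNIV. t k * I k n w) - iexp (\<Sum>k\<in>UNIV. t k * Y k w)) \<le> (\<Sum>k\<in>UNIV. min 2 \<bar>t k * I k n w - t k * Y k w\<bar>)" .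
      qed (intro im iU iV Bochner_Integration.integrable_norm Bochner_Integration.integrable_diff Bochner_Integration.integrable_sum)+
      also have "\<dots> = (\<Sum>k\<in>UNIV. expectation (\<lambda>w. min 2 \<bar>t k * I k n w - t k * Y k w\<bar>))"
        by (intro Bochner_Integration.integral_sum im)
      finally show "norm (expectation (\<lambda>w. iexp (\<Sum>k\<in>UNIV. t k * I k n w)) - expectation (\<lambda>w. iexp (\<Sum>k\<in>UNIV. t k * Y k w)))
        \<le> (\<Sum>k\<in>UNIV. expectation (\<lambda>w. min 2 \<bar>t k * I k n w - t k * Y k w\<bar>))" .
    qed
    have "(\<lambda>n. expectation (\<lambda>w. min 2 \<bar>t k * I k n w - t k * Y k w\<bar>)) \<longlonglongrightarrow> 0" for k
    proof (rule LIMSEQ_I)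
      fix r :: real assume r: "0 < r"
      \<comment> \<open>Where the two integrals are within \<open>e\<close> of each other, the
        truncated difference is at most \<open>\<bar>t k\<bar> * e\<close>, less than
        \<open>r / 2\<close>; elsewhere it is at most 2, on an event of probability below
        \<open>r / 4\<close>. The added 1 covers \<open>t k = 0\<close>.\<close>
      define e where "e = r / (2 * (\<bar>t k\<bar> + 1))"
      have e: "0 < e" "\<bar>t k\<bar> * e < r / 2 + 0"
      proof -
        show "0 < e" using r by (simp add: e_def add_nonneg_pos)
        have "\<bar>t k\<bar> * e < (\<bar>t k\<bar> + 1) * e" using \<open>0 < e\<close> by simp
        also have "(\<bar>t k\<bar> + 1) * e = r / 2"
        proof -
          have "\<bar>t k\<bar> + 1 \<noteq> 0" by linarith
          moreover have "x * (r / (2 * x)) = r / 2" if "x \<noteq> 0" for x :: real using that by simp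
          ultimately show ?thesis by (simp only: e_def)
        qed
        finally show "\<bar>t k\<bar> * e < r / 2 + 0" by simp
      qed
      let ?P = "\<lambda>n. prob {w \<in> space Q. \<bar>I k n w - Y k w\<bar> > e}"
      have "?P \<longlonglongrightarrow> 0" using s_prob[of k] e(1) unfolding conv_in_prob_def I_def by blast
      from LIMSEQ_D[OF this, of "r / 4"] r obtain n0 where n0: "\<And>n. n \<ge> n0 \<Longrightarrow> ?P n < r / 4" by auto
      have "norm (expectation (\<lambda>w. min 2 \<bar>t k * I k n w - t k * Y k w\<bar>) - 0) < r" if "n \<ge> n0" for n
      proof -
        let ?A = "{w \<in> space Q. \<bar>I k n w - Y k w\<bar> > e}"
        have A: "?A \<in> events" by measurable
        have iA: "integrable Q (indicator ?A :: _ \<Rightarrow> real)"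
          using A by (intro integrable_real_indicator) (auto simp: emeasure_eq_measure)
        have "expectation (\<lambda>w. min 2 \<bar>t k * I k n w - t k * Y k w\<bar>) \<le> expectation (\<lambda>w. \<bar>t k\<bar> * e + 2 * indicator ?A w)"
        proof (rule integral_mono)
          fix w assume w: "w \<in> space Q"
          show "min 2 \<bar>t k * I k n w - t k * Y k w\<bar> \<le> \<bar>t k\<bar> * e + 2 * indicator ?A w"
          proof (cases "\<bar>I k n w - Y k w\<bar> > e")
            case True
            then show ?thesis using w e(1) by (simp add: min.coboundedI1)
          next
            case False
            have "\<bar>t k * I k n w - t k * Y k w\<bar> = \<bar>t k\<bar> * \<bar>I k n w - Y k w\<bar>"
              by (simp add: abs_mult[symmetric] right_diff_distrib)
            also have "\<dots> \<le> \<bar>t k\<bar> * e" using False by (intro mult_left_mono) auto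
            finally show ?thesis by (simp add: min.coboundedI2 indicator_def)
          qed
        next
          show "integrable Q (\<lambda>w. \<bar>t k\<bar> * e + 2 * indicator ?A w)"
            by (intro Bochner_Integration.integrable_add integrable_mult_right iA integrable_const)
        qed (rule im)
        also have "\<dots> = \<bar>t k\<bar> * e + 2 * expectation (indicator ?A)"
          using iA by (subst Bochner_Integration.integral_add) (auto simp: prob_space)
        also have "expectation (indicator ?A) = ?P n" using sets.sets_into_space[OF A] by (simp add: Int_absorb2)
        also have "\<bar>t k\<bar> * e + 2 * ?P n < r" using e(2) n0[OF that] by simp
        finally show ?thesis by simp
      qed
      then show "\<exists>no. \<forall>n\<ge>no. norm (expectation (\<lambda>w. min 2 \<bar>t k * I k n w - t k * Y k w\<bar>) - 0) < r" by blast
    qed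
    then show "(\<lambda>n. \<Sum>k\<in>UNIV. expectation (\<lambda>w. min 2 \<bar>t k * I k n w - t k * Y k w\<bar>)) \<longlonglongrightarrow> 0"
      by (rule tendsto_null_sum)
  qed
  define f where "f n x = (\<Sum>k\<in>UNIV. t k * s k n x)" for n x
  define g where "g x = (\<Sum>k\<in>UNIV. t k * \<psi> k x)" for x
  have [measurable]: "f n \<in> borel_measurable m" "g \<in> borel_measurable m" for n unfolding f_def g_def by measurable
  have i_f: "integrable m (\<lambda>x. stable_exponent \<gamma> b (f n x))"
    and E_f: "expectation (\<lambda>w. iexp (\<Sum>k\<in>UNIV. t k * I k n w)) = exp (- (CLINT x|m. stable_exponent \<gamma> b (f n x)))" for n
    using simple_integral_char[of "\<lambda>k. s k n" t, OF s] unfolding f_def I_def by auto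
  let ?N = "real CARD('i) powr \<gamma>"
  have gi: "integrable m (\<lambda>x. \<bar>g x\<bar> powr \<gamma>)"
  proof (rule Bochner_Integration.integrable_bound)
    show "integrable m (\<lambda>x. ?N * (\<Sum>k\<in>UNIV. \<bar>t k\<bar> powr \<gamma> * \<bar>\<psi> k x\<bar> powr \<gamma>))"
      by (intro integrable_mult_right Bochner_Integration.integrable_sum \<psi>i)
    show "AE x in m. norm (\<bar>g x\<bar> powr \<gamma>) \<le> norm (?N * (\<Sum>k\<in>UNIV. \<bar>t k\<bar> powr \<gamma> * \<bar>\<psi> k x\<bar> powr \<gamma>))"
      using powr_sum_le[OF gamma_pos, of UNIV "\<lambda>k. t k * \<psi> k x" for x]
      by (intro AE_I2) (simp add: g_def abs_mult powr_mult sum_nonneg)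
  qed simp
  have i_g: "integrable m (\<lambda>x. stable_exponent \<gamma> b (g x))"
  proof (rule Bochner_Integration.integrable_bound)
    show "integrable m (\<lambda>x. (1 + \<bar>b * tan (pi * \<gamma> / 2)\<bar>) * \<bar>g x\<bar> powr \<gamma>)" using gi by (rule integrable_mult_right)
    show "AE x in m. norm (stable_exponent \<gamma> b (g x)) \<le> norm ((1 + \<bar>b * tan (pi * \<gamma> / 2)\<bar>) * \<bar>g x\<bar> powr \<gamma>)"
      using norm_stable_exponent_le by (intro AE_I2) (simp add: abs_mult)
  qed measurable
  define D where "D n = (\<integral>\<^sup>+x. ennreal (\<bar>f n x - g x\<bar> powr \<gamma>) \<partial>m)" for n
  have D_lim: "D \<longlonglongrightarrow> 0"
  proof -
    have D_le: "D n \<le> (\<Sum>k\<in>UNIV. ennreal (?N * \<bar>t k\<bar> powr \<gamma>) * (\<integral>\<^sup>+x. ennreal (\<bar>s k n x - \<psi> k x\<bar> powr \<gamma>) \<partial>m))" for n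
    proof -
      have "D n \<le> (\<integral>\<^sup>+x. (\<Sum>k\<in>UNIV. ennreal (?N * \<bar>t k\<bar> powr \<gamma>) * ennreal (\<bar>s k n x - \<psi> k x\<bar> powr \<gamma>)) \<partial>m)"
        unfolding D_def
      proof (rule nn_integral_mono)
        fix x
        have "f n x - g x = (\<Sum>k\<in>UNIV. t k * (s k n x - \<psi> k x))"
          by (simp add: f_def g_def sum_subtractf right_diff_distrib)
        then have "\<bar>f n x - g x\<bar> powr \<gamma> \<le> ?N * (\<Sum>k\<in>UNIV. \<bar>t k * (s k n x - \<psi> k x)\<bar> powr \<gamma>)"
          using powr_sum_le[OF gamma_pos, of UNIV "\<lambda>k. t k * (s k n x - \<psi> k x)"] by simp
        also have "\<dots> = (\<Sum>k\<in>UNIV. ?N * \<bar>t k\<bar> powr \<gamma> * \<bar>s k n x - \<psi> k x\<bar> powr \<gamma>)"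
          by (simp add: abs_mult powr_mult sum_distrib_left mult.assoc)
        finally have "ennreal (\<bar>f n x - g x\<bar> powr \<gamma>) \<le> ennreal (\<Sum>k\<in>UNIV. ?N * \<bar>t k\<bar> powr \<gamma> * \<bar>s k n x - \<psi> k x\<bar> powr \<gamma>)"
          by (rule ennreal_leI)
        also have "\<dots> = (\<Sum>k\<in>UNIV. ennreal (?N * \<bar>t k\<bar> powr \<gamma>) * ennreal (\<bar>s k n x - \<psi> k x\<bar> powr \<gamma>))"
          by (subst sum_ennreal[symmetric]) (auto simp: ennreal_mult)
        finally show "ennreal (\<bar>f n x - g x\<bar> powr \<gamma>) \<le> (\<Sum>k\<in>UNIV. ennreal (?N * \<bar>t k\<bar> powr \<gamma>) * ennreal (\<bar>s k n x - \<psi> k x\<bar> powr \<gamma>))" .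
      qed
      also have "\<dots> = (\<Sum>k\<in>UNIV. ennreal (?N * \<bar>t k\<bar> powr \<gamma>) * (\<integral>\<^sup>+x. ennreal (\<bar>s k n x - \<psi> k x\<bar> powr \<gamma>) \<partial>m))"
        by (subst nn_integral_sum) (auto intro!: sum.cong nn_integral_cmult)
      finally show ?thesis .
    qed
    have "(\<lambda>n. ennreal (?N * \<bar>t k\<bar> powr \<gamma>) * (\<integral>\<^sup>+x. ennreal (\<bar>s k n x - \<psi> k x\<bar> powr \<gamma>) \<partial>m)) \<longlonglongrightarrow> 0" for k
      using ennreal_tendsto_cmult[OF _ s_lim[of k], of "ennreal (?N * \<bar>t k\<bar> powr \<gamma>)"] by simp
    then have up: "(\<lambda>n. \<Sum>k\<in>UNIV. ennreal (?N * \<bar>t k\<bar> powr \<gamma>) * (\<integral>\<^sup>+x. ennreal (\<bar>s k n x - \<psi> k x\<bar> powr \<gamma>) \<partial>m)) \<longlonglongrightarrow> 0"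
      by (rule tendsto_null_sum)
    show ?thesis
      by (rule tendsto_sandwich[OF _ _ tendsto_const up]) (use D_le in auto)
  qed
  have lim2: "(\<lambda>n. CLINT x|m. stable_exponent \<gamma> b (f n x)) \<longlonglongrightarrow> (CLINT x|m. stable_exponent \<gamma> b (g x))"
  proof (rule LIMSEQ_I)
    fix r :: real assume r: "0 < r"
    define P where "P = (LINT x|m. \<bar>g x\<bar> powr \<gamma>)"
    have P0: "0 \<le> P" unfolding P_def by (intro integral_nonneg_AE) auto
    \<comment> \<open>\<open>e\<close> controls the part proportional to the fixed integral
      \<open>P\<close>; the constant \<open>C\<close> obtained below depends on \<open>e\<close> and
      is beaten by the convergence of \<open>D n\<close> to 0. The added 1 covers
      \<open>P = 0\<close>.\<close>
    define e where "e = r / (2 * (P + 1))"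
    have e0: "0 < e" using r P0 by (simp add: e_def)
    have eP: "e * P < r / 2"
    proof -
      have "e * P < e * (P + 1)" using e0 by simp
      also have "\<dots> = r / 2"
      proof -
        have "r / (2 * x) * x = r / 2" if "x \<noteq> 0" for x :: real using that by simp
        moreover have "P + 1 \<noteq> 0" using P0 by simp
        ultimately show ?thesis by (simp only: e_def)
      qed
      finally show ?thesis .
    qed
    obtain C where C: "0 \<le> C" "\<And>a v. cmod (stable_exponent \<gamma> b a - stable_exponent \<gamma> b v) \<le> e * \<bar>v\<bar> powr \<gamma> + C * \<bar>a - v\<bar> powr \<gamma>"
      using stable_exponent_diff_le[OF gamma_pos e0] by blast
    have "(\<lambda>n. ennreal C * D n) \<longlonglongrightarrow> 0" using ennreal_tendsto_cmult[OF _ D_lim, of "ennreal C"] by simp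
    then have "\<forall>\<^sub>F n in sequentially. ennreal C * D n < ennreal (r / 2)" using r by (intro order_tendstoD(2)) auto
    then obtain n0 where n0: "\<And>n. n \<ge> n0 \<Longrightarrow> ennreal C * D n < ennreal (r / 2)" by (auto simp: eventually_sequentially)
    have "norm ((CLINT x|m. stable_exponent \<gamma> b (f n x)) - (CLINT x|m. stable_exponent \<gamma> b (g x))) < r" if n: "n \<ge> n0" for n
    proof -
      have "ennreal (norm ((CLINT x|m. stable_exponent \<gamma> b (f n x)) - (CLINT x|m. stable_exponent \<gamma> b (g x)))) =
        ennreal (norm (CLINT x|m. stable_exponent \<gamma> b (f n x) - stable_exponent \<gamma> b (g x)))"
        using i_f i_g by simp
      also have "\<dots> \<le> (\<integral>\<^sup>+x. norm (stable_exponent \<gamma> b (f n x) - stable_exponent \<gamma> b (g x)) \<partial>m)"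
        using i_f i_g by (intro integral_norm_bound_ennreal) auto
      also have "\<dots> \<le> (\<integral>\<^sup>+x. ennreal e * ennreal (\<bar>g x\<bar> powr \<gamma>) + ennreal C * ennreal (\<bar>f n x - g x\<bar> powr \<gamma>) \<partial>m)"
      proof (rule nn_integral_mono)
        fix x
        have "ennreal (norm (stable_exponent \<gamma> b (f n x) - stable_exponent \<gamma> b (g x))) \<le> ennreal (e * \<bar>g x\<bar> powr \<gamma> + C * \<bar>f n x - g x\<bar> powr \<gamma>)"
          by (intro ennreal_leI C(2))
        then show "ennreal (norm (stable_exponent \<gamma> b (f n x) - stable_exponent \<gamma> b (g x))) \<le> ennreal e * ennreal (\<bar>g x\<bar> powr \<gamma>) + ennreal C * ennreal (\<bar>f n x - g x\<bar> powr \<gamma>)"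
          using e0 C(1) by (simp add: ennreal_mult)
      qed
      also have "\<dots> = ennreal e * (\<integral>\<^sup>+x. ennreal (\<bar>g x\<bar> powr \<gamma>) \<partial>m) + ennreal C * D n"
        unfolding D_def by (subst nn_integral_add) (auto simp: nn_integral_cmult)
      also have "(\<integral>\<^sup>+x. ennreal (\<bar>g x\<bar> powr \<gamma>) \<partial>m) = ennreal P"
        unfolding P_def using gi by (intro nn_integral_eq_integral) auto
      also have "ennreal e * ennreal P + ennreal C * D n < ennreal (r / 2) + ennreal (r / 2)"
      proof (rule add_strict_mono)
        show "ennreal e * ennreal P < ennreal (r / 2)" using e0 eP P0 by (simp add: ennreal_mult[symmetric] ennreal_lessI r)
        show "ennreal C * D n < ennreal (r / 2)" by (rule n0[OF n])
      qed
      also have "\<dots> = ennreal r" using r by (simp flip: ennreal_plus)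
      finally show ?thesis by (simp add: ennreal_less_iff)
    qed
    then show "\<exists>no. \<forall>n\<ge>no. norm ((CLINT x|m. stable_exponent \<gamma> b (f n x)) - (CLINT x|m. stable_exponent \<gamma> b (g x))) < r" by blast
  qed
  have "(\<lambda>n. exp (- (CLINT x|m. stable_exponent \<gamma> b (f n x)))) \<longlonglongrightarrow> exp (- (CLINT x|m. stable_exponent \<gamma> b (g x)))"
    by (intro tendsto_intros lim2)
  then have "(\<lambda>n. expectation (\<lambda>w. iexp (\<Sum>k\<in>UNIV. t k * I k n w))) \<longlonglongrightarrow> exp (- (CLINT x|m. stable_exponent \<gamma> b (g x)))"
    unfolding E_f .
  from LIMSEQ_unique[OF lim1 this] show ?thesis by (simp add: g_def)
qed

end

section \<open>Centred exponentials and the limit exponent\<close>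

text \<open>Integrand of a Levy-Khintchine exponent compensated at all jump sizes. Its two bounds,
  linear for large and quadratic for small arguments, correspond to large and small balls.\<close>

definition centered_iexp :: "real \<Rightarrow> complex" where
  "centered_iexp u = iexp u - 1 - \<i> * complex_of_real u"

lemma centered_iexp_0[simp]: "centered_iexp 0 = 0"
  by (simp add: centered_iexp_def)

lemma borel_measurable_centered_iexp[measurable]: "centered_iexp \<in> borel_measurable borel"
  unfolding centered_iexp_def by measurable

lemma centered_iexp_lipschitz: "norm (centered_iexp x - centered_iexp y) \<le> 2 * \<bar>x - y\<bar>"
proof -
  have "centered_iexp x - centered_iexp y = (iexp x - iexp y) - \<i> * complex_of_real (x - y)"
    by (simp add: centered_iexp_def algebra_simps)
  also have "norm \<dots> \<le> norm (iexp x - iexp y) + norm (\<i> * complex_of_real (x - y))" by (rule norm_triangle_ineq4)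
  also have "norm (\<i> * complex_of_real (x - y)) = \<bar>x - y\<bar>" by (simp add: norm_mult del: of_real_diff)
  finally show ?thesis using iexp_diff_le[of x y] by simp
qed

lemma norm_centered_iexp_le: "norm (centered_iexp x) \<le> 2 * \<bar>x\<bar>"
  using centered_iexp_lipschitz[of x 0] by simp

lemma norm_centered_iexp_le_square: "norm (centered_iexp x) \<le> x\<^sup>2 / 2"
  using iexp_approx1[of x 1] by (simp add: centered_iexp_def numeral_2_eq_2 diff_diff_eq)

section \<open>Power tails of the radii and the stable exponent\<close>

lemma nn_integral_powr_near_0:
  assumes "0 < (a::real)"
  shows "(\<integral>\<^sup>+s. ennreal (s powr (a - 1)) * indicator {0<..1} s \<partial>lborel) = ennreal (1 / a)"
proof -
  have "(\<integral>\<^sup>+v. indicator {..1} v * indicator {0<..} (v::real) \<partial>lborel) = (\<integral>\<^sup>+v. indicator {0<..1::real} v \<partial>lborel)"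
    by (rule nn_integral_cong) (auto split: split_indicator)
  then have "1 = (\<integral>\<^sup>+v. indicator {..1} v * indicator {0<..} (v::real) \<partial>lborel)" by simp
  also have "\<dots> = (\<integral>\<^sup>+s. indicator {..1} (1 * s powr a) * ennreal (1 * a * s powr (a - 1)) * indicator {0<..} s \<partial>lborel)"
    using assms by (intro nn_integral_powr_substitution[symmetric]) auto
  also have "\<dots> = (\<integral>\<^sup>+s. ennreal a * (ennreal (s powr (a - 1)) * indicator {0<..1} s) \<partial>lborel)"
  proof (rule nn_integral_cong)
    fix s :: real
    have "s powr a \<le> 1 \<longleftrightarrow> s \<le> 1" if "0 < s"
    proof
      assume le: "s powr a \<le> 1"
      show "s \<le> 1"
      proof (rule ccontr)
        assume "\<not> s \<le> 1"
        then have "1 powr a < s powr a" using assms by (intro powr_less_mono2) auto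
        with le show False by simp
      qed
    next
      assume "s \<le> 1"
      then have "s powr a \<le> 1 powr a" using assms that by (intro powr_mono2) auto
      then show "s powr a \<le> 1" by simp
    qed
    then show "indicator {..1} (1 * s powr a) * ennreal (1 * a * s powr (a - 1)) * indicator {0<..} s = ennreal a * (ennreal (s powr (a - 1)) * indicator {0<..1} s)"
      using assms by (auto simp: ennreal_mult split: split_indicator)
  qed
  also have "\<dots> = ennreal a * (\<integral>\<^sup>+s. ennreal (s powr (a - 1)) * indicator {0<..1} s \<partial>lborel)"
    by (rule nn_integral_cmult) auto
  finally have "ennreal (1 / a) * 1 = ennreal (1 / a) * (ennreal a * (\<integral>\<^sup>+s. ennreal (s powr (a - 1)) * indicator {0<..1} s \<partial>lborel))" by simp
  then show ?thesis using assms by (simp add: mult.assoc[symmetric] ennreal_mult[symmetric])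
qed

lemma nn_integral_powr_at_top:
  assumes "0 < (a::real)"
  shows "(\<integral>\<^sup>+s. ennreal (s powr (- a - 1)) * indicator {1..} s \<partial>lborel) = ennreal (1 / a)"
proof -
  have "(\<integral>\<^sup>+s. ennreal (s powr (- a - 1)) * indicator {1..} s \<partial>lborel) = ennreal (0 - (- (1 powr (- a) / a)))"
  proof (rule nn_integral_FTC_atLeast)
    show "DERIV (\<lambda>s. - (s powr (- a) / a)) x :> x powr (- a - 1)" if "1 \<le> x" for x
      using that assms by (auto intro!: derivative_eq_intros simp: powr_diff)
    show "((\<lambda>s. - (s powr (- a) / a)) \<longlongrightarrow> 0) at_top" using assms by real_asymp
  qed auto
  then show ?thesis by simp
qed

text \<open>
  The substitution \<open>v = \<bar>u\<bar> s\<^sup>d\<close> turns the \<open>\<beta>\<close>-tail of the radii into the \<open>\<gamma>\<close>-tail of the volumes,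
  \<open>\<gamma> = \<beta>/d\<close>.
\<close>
lemma nn_integral_tail_substitution:
  fixes h :: "real \<Rightarrow> real"
  assumes [measurable]: "h \<in> borel_measurable borel" and h: "\<And>v. 0 < v \<Longrightarrow> 0 \<le> h v" and d: "0 < d" and u: "u \<noteq> 0"
    and I: "(\<integral>\<^sup>+v. ennreal (h v * v powr (- (\<beta> / d) - 1)) * indicator {0<..} v \<partial>lborel) = ennreal I" "0 \<le> I"
  shows "(\<integral>\<^sup>+s. ennreal (h (\<bar>u\<bar> * s powr d) * s powr (- \<beta> - 1)) * indicator {0<..} s \<partial>lborel) = ennreal (\<bar>u\<bar> powr (\<beta> / d) * I / d)"
proof -
  let ?u = "\<bar>u\<bar>" and ?g = "\<beta> / d"
  have u0: "0 < ?u" using u by simp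
  have "ennreal I = (\<integral>\<^sup>+s. ennreal (h (?u * s powr d) * (?u * s powr d) powr (- ?g - 1)) * ennreal (?u * d * s powr (d - 1)) * indicator {0<..} s \<partial>lborel)"
    unfolding I(1)[symmetric] using u0 d by (intro nn_integral_powr_substitution[symmetric]) auto
  also have "\<dots> = (\<integral>\<^sup>+s. ennreal (?u powr (- ?g) * d) * (ennreal (h (?u * s powr d) * s powr (- \<beta> - 1)) * indicator {0<..} s) \<partial>lborel)"
  proof (rule nn_integral_cong)
    fix s :: real
    show "ennreal (h (?u * s powr d) * (?u * s powr d) powr (- ?g - 1)) * ennreal (?u * d * s powr (d - 1)) * indicator {0<..} s =
      ennreal (?u powr (- ?g) * d) * (ennreal (h (?u * s powr d) * s powr (- \<beta> - 1)) * indicator {0<..} s)"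
    proof (cases "0 < s")
      case True
      have hs: "0 \<le> h (?u * s powr d)" using True u0 by (intro h) simp
      have "(?u * s powr d) powr (- ?g - 1) * (?u * s powr (d - 1)) = (?u powr (- ?g - 1) * ?u powr 1) * (s powr (d * (- ?g - 1)) * s powr (d - 1))"
        using True u0 by (simp add: powr_mult powr_powr)
      also have "\<dots> = ?u powr (- ?g) * s powr (d * (- ?g - 1) + (d - 1))"
        unfolding powr_add[symmetric] by simp
      also have "d * (- ?g - 1) + (d - 1) = - \<beta> - 1" using d by (simp add: field_simps)
      finally have e: "(?u * s powr d) powr (- ?g - 1) * (?u * s powr (d - 1)) = ?u powr (- ?g) * s powr (- \<beta> - 1)" .
      have "h (?u * s powr d) * (?u * s powr d) powr (- ?g - 1) * (?u * d * s powr (d - 1)) =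
        h (?u * s powr d) * d * ((?u * s powr d) powr (- ?g - 1) * (?u * s powr (d - 1)))" by (simp only: mult_ac)
      also have "\<dots> = (?u powr (- ?g) * d) * (h (?u * s powr d) * s powr (- \<beta> - 1))"
        unfolding e by (simp only: mult_ac)
      finally have "ennreal (h (?u * s powr d) * (?u * s powr d) powr (- ?g - 1) * (?u * d * s powr (d - 1))) =
        ennreal ((?u powr (- ?g) * d) * (h (?u * s powr d) * s powr (- \<beta> - 1)))" by (rule arg_cong)
      moreover have "ennreal (h (?u * s powr d) * (?u * s powr d) powr (- ?g - 1) * (?u * d * s powr (d - 1))) =
        ennreal (h (?u * s powr d) * (?u * s powr d) powr (- ?g - 1)) * ennreal (?u * d * s powr (d - 1))"
        using hs u0 d by (intro ennreal_mult) auto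
      moreover have "ennreal ((?u powr (- ?g) * d) * (h (?u * s powr d) * s powr (- \<beta> - 1))) =
        ennreal (?u powr (- ?g) * d) * ennreal (h (?u * s powr d) * s powr (- \<beta> - 1))"
        using hs d by (intro ennreal_mult) auto
      ultimately show ?thesis using True by (simp only: indicator_simps greaterThan_iff mult_1_right)
    qed simp
  qed
  also have "\<dots> = ennreal (?u powr (- ?g) * d) * (\<integral>\<^sup>+s. ennreal (h (?u * s powr d) * s powr (- \<beta> - 1)) * indicator {0<..} s \<partial>lborel)"
    by (rule nn_integral_cmult) measurable
  finally have "ennreal (?u powr ?g / d) * ennreal I = ennreal (?u powr ?g / d) * ennreal (?u powr (- ?g) * d) * (\<integral>\<^sup>+s. ennreal (h (?u * s powr d) * s powr (- \<beta> - 1)) * indicator {0<..} s \<partial>lborel)"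
    by (simp only: mult.assoc)
  moreover have "ennreal (?u powr ?g / d) * ennreal (?u powr (- ?g) * d) = 1"
  proof -
    have "?u powr ?g / d * (?u powr (- ?g) * d) = (?u powr ?g * ?u powr (- ?g)) * (d / d)" by simp
    also have "\<dots> = 1" unfolding powr_add[symmetric] using d u0 by simp
    finally show ?thesis using d by (simp only: ennreal_mult[symmetric] divide_nonneg_pos mult_nonneg_nonneg powr_ge_zero less_imp_le) simp
  qed
  moreover have "ennreal (?u powr ?g / d) * ennreal I = ennreal (?u powr ?g * I / d)"
    using d I(2) by (subst ennreal_mult[symmetric]) auto
  ultimately show ?thesis by (simp only: mult_1_left)
qed

lemma half_pi_multiple:
  assumes "1 < g" "g < (2::real)"
  shows "0 < sin (pi * g / 2)" "cos (pi * g / 2) < 0"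
proof -
  have "pi * g < pi * 2" "pi * 1 < pi * g" using assms by (auto intro: mult_strict_left_mono)
  then have g: "pi / 2 < pi * g / 2" "pi * g / 2 < pi" by linarith+
  then show "0 < sin (pi * g / 2)" using pi_gt_zero by (intro sin_gt_zero) linarith+
  have "cos (pi * g / 2) < cos (pi / 2)" using g by (intro cos_monotone_0_pi) auto
  then show "cos (pi * g / 2) < 0" by simp
qed

text \<open>Real and imaginary part of \<open>centered_iexp v\<close> are
  \<open>- (1 - cos v)\<close> and \<open>- (v - sin v)\<close>, of constant sign for
  \<open>v > 0\<close>, so both can be integrated in \<open>ennreal\<close>. The first is even in
  \<open>u\<close> and the second odd, which produces \<open>sgn u\<close>; the ratio
  \<open>- tan (pi * (\<beta> / d) / 2)\<close> of the two integrals is exactly the factor belonging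
  to skewness 1.\<close>

lemma tail_integral_centered_iexp:
  assumes d: "0 < d" and g: "1 < \<beta> / d" "\<beta> / d < 2"
  defines "I \<equiv> LINT r:{0<..}|lborel. (1 - cos r) / r powr (1 + \<beta> / d)"
  shows "integrable lborel (\<lambda>s. indicator {0<..} s *\<^sub>R (complex_of_real (s powr (- \<beta> - 1)) * centered_iexp (u * s powr d)))"
    and "(CLINT s|lborel. indicator {0<..} s *\<^sub>R (complex_of_real (s powr (- \<beta> - 1)) * centered_iexp (u * s powr d))) =
      - complex_of_real (I / d) * stable_exponent (\<beta> / d) 1 u"
    and "0 \<le> I"
proof -
  let ?g = "\<beta> / d"
  define c where "c = pi / (2 * sin (pi * ?g / 2) * Gamma (?g + 1))"
  have "0 < sin (pi * ?g / 2)" by (rule half_pi_multiple[OF g])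
  moreover have "0 < Gamma (?g + 1)" using g by (intro Gamma_real_pos) linarith
  ultimately have c0: "0 < c" unfolding c_def by (intro divide_pos_pos mult_pos_pos) auto
  have cosI: "(\<integral>\<^sup>+v. ennreal ((1 - cos v) * v powr (- ?g - 1)) * indicator {0<..} v \<partial>lborel) = ennreal c"
    unfolding c_def using g by (intro nn_integral_one_minus_cos_powr) linarith+
  have sinI: "(\<integral>\<^sup>+v. ennreal ((v - sin v) * v powr (- ?g - 1)) * indicator {0<..} v \<partial>lborel) = ennreal (- tan (pi * ?g / 2) * c)"
    unfolding c_def by (rule nn_integral_minus_sin_powr[OF g])
  have tan0: "0 \<le> - tan (pi * ?g / 2) * c"
  proof -
    have "cos (pi * ?g / 2) < 0" by (rule half_pi_multiple[OF g])
    then have "tan (pi * ?g / 2) \<le> 0" using \<open>0 < sin (pi * ?g / 2)\<close> by (simp add: tan_def divide_le_0_iff)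
    then show ?thesis using c0 by (simp add: mult_nonpos_nonneg)
  qed
  \<comment> \<open>The set integral that also occurs in \<open>\<sigma>\<^sub>\<gamma>\<close> is
    the integral evaluated in \<open>cosI\<close>, with the negative power written as a
    quotient.\<close>
  have I: "I = c"
  proof -
    have "ennreal c = (\<integral>\<^sup>+r. ennreal (indicator {0<..} r *\<^sub>R ((1 - cos r) / r powr (1 + ?g))) \<partial>lborel)"
      unfolding cosI[symmetric]
    proof (rule nn_integral_cong)
      fix v :: real
      have "- ?g - 1 = - (1 + ?g)" by simp
      then have "v powr (- ?g - 1) = inverse (v powr (1 + ?g))" by (simp only: powr_minus)
      then show "ennreal ((1 - cos v) * v powr (- ?g - 1)) * indicator {0<..} v = ennreal (indicator {0<..} v *\<^sub>R ((1 - cos v) / v powr (1 + ?g)))"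
        by (cases "0 < v") (simp_all add: divide_inverse)
    qed
    moreover have "I = enn2real (\<integral>\<^sup>+r. ennreal (indicator {0<..} r *\<^sub>R ((1 - cos r) / r powr (1 + ?g))) \<partial>lborel)"
      unfolding I_def set_lebesgue_integral_def by (rule integral_eq_nn_integral) (auto intro!: AE_I2 divide_nonneg_nonneg simp: indicator_def)
    ultimately show ?thesis using c0 by (metis enn2real_ennreal less_imp_le)
  qed
  then show "0 \<le> I" using c0 by simp
  define cs where "cs s = indicator {0<..} s * ((1 - cos (\<bar>u\<bar> * s powr d)) * s powr (- \<beta> - 1))" for s
  define sn where "sn s = indicator {0<..} s * ((\<bar>u\<bar> * s powr d - sin (\<bar>u\<bar> * s powr d)) * s powr (- \<beta> - 1))" for s
  have cs0: "0 \<le> cs s" for s unfolding cs_def by (auto simp: indicator_def)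
  have sn0: "0 \<le> sn s" for s
  proof -
    have "sin (\<bar>u\<bar> * s powr d) \<le> \<bar>u\<bar> * s powr d" by (rule sin_x_le_x) simp
    then show ?thesis unfolding sn_def by (auto simp: indicator_def)
  qed
  have [measurable]: "cs \<in> borel_measurable borel" "sn \<in> borel_measurable borel" unfolding cs_def sn_def by measurable
  have ncs: "(\<integral>\<^sup>+s. ennreal (cs s) \<partial>lborel) = ennreal (\<bar>u\<bar> powr ?g * I / d)"
  proof (cases "u = 0")
    case False
    have "(\<integral>\<^sup>+s. ennreal (cs s) \<partial>lborel) = (\<integral>\<^sup>+s. ennreal ((1 - cos (\<bar>u\<bar> * s powr d)) * s powr (- \<beta> - 1)) * indicator {0<..} s \<partial>lborel)"
      unfolding cs_def by (intro nn_integral_cong) (auto simp: indicator_def)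
    also have "\<dots> = ennreal (\<bar>u\<bar> powr ?g * c / d)"
      using c0 by (intro nn_integral_tail_substitution[of "\<lambda>v. 1 - cos v", OF _ _ d False cosI]) auto
    finally show ?thesis by (simp add: I)
  qed (simp add: cs_def)
  have nsn: "(\<integral>\<^sup>+s. ennreal (sn s) \<partial>lborel) = ennreal (\<bar>u\<bar> powr ?g * (- tan (pi * ?g / 2) * I) / d)"
  proof (cases "u = 0")
    case False
    have "(\<integral>\<^sup>+s. ennreal (sn s) \<partial>lborel) = (\<integral>\<^sup>+s. ennreal ((\<bar>u\<bar> * s powr d - sin (\<bar>u\<bar> * s powr d)) * s powr (- \<beta> - 1)) * indicator {0<..} s \<partial>lborel)"
      unfolding sn_def by (intro nn_integral_cong) (auto simp: indicator_def)
    also have "\<dots> = ennreal (\<bar>u\<bar> powr ?g * (- tan (pi * ?g / 2) * c) / d)"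
      by (rule nn_integral_tail_substitution[of "\<lambda>v. v - sin v", OF _ _ d False sinI tan0]) (auto intro: sin_x_le_x less_imp_le)
    finally show ?thesis by (simp only: I)
  qed (simp add: sn_def)
  have ics: "integrable lborel cs" using ncs cs0 by (intro integrableI_nonneg) auto
  have isn: "integrable lborel sn" using nsn sn0 by (intro integrableI_nonneg) auto
  have vcs: "integral\<^sup>L lborel cs = \<bar>u\<bar> powr ?g * I / d"
    using ncs cs0 c0 d by (subst integral_eq_nn_integral) (auto simp: I)
  have vsn: "integral\<^sup>L lborel sn = \<bar>u\<bar> powr ?g * (- tan (pi * ?g / 2) * I) / d"
  proof -
    have "0 \<le> \<bar>u\<bar> powr ?g * (- tan (pi * ?g / 2) * I) / d" unfolding I using tan0 d by (intro divide_nonneg_pos mult_nonneg_nonneg[OF powr_ge_zero]) auto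
    moreover have "integral\<^sup>L lborel sn = enn2real (\<integral>\<^sup>+s. ennreal (sn s) \<partial>lborel)"
      by (rule integral_eq_nn_integral) (auto simp: sn0)
    ultimately show ?thesis unfolding nsn by (simp only: enn2real_ennreal)
  qed
  have H_eq: "(\<lambda>s. indicator {0<..} s *\<^sub>R (complex_of_real (s powr (- \<beta> - 1)) * centered_iexp (u * s powr d))) =
    (\<lambda>s. - complex_of_real (cs s) - \<i> * complex_of_real (sgn u) * complex_of_real (sn s))"
  proof
    fix s :: real
    have a: "u * s powr d = sgn u * (\<bar>u\<bar> * s powr d)" by (simp add: mult.assoc[symmetric] sgn_mult_abs)
    have co: "cos (u * s powr d) = cos (\<bar>u\<bar> * s powr d)" by (cases "0 \<le> u") (simp_all add: abs_if)
    have si: "u * s powr d - sin (u * s powr d) = sgn u * (\<bar>u\<bar> * s powr d - sin (\<bar>u\<bar> * s powr d))"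
      by (cases u "0::real" rule: linorder_cases) (simp_all add: abs_if)
    have "centered_iexp x = - complex_of_real (1 - cos x) - \<i> * complex_of_real (x - sin x)" for x
      by (rule complex_eqI) (simp_all add: centered_iexp_def Re_exp Im_exp)
    then have ci: "centered_iexp (u * s powr d) = - complex_of_real (1 - cos (\<bar>u\<bar> * s powr d)) - \<i> * complex_of_real (sgn u * (\<bar>u\<bar> * s powr d - sin (\<bar>u\<bar> * s powr d)))"
      by (simp only: co si)
    show "indicator {0<..} s *\<^sub>R (complex_of_real (s powr (- \<beta> - 1)) * centered_iexp (u * s powr d)) =
      - complex_of_real (cs s) - \<i> * complex_of_real (sgn u) * complex_of_real (sn s)"
    proof -
      have "complex_of_real p * (- complex_of_real A - \<i> * complex_of_real (sgn u * B)) =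
        - complex_of_real (A * p) - \<i> * complex_of_real (sgn u) * complex_of_real (B * p)" for p A B
        by (simp add: algebra_simps)
      from this[of "s powr (- \<beta> - 1)" "1 - cos (\<bar>u\<bar> * s powr d)" "\<bar>u\<bar> * s powr d - sin (\<bar>u\<bar> * s powr d)"]
      show ?thesis unfolding ci
        by (cases "0 < s") (simp_all only: cs_def sn_def, simp_all)
    qed
  qed
  show "integrable lborel (\<lambda>s. indicator {0<..} s *\<^sub>R (complex_of_real (s powr (- \<beta> - 1)) * centered_iexp (u * s powr d)))"
    unfolding H_eq using ics isn by (intro Bochner_Integration.integrable_diff Bochner_Integration.integrable_minus integrable_mult_right integrable_of_real)
  have "(CLINT s|lborel. - complex_of_real (cs s) - \<i> * complex_of_real (sgn u) * complex_of_real (sn s)) =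
    - complex_of_real (integral\<^sup>L lborel cs) - \<i> * complex_of_real (sgn u) * complex_of_real (integral\<^sup>L lborel sn)"
    using ics isn by simp
  also have "\<dots> = - complex_of_real (I / d) * stable_exponent ?g 1 u"
    unfolding vcs vsn by (simp add: stable_exponent_def algebra_simps)
  finally show "(CLINT s|lborel. indicator {0<..} s *\<^sub>R (complex_of_real (s powr (- \<beta> - 1)) * centered_iexp (u * s powr d))) =
      - complex_of_real (I / d) * stable_exponent ?g 1 u" unfolding H_eq .
qed

section \<open>Ball integrals averaged over the radius\<close>

lemma ennreal_abs_divide: "0 < c \<Longrightarrow> ennreal \<bar>b / c\<bar> = ennreal (1 / c) * ennreal \<bar>b\<bar>"
  by (simp add: ennreal_mult[symmetric])

lemma ennreal_square_divide: "ennreal ((b / c)\<^sup>2) = ennreal (1 / c\<^sup>2) * ennreal (b\<^sup>2)"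
  by (simp add: ennreal_mult[symmetric] power_divide)

lemma ennreal_mult_mult: "0 \<le> a \<Longrightarrow> 0 \<le> b \<Longrightarrow> 0 \<le> c \<Longrightarrow> ennreal a * (ennreal b * ennreal c) = ennreal (a * (b * c))"
  by (simp add: ennreal_mult)

lemma ball_integral_null:
  assumes "ball_vol TYPE('a::euclidean_space) r = 0"
  shows "ball_integral \<phi> (x::'a) r = 0"
proof -
  have "emeasure lborel (cball x r) = 0" using assms by (simp only: emeasure_cball_eq_ball_vol ennreal_0)
  then have "cball x r \<in> null_sets lborel" by (simp add: null_sets_def)
  then have "AE y in lborel. indicator (cball x r) y * \<phi> y = 0"
    by (auto simp: AE_iff_null_sets[symmetric] dest!: AE_not_in elim!: eventually_mono)
  then show ?thesis unfolding ball_integral_def by (intro integral_eq_zero_AE)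
qed

lemma ball_vol_eq_if: "ball_vol TYPE('a::euclidean_space) r = (if 0 < r then ball_vol TYPE('a) 1 * r ^ DIM('a) else 0)"
proof -
  have "r < 0 \<or> r = 0 \<or> 0 < r" by linarith
  then show ?thesis using ball_vol_eq[of r, where 'a='a] by auto
qed

lemma borel_measurable_ball_vol[measurable]: "ball_vol TYPE('a::euclidean_space) \<in> borel_measurable borel"
  by (subst ball_vol_eq_if[abs_def]) measurable

lemma ball_vol_scale: "0 < c \<Longrightarrow> ball_vol TYPE('a::euclidean_space) (c * r) = c ^ DIM('a) * ball_vol TYPE('a) r"
  by (subst (1 2) ball_vol_eq_if) (auto simp: power_mult_distrib zero_less_mult_iff)

lemma measurable_ball_integral_pair:
  assumes [measurable]: "(\<phi> :: 'a::euclidean_space \<Rightarrow> real) \<in> borel_measurable borel"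
  shows "(\<lambda>(x, r). ball_integral \<phi> x r / n) \<in> borel_measurable (borel \<Otimes>\<^sub>M borel)"
  unfolding case_prod_beta' by measurable

text \<open>For the second bound the integral over the radius is split by Cauchy-Schwarz with the
  volume of the ball as weight. One factor is the mean volume \<open>v\<close>; in the other the
  squared ball integral is divided by the volume, and integrating over the centres leaves at most
  the volume times the integral of \<open>(\<phi> x)\<^sup>2\<close>. Thus \<open>v\<close> appears
  twice, whereas Cauchy-Schwarz without a weight would lead to the mean squared volume, which is
  infinite in the application.\<close>

lemma marked_ball_bounds:
  fixes \<phi> :: "'a::euclidean_space \<Rightarrow> real" and \<nu> :: "real measure"
  assumes sets[simp, measurable_cong]: "sets \<nu> = sets borel" and fin: "sigma_finite_measure \<nu>"
    and vol: "(\<integral>\<^sup>+r. ennreal (ball_vol TYPE('a) r) \<partial>\<nu>) = ennreal v" "0 \<le> v"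
    and \<phi>: "integrable lborel \<phi>" "integrable lborel (\<lambda>x. (\<phi> x)\<^sup>2)" and n: "0 < n"
  shows "(\<integral>\<^sup>+x. (\<integral>\<^sup>+r. ennreal \<bar>ball_integral \<phi> x r / n\<bar> \<partial>\<nu>) \<partial>lborel) < \<infinity>"
    and "(\<integral>\<^sup>+x. (\<integral>\<^sup>+r. ennreal \<bar>ball_integral \<phi> x r / n\<bar> \<partial>\<nu>)\<^sup>2 \<partial>lborel) \<le> ennreal ((v / n)\<^sup>2 * (LINT x|lborel. (\<phi> x)\<^sup>2))"
proof -
  interpret \<nu>: sigma_finite_measure \<nu> by fact
  interpret pair: pair_sigma_finite "lborel :: 'a measure" \<nu> ..
  have [measurable]: "\<phi> \<in> borel_measurable borel" using \<phi>(1) by auto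
  let ?V = "ball_vol TYPE('a)"
  have bm[measurable]: "(\<lambda>p. ball_integral \<phi> (fst p) (snd p)) \<in> borel_measurable (lborel \<Otimes>\<^sub>M \<nu>)" by measurable
  have bmr[measurable]: "(\<lambda>x. ball_integral \<phi> x r) \<in> borel_measurable borel" for r by measurable
  have bmx[measurable]: "ball_integral \<phi> x \<in> borel_measurable borel" for x by measurable
  have n1: "ennreal \<bar>ball_integral \<phi> x r / n\<bar> = ennreal (1 / n) * ennreal \<bar>ball_integral \<phi> x r\<bar>" for x r
    using n by (simp add: ennreal_mult[symmetric])
  have "(\<integral>\<^sup>+x. (\<integral>\<^sup>+r. ennreal \<bar>ball_integral \<phi> x r / n\<bar> \<partial>\<nu>) \<partial>lborel) = (\<integral>\<^sup>+r. (\<integral>\<^sup>+x. ennreal \<bar>ball_integral \<phi> x r / n\<bar> \<partial>lborel) \<partial>\<nu>)"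
    by (rule pair.Fubini'[symmetric]) (simp add: case_prod_beta')
  also have "\<dots> \<le> (\<integral>\<^sup>+r. ennreal (1 / n) * (ennreal (?V r) * (\<integral>\<^sup>+y. ennreal \<bar>\<phi> y\<bar> \<partial>lborel)) \<partial>\<nu>)"
  proof (rule nn_integral_mono)
    fix r
    have "(\<integral>\<^sup>+x. ennreal \<bar>ball_integral \<phi> x r / n\<bar> \<partial>lborel) = ennreal (1 / n) * (\<integral>\<^sup>+x. ennreal \<bar>ball_integral \<phi> x r\<bar> \<partial>lborel)"
      unfolding n1 by (rule nn_integral_cmult) measurable
    also have "\<dots> \<le> ennreal (1 / n) * (ennreal (?V r) * (\<integral>\<^sup>+y. ennreal \<bar>\<phi> y\<bar> \<partial>lborel))"
      by (intro mult_left_mono nn_integral_abs_ball_integral_le \<phi>) auto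
    finally show "(\<integral>\<^sup>+x. ennreal \<bar>ball_integral \<phi> x r / n\<bar> \<partial>lborel) \<le> ennreal (1 / n) * (ennreal (?V r) * (\<integral>\<^sup>+y. ennreal \<bar>\<phi> y\<bar> \<partial>lborel))" .
  qed
  also have "\<dots> = ennreal (1 / n) * (ennreal v * (\<integral>\<^sup>+y. ennreal \<bar>\<phi> y\<bar> \<partial>lborel))"
    by (simp add: nn_integral_cmult nn_integral_multc vol)
  also have "\<dots> < \<infinity>"
    using \<phi>(1) by (simp add: integrable_iff_bounded ennreal_mult_less_top)
  finally show "(\<integral>\<^sup>+x. (\<integral>\<^sup>+r. ennreal \<bar>ball_integral \<phi> x r / n\<bar> \<partial>\<nu>) \<partial>lborel) < \<infinity>" .
  let ?P = "LINT x|lborel. (\<phi> x)\<^sup>2"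
  have P: "(\<integral>\<^sup>+y. ennreal ((\<phi> y)\<^sup>2) \<partial>lborel) = ennreal ?P" using \<phi>(2) by (intro nn_integral_eq_integral) auto
  have P0: "0 \<le> ?P" by (intro integral_nonneg_AE) auto
  \<comment> \<open>The second factor of the weighted Cauchy-Schwarz inequality. For a ball of
    volume 0 the quotient is 0 by the convention for division, consistently with
    \<open>ball_integral_null\<close>.\<close>
  define w where "w x r = ennreal ((ball_integral \<phi> x r / n)\<^sup>2 / ?V r)" for x r
  have wm[measurable]: "(\<lambda>p. w (fst p) (snd p)) \<in> borel_measurable (lborel \<Otimes>\<^sub>M \<nu>)" unfolding w_def by measurable
  have wr[measurable]: "(\<lambda>x. w x r) \<in> borel_measurable borel" and wx[measurable]: "w x \<in> borel_measurable borel" for x r unfolding w_def by measurable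
  have CS: "(\<integral>\<^sup>+r. ennreal \<bar>ball_integral \<phi> x r / n\<bar> \<partial>\<nu>)\<^sup>2 \<le> ennreal v * (\<integral>\<^sup>+r. w x r \<partial>\<nu>)" for x
  proof -
    have "(\<integral>\<^sup>+r. ennreal \<bar>ball_integral \<phi> x r / n\<bar> \<partial>\<nu>) = (\<integral>\<^sup>+r. ennreal (sqrt (?V r)) * ennreal (\<bar>ball_integral \<phi> x r / n\<bar> / sqrt (?V r)) \<partial>\<nu>)"
    proof (rule nn_integral_cong)
      fix r
      have "\<bar>ball_integral \<phi> x r / n\<bar> = sqrt (?V r) * (\<bar>ball_integral \<phi> x r / n\<bar> / sqrt (?V r))"
        by (cases "?V r = 0") (simp_all add: ball_integral_null)
      then show "ennreal \<bar>ball_integral \<phi> x r / n\<bar> = ennreal (sqrt (?V r)) * ennreal (\<bar>ball_integral \<phi> x r / n\<bar> / sqrt (?V r))"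
        by (subst ennreal_mult[symmetric]) auto
    qed
    also have "\<dots>\<^sup>2 \<le> (\<integral>\<^sup>+r. (ennreal (sqrt (?V r)))\<^sup>2 \<partial>\<nu>) * (\<integral>\<^sup>+r. (ennreal (\<bar>ball_integral \<phi> x r / n\<bar> / sqrt (?V r)))\<^sup>2 \<partial>\<nu>)"
      by (rule Cauchy_Schwarz_nn_integral) measurable
    also have "(\<integral>\<^sup>+r. (ennreal (sqrt (?V r)))\<^sup>2 \<partial>\<nu>) = ennreal v"
      unfolding vol(1)[symmetric] by (intro nn_integral_cong) (simp add: ennreal_power)
    also have "(\<integral>\<^sup>+r. (ennreal (\<bar>ball_integral \<phi> x r / n\<bar> / sqrt (?V r)))\<^sup>2 \<partial>\<nu>) = (\<integral>\<^sup>+r. w x r \<partial>\<nu>)"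
    proof (rule nn_integral_cong)
      fix r
      have "(\<bar>ball_integral \<phi> x r / n\<bar> / sqrt (?V r))\<^sup>2 = (ball_integral \<phi> x r / n)\<^sup>2 / ?V r"
        by (simp only: power_divide[of _ "sqrt (?V r)"] power2_abs real_sqrt_pow2 measure_nonneg)
      moreover have "0 \<le> \<bar>ball_integral \<phi> x r / n\<bar> / sqrt (?V r)" by (simp only: divide_nonneg_nonneg abs_ge_zero real_sqrt_ge_zero measure_nonneg)
      ultimately show "(ennreal (\<bar>ball_integral \<phi> x r / n\<bar> / sqrt (?V r)))\<^sup>2 = w x r"
        unfolding w_def by (simp only: ennreal_power)
    qed
    finally show ?thesis .
  qed
  have "(\<integral>\<^sup>+x. (\<integral>\<^sup>+r. ennreal \<bar>ball_integral \<phi> x r / n\<bar> \<partial>\<nu>)\<^sup>2 \<partial>lborel) \<le> (\<integral>\<^sup>+x. ennreal v * (\<integral>\<^sup>+r. w x r \<partial>\<nu>) \<partial>lborel)"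
    by (intro nn_integral_mono CS)
  also have "\<dots> = ennreal v * (\<integral>\<^sup>+x. (\<integral>\<^sup>+r. w x r \<partial>\<nu>) \<partial>lborel)"
  proof (rule nn_integral_cmult)
    show "(\<lambda>x. \<integral>\<^sup>+r. w x r \<partial>\<nu>) \<in> borel_measurable lborel"
      by (rule \<nu>.borel_measurable_nn_integral) (simp add: case_prod_beta')
  qed
  also have "(\<integral>\<^sup>+x. (\<integral>\<^sup>+r. w x r \<partial>\<nu>) \<partial>lborel) = (\<integral>\<^sup>+r. (\<integral>\<^sup>+x. w x r \<partial>lborel) \<partial>\<nu>)"
    by (rule pair.Fubini'[symmetric]) (simp add: case_prod_beta')
  also have "\<dots> \<le> (\<integral>\<^sup>+r. ennreal (?P / n\<^sup>2) * ennreal (?V r) \<partial>\<nu>)"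
  proof (rule nn_integral_mono)
    fix r
    show "(\<integral>\<^sup>+x. w x r \<partial>lborel) \<le> ennreal (?P / n\<^sup>2) * ennreal (?V r)"
    proof (cases "?V r = 0")
      case True
      then have "w x r = 0" for x unfolding w_def by (simp only: ball_integral_null) simp
      then show ?thesis by simp
    next
      case False
      then have V: "0 < ?V r" using measure_nonneg[of lborel "cball (0::'a) r"] by linarith
      have "(\<integral>\<^sup>+x. w x r \<partial>lborel) = (\<integral>\<^sup>+x. ennreal (1 / (n\<^sup>2 * ?V r)) * ennreal ((ball_integral \<phi> x r)\<^sup>2) \<partial>lborel)"
      proof (rule nn_integral_cong)
        fix x
        have "(ball_integral \<phi> x r / n)\<^sup>2 / ?V r = 1 / (n\<^sup>2 * ?V r) * (ball_integral \<phi> x r)\<^sup>2" by (simp only: power_divide) simp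
        moreover have "0 \<le> 1 / (n\<^sup>2 * ?V r)" using V by (simp only: divide_nonneg_nonneg mult_nonneg_nonneg zero_le_power2 zero_le_one less_imp_le)
        ultimately show "w x r = ennreal (1 / (n\<^sup>2 * ?V r)) * ennreal ((ball_integral \<phi> x r)\<^sup>2)"
          unfolding w_def by (simp only: ennreal_mult zero_le_power2)
      qed
      also have "\<dots> = ennreal (1 / (n\<^sup>2 * ?V r)) * (\<integral>\<^sup>+x. ennreal ((ball_integral \<phi> x r)\<^sup>2) \<partial>lborel)"
        by (rule nn_integral_cmult) measurable
      also have "\<dots> \<le> ennreal (1 / (n\<^sup>2 * ?V r)) * (ennreal ((?V r)\<^sup>2) * (\<integral>\<^sup>+y. ennreal ((\<phi> y)\<^sup>2) \<partial>lborel))"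
        by (intro mult_left_mono nn_integral_ball_integral_square_le \<phi>) auto
      also have "\<dots> = ennreal (1 / (n\<^sup>2 * ?V r) * ((?V r)\<^sup>2 * ?P))"
      proof -
        have "0 \<le> 1 / (n\<^sup>2 * ?V r)" using V by (simp only: divide_nonneg_nonneg mult_nonneg_nonneg zero_le_power2 zero_le_one less_imp_le)
        then show ?thesis unfolding P using P0 by (simp only: ennreal_mult zero_le_power2 mult_nonneg_nonneg)
      qed
      also have "1 / (n\<^sup>2 * ?V r) * ((?V r)\<^sup>2 * ?P) = ?P / n\<^sup>2 * ?V r"
      proof -
        have alg: "1 / (m * V) * (V\<^sup>2 * p) = p / m * V" if "0 < V" for V m p :: real using that by (simp add: power2_eq_square)
        show ?thesis by (rule alg[OF V])
      qed
      also have "ennreal (?P / n\<^sup>2 * ?V r) = ennreal (?P / n\<^sup>2) * ennreal (?V r)"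
        using V P0 by (intro ennreal_mult less_imp_le[OF V]) simp
      finally show ?thesis .
    qed
  qed
  also have "\<dots> = ennreal (?P / n\<^sup>2) * ennreal v"
    unfolding vol(1)[symmetric] by (rule nn_integral_cmult) measurable
  also have "ennreal v * (ennreal (?P / n\<^sup>2) * ennreal v) = ennreal (v * (?P / n\<^sup>2 * v))"
  proof -
    have "0 \<le> ?P / n\<^sup>2" using P0 by simp
    then show ?thesis using vol(2) by (simp only: ennreal_mult mult_nonneg_nonneg)
  qed
  also have "v * (?P / n\<^sup>2 * v) = (v / n)\<^sup>2 * ?P" by (simp add: power2_eq_square)
  finally show "(\<integral>\<^sup>+x. (\<integral>\<^sup>+r. ennreal \<bar>ball_integral \<phi> x r / n\<bar> \<partial>\<nu>)\<^sup>2 \<partial>lborel) \<le> ennreal ((v / n)\<^sup>2 * ?P)"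
    by (simp add: mult_left_mono)
qed

text \<open>The linear and the quadratic bound for \<open>centered_iexp\<close> in one estimate: the
  first is the better one for large balls, the second for small ones.\<close>

lemma norm_integral_centered_iexp_le:
  fixes F :: "'a::euclidean_space \<Rightarrow> real"
  assumes [measurable]: "F \<in> borel_measurable borel" and A: "(\<integral>\<^sup>+x. ennreal \<bar>F x\<bar> \<partial>lborel) \<le> ennreal A" "0 \<le> A"
    and B: "(\<integral>\<^sup>+x. ennreal ((F x)\<^sup>2) \<partial>lborel) \<le> ennreal B" "0 \<le> B"
  shows "integrable lborel (\<lambda>x. centered_iexp (F x))"
    and "(LINT x|lborel. norm (centered_iexp (F x))) \<le> min (2 * A) (B / 2)"
    and "norm (CLINT x|lborel. centered_iexp (F x)) \<le> min (2 * A) (B / 2)"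
proof -
  have a: "(\<integral>\<^sup>+x. norm (centered_iexp (F x)) \<partial>lborel) \<le> ennreal (2 * A)"
  proof -
    have "(\<integral>\<^sup>+x. norm (centered_iexp (F x)) \<partial>lborel) \<le> (\<integral>\<^sup>+x. ennreal 2 * ennreal \<bar>F x\<bar> \<partial>lborel)"
      by (intro nn_integral_mono) (simp only: ennreal_mult[symmetric] abs_ge_zero zero_le_numeral ennreal_leI norm_centered_iexp_le)
    also have "\<dots> \<le> ennreal 2 * ennreal A" by (subst nn_integral_cmult) (auto intro!: mult_left_mono A)
    finally show ?thesis using A by (simp only: ennreal_mult zero_le_numeral)
  qed
  have b: "(\<integral>\<^sup>+x. norm (centered_iexp (F x)) \<partial>lborel) \<le> ennreal (B / 2)"
  proof -
    have "(\<integral>\<^sup>+x. norm (centered_iexp (F x)) \<partial>lborel) \<le> (\<integral>\<^sup>+x. ennreal (1/2) * ennreal ((F x)\<^sup>2) \<partial>lborel)"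
    proof (intro nn_integral_mono)
      fix x
      have "norm (centered_iexp (F x)) \<le> 1/2 * (F x)\<^sup>2" using norm_centered_iexp_le_square[of "F x"] by simp
      then have "ennreal (norm (centered_iexp (F x))) \<le> ennreal (1/2 * (F x)\<^sup>2)" by (rule ennreal_leI)
      also have "\<dots> = ennreal (1/2) * ennreal ((F x)\<^sup>2)" by (rule ennreal_mult) auto
      finally show "ennreal (norm (centered_iexp (F x))) \<le> ennreal (1/2) * ennreal ((F x)\<^sup>2)" .
    qed
    also have "\<dots> \<le> ennreal (1/2) * ennreal B" by (subst nn_integral_cmult) (auto intro!: mult_left_mono B)
    also have "\<dots> = ennreal (B / 2)" using B by (subst ennreal_mult[symmetric]) auto
    finally show ?thesis .
  qed
  show i: "integrable lborel (\<lambda>x. centered_iexp (F x))"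
    using le_less_trans[OF a ennreal_less_top] by (simp add: integrable_iff_bounded)
  have "ennreal (LINT x|lborel. norm (centered_iexp (F x))) = (\<integral>\<^sup>+x. norm (centered_iexp (F x)) \<partial>lborel)"
    using i by (intro nn_integral_eq_integral[symmetric]) auto
  then have "ennreal (LINT x|lborel. norm (centered_iexp (F x))) \<le> ennreal (2 * A)" "ennreal (LINT x|lborel. norm (centered_iexp (F x))) \<le> ennreal (B / 2)"
    using a b by simp_all
  then show l: "(LINT x|lborel. norm (centered_iexp (F x))) \<le> min (2 * A) (B / 2)"
    using A B by (simp add: ennreal_le_iff)
  show "norm (CLINT x|lborel. centered_iexp (F x)) \<le> min (2 * A) (B / 2)"
    by (rule order_trans[OF integral_norm_bound l])
qed

text \<open>Near 0 the quadratic term leaves the power \<open>2 * d - \<beta> - 1\<close>, at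
  infinity the linear one leaves \<open>d - \<beta> - 1\<close>; their integrability is the
  condition that \<beta> lies strictly between \<open>d\<close> and \<open>2 * d\<close>.\<close>

lemma integrable_tail_majorant:
  fixes d \<beta> c1 c2 :: real
  assumes "d < \<beta>" "\<beta> < 2 * d" "0 \<le> c1" "0 \<le> c2"
  shows "integrable lborel (\<lambda>s. indicator {0<..} s * (s powr (- \<beta> - 1) * min (c1 * s powr d) (c2 * s powr (2 * d))))"
proof -
  let ?w = "\<lambda>s. indicator {0<..} s * (s powr (- \<beta> - 1) * min (c1 * s powr d) (c2 * s powr (2 * d)))"
  have w0: "0 \<le> ?w s" for s using assms by (auto simp: indicator_def)
  have "(\<integral>\<^sup>+s. ennreal (?w s) \<partial>lborel) \<le> (\<integral>\<^sup>+s. ennreal c2 * (ennreal (s powr ((2 * d - \<beta>) - 1)) * indicator {0<..1} s) + ennreal c1 * (ennreal (s powr (- (\<beta> - d) - 1)) * indicator {1..} s) \<partial>lborel)"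
  proof (rule nn_integral_mono)
    fix s :: real
    have e1: "s powr (- \<beta> - 1) * s powr d = s powr (- (\<beta> - d) - 1)" "s powr (- \<beta> - 1) * s powr (2 * d) = s powr ((2 * d - \<beta>) - 1)"
      unfolding powr_add[symmetric] by (simp_all add: algebra_simps)
    consider "s \<le> 0" | "0 < s" "s \<le> 1" | "1 < s" by linarith
    then show "ennreal (?w s) \<le> ennreal c2 * (ennreal (s powr ((2 * d - \<beta>) - 1)) * indicator {0<..1} s) + ennreal c1 * (ennreal (s powr (- (\<beta> - d) - 1)) * indicator {1..} s)"
    proof cases
      case 2
      have "?w s \<le> s powr (- \<beta> - 1) * (c2 * s powr (2 * d))" using 2 by (simp add: mult_left_mono)
      also have "\<dots> = c2 * s powr ((2 * d - \<beta>) - 1)" unfolding e1(2)[symmetric] by (simp only: mult_ac)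
      finally have "ennreal (?w s) \<le> ennreal c2 * ennreal (s powr ((2 * d - \<beta>) - 1))"
        using assms by (subst ennreal_mult[symmetric]) (auto intro: ennreal_leI)
      then show ?thesis using 2 by (simp add: add_increasing2)
    next
      case 3
      have "?w s \<le> s powr (- \<beta> - 1) * (c1 * s powr d)" using 3 by (simp add: mult_left_mono)
      also have "\<dots> = c1 * s powr (- (\<beta> - d) - 1)" unfolding e1(1)[symmetric] by (simp only: mult_ac)
      finally have "ennreal (?w s) \<le> ennreal c1 * ennreal (s powr (- (\<beta> - d) - 1))"
        using assms by (subst ennreal_mult[symmetric]) (auto intro: ennreal_leI)
      then show ?thesis using 3 by (simp add: add_increasing)
    qed simp
  qed
  also have "\<dots> = ennreal c2 * ennreal (1 / (2 * d - \<beta>)) + ennreal c1 * ennreal (1 / (\<beta> - d))"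
    using assms nn_integral_powr_near_0[of "2 * d - \<beta>"] nn_integral_powr_at_top[of "\<beta> - d"]
    by (subst nn_integral_add) (auto simp: nn_integral_cmult)
  also have "\<dots> < \<infinity>" by (simp add: ennreal_mult_less_top)
  finally show ?thesis using w0 by (intro integrableI_nonneg) auto
qed

lemma norm_centered_iexp_le_norm: "norm (centered_iexp x) \<le> norm (2 * x :: real)"
  using norm_centered_iexp_le[of x] by (simp add: abs_mult)

lemma powr_rescale:
  fixes s l b :: real
  assumes "0 < s" "0 < l"
  shows "l powr (b + 1) = s powr (- b - 1) * (l * s) powr (b + 1)"
proof -
  have "s powr (- b - 1) * s powr (b + 1) = 1" using assms by (subst powr_add[symmetric]) simp
  then show ?thesis using assms by (simp add: powr_mult mult.left_commute)
qed

text \<open>In the application \<open>s\<close> is a radius measured in the unit \<open>q j\<close>,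
  and \<open>l j * s\<close> is the same radius before scaling by \<rho>. The rescaled density tends
  to the pure power tail and is dominated by a multiple of it. Dividing by
  \<open>q j ^ DIM('a)\<close> makes the ball integral equal to \<open>V * s powr d\<close> times
  the mean of \<phi> over a ball of radius \<open>q j * s\<close>, and these means tend to \<phi> in
  L^1.\<close>

lemma scaled_tail_limit:
  fixes \<phi> :: "'a::euclidean_space \<Rightarrow> real" and f :: "real \<Rightarrow> real" and l q :: "nat \<Rightarrow> real"
  defines "d \<equiv> real DIM('a)" and "V \<equiv> ball_vol TYPE('a) 1"
  assumes \<phi>: "integrable lborel \<phi>" "integrable lborel (\<lambda>x. (\<phi> x)\<^sup>2)"
    and beta: "d < \<beta>" "\<beta> < 2 * d"
    and f: "f \<in> borel_measurable borel" "\<And>r. 0 \<le> f r" "\<And>r. r < 0 \<Longrightarrow> f r = 0"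
    and tail: "f \<sim>[at_top] (\<lambda>r. C\<^sub>\<beta> * r powr (- \<beta> - 1))" "0 < C\<^sub>\<beta>" and bound: "\<And>r. 0 \<le> r \<Longrightarrow> r powr (\<beta> + 1) * f r \<le> C\<^sub>0"
    and l: "\<And>j. 0 < l j" "filterlim l at_top sequentially" and q: "\<And>j. 0 < q j" "q \<longlonglongrightarrow> 0"
  shows "(\<lambda>j. CLINT s|lborel. (l j powr (\<beta> + 1) * f (l j * s)) *\<^sub>R (CLINT x|lborel. centered_iexp (ball_integral \<phi> x (q j * s) / q j ^ DIM('a))))
    \<longlonglongrightarrow> (CLINT s|lborel. (indicator {0<..} s * (C\<^sub>\<beta> * s powr (- \<beta> - 1))) *\<^sub>R (CLINT x|lborel. centered_iexp (V * \<phi> x * s powr d)))"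
proof -
  note [measurable] = f(1)
  have [measurable]: "\<phi> \<in> borel_measurable borel" using \<phi>(1) by auto
  have V0: "0 < V" unfolding V_def by (rule ball_vol_pos) simp
  define N1 where "N1 = (LINT x|lborel. \<bar>\<phi> x\<bar>)"
  define N2 where "N2 = (LINT x|lborel. (\<phi> x)\<^sup>2)"
  have N: "(\<integral>\<^sup>+y. ennreal \<bar>\<phi> y\<bar> \<partial>lborel) = ennreal N1" "(\<integral>\<^sup>+y. ennreal ((\<phi> y)\<^sup>2) \<partial>lborel) = ennreal N2" "0 \<le> N1" "0 \<le> N2"
    unfolding N1_def N2_def using \<phi> by (auto intro!: nn_integral_eq_integral integral_nonneg_AE)
  have C0: "0 \<le> C\<^sub>0" using bound[of 0] by simp
  \<comment> \<open>The uniform bound on the rescaled density times the minimum of the two bounds on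
    the spatial integral.\<close>
  let ?w = "\<lambda>s. C\<^sub>0 * (indicator {0<..} s * (s powr (- \<beta> - 1) * min ((2 * V * N1) * s powr d) ((V\<^sup>2 * N2 / 2) * s powr (2 * d))))"
  have sd: "s ^ DIM('a) = s powr d" if "0 < s" for s unfolding d_def using that by (simp add: powr_realpow)
  have vol_eq: "ball_vol TYPE('a) (c * s) = c ^ DIM('a) * (V * s powr d)" if "0 < c" "0 < s" for c s
    using ball_vol_scale[OF that(1), of s, where 'a='a] ball_vol_eq_if[of s, where 'a='a] that unfolding V_def by (simp only: sd if_True)
  have Jbound: "norm (CLINT x|lborel. centered_iexp (ball_integral \<phi> x (q j * s) / q j ^ DIM('a))) \<le> min ((2 * V * N1) * s powr d) ((V\<^sup>2 * N2 / 2) * s powr (2 * d))"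
    if s: "0 < s" for s j
  proof -
    define Q where "Q = q j ^ DIM('a)"
    have Q: "0 < Q" unfolding Q_def using q(1) by simp
    define a where "a = V * s powr d"
    have a0: "0 \<le> a" unfolding a_def using V0 by simp
    have vol: "ball_vol TYPE('a) (q j * s) = Q * a"
      using q(1)[of j] s unfolding a_def Q_def by (simp only: vol_eq)
    have A: "(\<integral>\<^sup>+x. ennreal \<bar>ball_integral \<phi> x (q j * s) / Q\<bar> \<partial>lborel) \<le> ennreal (a * N1)"
    proof -
      have "(\<integral>\<^sup>+x. ennreal \<bar>ball_integral \<phi> x (q j * s) / Q\<bar> \<partial>lborel) = ennreal (1 / Q) * (\<integral>\<^sup>+x. ennreal \<bar>ball_integral \<phi> x (q j * s)\<bar> \<partial>lborel)"
        unfolding ennreal_abs_divide[OF Q] by (rule nn_integral_cmult) measurable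
      also have "\<dots> \<le> ennreal (1 / Q) * (ennreal (Q * a) * ennreal N1)"
        using nn_integral_abs_ball_integral_le[OF \<phi>(1), of "q j * s"] unfolding vol N(1) by (intro mult_left_mono) auto
      also have "\<dots> = ennreal (1 / Q * (Q * a * N1))"
        using Q a0 N(3) by (intro ennreal_mult_mult) auto
      also have "1 / Q * (Q * a * N1) = a * N1" using Q by simp
      finally show ?thesis .
    qed
    have B: "(\<integral>\<^sup>+x. ennreal ((ball_integral \<phi> x (q j * s) / Q)\<^sup>2) \<partial>lborel) \<le> ennreal (a\<^sup>2 * N2)"
    proof -
      have "(\<integral>\<^sup>+x. ennreal ((ball_integral \<phi> x (q j * s) / Q)\<^sup>2) \<partial>lborel) = ennreal (1 / Q\<^sup>2) * (\<integral>\<^sup>+x. ennreal ((ball_integral \<phi> x (q j * s))\<^sup>2) \<partial>lborel)"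
        unfolding ennreal_square_divide by (rule nn_integral_cmult) measurable
      also have "\<dots> \<le> ennreal (1 / Q\<^sup>2) * (ennreal ((Q * a)\<^sup>2) * ennreal N2)"
        using nn_integral_ball_integral_square_le[OF \<phi>(1), of "q j * s"] unfolding vol N(2) by (intro mult_left_mono) auto
      also have "\<dots> = ennreal (1 / Q\<^sup>2 * ((Q * a)\<^sup>2 * N2))"
        using N(4) by (intro ennreal_mult_mult) auto
      also have "1 / Q\<^sup>2 * ((Q * a)\<^sup>2 * N2) = a\<^sup>2 * N2" using Q by (simp add: power_mult_distrib)
      finally show ?thesis .
    qed
    have "norm (CLINT x|lborel. centered_iexp (ball_integral \<phi> x (q j * s) / Q)) \<le> min (2 * (a * N1)) (a\<^sup>2 * N2 / 2)"
      using a0 N(3,4) by (intro norm_integral_centered_iexp_le(3) A B) auto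
    also have "2 * (a * N1) = (2 * V * N1) * s powr d" unfolding a_def by (simp only: mult_ac)
    also have "a\<^sup>2 * N2 / 2 = (V\<^sup>2 * N2 / 2) * s powr (2 * d)"
      using s unfolding a_def by (simp add: power_mult_distrib power2_eq_square powr_add[symmetric])
    finally show ?thesis unfolding Q_def .
  qed
  show ?thesis
  proof (rule integral_dominated_convergence[where w="?w"])
    show "integrable lborel ?w"
      using V0 N beta by (intro integrable_mult_right integrable_tail_majorant) auto
    have Jm: "(\<lambda>s. CLINT x|lborel. centered_iexp (ball_integral \<phi> x (q j * s) / q j ^ DIM('a))) \<in> borel_measurable borel" for j
    proof -
      have "(\<lambda>p. centered_iexp (ball_integral \<phi> (snd p) (q j * fst p) / q j ^ DIM('a))) \<in> borel_measurable (borel \<Otimes>\<^sub>M (lborel :: 'a measure))" by measurable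
      then show ?thesis using lborel.borel_measurable_lebesgue_integral[of "\<lambda>s x. centered_iexp (ball_integral \<phi> x (q j * s) / q j ^ DIM('a))" borel] by (simp add: case_prod_beta')
    qed
    have J0m: "(\<lambda>s. CLINT x|lborel. centered_iexp (V * \<phi> x * s powr d)) \<in> borel_measurable borel"
    proof -
      have "(\<lambda>p. centered_iexp (V * \<phi> (snd p) * fst p powr d)) \<in> borel_measurable (borel \<Otimes>\<^sub>M (lborel :: 'a measure))" by measurable
      then show ?thesis using lborel.borel_measurable_lebesgue_integral[of "\<lambda>s x. centered_iexp (V * \<phi> x * s powr d)" borel] by (simp add: case_prod_beta')
    qed
    show "(\<lambda>s. (indicator {0<..} s * (C\<^sub>\<beta> * s powr (- \<beta> - 1))) *\<^sub>R (CLINT x|lborel. centered_iexp (V * \<phi> x * s powr d))) \<in> borel_measurable lborel"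
      using J0m by measurable
    show "(\<lambda>s. (l j powr (\<beta> + 1) * f (l j * s)) *\<^sub>R (CLINT x|lborel. centered_iexp (ball_integral \<phi> x (q j * s) / q j ^ DIM('a)))) \<in> borel_measurable lborel" for j
      using Jm[of j] by measurable
    \<comment> \<open>With the origin removed, an \<open>s\<close> that is not positive means a
      negative radius, where \<open>f\<close> vanishes.\<close>
    have nz: "AE s in lborel. s \<noteq> (0::real)" by (rule AE_lborel_singleton)
    show "AE s in lborel. norm ((l j powr (\<beta> + 1) * f (l j * s)) *\<^sub>R (CLINT x|lborel. centered_iexp (ball_integral \<phi> x (q j * s) / q j ^ DIM('a)))) \<le> ?w s" for j
      using nz
    proof eventually_elim
      fix s :: real assume "s \<noteq> 0"
      let ?J = "CLINT x|lborel. centered_iexp (ball_integral \<phi> x (q j * s) / q j ^ DIM('a))"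
      show "norm ((l j powr (\<beta> + 1) * f (l j * s)) *\<^sub>R ?J) \<le> ?w s"
      proof (cases "0 < s")
        case True
        have "l j powr (\<beta> + 1) * f (l j * s) = s powr (- \<beta> - 1) * ((l j * s) powr (\<beta> + 1) * f (l j * s))"
          unfolding powr_rescale[OF True l(1)] by (simp only: mult.assoc)
        also have "\<dots> \<le> s powr (- \<beta> - 1) * C\<^sub>0"
          using True l(1)[of j] by (intro mult_left_mono bound) auto
        finally have fb: "l j powr (\<beta> + 1) * f (l j * s) \<le> C\<^sub>0 * s powr (- \<beta> - 1)" by (simp add: mult.commute)
        have "norm ((l j powr (\<beta> + 1) * f (l j * s)) *\<^sub>R ?J) = (l j powr (\<beta> + 1) * f (l j * s)) * norm ?J"
          using f(2) by simp
        also have "\<dots> \<le> (C\<^sub>0 * s powr (- \<beta> - 1)) * min ((2 * V * N1) * s powr d) ((V\<^sup>2 * N2 / 2) * s powr (2 * d))"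
          using C0 f(2) by (intro mult_mono fb Jbound True) auto
        finally show ?thesis using True by simp
      next
        case False
        then have "l j * s < 0" using \<open>s \<noteq> 0\<close> l(1)[of j] by (simp add: mult_pos_neg)
        then show ?thesis using False by (simp add: f(3))
      qed
    qed
    show "AE s in lborel. (\<lambda>j. (l j powr (\<beta> + 1) * f (l j * s)) *\<^sub>R (CLINT x|lborel. centered_iexp (ball_integral \<phi> x (q j * s) / q j ^ DIM('a))))
      \<longlonglongrightarrow> (indicator {0<..} s * (C\<^sub>\<beta> * s powr (- \<beta> - 1))) *\<^sub>R (CLINT x|lborel. centered_iexp (V * \<phi> x * s powr d))"
      using nz
    proof eventually_elim
      fix s :: real assume s0: "s \<noteq> 0"
      show "(\<lambda>j. (l j powr (\<beta> + 1) * f (l j * s)) *\<^sub>R (CLINT x|lborel. centered_iexp (ball_integral \<phi> x (q j * s) / q j ^ DIM('a))))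
        \<longlonglongrightarrow> (indicator {0<..} s * (C\<^sub>\<beta> * s powr (- \<beta> - 1))) *\<^sub>R (CLINT x|lborel. centered_iexp (V * \<phi> x * s powr d))"
      proof (cases "0 < s")
        case False
        then have "l j * s < 0" for j using s0 l(1)[of j] by (simp add: mult_pos_neg)
        then show ?thesis using False by (simp add: f(3))
      next
        case True
        have flim: "(\<lambda>j. l j powr (\<beta> + 1) * f (l j * s)) \<longlonglongrightarrow> C\<^sub>\<beta> * s powr (- \<beta> - 1)"
        proof -
          \<comment> \<open>Asymptotic equivalence is defined with the value 1 for
            \<open>0 / 0\<close>; the comparison function is positive for \<open>r > 0\<close>, so
            the plain quotient converges as well.\<close>
          have r: "((\<lambda>r. f r / (C\<^sub>\<beta> * r powr (- \<beta> - 1))) \<longlongrightarrow> 1) at_top"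
          proof (rule Lim_transform_eventually[OF asymp_equivD[OF tail(1)]])
            show "\<forall>\<^sub>F r in at_top. (if f r = 0 \<and> C\<^sub>\<beta> * r powr (- \<beta> - 1) = 0 then 1 else f r / (C\<^sub>\<beta> * r powr (- \<beta> - 1))) = f r / (C\<^sub>\<beta> * r powr (- \<beta> - 1))"
              using eventually_gt_at_top[of 0] by eventually_elim (use tail(2) in auto)
          qed
          have "filterlim (\<lambda>j. l j * s) at_top sequentially"
            using True by (rule filterlim_at_top_mult_tendsto_pos[OF tendsto_const _ l(2)])
          from filterlim_compose[OF r this]
          have "(\<lambda>j. f (l j * s) / (C\<^sub>\<beta> * (l j * s) powr (- \<beta> - 1))) \<longlonglongrightarrow> 1" .
          then have "(\<lambda>j. (C\<^sub>\<beta> * s powr (- \<beta> - 1)) * (f (l j * s) / (C\<^sub>\<beta> * (l j * s) powr (- \<beta> - 1)))) \<longlonglongrightarrow> (C\<^sub>\<beta> * s powr (- \<beta> - 1)) * 1"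
            by (intro tendsto_mult tendsto_const)
          moreover have "(C\<^sub>\<beta> * s powr (- \<beta> - 1)) * (f (l j * s) / (C\<^sub>\<beta> * (l j * s) powr (- \<beta> - 1))) = l j powr (\<beta> + 1) * f (l j * s)" for j
          proof -
            have alg: "c * S * (F / (c * (inverse L * S))) = L * F" if "0 < c" "0 < S" "0 < L" for c S L F :: real
              using that by (simp add: field_simps)
            have "(l j * s) powr (- \<beta> - 1) = l j powr (- (\<beta> + 1)) * s powr (- \<beta> - 1)"
              using True l(1)[of j] by (simp add: powr_mult)
            then have eq: "(l j * s) powr (- \<beta> - 1) = inverse (l j powr (\<beta> + 1)) * s powr (- \<beta> - 1)"
              by (simp only: powr_minus)
            show ?thesis unfolding eq using True l(1)[of j] tail(2) by (intro alg) auto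
          qed
          ultimately show ?thesis by simp
        qed
        have Jlim: "(\<lambda>j. CLINT x|lborel. centered_iexp (ball_integral \<phi> x (q j * s) / q j ^ DIM('a))) \<longlonglongrightarrow> (CLINT x|lborel. centered_iexp (V * \<phi> x * s powr d))"
        proof (rule LIM_zero_cancel, rule Lim_null_comparison)
          define a where "a = V * s powr d"
          have a0: "0 < a" using V0 True by (simp add: a_def)
          \<comment> \<open>\<open>centered_iexp\<close> is Lipschitz with constant 2, so the two
            spatial integrals differ by at most \<open>2 * a\<close> times the L^1 error of the
            averages over balls of radius \<open>q j * s\<close>.\<close>
          let ?e = "\<lambda>j. ennreal (2 * a) * ball_average_error \<phi> (q j * s)"
          have qs: "filterlim (\<lambda>j. q j * s) (at_right 0) sequentially"
          proof -
            have "(\<lambda>j. q j * s) \<longlonglongrightarrow> 0 * s" by (intro tendsto_mult q(2) tendsto_const)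
            then show ?thesis using q(1) True by (intro filterlim_at_withinI) (auto intro!: always_eventually)
          qed
          have elim: "?e \<longlonglongrightarrow> 0"
            using ennreal_tendsto_cmult[OF _ filterlim_compose[OF ball_average_error_tendsto_0[OF \<phi>(1)] qs], of "ennreal (2 * a)"] by simp
          \<comment> \<open>The bound 1 serves to make the error finite, as monotonicity of
            \<open>enn2real\<close> requires.\<close>
          then have "\<forall>\<^sub>F j in sequentially. ?e j < 1" by (intro order_tendstoD(2)) auto
          then show "\<forall>\<^sub>F j in sequentially. norm ((CLINT x|lborel. centered_iexp (ball_integral \<phi> x (q j * s) / q j ^ DIM('a))) - (CLINT x|lborel. centered_iexp (V * \<phi> x * s powr d))) \<le> enn2real (?e j)"
          proof eventually_elim
            fix j assume e1: "?e j < 1"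
            let ?B = "\<lambda>x. ball_integral \<phi> x (q j * s) / q j ^ DIM('a)"
            have vol: "ball_vol TYPE('a) (q j * s) = q j ^ DIM('a) * a"
              using q(1)[of j] True unfolding a_def by (simp only: vol_eq)
            have eqx: "?B x - a * \<phi> x = a * (ball_integral \<phi> x (q j * s) / ball_vol TYPE('a) (q j * s) - \<phi> x)" for x
              unfolding vol using a0 q(1)[of j] by (simp add: right_diff_distrib)
            have i1: "integrable lborel (\<lambda>x. centered_iexp (?B x))"
            proof (rule Bochner_Integration.integrable_bound)
              have "(\<integral>\<^sup>+x. ennreal \<bar>ball_integral \<phi> x (q j * s)\<bar> \<partial>lborel) < \<infinity>"
                using le_less_trans[OF nn_integral_abs_ball_integral_le[OF \<phi>(1), of "q j * s"]] N by (simp add: ennreal_mult_less_top)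
              then show "integrable lborel (\<lambda>x. 2 * (ball_integral \<phi> x (q j * s) / q j ^ DIM('a)))"
                by (intro integrable_mult_right integrable_divide) (simp add: integrable_iff_bounded)
              show "AE x in lborel. norm (centered_iexp (?B x)) \<le> norm (2 * ?B x)"
                by (intro AE_I2 norm_centered_iexp_le_norm)
            qed measurable
            have i2: "integrable lborel (\<lambda>x. centered_iexp (a * \<phi> x))"
            proof (rule Bochner_Integration.integrable_bound)
              show "integrable lborel (\<lambda>x. 2 * (a * \<phi> x))" using \<phi>(1) by simp
              show "AE x in lborel. norm (centered_iexp (a * \<phi> x)) \<le> norm (2 * (a * \<phi> x))"
                by (intro AE_I2 norm_centered_iexp_le_norm)
            qed measurable
            have "ennreal (norm ((CLINT x|lborel. centered_iexp (?B x)) - (CLINT x|lborel. centered_iexp (a * \<phi> x)))) =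
              ennreal (norm (CLINT x|lborel. centered_iexp (?B x) - centered_iexp (a * \<phi> x)))"
              using i1 i2 by (subst Bochner_Integration.integral_diff) auto
            also have "\<dots> \<le> (\<integral>\<^sup>+x. norm (centered_iexp (?B x) - centered_iexp (a * \<phi> x)) \<partial>lborel)"
              by (rule integral_norm_bound_ennreal) (rule Bochner_Integration.integrable_diff[OF i1 i2])
            also have "\<dots> \<le> (\<integral>\<^sup>+x. ennreal (2 * a) * ennreal \<bar>ball_integral \<phi> x (q j * s) / ball_vol TYPE('a) (q j * s) - \<phi> x\<bar> \<partial>lborel)"
            proof (rule nn_integral_mono)
              fix x
              have "norm (centered_iexp (?B x) - centered_iexp (a * \<phi> x)) \<le> 2 * \<bar>?B x - a * \<phi> x\<bar>" by (rule centered_iexp_lipschitz)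
              also have "\<dots> = 2 * a * \<bar>ball_integral \<phi> x (q j * s) / ball_vol TYPE('a) (q j * s) - \<phi> x\<bar>"
                unfolding eqx using a0 by (simp only: abs_mult abs_of_pos mult.assoc)
              finally have "ennreal (norm (centered_iexp (?B x) - centered_iexp (a * \<phi> x))) \<le> ennreal (2 * a * \<bar>ball_integral \<phi> x (q j * s) / ball_vol TYPE('a) (q j * s) - \<phi> x\<bar>)"
                by (rule ennreal_leI)
              also have "\<dots> = ennreal (2 * a) * ennreal \<bar>ball_integral \<phi> x (q j * s) / ball_vol TYPE('a) (q j * s) - \<phi> x\<bar>"
                using a0 by (intro ennreal_mult) auto
              finally show "ennreal (norm (centered_iexp (?B x) - centered_iexp (a * \<phi> x))) \<le> ennreal (2 * a) * ennreal \<bar>ball_integral \<phi> x (q j * s) / ball_vol TYPE('a) (q j * s) - \<phi> x\<bar>" .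
            qed
            also have "\<dots> = ?e j" unfolding ball_average_error_def by (rule nn_integral_cmult) measurable
            finally have "ennreal (norm ((CLINT x|lborel. centered_iexp (?B x)) - (CLINT x|lborel. centered_iexp (a * \<phi> x)))) \<le> ?e j" .
            then have "enn2real (ennreal (norm ((CLINT x|lborel. centered_iexp (?B x)) - (CLINT x|lborel. centered_iexp (a * \<phi> x))))) \<le> enn2real (?e j)"
              using e1 by (intro enn2real_mono) (auto intro: less_trans)
            then show "norm ((CLINT x|lborel. centered_iexp (?B x)) - (CLINT x|lborel. centered_iexp (V * \<phi> x * s powr d))) \<le> enn2real (?e j)"
              by (simp add: a_def mult_ac)
          qed
          have "(\<lambda>j. enn2real (?e j)) \<longlonglongrightarrow> enn2real 0" using elim by (intro tendsto_enn2real) auto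
          then show "(\<lambda>j. enn2real (?e j)) \<longlonglongrightarrow> 0" by simp
        qed
        have "(\<lambda>j. (l j powr (\<beta> + 1) * f (l j * s)) *\<^sub>R (CLINT x|lborel. centered_iexp (ball_integral \<phi> x (q j * s) / q j ^ DIM('a))))
          \<longlonglongrightarrow> (C\<^sub>\<beta> * s powr (- \<beta> - 1)) *\<^sub>R (CLINT x|lborel. centered_iexp (V * \<phi> x * s powr d))"
          by (intro tendsto_scaleR flim Jlim)
        then show ?thesis using True by simp
      qed
    qed
  qed
qed

text \<open>After exchanging the integrals, the one over \<open>s\<close> for a fixed
  \<open>x\<close> is \<open>tail_integral_centered_iexp\<close> with
  \<open>u = V * \<phi> x\<close>; homogeneity of \<open>stable_exponent\<close> then extracts
  \<open>V powr (\<beta> / d)\<close>.\<close>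

lemma tail_limit_value:
  fixes \<phi> :: "'a::euclidean_space \<Rightarrow> real"
  defines "d \<equiv> real DIM('a)" and "V \<equiv> ball_vol TYPE('a) 1"
  assumes \<phi>: "integrable lborel \<phi>" "integrable lborel (\<lambda>x. (\<phi> x)\<^sup>2)"
    and beta: "d < \<beta>" "\<beta> < 2 * d"
  defines "I \<equiv> LINT r:{0<..}|lborel. (1 - cos r) / r powr (1 + \<beta> / d)"
  shows "(CLINT s|lborel. (indicator {0<..} s * (C\<^sub>\<beta> * s powr (- \<beta> - 1))) *\<^sub>R (CLINT x|lborel. centered_iexp (V * \<phi> x * s powr d)))
    = - (complex_of_real (C\<^sub>\<beta> * V powr (\<beta> / d) / d * I)) * (CLINT x|lborel. stable_exponent (\<beta> / d) 1 (\<phi> x))"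
    and "0 \<le> I"
proof -
  have d0: "0 < d" unfolding d_def by simp
  have g: "1 < \<beta> / d" "\<beta> / d < 2" using beta d0 by (simp_all add: field_simps)
  show "0 \<le> I" unfolding I_def by (rule tail_integral_centered_iexp(3)[OF d0 g])
  have [measurable]: "\<phi> \<in> borel_measurable borel" using \<phi>(1) by auto
  have V0: "0 < V" unfolding V_def by (rule ball_vol_pos) simp
  define N1 where "N1 = (LINT x|lborel. \<bar>\<phi> x\<bar>)"
  define N2 where "N2 = (LINT x|lborel. (\<phi> x)\<^sup>2)"
  have N: "(\<integral>\<^sup>+y. ennreal \<bar>\<phi> y\<bar> \<partial>lborel) = ennreal N1" "(\<integral>\<^sup>+y. ennreal ((\<phi> y)\<^sup>2) \<partial>lborel) = ennreal N2" "0 \<le> N1" "0 \<le> N2"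
    unfolding N1_def N2_def using \<phi> by (auto intro!: nn_integral_eq_integral integral_nonneg_AE)
  let ?h = "\<lambda>s x. indicator {0<..} s *\<^sub>R (complex_of_real (s powr (- \<beta> - 1)) * centered_iexp (V * \<phi> x * s powr d))"
  have hm[measurable]: "(\<lambda>p. ?h (fst p) (snd p)) \<in> borel_measurable (lborel \<Otimes>\<^sub>M (lborel :: 'a measure))" by measurable
  have bnd: "integrable lborel (\<lambda>x. centered_iexp (V * \<phi> x * s powr d)) \<and>
    (LINT x|lborel. norm (centered_iexp (V * \<phi> x * s powr d))) \<le> min ((2 * V * N1) * s powr d) ((V\<^sup>2 * N2 / 2) * s powr (2 * d))" if s: "0 < s" for s
  proof -
    let ?a = "V * s powr d"
    have a0: "0 \<le> ?a" using V0 by simp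
    have A: "(\<integral>\<^sup>+x. ennreal \<bar>V * \<phi> x * s powr d\<bar> \<partial>lborel) \<le> ennreal (?a * N1)"
    proof -
      have "(\<integral>\<^sup>+x. ennreal \<bar>V * \<phi> x * s powr d\<bar> \<partial>lborel) = (\<integral>\<^sup>+x. ennreal ?a * ennreal \<bar>\<phi> x\<bar> \<partial>lborel)"
        using V0 by (intro nn_integral_cong) (simp add: ennreal_mult[symmetric] abs_mult mult_ac)
      also have "\<dots> = ennreal ?a * ennreal N1" unfolding N(1)[symmetric] by (rule nn_integral_cmult) measurable
      finally show ?thesis using a0 N by (simp add: ennreal_mult)
    qed
    have B: "(\<integral>\<^sup>+x. ennreal ((V * \<phi> x * s powr d)\<^sup>2) \<partial>lborel) \<le> ennreal (?a\<^sup>2 * N2)"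
    proof -
      have "(\<integral>\<^sup>+x. ennreal ((V * \<phi> x * s powr d)\<^sup>2) \<partial>lborel) = (\<integral>\<^sup>+x. ennreal (?a\<^sup>2) * ennreal ((\<phi> x)\<^sup>2) \<partial>lborel)"
        by (intro nn_integral_cong) (simp add: ennreal_mult[symmetric] power_mult_distrib mult_ac)
      also have "\<dots> = ennreal (?a\<^sup>2) * ennreal N2" unfolding N(2)[symmetric] by (rule nn_integral_cmult) measurable
      finally show ?thesis using N by (simp add: ennreal_mult)
    qed
    have "(LINT x|lborel. norm (centered_iexp (V * \<phi> x * s powr d))) \<le> min (2 * (?a * N1)) (?a\<^sup>2 * N2 / 2)"
      using a0 N by (intro norm_integral_centered_iexp_le(2) A B) auto
    also have "?a\<^sup>2 = V\<^sup>2 * s powr (2 * d)" using s by (simp add: power_mult_distrib power2_eq_square powr_add[symmetric])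
    finally show ?thesis using norm_integral_centered_iexp_le(1)[OF _ A _ B] a0 N by (simp add: mult_ac)
  qed
  \<comment> \<open>Absolute integrability on the product comes from the same majorant in
    \<open>s\<close> as in the passage to the limit.\<close>
  have int: "integrable (lborel \<Otimes>\<^sub>M (lborel :: 'a measure)) (\<lambda>(s, x). ?h s x)"
  proof (rule lborel_pair.Fubini_integrable)
    show "(\<lambda>(s, x). ?h s x) \<in> borel_measurable (lborel \<Otimes>\<^sub>M (lborel :: 'a measure))" using hm by (simp add: case_prod_beta')
    have norm_h: "norm (?h s x) = indicator {0<..} s * (s powr (- \<beta> - 1) * norm (centered_iexp (V * \<phi> x * s powr d)))" for s x
      by (simp add: norm_mult)
    have im: "(\<lambda>s. LINT x|lborel. norm (?h s x)) \<in> borel_measurable lborel"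
    proof -
      have "(\<lambda>p. norm (?h (fst p) (snd p))) \<in> borel_measurable (lborel \<Otimes>\<^sub>M (lborel :: 'a measure))" by measurable
      then show ?thesis using lborel.borel_measurable_lebesgue_integral[of "\<lambda>s x. norm (?h s x)" lborel] by (simp only: case_prod_beta')
    qed
    show "integrable lborel (\<lambda>s. LINT x|lborel. norm (case (s, x) of (s, x) \<Rightarrow> ?h s x))"
    proof (rule Bochner_Integration.integrable_bound)
      show "integrable lborel (\<lambda>s. indicator {0<..} s * (s powr (- \<beta> - 1) * min ((2 * V * N1) * s powr d) ((V\<^sup>2 * N2 / 2) * s powr (2 * d))))"
        using V0 N beta by (intro integrable_tail_majorant) auto
      show "(\<lambda>s. LINT x|lborel. norm (case (s, x) of (s, x) \<Rightarrow> ?h s x)) \<in> borel_measurable lborel" using im by (simp only: prod.case)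
      show "AE s in lborel. norm (LINT x|lborel. norm (case (s, x) of (s, x) \<Rightarrow> ?h s x)) \<le> norm (indicator {0<..} s * (s powr (- \<beta> - 1) * min ((2 * V * N1) * s powr d) ((V\<^sup>2 * N2 / 2) * s powr (2 * d))))"
      proof (rule AE_I2)
        fix s :: real
        show "norm (LINT x|lborel. norm (case (s, x) of (s, x) \<Rightarrow> ?h s x)) \<le> norm (indicator {0<..} s * (s powr (- \<beta> - 1) * min ((2 * V * N1) * s powr d) ((V\<^sup>2 * N2 / 2) * s powr (2 * d))))"
        proof (cases "0 < s")
          case True
          have "(LINT x|lborel. norm (?h s x)) = s powr (- \<beta> - 1) * (LINT x|lborel. norm (centered_iexp (V * \<phi> x * s powr d)))"
            unfolding norm_h using True by simp
          also have "\<dots> \<le> s powr (- \<beta> - 1) * min ((2 * V * N1) * s powr d) ((V\<^sup>2 * N2 / 2) * s powr (2 * d))"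
            using bnd[OF True] by (intro mult_left_mono) auto
          finally have le: "(LINT x|lborel. norm (?h s x)) \<le> s powr (- \<beta> - 1) * min ((2 * V * N1) * s powr d) ((V\<^sup>2 * N2 / 2) * s powr (2 * d))" .
          have "0 \<le> (LINT x|lborel. norm (?h s x))" by (intro integral_nonneg_AE) simp
          then have "norm (LINT x|lborel. norm (?h s x)) = (LINT x|lborel. norm (?h s x))" by (simp only: real_norm_def abs_of_nonneg)
          also note le
          also have "s powr (- \<beta> - 1) * min ((2 * V * N1) * s powr d) ((V\<^sup>2 * N2 / 2) * s powr (2 * d)) \<le> norm (indicator {0<..} s * (s powr (- \<beta> - 1) * min ((2 * V * N1) * s powr d) ((V\<^sup>2 * N2 / 2) * s powr (2 * d))))"
            using True by simp
          finally show ?thesis by (simp only: prod.case)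
        qed simp
      qed
    qed
    show "AE s in lborel. integrable lborel (\<lambda>x. case (s, x) of (s, x) \<Rightarrow> ?h s x)"
    proof (rule AE_I2)
      fix s :: real
      show "integrable lborel (\<lambda>x. case (s, x) of (s, x) \<Rightarrow> ?h s x)"
        using bnd[of s] by (cases "0 < s") simp_all
    qed
  qed
  have "(CLINT s|lborel. (indicator {0<..} s * (C\<^sub>\<beta> * s powr (- \<beta> - 1))) *\<^sub>R (CLINT x|lborel. centered_iexp (V * \<phi> x * s powr d))) =
    (CLINT s|lborel. complex_of_real C\<^sub>\<beta> * (CLINT x|lborel. ?h s x))"
  proof (intro Bochner_Integration.integral_cong refl)
    fix s :: real
    show "(indicator {0<..} s * (C\<^sub>\<beta> * s powr (- \<beta> - 1))) *\<^sub>R (CLINT x|lborel. centered_iexp (V * \<phi> x * s powr d)) = complex_of_real C\<^sub>\<beta> * (CLINT x|lborel. ?h s x)"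
      by (cases "0 < s") (simp_all add: scaleR_conv_of_real mult.assoc)
  qed
  also have "\<dots> = complex_of_real C\<^sub>\<beta> * (CLINT s|lborel. CLINT x|lborel. ?h s x)" by (rule integral_mult_right_zero)
  also have "(CLINT s|lborel. CLINT x|lborel. ?h s x) = (CLINT x|lborel. CLINT s|lborel. ?h s x)"
    by (rule lborel_pair.Fubini_integral[symmetric]) (rule int)
  also have "\<dots> = (CLINT x|lborel. - complex_of_real (I / d) * stable_exponent (\<beta> / d) 1 (V * \<phi> x))"
    unfolding I_def by (intro Bochner_Integration.integral_cong refl tail_integral_centered_iexp(2)[OF d0 g])
  also have "\<dots> = - complex_of_real (I / d) * (complex_of_real (V powr (\<beta> / d)) * (CLINT x|lborel. stable_exponent (\<beta> / d) 1 (\<phi> x)))"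
    unfolding stable_exponent_mult[OF V0] by simp
  finally show "(CLINT s|lborel. (indicator {0<..} s * (C\<^sub>\<beta> * s powr (- \<beta> - 1))) *\<^sub>R (CLINT x|lborel. centered_iexp (V * \<phi> x * s powr d)))
    = - (complex_of_real (C\<^sub>\<beta> * V powr (\<beta> / d) / d * I)) * (CLINT x|lborel. stable_exponent (\<beta> / d) 1 (\<phi> x))"
    by (simp add: mult_ac)
qed

section \<open>Characteristic functions of the centred fields\<close>

context marked_dpp
begin

lemma pair_sigma_finite_mark: "pair_sigma_finite (lborel :: 'a measure) \<nu>" ..

lemma sets_pair_mark[simp, measurable_cong]: "sets ((lborel :: 'a measure) \<Otimes>\<^sub>M \<nu>) = sets (borel \<Otimes>\<^sub>M borel)"
  by (intro sets_pair_measure_cong) simp_all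

lemma summable_marks_iff: "summable_marks u \<longleftrightarrow> integrable (lborel \<Otimes>\<^sub>M \<nu>) (\<lambda>p. u (fst p) (snd p))"
proof -
  have m: "(\<lambda>(x, r). u x r) \<in> borel_measurable (borel \<Otimes>\<^sub>M borel) \<longleftrightarrow> (\<lambda>p. u (fst p) (snd p)) \<in> borel_measurable ((lborel :: 'a measure) \<Otimes>\<^sub>M \<nu>)"
    unfolding case_prod_beta' by (intro measurable_cong_sets[THEN arg_cong2[where f="(\<in>)", OF refl]]) simp_all
  show ?thesis
  proof (cases "(\<lambda>p. u (fst p) (snd p)) \<in> borel_measurable ((lborel :: 'a measure) \<Otimes>\<^sub>M \<nu>)")
    case True
    then have "(\<integral>\<^sup>+x. (\<integral>\<^sup>+r. ennreal \<bar>u x r\<bar> \<partial>\<nu>) \<partial>lborel) = (\<integral>\<^sup>+p. ennreal \<bar>u (fst p) (snd p)\<bar> \<partial>(lborel \<Otimes>\<^sub>M \<nu>))"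
      by (subst mark.nn_integral_fst[symmetric]) auto
    then show ?thesis unfolding summable_marks_def m using True by (simp add: integrable_iff_bounded)
  next
    case False
    then show ?thesis unfolding summable_marks_def m by auto
  qed
qed

text \<open>Subtracting the means multiplies the characteristic function by
  \<open>iexp (- E)\<close>, and the same factor turns the exponent with \<open>iexp u - 1\<close>
  into the one with \<open>centered_iexp u\<close>. As it has modulus 1, the error bound for the
  uncentred sum carries over unchanged.\<close>

lemma centered_mark_sums_char:
  fixes a :: "'i::finite \<Rightarrow> 'a \<Rightarrow> real \<Rightarrow> real"
  defines "u \<equiv> \<lambda>t x r. \<Sum>i\<in>UNIV. t i * a i x r"
  assumes sm: "\<And>i. summable_marks (a i)" and pos: "\<And>i x r. 0 \<le> a i x r"
    and B: "(\<integral>\<^sup>+x. (\<integral>\<^sup>+r. ennreal \<bar>u t x r\<bar> \<partial>\<nu>)\<^sup>2 \<partial>lborel) \<le> ennreal B" "0 \<le> B"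
  shows "cmod (expectation (\<lambda>w. iexp (\<Sum>i\<in>UNIV. t i * (mark_sum (a i) w - expectation (mark_sum (a i))))) -
      exp (complex_of_real intensity * (CLINT x|lborel. CLINT r|\<nu>. centered_iexp (u t x r))))
    \<le> intensity * B + 3 * sqrt ((intensity + kernel_energy) * B)"
proof -
  interpret pair: pair_sigma_finite "lborel :: 'a measure" \<nu> by (rule pair_sigma_finite_mark)
  let ?P = "(lborel :: 'a measure) \<Otimes>\<^sub>M \<nu>"
  let ?u = "u t"
  have ai: "integrable ?P (\<lambda>p. a i (fst p) (snd p))" for i using sm[of i] by (simp only: summable_marks_iff)
  have ui: "integrable ?P (\<lambda>p. ?u (fst p) (snd p))" unfolding u_def by (intro Bochner_Integration.integrable_sum integrable_mult_right ai)
  then have smu: "summable_marks ?u" by (simp only: summable_marks_iff)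
  have um: "(\<lambda>(x, r). ?u x r) \<in> borel_measurable (borel \<Otimes>\<^sub>M borel)" using smu by (simp add: summable_marks_def)
  have um'[measurable]: "(\<lambda>p. ?u (fst p) (snd p)) \<in> borel_measurable ?P" using ui by auto
  have ux[measurable]: "?u x \<in> borel_measurable borel" for x using compose_measurable[OF um, of "\<lambda>_. x" borel "\<lambda>r. r"] by simp
  have msm[measurable]: "mark_sum (a i) \<in> borel_measurable M" for i using sm[of i] by (intro mark_sum_measurable) (simp add: summable_marks_def)
  have msu[measurable]: "mark_sum ?u \<in> borel_measurable M" by (rule mark_sum_measurable[OF um])
  define E where "E = intensity * (LINT p|?P. ?u (fst p) (snd p))"
  have Ea: "(\<Sum>i\<in>UNIV. t i * expectation (mark_sum (a i))) = E"
  proof -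
    have "expectation (mark_sum (a i)) = intensity * (LINT p|?P. a i (fst p) (snd p))" for i
      using mark_sum_expectation(1)[OF sm pos] pair.integral_fst'[OF ai[of i]] by simp
    then have "(\<Sum>i\<in>UNIV. t i * expectation (mark_sum (a i))) = intensity * (\<Sum>i\<in>UNIV. t i * (LINT p|?P. a i (fst p) (snd p)))"
      by (simp add: sum_distrib_left mult.left_commute)
    also have "(\<Sum>i\<in>UNIV. t i * (LINT p|?P. a i (fst p) (snd p))) = (LINT p|?P. ?u (fst p) (snd p))"
      unfolding u_def using ai by (subst Bochner_Integration.integral_sum) auto
    finally show ?thesis unfolding E_def .
  qed
  \<comment> \<open>Linearity of \<open>mark_sum\<close> requires the series to converge absolutely,
    which holds almost surely by the summability of each \<open>a i\<close>.\<close>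
  have lin: "AE w in M. iexp (\<Sum>i\<in>UNIV. t i * (mark_sum (a i) w - expectation (mark_sum (a i)))) = iexp (- E) * iexp (mark_sum ?u w)"
  proof -
    have "AE w in M. \<forall>i\<in>UNIV. integrable (count_space UNIV) (\<lambda>n. of_bool (alive n w) * a i (X n w) (R n w))"
      by (intro AE_finite_allI mark_sum_AE_integrable sm) simp
    then show ?thesis
    proof eventually_elim
      fix w assume i: "\<forall>i\<in>UNIV. integrable (count_space UNIV) (\<lambda>n. of_bool (alive n w) * a i (X n w) (R n w))"
      have "mark_sum ?u w = (LINT n|count_space UNIV. (\<Sum>i\<in>UNIV. t i * (of_bool (alive n w) * a i (X n w) (R n w))))"
        unfolding mark_sum_def u_def by (simp only: sum_distrib_left mult.left_commute)
      also have "\<dots> = (\<Sum>i\<in>UNIV. t i * mark_sum (a i) w)"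
        unfolding mark_sum_def using i by (subst Bochner_Integration.integral_sum) auto
      finally have "(\<Sum>i\<in>UNIV. t i * (mark_sum (a i) w - expectation (mark_sum (a i)))) = - E + mark_sum ?u w"
        by (simp add: right_diff_distrib sum_subtractf Ea)
      then show "iexp (\<Sum>i\<in>UNIV. t i * (mark_sum (a i) w - expectation (mark_sum (a i)))) = iexp (- E) * iexp (mark_sum ?u w)"
        by (simp only: of_real_add distrib_left exp_add)
    qed
  qed
  define G where "G x = (CLINT r|\<nu>. iexp (?u x r) - 1)" for x
  have Gm[measurable]: "G \<in> borel_measurable lborel"
  proof -
    have "(\<lambda>p. iexp (?u (fst p) (snd p)) - 1) \<in> borel_measurable ?P" by measurable
    then show ?thesis unfolding G_def using mark.borel_measurable_lebesgue_integral[of "\<lambda>x r. iexp (?u x r) - 1" lborel] by (simp only: case_prod_beta')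
  qed
  have Gle: "ennreal (cmod (G x)) \<le> (\<integral>\<^sup>+r. ennreal \<bar>?u x r\<bar> \<partial>\<nu>)" for x
  proof -
    have i: "integrable \<nu> (\<lambda>r. iexp (?u x r) - 1)"
      by (rule mark.integrable_const_bound[where B=2]) (auto intro!: AE_I2 order_trans[OF norm_triangle_ineq4])
    have "ennreal (cmod (G x)) \<le> (\<integral>\<^sup>+r. norm (iexp (?u x r) - 1) \<partial>\<nu>)"
      unfolding G_def by (rule integral_norm_bound_ennreal[OF i])
    also have "\<dots> \<le> (\<integral>\<^sup>+r. ennreal \<bar>?u x r\<bar> \<partial>\<nu>)" by (intro nn_integral_mono ennreal_leI norm_iexp_minus_one_le)
    finally show ?thesis .
  qed
  have G2n: "(\<integral>\<^sup>+x. ennreal ((cmod (G x))\<^sup>2) \<partial>lborel) \<le> ennreal B"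
  proof -
    have "(\<integral>\<^sup>+x. ennreal ((cmod (G x))\<^sup>2) \<partial>lborel) \<le> (\<integral>\<^sup>+x. (\<integral>\<^sup>+r. ennreal \<bar>?u x r\<bar> \<partial>\<nu>)\<^sup>2 \<partial>lborel)"
    proof (rule nn_integral_mono)
      fix x
      have "ennreal ((cmod (G x))\<^sup>2) = (ennreal (cmod (G x)))\<^sup>2" by (simp add: ennreal_power)
      also have "\<dots> \<le> (\<integral>\<^sup>+r. ennreal \<bar>?u x r\<bar> \<partial>\<nu>)\<^sup>2" by (intro power_mono Gle) simp
      finally show "ennreal ((cmod (G x))\<^sup>2) \<le> (\<integral>\<^sup>+r. ennreal \<bar>?u x r\<bar> \<partial>\<nu>)\<^sup>2" .
    qed
    then show ?thesis using B by (rule_tac order_trans)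
  qed
  have G2i: "integrable lborel (\<lambda>x. (cmod (G x))\<^sup>2)"
    using le_less_trans[OF G2n ennreal_less_top] by (intro integrableI_nonneg) auto
  have G2B: "(LINT x|lborel. (cmod (G x))\<^sup>2) \<le> B"
  proof -
    have "ennreal (LINT x|lborel. (cmod (G x))\<^sup>2) \<le> ennreal B"
      using G2n G2i by (subst nn_integral_eq_integral[symmetric]) auto
    then show ?thesis using B(2) by (simp only: ennreal_le_iff)
  qed
  have bound: "cmod (expectation (\<lambda>w. iexp (mark_sum ?u w)) - exp (complex_of_real intensity * (CLINT x|lborel. G x)))
    \<le> intensity * B + 3 * sqrt ((intensity + kernel_energy) * B)"
  proof -
    have "cmod (expectation (\<lambda>w. iexp (mark_sum ?u w)) - exp (complex_of_real intensity * (CLINT x|lborel. G x))) \<le>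
      intensity * (LINT x|lborel. (cmod (G x))\<^sup>2) + 3 * sqrt ((intensity + kernel_energy) * (LINT x|lborel. (cmod (G x))\<^sup>2))"
      unfolding G_def using characteristic_function_bound(1)[OF smu] G2i unfolding G_def .
    also have "\<dots> \<le> intensity * B + 3 * sqrt ((intensity + kernel_energy) * B)"
      using intensity_nonneg kernel_energy_nonneg G2B by (intro add_mono mult_left_mono real_sqrt_le_mono) auto
    finally show ?thesis .
  qed
  have uci: "integrable ?P (\<lambda>p. complex_of_real (?u (fst p) (snd p)))" using ui by simp
  have ei: "integrable ?P (\<lambda>p. iexp (?u (fst p) (snd p)) - 1)"
    by (rule Bochner_Integration.integrable_bound[OF ui]) (auto intro!: AE_I2 norm_iexp_minus_one_le)
  have ci: "integrable ?P (\<lambda>p. centered_iexp (?u (fst p) (snd p)))"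
    unfolding centered_iexp_def by (intro Bochner_Integration.integrable_diff ei integrable_mult_right uci)
  have "(CLINT x|lborel. CLINT r|\<nu>. centered_iexp (?u x r)) = (CLINT p|?P. centered_iexp (?u (fst p) (snd p)))"
    using pair.integral_fst'[OF ci] by simp
  also have "\<dots> = (CLINT p|?P. iexp (?u (fst p) (snd p)) - 1) - (CLINT p|?P. \<i> * complex_of_real (?u (fst p) (snd p)))"
    unfolding centered_iexp_def by (intro Bochner_Integration.integral_diff ei integrable_mult_right uci)
  also have "(CLINT p|?P. iexp (?u (fst p) (snd p)) - 1) = (CLINT x|lborel. G x)"
    unfolding G_def using pair.integral_fst'[OF ei] by simp
  also have "(CLINT p|?P. \<i> * complex_of_real (?u (fst p) (snd p))) = \<i> * complex_of_real (LINT p|?P. ?u (fst p) (snd p))"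
    by simp
  finally have "complex_of_real intensity * (CLINT x|lborel. CLINT r|\<nu>. centered_iexp (?u x r)) =
    \<i> * complex_of_real (- E) + complex_of_real intensity * (CLINT x|lborel. G x)"
    unfolding E_def by (simp add: right_diff_distrib)
  then have ex: "exp (complex_of_real intensity * (CLINT x|lborel. CLINT r|\<nu>. centered_iexp (?u x r))) =
    iexp (- E) * exp (complex_of_real intensity * (CLINT x|lborel. G x))"
    by (simp only: exp_add)
  have "expectation (\<lambda>w. iexp (\<Sum>i\<in>UNIV. t i * (mark_sum (a i) w - expectation (mark_sum (a i))))) = (CLINT w|M. iexp (- E) * iexp (mark_sum ?u w))"
    by (rule integral_cong_AE[OF _ _ lin]) measurable
  also have "\<dots> = iexp (- E) * expectation (\<lambda>w. iexp (mark_sum ?u w))" by (rule integral_mult_right_zero)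
  finally have eq: "expectation (\<lambda>w. iexp (\<Sum>i\<in>UNIV. t i * (mark_sum (a i) w - expectation (mark_sum (a i))))) = iexp (- E) * expectation (\<lambda>w. iexp (mark_sum ?u w))" .
  show ?thesis
    unfolding eq ex right_diff_distrib[symmetric] norm_mult norm_exp_i_times mult_1 by (rule bound)
qed

end

lemma ball_integral_nonneg: "(\<And>y. 0 \<le> \<psi> y) \<Longrightarrow> 0 \<le> ball_integral \<psi> x r"
  unfolding ball_integral_def by (intro integral_nonneg_AE) auto

lemma measure_density_cball:
  fixes \<psi> :: "'a::euclidean_space \<Rightarrow> real"
  assumes [measurable]: "\<psi> \<in> borel_measurable borel" and pos: "\<And>y. 0 \<le> \<psi> y"
  shows "measure (density lborel (\<lambda>y. ennreal (\<psi> y))) (cball x r) = ball_integral \<psi> x r"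
proof -
  have "emeasure (density lborel (\<lambda>y. ennreal (\<psi> y))) (cball x r) = (\<integral>\<^sup>+y. ennreal (\<psi> y) * indicator (cball x r) y \<partial>lborel)"
    by (rule emeasure_density) auto
  also have "\<dots> = (\<integral>\<^sup>+y. ennreal (indicator (cball x r) y * \<psi> y) \<partial>lborel)"
    by (intro nn_integral_cong) (auto split: split_indicator)
  finally show ?thesis unfolding Sigma_Algebra.measure_def ball_integral_def
    using pos by (subst integral_eq_nn_integral) auto
qed

lemma L2c_densities_integrable:
  assumes "(\<psi> :: 'a::euclidean_space \<Rightarrow> real) \<in> L2c_densities"
  shows "integrable lborel \<psi>" "integrable lborel (\<lambda>x. (\<psi> x)\<^sup>2)" "0 \<le> \<psi> x" "\<psi> \<in> borel_measurable borel"
proof -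
  show m: "\<psi> \<in> borel_measurable borel" and sq: "integrable lborel (\<lambda>x. (\<psi> x)\<^sup>2)" and "0 \<le> \<psi> x"
    using assms by (auto simp: L2c_densities_def)
  have pos: "0 \<le> \<psi> x" for x using assms by (auto simp: L2c_densities_def)
  obtain C where C: "compact C" "\<And>x. x \<notin> C \<Longrightarrow> \<psi> x = 0" using assms by (auto simp: L2c_densities_def)
  show "integrable lborel \<psi>"
  proof (rule Bochner_Integration.integrable_bound)
    have "emeasure lborel C < \<infinity>" using C(1) by (rule emeasure_compact_finite)
    then have "integrable lborel (indicat_real C)" using C(1) by (intro integrable_real_indicator) (auto intro: borel_compact)
    then show "integrable lborel (\<lambda>x. indicat_real C x + (\<psi> x)\<^sup>2)" using sq by simp
    show "\<psi> \<in> borel_measurable lborel" using m by simp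
    \<comment> \<open>From \<open>(p - 1/2)\<^sup>2 \<ge> 0\<close>. On the compact support the
      constant 1 is integrable, so the density is dominated by an integrable function.\<close>
    have alg: "p \<le> 1 + p\<^sup>2" for p :: real
      using zero_le_power2[of "p - 1/2"] by (simp add: power2_eq_square algebra_simps)
    show "AE x in lborel. norm (\<psi> x) \<le> norm (indicat_real C x + (\<psi> x)\<^sup>2)"
    proof (rule AE_I2)
      fix x show "norm (\<psi> x) \<le> norm (indicat_real C x + (\<psi> x)\<^sup>2)"
        using pos[of x] alg[of "\<psi> x"] C(2)[of x] by (cases "x \<in> C") auto
    qed
  qed
qed

lemma integrable_square_linear_combination:
  fixes \<psi> :: "'i \<Rightarrow> 'a::euclidean_space \<Rightarrow> real"
  assumes \<psi>: "\<And>i. integrable lborel (\<psi> i)" "\<And>i. integrable lborel (\<lambda>x. (\<psi> i x)\<^sup>2)"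
  shows "integrable lborel (\<lambda>x. (\<Sum>i\<in>I. t i * \<psi> i x)\<^sup>2)"
proof (rule Bochner_Integration.integrable_bound)
  show "integrable lborel (\<lambda>x. (\<Sum>i\<in>I. (t i)\<^sup>2) * (\<Sum>i\<in>I. (\<psi> i x)\<^sup>2))"
    by (intro integrable_mult_right Bochner_Integration.integrable_sum \<psi>)
  show "(\<lambda>x. (\<Sum>i\<in>I. t i * \<psi> i x)\<^sup>2) \<in> borel_measurable lborel"
    using borel_measurable_integrable[OF \<psi>(1)] by measurable
  show "AE x in lborel. norm ((\<Sum>i\<in>I. t i * \<psi> i x)\<^sup>2) \<le> norm ((\<Sum>i\<in>I. (t i)\<^sup>2) * (\<Sum>i\<in>I. (\<psi> i x)\<^sup>2))"
  proof (rule AE_I2)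
    fix x
    have "(\<Sum>i\<in>I. t i * \<psi> i x)\<^sup>2 \<le> (\<Sum>i\<in>I. (t i)\<^sup>2) * (\<Sum>i\<in>I. (\<psi> i x)\<^sup>2)" by (rule Cauchy_Schwarz_ineq_sum)
    then show "norm ((\<Sum>i\<in>I. t i * \<psi> i x)\<^sup>2) \<le> norm ((\<Sum>i\<in>I. (t i)\<^sup>2) * (\<Sum>i\<in>I. (\<psi> i x)\<^sup>2))"
      by (simp only: real_norm_def abs_of_nonneg zero_le_power2 order_trans[OF _ abs_ge_self])
  qed
qed

text \<open>Interface between the definitions and the marked process: the enumeration is extracted
  from \<open>iid_marking\<close>, and the integral against the counting measure of
  \<open>\<Phi> w\<close> becomes a \<open>mark_sum\<close>. The constant \<open>B\<close> is the
  bound of \<open>marked_ball_bounds\<close> with mean ball volume \<open>v\<close>.\<close>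

lemma ball_fields_char_bound:
  fixes \<psi> :: "'i::finite \<Rightarrow> 'a::euclidean_space \<Rightarrow> real" and k :: "'a \<Rightarrow> complex" and t :: "'i \<Rightarrow> real"
  defines "\<Psi> \<equiv> \<lambda>x. \<Sum>i\<in>UNIV. t i * \<psi> i x"
  assumes dpp: "determinantal_pp (M :: 'w measure) \<xi> (\<lambda>x y. k (x - y))" and k_square: "integrable lborel (\<lambda>x. (cmod (k x))\<^sup>2)"
    and marks: "iid_marking M \<xi> \<Phi> g" and \<nu>: "\<nu> = density lborel (\<lambda>r. ennreal (g r))"
    and vol: "(\<integral>\<^sup>+r. ennreal (ball_vol TYPE('a) r) \<partial>\<nu>) = ennreal v" "0 \<le> v"
    and \<psi>: "\<And>i. integrable lborel (\<psi> i)" "\<And>i. integrable lborel (\<lambda>x. (\<psi> i x)\<^sup>2)" "\<And>i x. 0 \<le> \<psi> i x"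
    and n: "0 < n"
  defines "B \<equiv> (v / n)\<^sup>2 * (LINT x|lborel. (\<Psi> x)\<^sup>2)"
  shows "cmod ((CLINT w|M. iexp (\<Sum>i\<in>UNIV. t i * (centered_ball_field M \<Phi> (density lborel (\<lambda>x. ennreal (\<psi> i x))) w / n))) -
      exp (complex_of_real (Re (k 0)) * (CLINT x|lborel. CLINT r|\<nu>. centered_iexp (ball_integral \<Psi> x r / n))))
    \<le> Re (k 0) * B + 3 * sqrt ((Re (k 0) + (LINT x|lborel. (cmod (k x))\<^sup>2)) * B)"
    and "centered_ball_field M \<Phi> (density lborel (\<lambda>x. ennreal (\<psi> i x))) \<in> borel_measurable M"
    and "0 \<le> Re (k 0)" and "prob_space M"
proof -
  obtain N :: "'w \<Rightarrow> enat" and X :: "nat \<Rightarrow> 'w \<Rightarrow> 'a" and R :: "nat \<Rightarrow> 'w \<Rightarrow> real" where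
    marking: "N \<in> measurable M (count_space UNIV) \<and> (\<forall>n. X n \<in> borel_measurable M) \<and>
        (\<forall>n. distributed M lborel (R n) (\<lambda>r. ennreal (g r))) \<and>
        prob_space.indep_vars M (\<lambda>_. borel) R UNIV \<and>
        prob_space.indep_set M
          (sets (vimage_algebra (space M) (\<lambda>\<omega>. (N \<omega>, \<lambda>n. X n \<omega>))
             (count_space UNIV \<Otimes>\<^sub>M (\<Pi>\<^sub>M n\<in>UNIV. borel))))
          (sets (vimage_algebra (space M) (\<lambda>\<omega> n. R n \<omega>) (\<Pi>\<^sub>M n\<in>UNIV. borel))) \<and>
        (\<forall>\<omega>\<in>space M.
           inj_on (\<lambda>n. X n \<omega>) {n. enat n < N \<omega>} \<and>
           \<xi> \<omega> = (\<lambda>n. X n \<omega>) ` {n. enat n < N \<omega>} \<and>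
           \<Phi> \<omega> = (\<lambda>n. (X n \<omega>, R n \<omega>)) ` {n. enat n < N \<omega>})"
    using marks unfolding iid_marking_def by (elim exE) (rule that)
  note N = marking[THEN conjunct1]
    and X = marking[THEN conjunct2, THEN conjunct1, rule_format]
    and R = marking[THEN conjunct2, THEN conjunct2, THEN conjunct1, rule_format]
    and Ri = marking[THEN conjunct2, THEN conjunct2, THEN conjunct2, THEN conjunct1]
    and ind = marking[THEN conjunct2, THEN conjunct2, THEN conjunct2, THEN conjunct2, THEN conjunct1]
    and pts = marking[THEN conjunct2, THEN conjunct2, THEN conjunct2, THEN conjunct2, THEN conjunct2, rule_format]
  show prob: "prob_space M" using dpp by (simp add: determinantal_pp_def simple_point_process_def)
  interpret prob_space M by (rule prob)
  have Rm: "R n \<in> borel_measurable M" for n using R[of n] by (simp add: distributed_def)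
  have Rd: "distr M borel (R n) = \<nu>" for n
  proof -
    have "distr M borel (R n) = distr M lborel (R n)" by (intro distr_cong) auto
    then show ?thesis using R[of n] unfolding \<nu> by (simp add: distributed_def)
  qed
  interpret marked_dpp M \<xi> k N X R \<nu>
  proof unfold_locales
    show "(\<lambda>w. (N w, \<lambda>n. X n w)) \<in> measurable M (count_space UNIV \<Otimes>\<^sub>M (\<Pi>\<^sub>M n\<in>UNIV. borel))"
      using N X by (intro measurable_Pair measurable_PiM_single') auto
    show "(\<lambda>w n. R n w) \<in> measurable M (\<Pi>\<^sub>M n\<in>UNIV. borel)" using Rm by (intro measurable_PiM_single') auto
  qed (rule dpp k_square N X ind Rm Rd Ri conjunct1[OF pts] conjunct1[OF conjunct2[OF pts]], assumption?)+
  show "0 \<le> Re (k 0)" using intensity_nonneg unfolding intensity_def .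
  have sf: "sigma_finite_measure \<nu>" ..
  have \<psi>m[measurable]: "\<psi> i \<in> borel_measurable borel" for i using \<psi>(1)[of i] by auto
  have field: "ball_field \<Phi> (density lborel (\<lambda>x. ennreal (\<psi> i x))) w = mark_sum (ball_integral (\<psi> i)) w" if w: "w \<in> space M" for i w
  proof -
    \<comment> \<open>The marked points are distinct already because their first components
      are.\<close>
    have "inj_on (\<lambda>n. (X n w, R n w)) {n. enat n < N w}" using pts[OF w] by (auto simp: inj_on_def)
    from integral_count_space_image[OF this, of "\<lambda>(x, r). ball_integral (\<psi> i) x r"]
    show ?thesis unfolding ball_field_def mark_sum_def measure_density_cball[OF \<psi>m \<psi>(3)] using pts[OF w]
      by (simp add: indicator_def alive_def cong: Bochner_Integration.integral_cong)
  qed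
  have div: "mark_sum (\<lambda>x r. ball_integral (\<psi> i) x r / n) w = mark_sum (ball_integral (\<psi> i)) w / n" for i w
    unfolding mark_sum_def times_divide_eq_right by (rule integral_divide_zero)
  have msm[measurable]: "mark_sum (ball_integral (\<psi> i)) \<in> borel_measurable M" for i
    using measurable_ball_integral_pair[of "\<psi> i" 1] by (intro mark_sum_measurable) simp
  show "centered_ball_field M \<Phi> (density lborel (\<lambda>x. ennreal (\<psi> i x))) \<in> borel_measurable M"
    unfolding centered_ball_field_def
    by (subst measurable_cong[where g="\<lambda>w. mark_sum (ball_integral (\<psi> i)) w - (LINT w|M. ball_field \<Phi> (density lborel (\<lambda>x. ennreal (\<psi> i x))) w)"]) (simp_all add: field)
  have cfield: "centered_ball_field M \<Phi> (density lborel (\<lambda>x. ennreal (\<psi> i x))) w / n =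
    mark_sum (\<lambda>x r. ball_integral (\<psi> i) x r / n) w - expectation (mark_sum (\<lambda>x r. ball_integral (\<psi> i) x r / n))" if w: "w \<in> space M" for i w
  proof -
    have "(LINT w|M. ball_field \<Phi> (density lborel (\<lambda>x. ennreal (\<psi> i x))) w) = expectation (mark_sum (ball_integral (\<psi> i)))"
      by (intro Bochner_Integration.integral_cong refl field)
    then show ?thesis unfolding centered_ball_field_def field[OF w] div by (simp add: diff_divide_distrib)
  qed
  have sm: "summable_marks (\<lambda>x r. ball_integral (\<psi> i) x r / n)" for i
    unfolding summable_marks_def
    using marked_ball_bounds(1)[OF sets_mark sf vol \<psi>(1,2) n, of i] measurable_ball_integral_pair[OF \<psi>m[of i], of n] by simp
  have \<Psi>i: "integrable lborel \<Psi>" unfolding \<Psi>_def by (intro Bochner_Integration.integrable_sum integrable_mult_right \<psi>)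
  have \<Psi>2: "integrable lborel (\<lambda>x. (\<Psi> x)\<^sup>2)" unfolding \<Psi>_def by (rule integrable_square_linear_combination[OF \<psi>(1,2)])
  have lin: "(\<Sum>i\<in>UNIV. t i * (ball_integral (\<psi> i) x r / n)) = ball_integral \<Psi> x r / n" for x r
  proof -
    have "ball_integral \<Psi> x r = (\<Sum>i\<in>UNIV. t i * ball_integral (\<psi> i) x r)"
      unfolding \<Psi>_def by (subst ball_integral_sum) (auto simp: ball_integral_cmult \<psi>)
    then show ?thesis by (simp add: sum_divide_distrib)
  qed
  have B0: "0 \<le> B" unfolding B_def by (intro mult_nonneg_nonneg integral_nonneg_AE) auto
  have "cmod (expectation (\<lambda>w. iexp (\<Sum>i\<in>UNIV. t i * (mark_sum (\<lambda>x r. ball_integral (\<psi> i) x r / n) w - expectation (mark_sum (\<lambda>x r. ball_integral (\<psi> i) x r / n))))) -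
      exp (complex_of_real intensity * (CLINT x|lborel. CLINT r|\<nu>. centered_iexp (\<Sum>i\<in>UNIV. t i * (ball_integral (\<psi> i) x r / n)))))
    \<le> intensity * B + 3 * sqrt ((intensity + kernel_energy) * B)"
  proof (rule centered_mark_sums_char[where a="\<lambda>i x r. ball_integral (\<psi> i) x r / n" and t=t, OF sm])
    show "0 \<le> ball_integral (\<psi> i) x r / n" for i x r using ball_integral_nonneg[of "\<psi> i" x r, OF \<psi>(3)] n by simp
    show "(\<integral>\<^sup>+x. (\<integral>\<^sup>+r. ennreal \<bar>\<Sum>i\<in>UNIV. t i * (ball_integral (\<psi> i) x r / n)\<bar> \<partial>\<nu>)\<^sup>2 \<partial>lborel) \<le> ennreal B"
      unfolding lin B_def by (rule marked_ball_bounds(2)[OF sets_mark sf vol \<Psi>i \<Psi>2 n])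
  qed (rule B0)
  moreover have "expectation (\<lambda>w. iexp (\<Sum>i\<in>UNIV. t i * (mark_sum (\<lambda>x r. ball_integral (\<psi> i) x r / n) w - expectation (mark_sum (\<lambda>x r. ball_integral (\<psi> i) x r / n))))) =
    (CLINT w|M. iexp (\<Sum>i\<in>UNIV. t i * (centered_ball_field M \<Phi> (density lborel (\<lambda>x. ennreal (\<psi> i x))) w / n)))"
    by (intro Bochner_Integration.integral_cong refl) (simp only: cfield)
  ultimately show "cmod ((CLINT w|M. iexp (\<Sum>i\<in>UNIV. t i * (centered_ball_field M \<Phi> (density lborel (\<lambda>x. ennreal (\<psi> i x))) w / n))) -
      exp (complex_of_real (Re (k 0)) * (CLINT x|lborel. CLINT r|\<nu>. centered_iexp (ball_integral \<Psi> x r / n))))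
    \<le> Re (k 0) * B + 3 * sqrt ((Re (k 0) + (LINT x|lborel. (cmod (k x))\<^sup>2)) * B)"
    unfolding lin intensity_def kernel_energy_def by (simp only:)
qed

text \<open>Radii up to 1 contribute at most the volume of the unit ball; beyond 1 the bound on
  \<open>f\<close> leaves the power \<open>d - \<beta> - 1\<close>, integrable because \<beta> > d.
  The constant \<open>v\<close> is the mean volume for \<rho> = 1, and scaling radii by \<rho>
  scales volumes by \<open>\<rho> ^ DIM('a)\<close>.\<close>

lemma radius_ball_vol:
  fixes f :: "real \<Rightarrow> real"
  assumes f: "f \<in> borel_measurable borel" "\<And>r. 0 \<le> f r" "\<And>r. r < 0 \<Longrightarrow> f r = 0" "(\<integral>\<^sup>+r. ennreal (f r) \<partial>lborel) = 1"
    and bound: "\<And>r. 0 \<le> r \<Longrightarrow> r powr (\<beta> + 1) * f r \<le> C\<^sub>0" and beta: "real DIM('a::euclidean_space) < \<beta>"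
  obtains v where "0 \<le> v"
    "\<And>\<rho>. 0 < \<rho> \<Longrightarrow> (\<integral>\<^sup>+r. ennreal (ball_vol TYPE('a) r) \<partial>density lborel (\<lambda>r. ennreal (f (r / \<rho>) / \<rho>))) = ennreal (v * \<rho> ^ DIM('a))"
proof -
  note [measurable] = f(1)
  let ?d = "real DIM('a)"
  define V where "V = ball_vol TYPE('a) 1"
  have V0: "0 \<le> V" unfolding V_def by simp
  have C0: "0 \<le> C\<^sub>0" using bound[of 0] by simp
  let ?I = "\<integral>\<^sup>+s. ennreal (ball_vol TYPE('a) s * f s) \<partial>lborel"
  have "?I \<le> (\<integral>\<^sup>+s. ennreal V * ennreal (f s) + ennreal (V * C\<^sub>0) * (ennreal (s powr (- (\<beta> - ?d) - 1)) * indicator {1..} s) \<partial>lborel)"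
  proof (rule nn_integral_mono)
    fix s
    show "ennreal (ball_vol TYPE('a) s * f s) \<le> ennreal V * ennreal (f s) + ennreal (V * C\<^sub>0) * (ennreal (s powr (- (\<beta> - ?d) - 1)) * indicator {1..} s)"
    proof (cases "1 \<le> s")
      case True
      have "s ^ DIM('a) = s powr ?d" using True by (simp add: powr_realpow)
      then have vs: "ball_vol TYPE('a) s = V * s powr ?d" using True ball_vol_eq[of s, where 'a='a] unfolding V_def by (simp only:)
      have "f s = s powr (- \<beta> - 1) * (s powr (\<beta> + 1) * f s)"
        using powr_rescale[of s 1 \<beta>] True by (simp add: mult.assoc[symmetric])
      also have "\<dots> \<le> s powr (- \<beta> - 1) * C\<^sub>0" using True by (intro mult_left_mono bound) auto
      finally have "ball_vol TYPE('a) s * f s \<le> V * s powr ?d * (s powr (- \<beta> - 1) * C\<^sub>0)"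
        unfolding vs using V0 by (intro mult_left_mono) auto
      also have "\<dots> = V * C\<^sub>0 * (s powr ?d * s powr (- \<beta> - 1))" by (simp only: mult_ac)
      also have "s powr ?d * s powr (- \<beta> - 1) = s powr (- (\<beta> - ?d) - 1)" by (simp add: powr_add[symmetric] algebra_simps)
      finally have "ennreal (ball_vol TYPE('a) s * f s) \<le> ennreal (V * C\<^sub>0 * s powr (- (\<beta> - ?d) - 1))" by (rule ennreal_leI)
      also have "\<dots> = ennreal (V * C\<^sub>0) * ennreal (s powr (- (\<beta> - ?d) - 1))" using V0 C0 by (intro ennreal_mult) auto
      finally show ?thesis using True by (simp add: add_increasing)
    next
      case False
      have "ball_vol TYPE('a) s \<le> V"
      proof (cases "0 \<le> s")
        case True
        have "V * s ^ DIM('a) \<le> V * 1" using False True V0 by (intro mult_left_mono power_le_one) auto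
        then show ?thesis using ball_vol_eq[OF True, where 'a='a] unfolding V_def by (simp only: mult_1_right)
      qed (use V0 in simp)
      then have "ennreal (ball_vol TYPE('a) s * f s) \<le> ennreal (V * f s)" using f(2) by (intro ennreal_leI mult_right_mono)
      also have "\<dots> = ennreal V * ennreal (f s)" using V0 f(2) by (intro ennreal_mult)
      finally show ?thesis by (simp add: add_increasing2)
    qed
  qed
  also have "\<dots> = ennreal V * 1 + ennreal (V * C\<^sub>0) * ennreal (1 / (\<beta> - ?d))"
    using beta nn_integral_powr_at_top[of "\<beta> - ?d"] unfolding f(4)[symmetric]
    by (subst nn_integral_add) (auto simp: nn_integral_cmult)
  also have "\<dots> < \<infinity>" by (simp add: ennreal_mult_less_top)
  finally obtain v where v: "0 \<le> v" "?I = ennreal v" by (cases ?I) auto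
  show ?thesis
  proof (rule that[OF v(1)])
    fix \<rho> :: real assume \<rho>: "0 < \<rho>"
    have "(\<integral>\<^sup>+r. ennreal (ball_vol TYPE('a) r) \<partial>density lborel (\<lambda>r. ennreal (f (r / \<rho>) / \<rho>))) =
      (\<integral>\<^sup>+r. ennreal (f (r / \<rho>) / \<rho>) * ennreal (ball_vol TYPE('a) r) \<partial>lborel)"
      by (rule nn_integral_density) auto
    also have "\<dots> = ennreal \<bar>\<rho>\<bar> * (\<integral>\<^sup>+s. ennreal (f ((0 + \<rho> * s) / \<rho>) / \<rho>) * ennreal (ball_vol TYPE('a) (0 + \<rho> * s)) \<partial>lborel)"
      using \<rho> by (intro nn_integral_real_affine) auto
    also have "\<dots> = (\<integral>\<^sup>+s. ennreal \<bar>\<rho>\<bar> * (ennreal (f ((0 + \<rho> * s) / \<rho>) / \<rho>) * ennreal (ball_vol TYPE('a) (0 + \<rho> * s))) \<partial>lborel)"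
      by (rule nn_integral_cmult[symmetric]) measurable
    also have "\<dots> = (\<integral>\<^sup>+s. ennreal (\<rho> ^ DIM('a)) * ennreal (ball_vol TYPE('a) s * f s) \<partial>lborel)"
    proof (rule nn_integral_cong)
      fix s
      have "ennreal \<bar>\<rho>\<bar> * (ennreal (f ((0 + \<rho> * s) / \<rho>) / \<rho>) * ennreal (ball_vol TYPE('a) (0 + \<rho> * s))) = ennreal \<rho> * (ennreal (f s / \<rho>) * ennreal (\<rho> ^ DIM('a) * ball_vol TYPE('a) s))"
        using \<rho> ball_vol_scale[OF \<rho>, of s, where 'a='a] f(2)[of s] by (simp add: divide_ennreal[symmetric])
      also have "\<dots> = ennreal (\<rho> * (f s / \<rho> * (\<rho> ^ DIM('a) * ball_vol TYPE('a) s)))"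
        using \<rho> f(2) by (intro ennreal_mult_mult) auto
      also have "\<rho> * (f s / \<rho> * (\<rho> ^ DIM('a) * ball_vol TYPE('a) s)) = \<rho> ^ DIM('a) * (ball_vol TYPE('a) s * f s)" using \<rho> by simp
      also have "ennreal (\<rho> ^ DIM('a) * (ball_vol TYPE('a) s * f s)) = ennreal (\<rho> ^ DIM('a)) * ennreal (ball_vol TYPE('a) s * f s)"
        using \<rho> f(2) by (intro ennreal_mult mult_nonneg_nonneg) auto
      finally show "ennreal \<bar>\<rho>\<bar> * (ennreal (f ((0 + \<rho> * s) / \<rho>) / \<rho>) * ennreal (ball_vol TYPE('a) (0 + \<rho> * s))) = ennreal (\<rho> ^ DIM('a)) * ennreal (ball_vol TYPE('a) s * f s)" .
    qed
    also have "\<dots> = ennreal (\<rho> ^ DIM('a)) * ennreal v" unfolding v(2)[symmetric] by (rule nn_integral_cmult) measurable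
    also have "\<dots> = ennreal (v * \<rho> ^ DIM('a))" using v(1) \<rho> by (simp only: ennreal_mult[symmetric] zero_le_power less_imp_le mult.commute)
    finally show "(\<integral>\<^sup>+r. ennreal (ball_vol TYPE('a) r) \<partial>density lborel (\<lambda>r. ennreal (f (r / \<rho>) / \<rho>))) = ennreal (v * \<rho> ^ DIM('a))" .
  qed
qed

text \<open>Substitution \<open>r = l * \<rho> * s\<close> in the radius law. In the application
  \<open>l powr \<beta>\<close> is \<lambda>(\<rho>), so the growing intensity is absorbed into the
  density; the Jacobian raises the power to \<open>\<beta> + 1\<close>, which balances the tail of
  \<open>f\<close>.\<close>

lemma scaled_exponent:
  fixes f :: "real \<Rightarrow> real" and \<psi> :: "'a::euclidean_space \<Rightarrow> real"
  assumes f: "f \<in> borel_measurable borel" "\<And>r. 0 \<le> f r" and \<nu>: "\<nu> = density lborel (\<lambda>r. ennreal (f (r / \<rho>) / \<rho>))"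
    and prob: "prob_space \<nu>" and vol: "(\<integral>\<^sup>+r. ennreal (ball_vol TYPE('a) r) \<partial>\<nu>) = ennreal v" "0 \<le> v"
    and \<psi>: "integrable lborel \<psi>" "integrable lborel (\<lambda>x. (\<psi> x)\<^sup>2)" and \<rho>: "0 < \<rho>" and l: "0 < l"
  shows "complex_of_real (l powr \<beta>) * (CLINT x|lborel. CLINT r|\<nu>. centered_iexp (ball_integral \<psi> x r / (l * \<rho>) ^ DIM('a))) =
    (CLINT s|lborel. (l powr (\<beta> + 1) * f (l * s)) *\<^sub>R (CLINT x|lborel. centered_iexp (ball_integral \<psi> x (l * \<rho> * s) / (l * \<rho>) ^ DIM('a))))"
proof -
  note [measurable] = f(1)
  have [measurable]: "\<psi> \<in> borel_measurable borel" using \<psi>(1) by auto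
  interpret \<nu>: prob_space \<nu> by (rule prob)
  interpret pair: pair_sigma_finite "lborel :: 'a measure" \<nu> ..
  have sets[simp, measurable_cong]: "sets \<nu> = sets borel" by (simp add: \<nu>)
  define n where "n = (l * \<rho>) ^ DIM('a)"
  have n: "0 < n" unfolding n_def using \<rho> l by simp
  have sf: "sigma_finite_measure \<nu>" ..
  define F where "F x r = centered_iexp (ball_integral \<psi> x r / n)" for x r
  have Fm[measurable]: "(\<lambda>p. F (fst p) (snd p)) \<in> borel_measurable (lborel \<Otimes>\<^sub>M \<nu>)" unfolding F_def by measurable
  have Fi: "integrable (lborel \<Otimes>\<^sub>M \<nu>) (\<lambda>(x, r). F x r)"
  proof (rule Bochner_Integration.integrable_bound)
    have m: "(\<lambda>p. ball_integral \<psi> (fst p) (snd p) / n) \<in> borel_measurable (lborel \<Otimes>\<^sub>M \<nu>)" by measurable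
    have "(\<integral>\<^sup>+p. ennreal \<bar>ball_integral \<psi> (fst p) (snd p) / n\<bar> \<partial>(lborel \<Otimes>\<^sub>M \<nu>)) = (\<integral>\<^sup>+x. (\<integral>\<^sup>+r. ennreal \<bar>ball_integral \<psi> x r / n\<bar> \<partial>\<nu>) \<partial>lborel)"
      by (subst \<nu>.nn_integral_fst[symmetric]) simp_all
    also have "\<dots> < \<infinity>" by (rule marked_ball_bounds(1)[OF sets sf vol \<psi> n])
    finally have "integrable (lborel \<Otimes>\<^sub>M \<nu>) (\<lambda>p. ball_integral \<psi> (fst p) (snd p) / n)"
      using m by (simp only: integrable_iff_bounded real_norm_def)
    then show "integrable (lborel \<Otimes>\<^sub>M \<nu>) (\<lambda>p. 2 * (ball_integral \<psi> (fst p) (snd p) / n))" by (rule integrable_mult_right)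
    show "(\<lambda>(x, r). F x r) \<in> borel_measurable (lborel \<Otimes>\<^sub>M \<nu>)" using Fm by (simp add: case_prod_beta')
    show "AE p in lborel \<Otimes>\<^sub>M \<nu>. norm (case p of (x, r) \<Rightarrow> F x r) \<le> norm (2 * (ball_integral \<psi> (fst p) (snd p) / n))"
      unfolding F_def case_prod_beta' by (intro AE_I2 norm_centered_iexp_le_norm)
  qed
  define J where "J r = (CLINT x|lborel. F x r)" for r
  have Jm[measurable]: "J \<in> borel_measurable borel"
  proof -
    have "(\<lambda>p. F (snd p) (fst p)) \<in> borel_measurable (borel \<Otimes>\<^sub>M (lborel :: 'a measure))" unfolding F_def by measurable
    then show ?thesis unfolding J_def using lborel.borel_measurable_lebesgue_integral[of "\<lambda>r x. F x r" borel] by (simp only: case_prod_beta')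
  qed
  have "(CLINT x|lborel. CLINT r|\<nu>. F x r) = (CLINT r|\<nu>. J r)"
    unfolding J_def by (rule pair.Fubini_integral[symmetric, OF Fi])
  also have "\<dots> = (CLINT r|lborel. (f (r / \<rho>) / \<rho>) *\<^sub>R J r)"
    unfolding \<nu> using f(2) \<rho> by (intro integral_density) auto
  also have "\<dots> = \<bar>l * \<rho>\<bar> *\<^sub>R (CLINT s|lborel. (f ((0 + l * \<rho> * s) / \<rho>) / \<rho>) *\<^sub>R J (0 + l * \<rho> * s))"
    using l \<rho> by (intro lborel_integral_real_affine) simp
  also have "(\<lambda>s. (f ((0 + l * \<rho> * s) / \<rho>) / \<rho>) *\<^sub>R J (0 + l * \<rho> * s)) = (\<lambda>s. (f (l * s) / \<rho>) *\<^sub>R J (l * \<rho> * s))"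
    using \<rho> by (intro ext) (simp add: mult_ac)
  finally have "complex_of_real (l powr \<beta>) * (CLINT x|lborel. CLINT r|\<nu>. F x r) =
    (l powr \<beta> * (l * \<rho>)) *\<^sub>R (CLINT s|lborel. (f (l * s) / \<rho>) *\<^sub>R J (l * \<rho> * s))"
    using l \<rho> by (simp only: abs_of_pos mult_pos_pos scaleR_conv_of_real of_real_mult mult.assoc)
  also have "\<dots> = (CLINT s|lborel. (l powr \<beta> * (l * \<rho>)) *\<^sub>R ((f (l * s) / \<rho>) *\<^sub>R J (l * \<rho> * s)))"
    by (simp only: scaleR_conv_of_real integral_mult_right_zero)
  also have "\<dots> = (CLINT s|lborel. (l powr (\<beta> + 1) * f (l * s)) *\<^sub>R J (l * \<rho> * s))"
  proof (intro Bochner_Integration.integral_cong refl)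
    fix s
    have "l powr \<beta> * (l * \<rho>) * (f (l * s) / \<rho>) = l powr (\<beta> + 1) * f (l * s)" using l \<rho> by (simp add: powr_add)
    then show "(l powr \<beta> * (l * \<rho>)) *\<^sub>R ((f (l * s) / \<rho>) *\<^sub>R J (l * \<rho> * s)) = (l powr (\<beta> + 1) * f (l * s)) *\<^sub>R J (l * \<rho> * s)"
      by (simp only: scaleR_scaleR)
  qed
  finally show ?thesis unfolding F_def J_def n_def .
qed

section \<open>Convergence of the ball fields\<close>

lemma borel_measurable_vec_lambda:
  fixes F :: "'i::finite \<Rightarrow> 'w \<Rightarrow> real"
  assumes [measurable]: "\<And>i. F i \<in> borel_measurable M"
  shows "(\<lambda>w. \<chi> i. F i w) \<in> borel_measurable M"
  by (subst borel_measurable_euclidean_space) (auto simp: Basis_vec_def inner_axis)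

text \<open>Dropping finitely many terms of a sequence turns conditions that hold eventually into
  conditions on every term, so that sequential lemmas can assume them without exception.\<close>

lemma tendsto_at_right_sequentiallyI:
  fixes F :: "real \<Rightarrow> 'b::topological_space"
  assumes good: "\<forall>\<^sub>F \<rho> in at_right 0. good \<rho>"
    and lim: "\<And>r. filterlim r (at_right 0) sequentially \<Longrightarrow> (\<And>j. good (r j)) \<Longrightarrow> (\<lambda>j. F (r j)) \<longlonglongrightarrow> l"
  shows "(F \<longlongrightarrow> l) (at_right 0)"
proof -
  have "(F \<circ> s) \<longlonglongrightarrow> l" if s: "\<forall>i. s i \<in> {0<..} - {0}" "s \<longlonglongrightarrow> 0" for s
  proof -
    have fs: "filterlim s (at_right 0) sequentially" using s by (intro filterlim_at_withinI) (auto intro!: always_eventually)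
    then have "\<forall>\<^sub>F j in sequentially. good (s j)" using good by (rule filterlim_iff[THEN iffD1, rule_format])
    then obtain m where m: "\<And>j. good (s (j + m))" unfolding eventually_sequentially using le_add2 by blast
    have "(\<lambda>j. F (s (j + m))) \<longlonglongrightarrow> l"
      by (rule lim) (use m fs in \<open>auto intro: filterlim_compose[OF _ filterlim_add_const_nat_at_top]\<close>)
    then show ?thesis unfolding o_def by (rule LIMSEQ_offset)
  qed
  then show ?thesis unfolding tendsto_at_iff_sequentially by blast
qed

text \<open>Sequential form of the limit: \<open>L j\<close> and \<open>k j\<close> stand for
  \<lambda> and the kernel at \<open>\<rho> j\<close>, \<kappa> for the real part of
  \<open>K 0\<close>, and \<open>C\<close> for the constant in assumption (c). Conditions that hold
  only near 0 are assumed for every \<open>j\<close>.\<close>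

lemma ball_fields_char_limit:
  fixes M :: "nat \<Rightarrow> 'w measure" and \<xi> :: "nat \<Rightarrow> 'w \<Rightarrow> 'a::euclidean_space set" and k :: "nat \<Rightarrow> 'a \<Rightarrow> complex"
    and \<psi> :: "'i::finite \<Rightarrow> 'a \<Rightarrow> real" and t :: "'i \<Rightarrow> real" and L \<rho> :: "nat \<Rightarrow> real" and f :: "real \<Rightarrow> real"
    and \<beta> \<kappa> C\<^sub>\<beta> C\<^sub>0 C :: real
  defines "d \<equiv> real DIM('a)" and "\<Psi> \<equiv> \<lambda>x. \<Sum>i\<in>UNIV. t i * \<psi> i x"
  defines "\<sigma> \<equiv> \<kappa> * C\<^sub>\<beta> * ball_vol TYPE('a) 1 powr (\<beta> / d) / d * (LINT r:{0<..}|lborel. (1 - cos r) / r powr (1 + \<beta> / d))"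
  assumes beta: "d < \<beta>" "\<beta> < 2 * d"
    and f: "f \<in> borel_measurable borel" "\<And>r. 0 \<le> f r" "\<And>r. r < 0 \<Longrightarrow> f r = 0" "(\<integral>\<^sup>+r. ennreal (f r) \<partial>lborel) = 1"
    and tail: "f \<sim>[at_top] (\<lambda>r. C\<^sub>\<beta> * r powr (- \<beta> - 1))" "0 < C\<^sub>\<beta>" and bound: "\<And>r. 0 \<le> r \<Longrightarrow> r powr (\<beta> + 1) * f r \<le> C\<^sub>0"
    and dpp: "\<And>j. determinantal_pp (M j) (\<xi> j) (\<lambda>x y. k j (x - y))"
    and k_square: "\<And>j. integrable lborel (\<lambda>x. (cmod (k j x))\<^sup>2)"
    and marks: "\<And>j. iid_marking (M j) (\<xi> j) (\<Phi> j) (\<lambda>r. f (r / \<rho> j) / \<rho> j)"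
    and k0: "\<And>j. Re (k j 0) = L j * \<kappa>" and energy: "\<And>j. (LINT x|lborel. (cmod (k j x))\<^sup>2) \<le> C * L j"
    and L: "\<And>j. 0 < L j" "filterlim L at_top sequentially" and \<rho>: "\<And>j. 0 < \<rho> j" and regime: "(\<lambda>j. L j * \<rho> j powr \<beta>) \<longlonglongrightarrow> 0"
    and \<psi>: "\<And>i. \<psi> i \<in> L2c_densities"
  shows "(\<lambda>j. CLINT w|M j. iexp (\<Sum>i\<in>UNIV. t i * (centered_ball_field (M j) (\<Phi> j) (density lborel (\<lambda>x. ennreal (\<psi> i x))) w /
      (L j * \<rho> j powr \<beta>) powr (1 / (\<beta> / d)))))
    \<longlonglongrightarrow> exp (- (complex_of_real \<sigma> * (CLINT x|lborel. stable_exponent (\<beta> / d) 1 (\<Psi> x))))"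
proof -
  have d0: "0 < d" unfolding d_def by simp
  have b0: "0 < \<beta>" using beta d0 by linarith
  define \<nu> where "\<nu> j = density lborel (\<lambda>r. ennreal (f (r / \<rho> j) / \<rho> j))" for j
  obtain v where v0: "0 \<le> v" and
    vv: "\<And>\<rho>. 0 < \<rho> \<Longrightarrow> (\<integral>\<^sup>+r. ennreal (ball_vol TYPE('a) r) \<partial>density lborel (\<lambda>r. ennreal (f (r / \<rho>) / \<rho>))) = ennreal (v * \<rho> ^ DIM('a))"
    using radius_ball_vol[OF f bound beta(1)[unfolded d_def]] by blast
  have vol: "(\<integral>\<^sup>+r. ennreal (ball_vol TYPE('a) r) \<partial>\<nu> j) = ennreal (v * \<rho> j ^ DIM('a))" and vol0: "0 \<le> v * \<rho> j ^ DIM('a)" for j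
    using vv[OF \<rho>] v0 less_imp_le[OF \<rho>[of j]] unfolding \<nu>_def by auto
  have \<psi>i: "integrable lborel (\<psi> i)" and \<psi>2: "integrable lborel (\<lambda>x. (\<psi> i x)\<^sup>2)" and \<psi>0: "0 \<le> \<psi> i x" for i x
    using L2c_densities_integrable[OF \<psi>] by auto
  have \<Psi>i: "integrable lborel \<Psi>" unfolding \<Psi>_def by (intro Bochner_Integration.integrable_sum integrable_mult_right \<psi>i)
  have \<Psi>2: "integrable lborel (\<lambda>x. (\<Psi> x)\<^sup>2)" unfolding \<Psi>_def by (rule integrable_square_linear_combination[OF \<psi>i \<psi>2])
  define N where "N = (LINT x|lborel. (\<Psi> x)\<^sup>2)"
  have N0: "0 \<le> N" unfolding N_def by (intro integral_nonneg_AE) auto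
  \<comment> \<open>Choice of units: \<open>l j powr \<beta> = L j\<close>, and \<open>q j\<close>
    is the radius that, up to constants, one ball per unit volume exceeds. The normalisation
    \<open>n j\<close> is its \<open>d\<close>-th power because
    \<open>1 / (\<beta> / d) = d / \<beta>\<close>.\<close>
  define l where "l j = L j powr (1 / \<beta>)" for j
  define q where "q j = l j * \<rho> j" for j
  define n where "n j = (L j * \<rho> j powr \<beta>) powr (1 / (\<beta> / d))" for j
  have l0: "0 < l j" for j unfolding l_def using L(1)[of j] by simp
  have q0: "0 < q j" for j unfolding q_def using l0 \<rho> by simp
  have l_beta: "l j powr \<beta> = L j" for j unfolding l_def using b0 L(1)[of j] by (simp add: powr_powr)
  have q_eq: "q j = (L j * \<rho> j powr \<beta>) powr (1 / \<beta>)" for j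
    unfolding q_def l_def using b0 L(1)[of j] \<rho>[of j] by (simp add: powr_mult powr_powr)
  have q_lim: "q \<longlonglongrightarrow> 0"
  proof -
    have "(\<lambda>j. (L j * \<rho> j powr \<beta>) powr (1 / \<beta>)) \<longlonglongrightarrow> 0 powr (1 / \<beta>)"
      using b0 less_imp_le[OF L(1)] by (intro tendsto_powr' regime tendsto_const) auto
    then show ?thesis unfolding q_eq by simp
  qed
  have l_lim: "filterlim l at_top sequentially"
  proof -
    have "filterlim (\<lambda>x::real. x powr (1 / \<beta>)) at_top at_top" using b0 by real_asymp
    from filterlim_compose[OF this L(2)] show ?thesis unfolding l_def .
  qed
  have n_eq: "n j = q j ^ DIM('a)" for j
  proof -
    have "n j = ((L j * \<rho> j powr \<beta>) powr (1 / \<beta>)) powr d" unfolding n_def using d0 by (simp add: powr_powr)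
    also have "\<dots> = q j powr d" by (simp only: q_eq)
    also have "\<dots> = q j ^ DIM('a)" unfolding d_def using q0 by (rule powr_realpow)
    finally show ?thesis .
  qed
  have n0: "0 < n j" for j unfolding n_eq using q0 by simp
  have \<nu>_prob: "prob_space (\<nu> j)" for j
  proof
    have "emeasure (\<nu> j) (space (\<nu> j)) = (\<integral>\<^sup>+r. ennreal (f (r / \<rho> j) / \<rho> j) \<partial>lborel)"
      unfolding \<nu>_def using f(1) by (simp add: emeasure_density)
    also have "\<dots> = ennreal \<bar>\<rho> j\<bar> * (\<integral>\<^sup>+s. ennreal (f ((0 + \<rho> j * s) / \<rho> j) / \<rho> j) \<partial>lborel)"
      using \<rho>[of j] f(1) by (intro nn_integral_real_affine) auto
    also have "\<dots> = (\<integral>\<^sup>+s. ennreal \<bar>\<rho> j\<bar> * ennreal (f ((0 + \<rho> j * s) / \<rho> j) / \<rho> j) \<partial>lborel)"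
      using f(1) by (intro nn_integral_cmult[symmetric]) auto
    also have "\<dots> = (\<integral>\<^sup>+s. ennreal (f s) \<partial>lborel)"
      using \<rho>[of j] f(2) by (intro nn_integral_cong) (simp add: ennreal_mult[symmetric])
    finally show "emeasure (\<nu> j) (space (\<nu> j)) = 1" using f(4) by simp
  qed
  define \<Theta> where "\<Theta> j = (CLINT x|lborel. CLINT r|\<nu> j. centered_iexp (ball_integral \<Psi> x r / n j))" for j
  define S where "S = (CLINT x|lborel. stable_exponent (\<beta> / d) 1 (\<Psi> x))"
  have exponent: "(\<lambda>j. complex_of_real (Re (k j 0)) * \<Theta> j) \<longlonglongrightarrow> - (complex_of_real \<sigma> * S)"
  proof -
    let ?T = "\<lambda>j. CLINT s|lborel. (l j powr (\<beta> + 1) * f (l j * s)) *\<^sub>R (CLINT x|lborel. centered_iexp (ball_integral \<Psi> x (q j * s) / q j ^ DIM('a)))"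
    \<comment> \<open>The intensity \<open>L j * \<kappa>\<close> equals
      \<open>\<kappa> * l j powr \<beta>\<close>, and the power of \<open>l j\<close> is what the
      change of units absorbs.\<close>
    have "complex_of_real (Re (k j 0)) * \<Theta> j = complex_of_real \<kappa> * ?T j" for j
    proof -
      have "complex_of_real (l j powr \<beta>) * \<Theta> j = ?T j"
        unfolding \<Theta>_def n_eq q_def
        by (rule scaled_exponent[OF f(1,2) \<nu>_def \<nu>_prob vol vol0 \<Psi>i \<Psi>2 \<rho> l0])
      then show ?thesis unfolding k0 l_beta by (simp only: of_real_mult mult_ac)
    qed
    moreover have "(\<lambda>j. complex_of_real \<kappa> * ?T j) \<longlonglongrightarrow> complex_of_real \<kappa> * (- (complex_of_real (C\<^sub>\<beta> * ball_vol TYPE('a) 1 powr (\<beta> / d) / d * (LINT r:{0<..}|lborel. (1 - cos r) / r powr (1 + \<beta> / d)))) * S)"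
      using scaled_tail_limit[OF \<Psi>i \<Psi>2 beta[unfolded d_def] f(1,2,3) tail bound l0 l_lim q0 q_lim]
      unfolding S_def d_def tail_limit_value(1)[OF \<Psi>i \<Psi>2 beta[unfolded d_def]]
      by (intro tendsto_mult tendsto_const)
    moreover have "complex_of_real \<kappa> * (- (complex_of_real (C\<^sub>\<beta> * ball_vol TYPE('a) 1 powr (\<beta> / d) / d * (LINT r:{0<..}|lborel. (1 - cos r) / r powr (1 + \<beta> / d)))) * S) = - (complex_of_real \<sigma> * S)"
      unfolding \<sigma>_def by simp
    ultimately show ?thesis by simp
  qed
  define A where "A = v\<^sup>2 * N"
  have A0: "0 \<le> A" unfolding A_def using N0 by simp
  \<comment> \<open>\<open>D j\<close> is the rate of the error. The mean ball volume divided by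
    \<open>n j\<close> is \<open>v / l j ^ DIM('a)\<close>; its square times \<open>L j\<close> has
    the exponent \<open>1 - 2 * d / \<beta>\<close>, negative because \<beta> < 2d. Both error terms
    of the characteristic function are controlled by this quantity.\<close>
  define D where "D j = L j powr (1 - 2 * d / \<beta>)" for j
  have D_lim: "D \<longlonglongrightarrow> 0"
  proof -
    have "1 - 2 * d / \<beta> < 0" using beta b0 by (simp add: field_simps)
    then have "((\<lambda>x::real. x powr (1 - 2 * d / \<beta>)) \<longlongrightarrow> 0) at_top" by real_asymp
    from filterlim_compose[OF this L(2)] show ?thesis unfolding D_def .
  qed
  define B where "B j = (v * \<rho> j ^ DIM('a) / n j)\<^sup>2 * N" for j
  have B0: "0 \<le> B j" for j unfolding B_def using N0 by simp
  have LB: "L j * B j = A * D j" for j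
  proof -
    have "\<rho> j ^ DIM('a) / n j = 1 / l j ^ DIM('a)"
      unfolding n_eq q_def using \<rho>[of j] by (simp add: power_mult_distrib)
    then have r: "v * \<rho> j ^ DIM('a) / n j = v / l j ^ DIM('a)" by (metis times_divide_eq_right mult.right_neutral)
    have "(l j ^ DIM('a))\<^sup>2 = l j powr (2 * d)"
    proof -
      have "l j ^ DIM('a) = l j powr d" unfolding d_def using l0 by (rule powr_realpow[symmetric])
      then show ?thesis by (simp add: power2_eq_square powr_add[symmetric])
    qed
    also have "\<dots> = L j powr (2 * d / \<beta>)" unfolding l_def by (simp add: powr_powr)
    finally have "B j = A / L j powr (2 * d / \<beta>)" unfolding B_def A_def r by (simp add: power_divide)
    then show ?thesis unfolding D_def using L(1)[of j] by (simp add: powr_diff)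
  qed
  define H where "H j = (CLINT w|M j. iexp (\<Sum>i\<in>UNIV. t i * (centered_ball_field (M j) (\<Phi> j) (density lborel (\<lambda>x. ennreal (\<psi> i x))) w / n j)))" for j
  have cb: "cmod (H j - exp (complex_of_real (Re (k j 0)) * \<Theta> j))
    \<le> Re (k j 0) * B j + 3 * sqrt ((Re (k j 0) + (LINT x|lborel. (cmod (k j x))\<^sup>2)) * B j)" for j
    unfolding H_def \<Theta>_def B_def N_def \<Psi>_def
    by (rule ball_fields_char_bound(1)[OF dpp k_square marks \<nu>_def vol vol0 \<psi>i \<psi>2 \<psi>0 n0])
  have bnd: "norm (H j - exp (complex_of_real (Re (k j 0)) * \<Theta> j)) \<le> \<kappa> * (A * D j) + 3 * sqrt ((\<kappa> + C) * (A * D j))" for j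
  proof -
    have 1: "Re (k j 0) * B j = \<kappa> * (A * D j)" unfolding k0 LB[symmetric] by (simp only: mult_ac)
    have "(Re (k j 0) + (LINT x|lborel. (cmod (k j x))\<^sup>2)) * B j \<le> (L j * \<kappa> + C * L j) * B j"
      unfolding k0 using energy[of j] B0 by (intro mult_right_mono add_left_mono) auto
    also have "\<dots> = (\<kappa> + C) * (A * D j)" unfolding LB[symmetric] by (simp add: algebra_simps)
    finally have 2: "sqrt ((Re (k j 0) + (LINT x|lborel. (cmod (k j x))\<^sup>2)) * B j) \<le> sqrt ((\<kappa> + C) * (A * D j))"
      by (rule real_sqrt_le_mono)
    show ?thesis using cb[of j] 2 unfolding 1 by linarith
  qed
  have "(\<lambda>j. H j - exp (complex_of_real (Re (k j 0)) * \<Theta> j)) \<longlonglongrightarrow> 0"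
  proof (rule Lim_null_comparison)
    show "\<forall>\<^sub>F j in sequentially. norm (H j - exp (complex_of_real (Re (k j 0)) * \<Theta> j)) \<le> \<kappa> * (A * D j) + 3 * sqrt ((\<kappa> + C) * (A * D j))"
      using bnd by simp
    have "(\<lambda>j. \<kappa> * (A * D j) + 3 * sqrt ((\<kappa> + C) * (A * D j))) \<longlonglongrightarrow> \<kappa> * (A * 0) + 3 * sqrt ((\<kappa> + C) * (A * 0))"
      by (intro tendsto_intros D_lim)
    then show "(\<lambda>j. \<kappa> * (A * D j) + 3 * sqrt ((\<kappa> + C) * (A * D j))) \<longlonglongrightarrow> 0" by simp
  qed
  from tendsto_add[OF this tendsto_exp[OF exponent]] have "H \<longlonglongrightarrow> exp (- (complex_of_real \<sigma> * S))" by simp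
  then show ?thesis unfolding H_def n_def S_def .
qed

theorem theorem2p14:
  fixes \<beta> \<gamma> C\<^sub>\<beta> C\<^sub>0 \<sigma>\<^sub>\<gamma> :: real
    and f :: "real \<Rightarrow> real"
    and P0 :: "'v measure" and \<phi>0 :: "'v \<Rightarrow> 'a::euclidean_space set" and K :: "'a \<Rightarrow> complex"
    and lam n :: "real \<Rightarrow> real"
    and P :: "real \<Rightarrow> 'w measure"
    and \<phi> :: "real \<Rightarrow> 'w \<Rightarrow> 'a set"
    and K\<rho> :: "real \<Rightarrow> 'a \<Rightarrow> complex"
    and \<Phi> :: "real \<Rightarrow> 'w \<Rightarrow> ('a \<times> real) set"
    and Q :: "'u measure"
    and W :: "'a set \<Rightarrow> 'u \<Rightarrow> real"
    and Z :: "'a measure \<Rightarrow> 'u \<Rightarrow> real"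
    and \<mu> :: "'i::finite \<Rightarrow> 'a measure"
  assumes beta: "real DIM('a) < \<beta>" "\<beta> < 2 * real DIM('a)"
    and f_density: "f \<in> borel_measurable borel" "\<And>r. 0 \<le> f r" "\<And>r. r < 0 \<Longrightarrow> f r = 0"
      "(\<integral>\<^sup>+r. ennreal (f r) \<partial>lborel) = 1"
    and f_tail: "C\<^sub>\<beta> > 0" "f \<sim>[at_top] (\<lambda>r. C\<^sub>\<beta> * r powr (- \<beta> - 1))"
    and f_bound: "\<And>r. 0 \<le> r \<Longrightarrow> r powr (\<beta> + 1) * f r \<le> C\<^sub>0"
    and unscaled: "determinantal_pp P0 \<phi>0 (\<lambda>x y. K (x - y))" "stationary_pp P0 \<phi>0"
    and dpp: "\<And>\<rho>. \<rho> > 0 \<Longrightarrow> determinantal_pp (P \<rho>) (\<phi> \<rho>) (\<lambda>x y. K\<rho> \<rho> (x - y))"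
      "\<And>\<rho>. \<rho> > 0 \<Longrightarrow> stationary_pp (P \<rho>) (\<phi> \<rho>)"
    and a: "\<And>\<rho>. \<rho> > 0 \<Longrightarrow> bounded_integral_op lborel (\<lambda>x y. K\<rho> \<rho> (x - y))"
      "\<And>\<rho>. \<rho> > 0 \<Longrightarrow> L2_symmetric_op lborel (kernel_op lborel (\<lambda>x y. K\<rho> \<rho> (x - y)))"
      "\<And>\<rho>. \<rho> > 0 \<Longrightarrow> L2_spectrum lborel (kernel_op lborel (\<lambda>x y. K\<rho> \<rho> (x - y)))
                        \<subseteq> complex_of_real ` {0..<1}"
      "\<And>\<rho>. \<rho> > 0 \<Longrightarrow> locally_trace_class (\<lambda>x y. K\<rho> \<rho> (x - y))"
    and b: "\<And>\<rho>. \<rho> > 0 \<Longrightarrow> K\<rho> \<rho> 0 = complex_of_real (lam \<rho>) * K 0"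
      "filterlim lam at_top (at_right 0)"
    and c: "\<forall>\<^sub>F \<rho> in at_right 0. integrable lborel (\<lambda>x. (cmod (K\<rho> \<rho> x))\<^sup>2)"
      "(\<lambda>\<rho>. \<integral>x. (cmod (K\<rho> \<rho> x))\<^sup>2 \<partial>lborel) \<in> O[at_right 0](lam)"
    and marks: "\<And>\<rho>. \<rho> > 0 \<Longrightarrow> iid_marking (P \<rho>) (\<phi> \<rho>) (\<Phi> \<rho>) (\<lambda>r. f (r / \<rho>) / \<rho>)"
    and regime: "((\<lambda>\<rho>. lam \<rho> * \<rho> powr \<beta>) \<longlongrightarrow> 0) (at_right 0)"
    and gamma: "\<gamma> = \<beta> / real DIM('a)"
    and n: "\<And>\<rho>. n \<rho> = (lam \<rho> * \<rho> powr \<beta>) powr (1 / \<gamma>)"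
    and sigma: "\<sigma>\<^sub>\<gamma> = Re (K 0) * C\<^sub>\<beta> * (measure lborel (cball (0::'a) 1)) powr \<gamma> / real DIM('a) *
                  (LINT r:{0<..}|lborel. (1 - cos r) / r powr (1 + \<gamma>))"
    and W: "stable_random_measure Q \<gamma> (density lborel (\<lambda>_. ennreal \<sigma>\<^sub>\<gamma>)) 1 W"
    and Z: "\<And>\<psi>. \<psi> \<in> L2c_densities \<Longrightarrow>
              has_stable_integral Q \<gamma> (density lborel (\<lambda>_. ennreal \<sigma>\<^sub>\<gamma>)) W \<psi>
                (Z (density lborel (\<lambda>x. ennreal (\<psi> x))))"
    and mu: "\<And>i. \<mu> i \<in> L2c_measures"
  shows "conv_in_distr (at_right 0)
           P (\<lambda>\<rho> \<omega>. \<chi> i. centered_ball_field (P \<rho>) (\<Phi> \<rho>) (\<mu> i) \<omega> / n \<rho>)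
           Q (\<lambda>\<omega>. \<chi> i. Z (\<mu> i) \<omega>)"
proof -
  have "\<forall>i. \<exists>\<psi>. \<psi> \<in> L2c_densities \<and> \<mu> i = density lborel (\<lambda>x. ennreal (\<psi> x))"
    using mu by (auto simp: L2c_measures_def)
  from choice[OF this] obtain \<psi> where \<psi>: "\<And>i. \<psi> i \<in> L2c_densities" and \<mu>_eq: "\<And>i. \<mu> i = density lborel (\<lambda>x. ennreal (\<psi> i x))"
    by blast
  have \<psi>i: "integrable lborel (\<psi> i)" and \<psi>2: "integrable lborel (\<lambda>x. (\<psi> i x)\<^sup>2)" and \<psi>0: "0 \<le> \<psi> i x" for i x
    using L2c_densities_integrable[OF \<psi>] by auto
  have Zi: "has_stable_integral Q \<gamma> (density lborel (\<lambda>_. ennreal \<sigma>\<^sub>\<gamma>)) W (\<psi> i) (Z (\<mu> i))" for i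
    unfolding \<mu>_eq by (rule Z[OF \<psi>])
  have Zm[measurable]: "Z (\<mu> i) \<in> borel_measurable Q" for i using Zi[of i] by (simp add: has_stable_integral_def)
  have g0: "0 < \<gamma>" unfolding gamma using beta by (intro divide_pos_pos) (auto intro: less_trans[OF DIM_positive[THEN of_nat_0_less_iff[THEN iffD2]]])
  interpret stable_measure Q \<gamma> "density lborel (\<lambda>_. ennreal \<sigma>\<^sub>\<gamma>)" 1 W
  proof -
    interpret prob_space Q using W by (simp add: stable_random_measure_def)
    show "stable_measure Q \<gamma> (density lborel (\<lambda>_. ennreal \<sigma>\<^sub>\<gamma>)) 1 W" by unfold_locales (rule W g0)+
  qed
  obtain v where v0: "0 \<le> v" and
    vol: "\<And>\<rho>. 0 < \<rho> \<Longrightarrow> (\<integral>\<^sup>+r. ennreal (ball_vol TYPE('a) r) \<partial>density lborel (\<lambda>r. ennreal (f (r / \<rho>) / \<rho>))) = ennreal (v * \<rho> ^ DIM('a))"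
    using radius_ball_vol[OF f_density f_bound beta(1)] by blast
  from landau_o.bigE[OF c(2)] obtain C where "0 < C"
    and C: "\<forall>\<^sub>F \<rho> in at_right 0. norm (\<integral>x. (cmod (K\<rho> \<rho> x))\<^sup>2 \<partial>lborel) \<le> C * norm (lam \<rho>)" by blast
  \<comment> \<open>Everything that holds only for small \<rho>, collected in one predicate.
    Positivity of \<open>lam \<rho>\<close> removes the norm from the Landau bound.\<close>
  define good where "good \<rho> \<longleftrightarrow> 0 < \<rho> \<and> 0 < lam \<rho> \<and> integrable lborel (\<lambda>x. (cmod (K\<rho> \<rho> x))\<^sup>2) \<and>
    (\<integral>x. (cmod (K\<rho> \<rho> x))\<^sup>2 \<partial>lborel) \<le> C * lam \<rho>" for \<rho>
  have lam_pos: "\<forall>\<^sub>F \<rho> in at_right 0. 0 < lam \<rho>" using b(2) by (simp add: filterlim_at_top_dense)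
  have good: "\<forall>\<^sub>F \<rho> in at_right 0. good \<rho>"
    using lam_pos C c(1) eventually_at_right_less[of "0::real"]
    by eventually_elim (auto simp: good_def)
  have good_struct: "prob_space (P \<rho>) \<and> (\<forall>i. centered_ball_field (P \<rho>) (\<Phi> \<rho>) (\<mu> i) \<in> borel_measurable (P \<rho>)) \<and> 0 \<le> lam \<rho> * Re (K 0)"
    if "good \<rho>" for \<rho>
  proof -
    have \<rho>: "0 < \<rho>" and k: "integrable lborel (\<lambda>x. (cmod (K\<rho> \<rho> x))\<^sup>2)" using that by (auto simp: good_def)
    have "0 \<le> v * \<rho> ^ DIM('a)" using v0 \<rho> by simp
    \<comment> \<open>The normalisation does not appear in these three conclusions; \<rho> is put in
      its place as a number known to be positive.\<close>
    note s = ball_fields_char_bound(2,3,4)[OF dpp(1)[OF \<rho>] k marks[OF \<rho>] refl vol[OF \<rho>] this \<psi>i \<psi>2 \<psi>0 \<rho>]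
    have "Re (K\<rho> \<rho> 0) = lam \<rho> * Re (K 0)" using b(1)[OF \<rho>] by simp
    then show ?thesis unfolding \<mu>_eq using s by auto
  qed
  obtain \<rho>0 where "good \<rho>0" using eventually_happens'[OF _ good] by (auto simp: trivial_limit_at_right_real)
  \<comment> \<open>The intensity \<open>lam \<rho>0 * Re (K 0)\<close> of the process at
    \<open>\<rho>0\<close> is nonnegative, and \<open>lam \<rho>0\<close> is positive.\<close>
  then have kappa0: "0 \<le> Re (K 0)" using good_struct[of \<rho>0] by (simp add: good_def zero_le_mult_iff)
  have g: "1 < \<beta> / real DIM('a)" "\<beta> / real DIM('a) < 2" using beta by (simp_all add: field_simps)
  \<comment> \<open>The control measure is built with
    \<open>ennreal \<sigma>\<^sub>\<gamma>\<close>, which would cut off a negative constant;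
    nonnegativity makes it the intended multiple of Lebesgue measure.\<close>
  have sigma0: "0 \<le> \<sigma>\<^sub>\<gamma>"
    unfolding sigma gamma using kappa0 f_tail(1) tail_integral_centered_iexp(3)[of "real DIM('a)" \<beta>] g
    by (intro mult_nonneg_nonneg divide_nonneg_nonneg) auto
  have meas: "(\<lambda>\<omega>. \<chi> i. centered_ball_field (P \<rho>) (\<Phi> \<rho>) (\<mu> i) \<omega> / n \<rho>) \<in> borel_measurable (P \<rho>)" if "good \<rho>" for \<rho>
    using good_struct[OF that] by (intro borel_measurable_vec_lambda borel_measurable_divide borel_measurable_const) auto
  have Ymeas: "(\<lambda>\<omega>. \<chi> i. Z (\<mu> i) \<omega>) \<in> borel_measurable Q" by (intro borel_measurable_vec_lambda) auto
  \<comment> \<open>The joint law of the stable integrals is read off from linear combinations of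
    the densities; the constant of the control measure comes out of the exponent as a
    factor.\<close>
  have limit_char: "(CLINT w|Q. iexp (t \<bullet> (\<chi> i. Z (\<mu> i) w))) =
    exp (- (complex_of_real \<sigma>\<^sub>\<gamma> * (CLINT x|lborel. stable_exponent \<gamma> 1 (\<Sum>i\<in>UNIV. t $ i * \<psi> i x))))" for t :: "real^'i"
  proof -
    have "(\<lambda>x. stable_exponent \<gamma> 1 (\<Sum>i\<in>UNIV. t $ i * \<psi> i x)) \<in> borel_measurable lborel"
      using borel_measurable_integrable[OF \<psi>i] by measurable
    then have "(CLINT x|density lborel (\<lambda>_. ennreal \<sigma>\<^sub>\<gamma>). stable_exponent \<gamma> 1 (\<Sum>i\<in>UNIV. t $ i * \<psi> i x)) =
      complex_of_real \<sigma>\<^sub>\<gamma> * (CLINT x|lborel. stable_exponent \<gamma> 1 (\<Sum>i\<in>UNIV. t $ i * \<psi> i x))"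
      using sigma0 by (subst integral_density) (auto simp: scaleR_conv_of_real)
    then show ?thesis using stable_integral_char[of \<psi> "\<lambda>i. Z (\<mu> i)" "vec_nth t", OF Zi] by (simp only: inner_vec_def inner_real_def vec_lambda_beta)
  qed
  show ?thesis unfolding conv_in_distr_def
  proof (intro conjI allI impI Ymeas)
    show "\<forall>\<^sub>F \<rho> in at_right 0. (\<lambda>\<omega>. \<chi> i. centered_ball_field (P \<rho>) (\<Phi> \<rho>) (\<mu> i) \<omega> / n \<rho>) \<in> borel_measurable (P \<rho>)"
      using good by (rule eventually_mono) (rule meas)
    fix h :: "real^'i \<Rightarrow> real"
    assume h: "continuous_on UNIV h \<and> bounded (range h)"
    show "((\<lambda>\<rho>. \<integral>\<omega>. h (\<chi> i. centered_ball_field (P \<rho>) (\<Phi> \<rho>) (\<mu> i) \<omega> / n \<rho>) \<partial>P \<rho>) \<longlongrightarrow> (\<integral>\<omega>. h (\<chi> i. Z (\<mu> i) \<omega>) \<partial>Q)) (at_right 0)"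
    \<comment> \<open>Dominated convergence and the continuity theorem are sequential, so the limit
      is taken along arbitrary sequences of good parameters tending to 0 from the right.\<close>
    proof (rule tendsto_at_right_sequentiallyI[OF good])
      fix r :: "nat \<Rightarrow> real"
      assume r: "filterlim r (at_right 0) sequentially" and gr: "\<And>j. good (r j)"
      have r0: "0 < r j" and lr: "0 < lam (r j)" and kr: "integrable lborel (\<lambda>x. (cmod (K\<rho> (r j) x))\<^sup>2)"
        and er: "(\<integral>x. (cmod (K\<rho> (r j) x))\<^sup>2 \<partial>lborel) \<le> C * lam (r j)" for j using gr[of j] by (auto simp: good_def)
      show "(\<lambda>j. \<integral>\<omega>. h (\<chi> i. centered_ball_field (P (r j)) (\<Phi> (r j)) (\<mu> i) \<omega> / n (r j)) \<partial>P (r j)) \<longlonglongrightarrow> (\<integral>\<omega>. h (\<chi> i. Z (\<mu> i) \<omega>) \<partial>Q)"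
      proof (rule levy_continuity_euclidean[where h=h and Y="\<lambda>\<omega>. \<chi> i. Z (\<mu> i) \<omega>"
            and X="\<lambda>j \<omega>. \<chi> i. centered_ball_field (P (r j)) (\<Phi> (r j)) (\<mu> i) \<omega> / n (r j)"])
        show "prob_space (P (r j))" for j using good_struct[OF gr] by blast
        show "prob_space Q" by unfold_locales
        show "(\<lambda>\<omega>. \<chi> i. centered_ball_field (P (r j)) (\<Phi> (r j)) (\<mu> i) \<omega> / n (r j)) \<in> borel_measurable (P (r j))" for j by (rule meas[OF gr])
        show "(\<lambda>j. CLINT w|P (r j). iexp (t \<bullet> (\<chi> i. centered_ball_field (P (r j)) (\<Phi> (r j)) (\<mu> i) w / n (r j)))) \<longlonglongrightarrow>
          (CLINT w|Q. iexp (t \<bullet> (\<chi> i. Z (\<mu> i) w)))" for t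
        proof -
          have "Re (K\<rho> (r j) 0) = lam (r j) * Re (K 0)" for j using b(1)[OF r0[of j]] by simp
          from ball_fields_char_limit[where t="vec_nth t" and \<psi>=\<psi> and L="\<lambda>j. lam (r j)" and \<rho>=r and \<Phi>="\<lambda>j. \<Phi> (r j)",
              OF beta f_density f_tail(2,1) f_bound dpp(1)[OF r0] kr marks[OF r0] this er lr
                filterlim_compose[OF b(2) r] r0 filterlim_compose[OF regime r] \<psi>]
          show ?thesis unfolding limit_char unfolding n gamma sigma \<mu>_eq
            by (simp only: inner_vec_def inner_real_def vec_lambda_beta)
        qed
      qed (use h Ymeas in auto)
    qed
  qed
qed

end
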